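(* Under Assumption A3, if the initialization $W^0$ satisfies $\llbracket W^0\rrbracket_{\psi,0}<K$, then the mean-field ODE system (with truncation $\chi_R$) started from $W(0)=W^0$ admits a unique solution $W(t)$ defined for all $t\ge0$.
   Context: Mean-field RNN. Let $L\in\mathbb N$, $d\ge1$, $\nu$ a probability measure on sequences $\mathbf x=(\mathbf x_k)_{k\in\mathbb Z}\subset\mathbb R^d$ (the invariant measure of a uniquely ergodic continuous map $T$ with $\mathbf x_{k+1}=T(\mathbf x_k)$, with finite fourth moments), $F^*$ a target depending only on $\mathbf x_{-L},\dots,\mathbf x_0$. Let $(\Omega_h,P_{hh})$ be a probability space and weights $W_{xh}:\Omega_h\to\mathbb R^d$, $W_{hh}:\Omega_h^2\to\mathbb R$, $W_{hy}:\Omega_h\to\mathbb R$. Set $H_{xh}(\theta;\mathbf x_k)=W_{xh}(\theta)\cdot\mathbf x_k$, $H_{hh}(\theta;\mathbf x,L)\equiv0$, and for $k=L-1,\dots,0$: $H_{hh}(\theta;\mathbf x,k)=\int W_{hh}(\theta,\theta')\sigma_h(H_{hh}(\theta';\mathbf x,k+1)+H_{xh}(\theta';\mathbf x_{-(k+1)}))P_{hh}(d\theta')$; $\hat F(\mathbf x;W)=\int W_{hy}(\theta)\sigma_h(H_{hh}(\theta;\mathbf x,0)+H_{xh}(\theta;\mathbf x_0))P_{hh}(d\theta)$; $\mathcal L(W)=\frac12\int(F^*-\hat F(\cdot;W))^2d\nu$. Mean-field ODEs: with $\chi_R$ smooth, $\chi_R(w)=w$ for $|w|\le R/2$, $\chi_R(w)=0$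 for $|w|\ge R$: $\partial_tW_{hy}=-\frac{\delta\mathcal L}{\delta W_{hy}}$, $\partial_tW_{xh}=-\frac{\delta\mathcal L}{\delta W_{xh}}$, $\partial_tW_{hh}=-\chi_R(W_{hh})\frac{\delta\mathcal L}{\delta W_{hh}}$ (variational derivatives in $L^2(P_{hh})$ resp. $L^2(P_{hh}^{\otimes2})$). Assumption A3: there is $K>R$ with (a) $\sigma_h$ bounded, differentiable, $\sigma_h(0)=0$, $\sigma_h'(0)\ne0$, $\sigma_h'$ $K$-bounded and $K$-Lipschitz; (b) $\mathrm{span}\{\sigma_h(w\cdot\mathbf x_0):w\in\mathbb R^d\}$ dense in $L^2(\nu_0)$; (c) the support of the law of $\theta\mapsto(W_{xh}(0;\theta),W_{hh}(0;\cdot,\theta),W_{hh}(0;\theta,\cdot))$ under $P_{hh}$ is $\mathbb R^d\times L_R^\infty(P_{hh})\times L_R^\infty(P_{hh})$, where $L^\infty_R(P_{hh})=\{f\in L^2(P_{hh}):\sup|f|\le R\}$; (d) $\sup|W_{hh}(0;\cdot,\cdot)|\le R$ and $\sup_{m\ge1}m^{-1/2}\big((\mathbb E|W_{xh}(0;\theta)|^m)^{1/m}\vee(\mathbb E|W_{hy}(0;\theta)|^m)^{1/m}\big)<K$. Sub-Gaussian norm: $\llbracket W_{hh}\rrbracket_{\psi,t}=\sqrt{50}\sup_{m\ge1}m^{-1/2}\big(\int\sup_{s<t}|W_{hh}(s;\theta,\theta')|^mP_{hh}^{\otimes2}(d\theta,d\theta')\big)^{1/m}$, and analogously $\llbracket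 W_{xh}\rrbracket_{\psi,t},\llbracket W_{hy}\rrbracket_{\psi,t}$ with integrals over $P_{hh}(d\theta)$; $\llbracket W\rrbracket_{\psi,t}$ is the maximum of the three (for $t=0$ the supremum is replaced by the value at time $0$). *)

theory Defs
  imports "HOL-Probability.Probability"
begin

abbreviation seq_space :: "(int \<Rightarrow> real^'d) measure" where
  "seq_space \<equiv> PiM UNIV (\<lambda>_. borel)"

definition uniquely_ergodic :: "(real^'d \<Rightarrow> real^'d) \<Rightarrow> bool" where
  "uniquely_ergodic T \<longleftrightarrow>
     (\<exists>!\<mu>. prob_space \<mu> \<and> sets \<mu> = sets borel \<and> distr \<mu> borel T = \<mu>)"

definition invariant_seq_measure ::
  "(real^'d \<Rightarrow> real^'d) \<Rightarrow> (int \<Rightarrow> real^'d) measure \<Rightarrow> bool" where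
  "invariant_seq_measure T \<nu> \<longleftrightarrow>
     prob_space \<nu> \<and> sets \<nu> = sets seq_space \<and>
     distr \<nu> seq_space (\<lambda>x k. x (k + 1)) = \<nu> \<and>
     (AE x in \<nu>. \<forall>k. x (k + 1) = T (x k))"

text \<open>Hhh ... j theta is H_hh(theta; x, L - j): index j counts steps from k = L.\<close>
primrec Hhh :: "'w measure \<Rightarrow> (real \<Rightarrow> real) \<Rightarrow> ('w \<Rightarrow> real^'d) \<Rightarrow> ('w \<Rightarrow> 'w \<Rightarrow> real)
    \<Rightarrow> (int \<Rightarrow> real^'d) \<Rightarrow> nat \<Rightarrow> nat \<Rightarrow> 'w \<Rightarrow> real" where
  "Hhh P \<sigma> Wxh Whh x L 0 \<theta> = 0"
| "Hhh P \<sigma> Wxh Whh x L (Suc j) \<theta> =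
     (\<integral>\<theta>'. Whh \<theta> \<theta>' * \<sigma> (Hhh P \<sigma> Wxh Whh x L j \<theta>' + Wxh \<theta>' \<bullet> x (- int (L - j))) \<partial>P)"

definition Fhat :: "'w measure \<Rightarrow> (real \<Rightarrow> real) \<Rightarrow> nat \<Rightarrow> ('w \<Rightarrow> real^'d)
    \<Rightarrow> ('w \<Rightarrow> 'w \<Rightarrow> real) \<Rightarrow> ('w \<Rightarrow> real) \<Rightarrow> (int \<Rightarrow> real^'d) \<Rightarrow> real" where
  "Fhat P \<sigma> L Wxh Whh Why x =
     (\<integral>\<theta>. Why \<theta> * \<sigma> (Hhh P \<sigma> Wxh Whh x L L \<theta> + Wxh \<theta> \<bullet> x 0) \<partial>P)"

definition loss :: "'w measure \<Rightarrow> (int \<Rightarrow> real^'d) measure \<Rightarrow> ((int \<Rightarrow> real^'d) \<Rightarrow> real)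
    \<Rightarrow> (real \<Rightarrow> real) \<Rightarrow> nat \<Rightarrow> ('w \<Rightarrow> real^'d) \<Rightarrow> ('w \<Rightarrow> 'w \<Rightarrow> real) \<Rightarrow> ('w \<Rightarrow> real) \<Rightarrow> real" where
  "loss P \<nu> Fs \<sigma> L Wxh Whh Why = 1/2 * (\<integral>x. (Fs x - Fhat P \<sigma> L Wxh Whh Why x)^2 \<partial>\<nu>)"

definition sq_int :: "'a measure \<Rightarrow> ('a \<Rightarrow> 'b::{real_normed_vector, second_countable_topology}) \<Rightarrow> bool" where
  "sq_int M f \<longleftrightarrow> f \<in> borel_measurable M \<and> integrable M (\<lambda>x. norm (f x) ^ 2)"

definition vd_xh :: "'w measure \<Rightarrow> (('w \<Rightarrow> real^'d) \<Rightarrow> ('w \<Rightarrow> 'w \<Rightarrow> real) \<Rightarrow> ('w \<Rightarrow> real) \<Rightarrow> real)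
    \<Rightarrow> ('w \<Rightarrow> real^'d) \<Rightarrow> ('w \<Rightarrow> 'w \<Rightarrow> real) \<Rightarrow> ('w \<Rightarrow> real) \<Rightarrow> ('w \<Rightarrow> real^'d) \<Rightarrow> bool" where
  "vd_xh P Lf Wxh Whh Why g \<longleftrightarrow> sq_int P g \<and>
     (\<forall>h. sq_int P h \<longrightarrow>
        ((\<lambda>\<epsilon>. Lf (\<lambda>\<theta>. Wxh \<theta> + \<epsilon> *\<^sub>R h \<theta>) Whh Why) has_real_derivative (\<integral>\<theta>. g \<theta> \<bullet> h \<theta> \<partial>P)) (at 0))"

definition vd_hh :: "'w measure \<Rightarrow> (('w \<Rightarrow> real^'d) \<Rightarrow> ('w \<Rightarrow> 'w \<Rightarrow> real) \<Rightarrow> ('w \<Rightarrow> real) \<Rightarrow> real)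
    \<Rightarrow> ('w \<Rightarrow> real^'d) \<Rightarrow> ('w \<Rightarrow> 'w \<Rightarrow> real) \<Rightarrow> ('w \<Rightarrow> real) \<Rightarrow> ('w \<Rightarrow> 'w \<Rightarrow> real) \<Rightarrow> bool" where
  "vd_hh P Lf Wxh Whh Why g \<longleftrightarrow> sq_int (P \<Otimes>\<^sub>M P) (case_prod g) \<and>
     (\<forall>h. sq_int (P \<Otimes>\<^sub>M P) (case_prod h) \<longrightarrow>
        ((\<lambda>\<epsilon>. Lf Wxh (\<lambda>\<theta> \<theta>'. Whh \<theta> \<theta>' + \<epsilon> * h \<theta> \<theta>') Why) has_real_derivative
           (\<integral>z. g (fst z) (snd z) * h (fst z) (snd z) \<partial>(P \<Otimes>\<^sub>M P))) (at 0))"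

definition vd_hy :: "'w measure \<Rightarrow> (('w \<Rightarrow> real^'d) \<Rightarrow> ('w \<Rightarrow> 'w \<Rightarrow> real) \<Rightarrow> ('w \<Rightarrow> real) \<Rightarrow> real)
    \<Rightarrow> ('w \<Rightarrow> real^'d) \<Rightarrow> ('w \<Rightarrow> 'w \<Rightarrow> real) \<Rightarrow> ('w \<Rightarrow> real) \<Rightarrow> ('w \<Rightarrow> real) \<Rightarrow> bool" where
  "vd_hy P Lf Wxh Whh Why g \<longleftrightarrow> sq_int P g \<and>
     (\<forall>h. sq_int P h \<longrightarrow>
        ((\<lambda>\<epsilon>. Lf Wxh Whh (\<lambda>\<theta>. Why \<theta> + \<epsilon> * h \<theta>)) has_real_derivative (\<integral>\<theta>. g \<theta> * h \<theta> \<partial>P)) (at 0))"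

definition mf_solution :: "'w measure \<Rightarrow> (int \<Rightarrow> real^'d) measure \<Rightarrow> ((int \<Rightarrow> real^'d) \<Rightarrow> real)
    \<Rightarrow> (real \<Rightarrow> real) \<Rightarrow> nat \<Rightarrow> (real \<Rightarrow> real)
    \<Rightarrow> ('w \<Rightarrow> real^'d) \<Rightarrow> ('w \<Rightarrow> 'w \<Rightarrow> real) \<Rightarrow> ('w \<Rightarrow> real)
    \<Rightarrow> (real \<Rightarrow> 'w \<Rightarrow> real^'d) \<Rightarrow> (real \<Rightarrow> 'w \<Rightarrow> 'w \<Rightarrow> real) \<Rightarrow> (real \<Rightarrow> 'w \<Rightarrow> real) \<Rightarrow> bool" where
  "mf_solution P \<nu> Fs \<sigma> L chi W0xh W0hh W0hy Wxh Whh Why \<longleftrightarrow>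
     (\<forall>\<theta>\<in>space P. Wxh 0 \<theta> = W0xh \<theta> \<and> Why 0 \<theta> = W0hy \<theta> \<and>
        (\<forall>\<theta>'\<in>space P. Whh 0 \<theta> \<theta>' = W0hh \<theta> \<theta>')) \<and>
     (\<exists>Dxh Dhh Dhy.
        (\<forall>t\<ge>0. \<forall>\<theta>\<in>space P.
           ((\<lambda>s. Wxh s \<theta>) has_vector_derivative Dxh t \<theta>) (at t within {0..}) \<and>
           ((\<lambda>s. Why s \<theta>) has_real_derivative Dhy t \<theta>) (at t within {0..}) \<and>
           (\<forall>\<theta>'\<in>space P. ((\<lambda>s. Whh s \<theta> \<theta>') has_real_derivative Dhh t \<theta> \<theta>') (at t within {0..}))) \<and>
        (\<forall>t\<ge>0.
           vd_hy P (loss P \<nu> Fs \<sigma> L) (Wxh t) (Whh t) (Why t) (\<lambda>\<theta>. - Dhy t \<theta>) \<and>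
           vd_xh P (loss P \<nu> Fs \<sigma> L) (Wxh t) (Whh t) (Why t) (\<lambda>\<theta>. - Dxh t \<theta>) \<and>
           (\<exists>g. vd_hh P (loss P \<nu> Fs \<sigma> L) (Wxh t) (Whh t) (Why t) g \<and>
              (\<forall>\<theta>\<in>space P. \<forall>\<theta>'\<in>space P. Dhh t \<theta> \<theta>' = - chi (Whh t \<theta> \<theta>') * g \<theta> \<theta>'))))"

text \<open>moment_const M f = sup_{m>=1} m^(-1/2) (integral f^m)^(1/m), written as the least c
  with (integral f^m) <= (c sqrt m)^m for all m >= 1 (infinity if no such c).\<close>
definition moment_const :: "'a measure \<Rightarrow> ('a \<Rightarrow> ennreal) \<Rightarrow> ereal" where
  "moment_const M f = Inf {ereal c | c. 0 \<le> c \<and>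
     (\<forall>m::nat. 1 \<le> m \<longrightarrow> (\<integral>\<^sup>+x. f x ^ m \<partial>M) \<le> ennreal ((c * sqrt (real m)) ^ m))}"

definition subg :: "'a measure \<Rightarrow> ('a \<Rightarrow> ennreal) \<Rightarrow> ereal" where
  "subg M f = ereal (sqrt 50) * moment_const M f"

definition psi_norm :: "'w measure \<Rightarrow> (real \<Rightarrow> 'w \<Rightarrow> real^'d) \<Rightarrow> (real \<Rightarrow> 'w \<Rightarrow> 'w \<Rightarrow> real)
    \<Rightarrow> (real \<Rightarrow> 'w \<Rightarrow> real) \<Rightarrow> real \<Rightarrow> ereal" where
  "psi_norm P Wxh Whh Why t = max (subg (P \<Otimes>\<^sub>M P) (\<lambda>z. SUP s\<in>{0..<t}. ennreal \<bar>Whh s (fst z) (snd z)\<bar>))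
     (max (subg P (\<lambda>\<theta>. SUP s\<in>{0..<t}. ennreal (norm (Wxh s \<theta>))))
          (subg P (\<lambda>\<theta>. SUP s\<in>{0..<t}. ennreal \<bar>Why s \<theta>\<bar>)))"

definition psi_norm0 :: "'w measure \<Rightarrow> ('w \<Rightarrow> real^'d) \<Rightarrow> ('w \<Rightarrow> 'w \<Rightarrow> real)
    \<Rightarrow> ('w \<Rightarrow> real) \<Rightarrow> ereal" where
  "psi_norm0 P Wxh Whh Why = max (subg (P \<Otimes>\<^sub>M P) (\<lambda>z. ennreal \<bar>Whh (fst z) (snd z)\<bar>))
     (max (subg P (\<lambda>\<theta>. ennreal (norm (Wxh \<theta>)))) (subg P (\<lambda>\<theta>. ennreal \<bar>Why \<theta>\<bar>)))"

definition admissible :: "'w measure \<Rightarrow> (real \<Rightarrow> 'w \<Rightarrow> real^'d) \<Rightarrow> (real \<Rightarrow> 'w \<Rightarrow> 'w \<Rightarrow> real)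
    \<Rightarrow> (real \<Rightarrow> 'w \<Rightarrow> real) \<Rightarrow> bool" where
  "admissible P Wxh Whh Why \<longleftrightarrow>
     (\<forall>t\<ge>0. Wxh t \<in> borel_measurable P \<and> Why t \<in> borel_measurable P \<and>
             case_prod (Whh t) \<in> borel_measurable (P \<Otimes>\<^sub>M P)) \<and>
     (\<forall>t>0. psi_norm P Wxh Whh Why t < \<infinity>)"

definition smooth_fun :: "(real \<Rightarrow> real) \<Rightarrow> bool" where
  "smooth_fun f \<longleftrightarrow> (\<exists>D. D 0 = f \<and> (\<forall>n x. (D n has_real_derivative D (Suc n) x) (at x)))"

definition L2_dist :: "'w measure \<Rightarrow> ('w \<Rightarrow> real) \<Rightarrow> ('w \<Rightarrow> real) \<Rightarrow> real" where
  "L2_dist P f g = sqrt (\<integral>\<theta>. (f \<theta> - g \<theta>)^2 \<partial>P)"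

text \<open>(w,f,g) lies in the support of the law of
  theta |-> (W_xh(0;theta), W_hh(0;.,theta), W_hh(0;theta,.)) in R^d x L^2 x L^2.\<close>
definition in_support :: "'w measure \<Rightarrow> ('w \<Rightarrow> real^'d) \<Rightarrow> ('w \<Rightarrow> 'w \<Rightarrow> real)
    \<Rightarrow> real^'d \<Rightarrow> ('w \<Rightarrow> real) \<Rightarrow> ('w \<Rightarrow> real) \<Rightarrow> bool" where
  "in_support P W0xh W0hh w f g \<longleftrightarrow>
     (\<forall>\<epsilon>>0. emeasure P {\<theta>\<in>space P. norm (W0xh \<theta> - w) + L2_dist P (\<lambda>\<theta>'. W0hh \<theta>' \<theta>) f
                                     + L2_dist P (\<lambda>\<theta>'. W0hh \<theta> \<theta>') g < \<epsilon>} > 0)"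

definition LinfR :: "'w measure \<Rightarrow> real \<Rightarrow> ('w \<Rightarrow> real) \<Rightarrow> bool" where
  "LinfR P R f \<longleftrightarrow> f \<in> borel_measurable P \<and> (\<forall>\<theta>\<in>space P. \<bar>f \<theta>\<bar> \<le> R)"

definition support_condition :: "'w measure \<Rightarrow> real \<Rightarrow> ('w \<Rightarrow> real^'d) \<Rightarrow> ('w \<Rightarrow> 'w \<Rightarrow> real) \<Rightarrow> bool" where
  "support_condition P R W0xh W0hh \<longleftrightarrow>
     (\<forall>w f g. LinfR P R f \<and> LinfR P R g \<longrightarrow> in_support P W0xh W0hh w f g) \<and>
     (\<forall>w f g. sq_int P f \<and> sq_int P g \<and> in_support P W0xh W0hh w f g \<longrightarrow>
        (AE \<theta> in P. \<bar>f \<theta>\<bar> \<le> R) \<and> (AE \<theta> in P. \<bar>g \<theta>\<bar> \<le> R))"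

definition dense_span :: "(real \<Rightarrow> real) \<Rightarrow> (real^'d) measure \<Rightarrow> bool" where
  "dense_span \<sigma> \<mu> \<longleftrightarrow>
     (\<forall>f. sq_int \<mu> (f :: real^'d \<Rightarrow> real) \<longrightarrow>
        (\<forall>\<epsilon>>0. \<exists>n (c :: nat \<Rightarrow> real) (w :: nat \<Rightarrow> real^'d).
           (\<integral>y. (f y - (\<Sum>i<n. c i * \<sigma> (w i \<bullet> y)))^2 \<partial>\<mu>) < \<epsilon>))"

end

(*
  The vector field is not Lipschitz: its Lipschitz constant at a neuron theta is of order
  a(theta) = 1 + |W0hy theta|, because the gradient in W_hy-direction is bounded, so that
  |W_hy(t, theta)| stays below |W0hy theta| + C(t).  The differences of two paths are therefore
  measured pointwise in theta against weights exp(mu t) v(t, theta), v = exp(a (1 + kappa t)), whose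
  logarithmic derivative mu + kappa a dominates twice the Lipschitz constant; sub-Gaussianity
  makes all averages of v finite.  For W_hh the weight is multiplied by 1 + eta v(t, theta') with
  eta = 1 / E[a v(T)], so that averaging over theta' costs only a factor 2; otherwise the rate kappa would depend
  on its own exponential moments.  In these norms the time-integrated vector field is a
  1/2-contraction on every [0, T], which gives existence by Picard iteration and uniqueness.

  W_hh is clipped to [-R, R] in the vector field; since chi vanishes outside this interval, solutions
  never leave it.  Variational derivatives are only determined almost everywhere for each time;
  for uniqueness, Fubini turns this into an identity for almost all theta and almost all times, and the
  Henstock-Kurzweil integral recovers the everywhere differentiable path from its derivative.
*)

theory Submission
  imports Defs
begin

section \<open>Weights, backpropagation and measurability\<close>

text \<open>The order in which the constants are fixed is what makes the weighted norm work. Every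
  Lipschitz bound is brought to the form \<open>c * (C0 * (a * v) + C1 * v)\<close>. Only
  \<open>C0\<close> has to be beaten by \<open>\<kappa>\<close>; it is built from \<open>K\<close>,
  \<open>R\<close>, \<open>B\<close>, \<open>L\<close>, \<open>q\<close>, the mean of
  \<open>a\<close> and the growth bound of W_hy, but from no moment of \<open>v\<close>. Whatever
  passes through an average over neurons produces the moment \<open>m = E[a v(T)]\<close> or
  \<open>1 / \<eta>\<close>, but then multiplies at most \<open>v\<close>, so it enters
  \<open>C1\<close> and is paid for by \<open>\<mu>\<close>. Hence \<open>C0\<close>,
  \<open>\<kappa>\<close>, \<open>v\<close>, \<open>m\<close>, \<open>\<eta>\<close>,
  \<open>\<mu>\<close> are chosen one after the other without circularity, for arbitrary T, and no
  continuation argument is needed. As \<open>\<kappa> * T\<close> may be large, exponential moments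
  of W0hy of every order are required; sub-Gaussian tails provide them, whereas exponential tails
  would limit the method to a finite time. The gradient is computed by backpropagation for all L2
  directions at once: perturbations of W_hh may be unbounded, so the loss is differentiated through
  a tangent recursion with L1 majorants, which Fubini then transposes.\<close>

locale rnn = P: prob_space P + nu: prob_space \<nu>
  for P :: "'w measure" and \<nu> :: "(int \<Rightarrow> real^'d) measure" +
  fixes Fs :: "(int \<Rightarrow> real^'d) \<Rightarrow> real" and L :: nat and \<sigma> \<sigma>' :: "real \<Rightarrow> real" and R K B :: real
  assumes sets_nu [measurable_cong]: "sets \<nu> = sets seq_space"
    and Fs_meas [measurable]: "Fs \<in> borel_measurable \<nu>"
    and Fs_L2: "integrable \<nu> (\<lambda>x. (Fs x)^2)"
    and moment4: "\<And>k. integrable \<nu> (\<lambda>x. norm (x k) ^ 4)"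
    and sigma_bdd: "\<And>w. \<bar>\<sigma> w\<bar> \<le> B"
    and sigma_deriv: "\<And>w. (\<sigma> has_real_derivative \<sigma>' w) (at w)"
    and sigma'_bdd: "\<And>w. \<bar>\<sigma>' w\<bar> \<le> K"
    and sigma'_lip: "\<And>u v. \<bar>\<sigma>' u - \<sigma>' v\<bar> \<le> K * \<bar>u - v\<bar>"
    and R_pos: "0 < R" and K_pos: "0 < K"
begin

lemma B_nonneg: "0 \<le> B"
  using sigma_bdd[of 0] by linarith

lemma sigma_lip: "\<bar>\<sigma> u - \<sigma> v\<bar> \<le> K * \<bar>u - v\<bar>"
  using field_differentiable_bound[of UNIV \<sigma> \<sigma>' K u v] sigma_deriv sigma'_bdd
  by (auto simp: has_field_derivative_at_within)

lemma continuous_sigma: "continuous_on A \<sigma>"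
  by (meson DERIV_continuous_on has_field_derivative_at_within sigma_deriv)

lemma continuous_sigma': "continuous_on A \<sigma>'"
proof (rule lipschitz_on_continuous_on)
  show "K-lipschitz_on A \<sigma>'"
    using sigma'_lip K_pos by (auto simp: lipschitz_on_def dist_real_def)
qed

lemma sigma_measurable [measurable]: "\<sigma> \<in> borel_measurable borel"
  and sigma'_measurable [measurable]: "\<sigma>' \<in> borel_measurable borel"
  by (auto intro: borel_measurable_continuous_onI continuous_sigma continuous_sigma')

text \<open>The preactivation with index \<open>j\<close> reads the input
  \<open>x (- int (L - j))\<close>: \<open>j = 0\<close> belongs to the oldest input, where the
  hidden contribution is 0, and \<open>j = L\<close> to the output time.\<close>

definition Z :: "('w \<Rightarrow> real^'d) \<Rightarrow> ('w \<Rightarrow> 'w \<Rightarrow> real) \<Rightarrow> (int \<Rightarrow> real^'d) \<Rightarrow> nat \<Rightarrow> 'w \<Rightarrow> real" where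
  "Z wx wh x j \<theta> = Hhh P \<sigma> wx wh x L j \<theta> + wx \<theta> \<bullet> x (- int (L - j))"

text \<open>The adjoint (backpropagated) variable: \<open>M wx wh wy x i\<close> is the sensitivity of the output with
  respect to the preactivation that reads the input \<open>x (- int i)\<close>.\<close>
primrec M :: "('w \<Rightarrow> real^'d) \<Rightarrow> ('w \<Rightarrow> 'w \<Rightarrow> real) \<Rightarrow> ('w \<Rightarrow> real) \<Rightarrow> (int \<Rightarrow> real^'d)
    \<Rightarrow> nat \<Rightarrow> 'w \<Rightarrow> real" where
  "M wx wh wy x 0 \<theta> = wy \<theta> * \<sigma>' (Z wx wh x L \<theta>)"
| "M wx wh wy x (Suc i) \<theta> = \<sigma>' (Z wx wh x (L - Suc i) \<theta>) * (\<integral>\<theta>'. M wx wh wy x i \<theta>' * wh \<theta>' \<theta> \<partial>P)"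

definition err :: "('w \<Rightarrow> real^'d) \<Rightarrow> ('w \<Rightarrow> 'w \<Rightarrow> real) \<Rightarrow> ('w \<Rightarrow> real) \<Rightarrow> (int \<Rightarrow> real^'d) \<Rightarrow> real" where
  "err wx wh wy x = Fs x - (\<integral>\<theta>. wy \<theta> * \<sigma> (Z wx wh x L \<theta>) \<partial>P)"

text \<open>\<open>Gy\<close>, \<open>Gx\<close> and \<open>Gh\<close> are the gradients predicted
  by backpropagation through time; the sign comes from differentiating the residual
  \<open>Fs - Fhat\<close>. In \<open>Gh\<close> the adjoint with index \<open>i\<close> is paired
  with the preactivation \<open>L - Suc i\<close>, one step earlier in time, which is why its sum
  stops before \<open>L\<close>.\<close>

definition Gy :: "('w \<Rightarrow> real^'d) \<Rightarrow> ('w \<Rightarrow> 'w \<Rightarrow> real) \<Rightarrow> ('w \<Rightarrow> real) \<Rightarrow> 'w \<Rightarrow> real" where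
  "Gy wx wh wy \<theta> = - (\<integral>x. err wx wh wy x * \<sigma> (Z wx wh x L \<theta>) \<partial>\<nu>)"

definition Gx :: "('w \<Rightarrow> real^'d) \<Rightarrow> ('w \<Rightarrow> 'w \<Rightarrow> real) \<Rightarrow> ('w \<Rightarrow> real) \<Rightarrow> 'w \<Rightarrow> real^'d" where
  "Gx wx wh wy \<theta> = - (\<integral>x. err wx wh wy x *\<^sub>R (\<Sum>i\<le>L. M wx wh wy x i \<theta> *\<^sub>R x (- int i)) \<partial>\<nu>)"

definition Gh :: "('w \<Rightarrow> real^'d) \<Rightarrow> ('w \<Rightarrow> 'w \<Rightarrow> real) \<Rightarrow> ('w \<Rightarrow> real) \<Rightarrow> 'w \<Rightarrow> 'w \<Rightarrow> real" where
  "Gh wx wh wy \<theta> \<theta>' =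
     - (\<integral>x. err wx wh wy x * (\<Sum>i<L. M wx wh wy x i \<theta> * \<sigma> (Z wx wh x (L - Suc i) \<theta>')) \<partial>\<nu>)"

lemma Hhh_Suc_Z: "Hhh P \<sigma> wx wh x L (Suc j) \<theta> = (\<integral>\<theta>'. wh \<theta> \<theta>' * \<sigma> (Z wx wh x j \<theta>') \<partial>P)"
  by (simp add: Z_def)

lemma Fhat_Z: "Fhat P \<sigma> L wx wh wy x = (\<integral>\<theta>. wy \<theta> * \<sigma> (Z wx wh x L \<theta>) \<partial>P)"
  by (simp add: Fhat_def Z_def)

lemma err_Fhat: "err wx wh wy x = Fs x - Fhat P \<sigma> L wx wh wy x"
  by (simp add: err_def Fhat_Z)

section \<open>Joint measurability in parameter, input and neuron\<close>

lemma component_measurable [measurable]: "(\<lambda>x. x k) \<in> borel_measurable \<nu>"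
proof -
  have "(\<lambda>x. x k) \<in> borel_measurable seq_space"
    by (rule measurable_component_singleton) simp
  then show ?thesis
    by (simp cong: measurable_cong_sets add: sets_nu)
qed

text \<open>The parameter space \<open>N\<close> will be the time axis, the space of input sequences, or their product.\<close>
definition meas_weights :: "'p measure \<Rightarrow> ('p \<Rightarrow> 'w \<Rightarrow> real^'d) \<Rightarrow> ('p \<Rightarrow> 'w \<Rightarrow> 'w \<Rightarrow> real)
    \<Rightarrow> ('p \<Rightarrow> 'w \<Rightarrow> real) \<Rightarrow> bool" where
  "meas_weights N wx wh wy \<longleftrightarrow>
     (\<lambda>(p, \<theta>). wx p \<theta>) \<in> borel_measurable (N \<Otimes>\<^sub>M P) \<and>
     (\<lambda>(p, \<theta>, \<theta>'). wh p \<theta> \<theta>') \<in> borel_measurable (N \<Otimes>\<^sub>M (P \<Otimes>\<^sub>M P)) \<and>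
     (\<lambda>(p, \<theta>). wy p \<theta>) \<in> borel_measurable (N \<Otimes>\<^sub>M P)"

lemma meas_weightsD:
  assumes "meas_weights N wx wh wy"
    and [measurable]: "f \<in> measurable A N" "g \<in> measurable A P"
  shows "(\<lambda>w. wx (f w) (g w)) \<in> borel_measurable A"
    and "(\<lambda>w. wy (f w) (g w)) \<in> borel_measurable A"
    and "h \<in> measurable A P \<Longrightarrow> (\<lambda>w. wh (f w) (g w) (h w)) \<in> borel_measurable A"
proof -
  have [measurable]: "(\<lambda>(p, \<theta>). wx p \<theta>) \<in> borel_measurable (N \<Otimes>\<^sub>M P)"
    "(\<lambda>(p, \<theta>, \<theta>'). wh p \<theta> \<theta>') \<in> borel_measurable (N \<Otimes>\<^sub>M (P \<Otimes>\<^sub>M P))"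
    "(\<lambda>(p, \<theta>). wy p \<theta>) \<in> borel_measurable (N \<Otimes>\<^sub>M P)"
    using assms(1) by (auto simp: meas_weights_def)
  show "(\<lambda>w. wx (f w) (g w)) \<in> borel_measurable A" "(\<lambda>w. wy (f w) (g w)) \<in> borel_measurable A"
    by measurable
  assume [measurable]: "h \<in> measurable A P"
  show "(\<lambda>w. wh (f w) (g w) (h w)) \<in> borel_measurable A"
    using measurable_compose[of "\<lambda>w. (f w, g w, h w)" A "N \<Otimes>\<^sub>M (P \<Otimes>\<^sub>M P)"
        "\<lambda>(p, \<theta>, \<theta>'). wh p \<theta> \<theta>'"] by simp
qed

lemma meas_weights_reparam:
  assumes "meas_weights N wx wh wy" and [measurable]: "f \<in> measurable A N"
  shows "meas_weights A (\<lambda>q. wx (f q)) (\<lambda>q. wh (f q)) (\<lambda>q. wy (f q))"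
  unfolding meas_weights_def split_beta'
  using assms(1) by (intro conjI meas_weightsD) measurable

lemma meas_weights_const:
  assumes [measurable]: "wx \<in> borel_measurable P" "case_prod wh \<in> borel_measurable (P \<Otimes>\<^sub>M P)"
    "wy \<in> borel_measurable P"
  shows "meas_weights N (\<lambda>_. wx) (\<lambda>_. wh) (\<lambda>_. wy)"
  unfolding meas_weights_def by measurable

context
  fixes N :: "'p measure" and wx wh wy and xs :: "'p \<Rightarrow> int \<Rightarrow> real^'d"
  assumes W: "meas_weights N wx wh wy"
    and xs [measurable]: "\<And>k. (\<lambda>p. xs p k) \<in> borel_measurable N"
begin

lemma Z_measurable_param:
  "(\<lambda>(p, \<theta>). Z (wx p) (wh p) (xs p) j \<theta>) \<in> borel_measurable (N \<Otimes>\<^sub>M P)"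
proof (induction j)
  case 0
  have [measurable]: "(\<lambda>z. wx (fst z) (snd z)) \<in> borel_measurable (N \<Otimes>\<^sub>M P)"
    by (rule meas_weightsD[OF W]) measurable
  show ?case by (simp add: Z_def split_beta')
next
  case (Suc j)
  note [measurable] = Suc
  have [measurable]: "(\<lambda>z. wx (fst z) (snd z)) \<in> borel_measurable (N \<Otimes>\<^sub>M P)"
    "(\<lambda>w. wh (fst (fst w)) (snd (fst w)) (snd w)) \<in> borel_measurable ((N \<Otimes>\<^sub>M P) \<Otimes>\<^sub>M P)"
    by (rule meas_weightsD[OF W], measurable)+
  show ?case
    \<comment> \<open>The inner preactivation is folded back, so that the induction hypothesis,
      declared as a measurability rule, covers the integrand.\<close>
    unfolding Z_def Hhh_Suc_Z unfolding Z_def[symmetric]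
    by (simp only: split_beta') measurable
qed

lemma M_measurable_param:
  "(\<lambda>(p, \<theta>). M (wx p) (wh p) (wy p) (xs p) i \<theta>) \<in> borel_measurable (N \<Otimes>\<^sub>M P)"
proof (induction i)
  case 0
  note [measurable] = Z_measurable_param
  have [measurable]: "(\<lambda>z. wy (fst z) (snd z)) \<in> borel_measurable (N \<Otimes>\<^sub>M P)"
    by (rule meas_weightsD[OF W]) measurable
  show ?case by (simp add: split_beta')
next
  case (Suc i)
  note [measurable] = Suc Z_measurable_param
  have [measurable]: "(\<lambda>w. wh (fst (fst w)) (snd w) (snd (fst w))) \<in> borel_measurable ((N \<Otimes>\<^sub>M P) \<Otimes>\<^sub>M P)"
    by (rule meas_weightsD[OF W]) measurable
  show ?case
    by (simp add: split_beta')
qed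

lemma err_measurable_param: "(\<lambda>p. err (wx p) (wh p) (wy p) (xs p)) \<in> borel_measurable N"
proof -
  note [measurable] = Z_measurable_param
  have "xs \<in> measurable N seq_space"
    by (rule measurable_PiM_single') (auto simp: xs)
  then have "xs \<in> measurable N \<nu>"
    by (simp cong: measurable_cong_sets add: sets_nu)
  then have [measurable]: "(\<lambda>p. Fs (xs p)) \<in> borel_measurable N"
    by measurable
  have [measurable]: "(\<lambda>z. wy (fst z) (snd z)) \<in> borel_measurable (N \<Otimes>\<^sub>M P)"
    by (rule meas_weightsD[OF W]) measurable
  have [measurable]: "(\<lambda>(p, \<theta>). wy p \<theta>) \<in> borel_measurable (N \<Otimes>\<^sub>M P)"
    using W by (simp add: meas_weights_def)
  show ?thesis unfolding err_def by measurable
qed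

end

context
  fixes N :: "'p measure" and wx wh wy
  assumes W: "meas_weights N wx wh wy"
begin

text \<open>The space \<open>A\<close> itself becomes the parameter space: weights, input sequence
  and neuron may all depend on the same variable. This form applies to arbitrary nested
  products.\<close>

lemma
  shows Z_nu: "\<And>f g h. f \<in> measurable A N \<Longrightarrow> g \<in> measurable A \<nu> \<Longrightarrow> h \<in> measurable A P \<Longrightarrow>
      (\<lambda>w. Z (wx (f w)) (wh (f w)) (g w) j (h w)) \<in> borel_measurable A"
    and M_nu: "\<And>f g h. f \<in> measurable A N \<Longrightarrow> g \<in> measurable A \<nu> \<Longrightarrow> h \<in> measurable A P \<Longrightarrow>
      (\<lambda>w. M (wx (f w)) (wh (f w)) (wy (f w)) (g w) j (h w)) \<in> borel_measurable A"
    and err_nu: "\<And>f g. f \<in> measurable A N \<Longrightarrow> g \<in> measurable A \<nu> \<Longrightarrow>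
      (\<lambda>w. err (wx (f w)) (wh (f w)) (wy (f w)) (g w)) \<in> borel_measurable A"
proof -
  fix f g h assume [measurable]: "f \<in> measurable A N" "g \<in> measurable A \<nu>"
  have 1: "meas_weights A (\<lambda>q. wx (f q)) (\<lambda>q. wh (f q)) (\<lambda>q. wy (f q))"
    by (rule meas_weights_reparam[OF W]) measurable
  have 2: "(\<lambda>q. g q k) \<in> borel_measurable A" for k
    by measurable
  show "(\<lambda>w. err (wx (f w)) (wh (f w)) (wy (f w)) (g w)) \<in> borel_measurable A"
    by (rule err_measurable_param[OF 1 2])
  assume [measurable]: "h \<in> measurable A P"
  note [measurable] = Z_measurable_param[OF 1 2] M_measurable_param[OF 1 2]
  show "(\<lambda>w. Z (wx (f w)) (wh (f w)) (g w) j (h w)) \<in> borel_measurable A"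
    "(\<lambda>w. M (wx (f w)) (wh (f w)) (wy (f w)) (g w) j (h w)) \<in> borel_measurable A"
    by measurable
qed

lemma Gy_measurable_param: "(\<lambda>(p, \<theta>). Gy (wx p) (wh p) (wy p) \<theta>) \<in> borel_measurable (N \<Otimes>\<^sub>M P)"
proof -
  have [measurable]: "(\<lambda>w. Z (wx (fst (fst w))) (wh (fst (fst w))) (snd w) L (snd (fst w)))
        \<in> borel_measurable ((N \<Otimes>\<^sub>M P) \<Otimes>\<^sub>M \<nu>)"
    "(\<lambda>w. err (wx (fst (fst w))) (wh (fst (fst w))) (wy (fst (fst w))) (snd w))
        \<in> borel_measurable ((N \<Otimes>\<^sub>M P) \<Otimes>\<^sub>M \<nu>)"
    by (rule Z_nu err_nu, measurable)+
  show ?thesis unfolding Gy_def split_beta' by measurable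
qed

lemma Gx_measurable_param: "(\<lambda>(p, \<theta>). Gx (wx p) (wh p) (wy p) \<theta>) \<in> borel_measurable (N \<Otimes>\<^sub>M P)"
proof -
  have [measurable]: "(\<lambda>w. M (wx (fst (fst w))) (wh (fst (fst w))) (wy (fst (fst w))) (snd w) i (snd (fst w)))
        \<in> borel_measurable ((N \<Otimes>\<^sub>M P) \<Otimes>\<^sub>M \<nu>)" for i
    by (rule M_nu) measurable
  have [measurable]: "(\<lambda>w. err (wx (fst (fst w))) (wh (fst (fst w))) (wy (fst (fst w))) (snd w))
        \<in> borel_measurable ((N \<Otimes>\<^sub>M P) \<Otimes>\<^sub>M \<nu>)"
    by (rule err_nu) measurable
  show ?thesis unfolding Gx_def split_beta' by measurable
qed

lemma Gh_measurable_param: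
  "(\<lambda>(p, \<theta>, \<theta>'). Gh (wx p) (wh p) (wy p) \<theta> \<theta>') \<in> borel_measurable (N \<Otimes>\<^sub>M (P \<Otimes>\<^sub>M P))"
proof -
  have [measurable]: "(\<lambda>w. M (wx (fst (fst w))) (wh (fst (fst w))) (wy (fst (fst w))) (snd w) i (fst (snd (fst w))))
        \<in> borel_measurable ((N \<Otimes>\<^sub>M (P \<Otimes>\<^sub>M P)) \<Otimes>\<^sub>M \<nu>)"
    "(\<lambda>w. Z (wx (fst (fst w))) (wh (fst (fst w))) (snd w) i (snd (snd (fst w))))
        \<in> borel_measurable ((N \<Otimes>\<^sub>M (P \<Otimes>\<^sub>M P)) \<Otimes>\<^sub>M \<nu>)" for i
    by (rule Z_nu M_nu, measurable)+
  have [measurable]: "(\<lambda>w. err (wx (fst (fst w))) (wh (fst (fst w))) (wy (fst (fst w))) (snd w))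
        \<in> borel_measurable ((N \<Otimes>\<^sub>M (P \<Otimes>\<^sub>M P)) \<Otimes>\<^sub>M \<nu>)"
    by (rule err_nu) measurable
  show ?thesis unfolding Gh_def split_beta' by measurable
qed

end

end

section \<open>Growth bounds\<close>

text \<open>No integrability of \<open>f\<close> is assumed: a Bochner integral that does not exist
  is 0 by convention, and the majorant has a nonnegative integral. This spares many side
  conditions.\<close>

lemma norm_integral_le_AE:
  fixes f :: "'a \<Rightarrow> 'b::{banach, second_countable_topology}"
  assumes "integrable M g" and "AE x in M. norm (f x) \<le> g x"
  shows "norm (\<integral>x. f x \<partial>M) \<le> (\<integral>x. g x \<partial>M)"
proof (cases "integrable M f")
  case True
  have "norm (\<integral>x. f x \<partial>M) \<le> (\<integral>x. norm (f x) \<partial>M)"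
    by (rule integral_norm_bound)
  also have "\<dots> \<le> (\<integral>x. g x \<partial>M)"
    using True assms by (intro integral_mono_AE) auto
  finally show ?thesis .
next
  case False
  have "AE x in M. 0 \<le> g x"
    using assms(2) by eventually_elim (meson norm_ge_zero order_trans)
  then have "0 \<le> (\<integral>x. g x \<partial>M)"
    by (rule integral_nonneg_AE)
  then show ?thesis
    using False by (simp add: not_integrable_integral_eq)
qed

lemma norm_integral_le_mult:
  fixes f :: "'a \<Rightarrow> 'b::{banach, second_countable_topology}"
  assumes "AE x in M. norm (f x) \<le> C * g x" and "integrable M g"
  shows "norm (\<integral>x. f x \<partial>M) \<le> C * (\<integral>x. g x \<partial>M)"
  using norm_integral_le_AE[OF _ assms(1)] assms(2) by simp

lemma integrable_mult_of_squares:
  fixes f g :: "'a \<Rightarrow> real"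
  assumes [measurable]: "f \<in> borel_measurable M" "g \<in> borel_measurable M"
    and "integrable M (\<lambda>x. (f x)^2)" "integrable M (\<lambda>x. (g x)^2)"
  shows "integrable M (\<lambda>x. f x * g x)"
proof (rule Bochner_Integration.integrable_bound[where f="\<lambda>x. (f x)^2 + (g x)^2"])
  have "norm (f x * g x) \<le> norm ((f x)\<^sup>2 + (g x)\<^sup>2)" for x
  proof -
    have "2 * \<bar>f x * g x\<bar> \<le> (f x)\<^sup>2 + (g x)\<^sup>2"
      using sum_squares_bound[of "\<bar>f x\<bar>" "\<bar>g x\<bar>"] by (simp add: abs_mult mult.assoc)
    then show ?thesis by (simp del: abs_mult)
  qed
  then show "AE x in M. norm (f x * g x) \<le> norm ((f x)\<^sup>2 + (g x)\<^sup>2)"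
    by blast
qed (use assms in auto)

lemma power4_add_le: "\<bar>x + y\<bar> ^ 4 \<le> 8 * (\<bar>x\<bar> ^ 4 + \<bar>y\<bar> ^ 4)" for x y :: real
proof -
  have sq: "(a + b)^2 \<le> 2 * (a^2 + b^2)" for a b :: real
    using sum_squares_bound[of a b] by (simp add: power2_sum)
  have "\<bar>x + y\<bar> ^ 4 = ((x + y)^2)^2"
    by simp
  also have "\<dots> \<le> (2 * (x^2 + y^2))^2"
    using sq by (intro power_mono) auto
  also have "\<dots> = 4 * (x^2 + y^2)^2"
    by (simp add: power2_eq_square algebra_simps)
  also have "\<dots> \<le> 4 * (2 * ((x^2)^2 + (y^2)^2))"
    using sq[of "x^2" "y^2"] by simp
  finally show ?thesis
    by simp
qed

lemma integrable_power4_add: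
  fixes f g :: "'a \<Rightarrow> real"
  assumes [measurable]: "f \<in> borel_measurable M" "g \<in> borel_measurable M"
    and "integrable M (\<lambda>x. \<bar>f x\<bar>^4)" "integrable M (\<lambda>x. \<bar>g x\<bar>^4)"
  shows "integrable M (\<lambda>x. \<bar>f x + g x\<bar>^4)"
  by (rule Bochner_Integration.integrable_bound[where f="\<lambda>x. 8 * (\<bar>f x\<bar>^4 + \<bar>g x\<bar>^4)"])
     (use assms power4_add_le in auto)

section \<open>Integrable majorants in the input sequence\<close>

context rnn
begin

lemma space_nu [simp]: "space \<nu> = UNIV"
  using sets_eq_imp_space_eq[OF sets_nu] by (simp add: space_PiM)

definition S :: "(int \<Rightarrow> real^'d) \<Rightarrow> real" where
  "S x = 1 + (\<Sum>i\<le>L. norm (x (- int i)))"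

text \<open>A single integrable majorant for the integrals over the input: the residual contributes
  \<open>1 + |Fs|\<close> and the other factors at most \<open>S^2\<close>. It is integrable because
  \<open>Fs\<close> and \<open>S^2\<close> are in L2, the latter by the fourth moments.\<close>

definition Q :: "(int \<Rightarrow> real^'d) \<Rightarrow> real" where
  "Q x = (1 + \<bar>Fs x\<bar>) * (S x)^2"

definition q :: real where
  "q = (\<integral>x. Q x \<partial>\<nu>)"

lemma S_measurable [measurable]: "S \<in> borel_measurable \<nu>"
  and Q_measurable [measurable]: "Q \<in> borel_measurable \<nu>"
  unfolding S_def[abs_def] Q_def[abs_def] by measurable

lemma S_ge_1: "1 \<le> S x"
  by (simp add: S_def sum_nonneg)

lemma norm_le_S: "i \<le> L \<Longrightarrow> norm (x (- int i)) \<le> S x"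
  unfolding S_def using member_le_sum[of i "{..L}" "\<lambda>i. norm (x (- int i))"] by simp

lemma S_L4: "integrable \<nu> (\<lambda>x. (S x)^4)"
proof -
  have "integrable \<nu> (\<lambda>x. \<bar>1 + (\<Sum>i\<le>n. norm (x (- int i)))\<bar>^4)" for n
  proof (induction n)
    case 0
    show ?case using moment4[of 0] by (intro integrable_power4_add) auto
  next
    case (Suc n)
    have "integrable \<nu> (\<lambda>x. \<bar>(1 + (\<Sum>i\<le>n. norm (x (- int i)))) + norm (x (- int (Suc n)))\<bar>^4)"
      using moment4[of "- int (Suc n)"] Suc by (intro integrable_power4_add[where f="\<lambda>x. 1 + (\<Sum>i\<le>n. norm (x (- int i)))"]) (auto simp del: of_nat_Suc)
    then show ?case by (simp add: add.assoc)
  qed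
  from this[of L] show ?thesis by (simp add: S_def)
qed

lemma Fs1_L2: "integrable \<nu> (\<lambda>x. (1 + \<bar>Fs x\<bar>)^2)"
proof (rule Bochner_Integration.integrable_bound[where f="\<lambda>x. 2 * (1 + (Fs x)^2)"])
  have "norm ((1 + \<bar>Fs x\<bar>)^2) \<le> norm (2 * (1 + (Fs x)^2))" for x
    using sum_squares_bound[of 1 "\<bar>Fs x\<bar>"] by (simp add: power2_sum)
  then show "AE x in \<nu>. norm ((1 + \<bar>Fs x\<bar>)^2) \<le> norm (2 * (1 + (Fs x)^2))"
    by blast
qed (use Fs_L2 in auto)

lemma Q_integrable: "integrable \<nu> Q"
  unfolding Q_def[abs_def] using S_L4 Fs1_L2
  by (intro integrable_mult_of_squares) (auto simp flip: power_mult)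

lemma Q_ge_1: "1 \<le> Q x"
proof -
  have "1 * 1 \<le> (1 + \<bar>Fs x\<bar>) * (S x)^2"
    using S_ge_1[of x] by (intro mult_mono one_le_power) auto
  then show ?thesis by (simp add: Q_def)
qed

lemma Fs_S_le_Q: "(1 + \<bar>Fs x\<bar>) * S x \<le> Q x" "1 + \<bar>Fs x\<bar> \<le> Q x" "(S x)^2 \<le> Q x" "S x \<le> Q x"
proof -
  have "S x \<le> (S x)^2" using S_ge_1[of x] by (simp add: power2_eq_square)
  then show 1: "(1 + \<bar>Fs x\<bar>) * S x \<le> Q x" unfolding Q_def by (intro mult_left_mono) auto
  have "(1 + \<bar>Fs x\<bar>) * 1 \<le> (1 + \<bar>Fs x\<bar>) * S x" using S_ge_1 by (intro mult_left_mono) auto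
  with 1 show "1 + \<bar>Fs x\<bar> \<le> Q x" by simp
  show 2: "(S x)^2 \<le> Q x" unfolding Q_def
    using mult_right_mono[of 1 "1 + \<bar>Fs x\<bar>" "(S x)^2"] by simp
  with \<open>S x \<le> (S x)^2\<close> show "S x \<le> Q x" by simp
qed

lemma q_ge_1: "1 \<le> q"
proof -
  have "(\<integral>x. 1 \<partial>\<nu>) \<le> q"
    unfolding q_def using Q_integrable Q_ge_1 by (intro integral_mono) auto
  then show ?thesis using nu.prob_space by simp
qed

end

text \<open>\<open>a\<close> is a pointwise majorant of the output weights up to the factor
  \<open>A\<close>. It is kept abstract because two choices are needed: \<open>1 + |W0y|\<close> for
  the contraction and, for a given solution at a fixed time, \<open>1 + |y t|\<close>.\<close>

locale growth = rnn P \<nu> Fs L \<sigma> \<sigma>' R K B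
  for P :: "'w measure" and \<nu> :: "(int \<Rightarrow> real^'d) measure" and Fs L \<sigma> \<sigma>' R K B +
  fixes a :: "'w \<Rightarrow> real" and A :: real
  assumes a_meas [measurable]: "a \<in> borel_measurable P"
    and a_ge_1: "\<And>\<theta>. 1 \<le> a \<theta>"
    and a_L2: "integrable P (\<lambda>\<theta>. (a \<theta>)^2)"
    and A_nonneg: "0 \<le> A"
begin

definition a1 :: real where "a1 = (\<integral>\<theta>. a \<theta> \<partial>P)"

lemma a_integrable: "integrable P a"
  using integrable_mult_of_squares[of a P "\<lambda>_. 1"] a_L2 by simp

lemma a1_ge_1: "1 \<le> a1"
proof -
  have "(\<integral>x. 1 \<partial>P) \<le> a1"
    unfolding a1_def using a_integrable a_ge_1 by (intro integral_mono) auto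
  then show ?thesis by (simp add: P.prob_space)
qed

text \<open>\<open>E\<close> and \<open>D i\<close> are the constants in
  \<open>|err| \<le> E * (1 + |Fs|)\<close> and \<open>|M i| \<le> D i * a\<close>. One backward
  step multiplies by at most \<open>K * R * a1\<close>; the base \<open>1 + K * R * a1\<close> is
  taken so that \<open>D\<close> is also increasing and \<open>D L\<close> serves for all
  \<open>i \<le> L\<close>.\<close>

definition E :: real where "E = 1 + B * A * a1"

definition D :: "nat \<Rightarrow> real" where "D i = K * A * (1 + K * R * a1) ^ i"

lemma E_ge_1: "1 \<le> E"
  using a1_ge_1 A_nonneg B_nonneg by (simp add: E_def)

lemma D_nonneg: "0 \<le> D i"
  using a1_ge_1 A_nonneg K_pos R_pos by (simp add: D_def)

lemma D_mono: "i \<le> j \<Longrightarrow> D i \<le> D j"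
  unfolding D_def using a1_ge_1 A_nonneg K_pos R_pos
  by (intro mult_left_mono power_increasing) auto

end

text \<open>The bound on \<open>wy\<close> is only required on a set \<open>G\<close> of full
  measure. The Picard iterates satisfy it on all of \<open>space P\<close>, an arbitrary solution
  only almost everywhere, and the same estimates have to serve both.\<close>

locale weights = growth P \<nu> Fs L \<sigma> \<sigma>' R K B a A
  for P :: "'w measure" and \<nu> :: "(int \<Rightarrow> real^'d) measure" and Fs L \<sigma> \<sigma>' R K B a A +
  fixes wx :: "'w \<Rightarrow> real^'d" and wh :: "'w \<Rightarrow> 'w \<Rightarrow> real" and wy :: "'w \<Rightarrow> real" and G :: "'w set"
  assumes wx_meas [measurable]: "wx \<in> borel_measurable P"
    and wh_meas [measurable]: "case_prod wh \<in> borel_measurable (P \<Otimes>\<^sub>M P)"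
    and wy_meas [measurable]: "wy \<in> borel_measurable P"
    and wh_bdd: "\<And>\<theta> \<theta>'. \<theta> \<in> space P \<Longrightarrow> \<theta>' \<in> space P \<Longrightarrow> \<bar>wh \<theta> \<theta>'\<bar> \<le> R"
    and G_sub: "G \<subseteq> space P"
    and AE_G: "AE \<theta> in P. \<theta> \<in> G"
    and wy_bdd: "\<And>\<theta>. \<theta> \<in> G \<Longrightarrow> \<bar>wy \<theta>\<bar> \<le> A * a \<theta>"
begin

text \<open>A single triple of weights is a family over a one-point parameter space; the parametric
  measurability results then specialise.\<close>

lemma meas_weights_unit: "meas_weights (count_space (UNIV :: unit set)) (\<lambda>_. wx) (\<lambda>_. wh) (\<lambda>_. wy)"
  by (rule meas_weights_const) measurable

lemma Z_measurable [measurable (raw)]: "g \<in> measurable N \<nu> \<Longrightarrow> h \<in> measurable N P \<Longrightarrow>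
    (\<lambda>w. Z wx wh (g w) j (h w)) \<in> borel_measurable N"
  by (rule Z_nu[OF meas_weights_unit, of "\<lambda>_. ()"]) simp_all

lemma M_measurable [measurable (raw)]: "g \<in> measurable N \<nu> \<Longrightarrow> h \<in> measurable N P \<Longrightarrow>
    (\<lambda>w. M wx wh wy (g w) j (h w)) \<in> borel_measurable N"
  by (rule M_nu[OF meas_weights_unit, of "\<lambda>_. ()"]) simp_all

lemma err_measurable [measurable (raw)]: "g \<in> measurable N \<nu> \<Longrightarrow>
    (\<lambda>w. err wx wh wy (g w)) \<in> borel_measurable N"
  by (rule err_nu[OF meas_weights_unit, of "\<lambda>_. ()"]) simp_all

lemma Z_section_meas [measurable]: "(\<lambda>\<theta>. Z wx wh x j \<theta>) \<in> borel_measurable P"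
  and M_section_meas [measurable]: "(\<lambda>\<theta>. M wx wh wy x i \<theta>) \<in> borel_measurable P"
  by (rule Z_measurable M_measurable, simp_all)+

lemma wh_sigma_integrable: "\<theta> \<in> space P \<Longrightarrow> integrable P (\<lambda>\<theta>'. wh \<theta> \<theta>' * \<sigma> (Z wx wh x j \<theta>'))"
proof (rule P.integrable_const_bound[where B="R * B"])
  assume *: "\<theta> \<in> space P"
  show "AE \<theta>' in P. norm (wh \<theta> \<theta>' * \<sigma> (Z wx wh x j \<theta>')) \<le> R * B"
    using wh_bdd[OF *] sigma_bdd R_pos by (auto simp: abs_mult intro!: AE_I2 mult_mono)
  show "(\<lambda>\<theta>'. wh \<theta> \<theta>' * \<sigma> (Z wx wh x j \<theta>')) \<in> borel_measurable P"
    using * by measurable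
qed

lemma AE_wy_bdd: "AE \<theta> in P. \<bar>wy \<theta>\<bar> \<le> A * a \<theta>"
  using AE_G by eventually_elim (rule wy_bdd)

lemma wy_sigma_bdd: "AE \<theta> in P. norm (wy \<theta> * \<sigma> (Z wx wh x j \<theta>)) \<le> A * a \<theta> * B"
  using AE_wy_bdd
  by eventually_elim (use sigma_bdd A_nonneg a_ge_1 in \<open>auto simp: abs_mult intro!: mult_mono\<close>)

lemma wy_sigma_integrable: "integrable P (\<lambda>\<theta>. wy \<theta> * \<sigma> (Z wx wh x j \<theta>))"
proof (rule Bochner_Integration.integrable_bound[where f="\<lambda>\<theta>. A * a \<theta> * B"])
  show "integrable P (\<lambda>\<theta>. A * a \<theta> * B)"
    using a_integrable by simp
  show "AE \<theta> in P. norm (wy \<theta> * \<sigma> (Z wx wh x j \<theta>)) \<le> norm (A * a \<theta> * B)"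
    using wy_sigma_bdd by eventually_elim (use abs_ge_self order_trans in fastforce)
qed measurable

lemma output_bdd: "\<bar>\<integral>\<theta>. wy \<theta> * \<sigma> (Z wx wh x j \<theta>) \<partial>P\<bar> \<le> A * a1 * B"
  using norm_integral_le_AE[OF _ wy_sigma_bdd, of x j] a_integrable by (simp add: a1_def)

lemma err_bdd: "\<bar>err wx wh wy x\<bar> \<le> E * (1 + \<bar>Fs x\<bar>)"
proof -
  have "\<bar>err wx wh wy x\<bar> \<le> \<bar>Fs x\<bar> + A * a1 * B"
    using output_bdd[of x L] unfolding err_def by linarith
  also have "\<dots> \<le> (1 + B * A * a1) * (1 + \<bar>Fs x\<bar>)"
    using A_nonneg a1_ge_1 B_nonneg by (simp add: algebra_simps)
  finally show ?thesis by (simp add: E_def)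
qed

text \<open>Averaging over the next layer replaces \<open>a\<close> by its mean \<open>a1\<close>,
  so from \<open>i = 1\<close> on the adjoint is even bounded in \<theta>. The factor
  \<open>a \<theta>\<close> is kept to have one form for all \<open>i\<close>.\<close>

lemma M_bdd: "\<theta> \<in> G \<Longrightarrow> \<bar>M wx wh wy x i \<theta>\<bar> \<le> D i * a \<theta>"
proof (induction i arbitrary: \<theta>)
  case 0
  have "\<bar>wy \<theta>\<bar> * \<bar>\<sigma>' (Z wx wh x L \<theta>)\<bar> \<le> (A * a \<theta>) * K"
    using wy_bdd[OF 0] sigma'_bdd A_nonneg a_ge_1[of \<theta>] by (intro mult_mono) auto
  then show ?case by (simp add: D_def abs_mult algebra_simps)
next
  case (Suc i)
  have "AE \<theta>' in P. norm (M wx wh wy x i \<theta>' * wh \<theta>' \<theta>) \<le> (D i * R) * a \<theta>'"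
    using AE_G
  proof eventually_elim
    case (elim \<theta>')
    have "\<bar>M wx wh wy x i \<theta>'\<bar> * \<bar>wh \<theta>' \<theta>\<bar> \<le> (D i * a \<theta>') * R"
      using Suc elim wh_bdd G_sub D_nonneg[of i] a_ge_1[of \<theta>'] by (intro mult_mono) auto
    then show ?case by (simp add: abs_mult mult_ac)
  qed
  from norm_integral_le_mult[OF this a_integrable]
  have "\<bar>\<integral>\<theta>'. M wx wh wy x i \<theta>' * wh \<theta>' \<theta> \<partial>P\<bar> \<le> D i * a1 * R"
    by (simp add: a1_def mult_ac)
  then have "\<bar>M wx wh wy x (Suc i) \<theta>\<bar> \<le> K * (D i * a1 * R)"
    using sigma'_bdd K_pos by (simp add: abs_mult) (intro mult_mono, auto)
  also have "\<dots> \<le> D (Suc i)"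
    using D_nonneg[of i] K_pos R_pos a1_ge_1 by (simp add: D_def algebra_simps)
  also have "\<dots> \<le> D (Suc i) * a \<theta>"
    using D_nonneg a_ge_1[of \<theta>] mult_left_mono[of 1 "a \<theta>" "D (Suc i)"] by simp
  finally show ?case .
qed

lemma M_integral_bdd:
  assumes "\<theta> \<in> space P"
  shows "\<bar>\<integral>\<theta>'. M wx wh wy x i \<theta>' * wh \<theta>' \<theta> \<partial>P\<bar> \<le> D i * a1 * R"
    and "integrable P (\<lambda>\<theta>'. M wx wh wy x i \<theta>' * wh \<theta>' \<theta>)"
proof -
  have *: "AE \<theta>' in P. norm (M wx wh wy x i \<theta>' * wh \<theta>' \<theta>) \<le> (D i * R) * a \<theta>'"
    using AE_G
  proof eventually_elim
    case (elim \<theta>')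
    have "\<bar>M wx wh wy x i \<theta>'\<bar> * \<bar>wh \<theta>' \<theta>\<bar> \<le> (D i * a \<theta>') * R"
      using M_bdd[OF elim] elim assms wh_bdd G_sub D_nonneg[of i] a_ge_1[of \<theta>']
      by (intro mult_mono) auto
    then show ?case by (simp add: abs_mult mult_ac)
  qed
  from norm_integral_le_mult[OF this a_integrable]
  show "\<bar>\<integral>\<theta>'. M wx wh wy x i \<theta>' * wh \<theta>' \<theta> \<partial>P\<bar> \<le> D i * a1 * R"
    by (simp add: a1_def mult_ac)
  show "integrable P (\<lambda>\<theta>'. M wx wh wy x i \<theta>' * wh \<theta>' \<theta>)"
  proof (rule Bochner_Integration.integrable_bound[where f="\<lambda>\<theta>'. (D i * R) * a \<theta>'"])
    show "AE \<theta>' in P. norm (M wx wh wy x i \<theta>' * wh \<theta>' \<theta>) \<le> norm ((D i * R) * a \<theta>')"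
      using * by eventually_elim (use abs_ge_self order_trans in fastforce)
  qed (use assms a_integrable in \<open>simp, measurable\<close>)
qed

lemma M_bdd_L:
  assumes "\<theta> \<in> G" "i \<le> L"
  shows "\<bar>M wx wh wy x i \<theta>\<bar> \<le> D L * a \<theta>"
proof -
  have "D i * a \<theta> \<le> D L * a \<theta>"
    using D_mono[OF assms(2)] a_ge_1[of \<theta>] by (intro mult_right_mono) auto
  with M_bdd[OF assms(1), of x i] show ?thesis by (rule order_trans)
qed

lemma M_sum_bdd: 
  assumes "\<theta> \<in> G"
  shows "norm (\<Sum>i\<le>L. M wx wh wy x i \<theta> *\<^sub>R x (- int i)) \<le> (L + 1) * (D L * a \<theta>) * S x"
proof -
  have "norm (\<Sum>i\<le>L. M wx wh wy x i \<theta> *\<^sub>R x (- int i)) \<le> (\<Sum>i\<le>L. (D L * a \<theta>) * S x)"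
  proof (rule sum_norm_le)
    fix i assume "i \<in> {..L}"
    then show "norm (M wx wh wy x i \<theta> *\<^sub>R x (- int i)) \<le> (D L * a \<theta>) * S x"
      using M_bdd_L[OF assms, of i x] norm_le_S[of i x] a_ge_1[of \<theta>] D_nonneg[of L]
      by (auto intro!: mult_mono)
  qed
  then show ?thesis by simp
qed

lemma M_sigma_sum_bdd: 
  assumes "\<theta> \<in> G"
  shows "\<bar>\<Sum>i<L. M wx wh wy x i \<theta> * \<sigma> (Z wx wh x (L - Suc i) \<theta>')\<bar> \<le> L * (D L * a \<theta>) * B"
proof -
  have "norm (\<Sum>i<L. M wx wh wy x i \<theta> * \<sigma> (Z wx wh x (L - Suc i) \<theta>')) \<le> (\<Sum>i<L. (D L * a \<theta>) * B)"
  proof (rule sum_norm_le)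
    fix i assume "i \<in> {..<L}"
    then show "norm (M wx wh wy x i \<theta> * \<sigma> (Z wx wh x (L - Suc i) \<theta>')) \<le> (D L * a \<theta>) * B"
      using M_bdd_L[OF assms, of i x] sigma_bdd a_ge_1[of \<theta>] D_nonneg[of L]
      by (auto simp: abs_mult intro!: mult_mono)
  qed
  then show ?thesis by simp
qed

lemma err_sigma_le: "norm (err wx wh wy x * \<sigma> z) \<le> (E * B) * Q x"
proof -
  have "\<bar>err wx wh wy x\<bar> * \<bar>\<sigma> z\<bar> \<le> (E * (1 + \<bar>Fs x\<bar>)) * B"
    using err_bdd[of x] sigma_bdd[of z] E_ge_1 by (intro mult_mono) auto
  also have "\<dots> \<le> (E * Q x) * B"
    using E_ge_1 B_nonneg Fs_S_le_Q[of x] by (intro mult_right_mono mult_left_mono) auto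
  finally show ?thesis by (simp add: abs_mult mult_ac)
qed

lemma err_M_sum_le:
  assumes "\<theta> \<in> G"
  shows "norm (err wx wh wy x *\<^sub>R (\<Sum>i\<le>L. M wx wh wy x i \<theta> *\<^sub>R x (- int i))) \<le> (E * ((L + 1) * (D L * a \<theta>))) * Q x"
proof -
  have "\<bar>err wx wh wy x\<bar> * norm (\<Sum>i\<le>L. M wx wh wy x i \<theta> *\<^sub>R x (- int i))
      \<le> (E * (1 + \<bar>Fs x\<bar>)) * ((L + 1) * (D L * a \<theta>) * S x)"
    using err_bdd[of x] M_sum_bdd[OF assms] E_ge_1 by (intro mult_mono) auto
  also have "\<dots> = (E * ((L + 1) * (D L * a \<theta>))) * ((1 + \<bar>Fs x\<bar>) * S x)"
    by (simp add: mult_ac)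
  also have "\<dots> \<le> (E * ((L + 1) * (D L * a \<theta>))) * Q x"
    using E_ge_1 D_nonneg[of L] a_ge_1[of \<theta>] Fs_S_le_Q[of x] by (intro mult_left_mono) auto
  finally show ?thesis by simp
qed

lemma err_M_sigma_sum_le:
  assumes "\<theta> \<in> G"
  shows "norm (err wx wh wy x * (\<Sum>i<L. M wx wh wy x i \<theta> * \<sigma> (Z wx wh x (L - Suc i) \<theta>')))
    \<le> (E * (L * (D L * a \<theta>) * B)) * Q x"
proof -
  have "\<bar>err wx wh wy x\<bar> * \<bar>\<Sum>i<L. M wx wh wy x i \<theta> * \<sigma> (Z wx wh x (L - Suc i) \<theta>')\<bar>
      \<le> (E * (1 + \<bar>Fs x\<bar>)) * (L * (D L * a \<theta>) * B)"
    using err_bdd[of x] M_sigma_sum_bdd[OF assms] E_ge_1 by (intro mult_mono) auto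
  also have "\<dots> = (E * (L * (D L * a \<theta>) * B)) * (1 + \<bar>Fs x\<bar>)"
    by (simp add: mult_ac)
  also have "\<dots> \<le> (E * (L * (D L * a \<theta>) * B)) * Q x"
    using E_ge_1 D_nonneg[of L] a_ge_1[of \<theta>] Fs_S_le_Q[of x] B_nonneg by (intro mult_left_mono) auto
  finally show ?thesis by (simp add: abs_mult)
qed

lemma G_integrands_integrable:
  shows "\<theta> \<in> space P \<Longrightarrow> integrable \<nu> (\<lambda>x. err wx wh wy x * \<sigma> (Z wx wh x L \<theta>))"
    and "\<theta> \<in> G \<Longrightarrow> integrable \<nu> (\<lambda>x. err wx wh wy x *\<^sub>R (\<Sum>i\<le>L. M wx wh wy x i \<theta> *\<^sub>R x (- int i)))"
    and "\<theta> \<in> G \<Longrightarrow> \<theta>' \<in> space P \<Longrightarrow>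
      integrable \<nu> (\<lambda>x. err wx wh wy x * (\<Sum>i<L. M wx wh wy x i \<theta> * \<sigma> (Z wx wh x (L - Suc i) \<theta>')))"
proof -
  \<comment> \<open>Every integrand over the input is dominated by a multiple of \<open>Q\<close>;
    the multiple may depend on the neuron.\<close>
  have dom: "integrable \<nu> f" if "f \<in> borel_measurable \<nu>" "\<And>x. norm (f x) \<le> C * Q x"
    for C and f :: "_ \<Rightarrow> 'e::{banach, second_countable_topology}"
    by (rule Bochner_Integration.integrable_bound[where f="\<lambda>x. C * Q x"])
       (use that Q_integrable abs_ge_self order_trans in \<open>fastforce+\<close>)
  show "integrable \<nu> (\<lambda>x. err wx wh wy x * \<sigma> (Z wx wh x L \<theta>))" if "\<theta> \<in> space P"
    using that by (intro dom[OF _ err_sigma_le]) measurable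
  assume \<theta>: "\<theta> \<in> G"
  then have [measurable]: "\<theta> \<in> space P" using G_sub by auto
  show "integrable \<nu> (\<lambda>x. err wx wh wy x *\<^sub>R (\<Sum>i\<le>L. M wx wh wy x i \<theta> *\<^sub>R x (- int i)))"
    by (intro dom[OF _ err_M_sum_le[OF \<theta>]]) measurable
  assume [measurable]: "\<theta>' \<in> space P"
  show "integrable \<nu> (\<lambda>x. err wx wh wy x * (\<Sum>i<L. M wx wh wy x i \<theta> * \<sigma> (Z wx wh x (L - Suc i) \<theta>')))"
    by (intro dom[OF _ err_M_sigma_sum_le[OF \<theta>]]) measurable
qed

lemma Gy_bdd: "\<bar>Gy wx wh wy \<theta>\<bar> \<le> E * B * q"
  using norm_integral_le_mult[OF AE_I2[OF err_sigma_le] Q_integrable]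
  by (simp add: Gy_def q_def)

lemma Gx_bdd: "\<theta> \<in> G \<Longrightarrow> norm (Gx wx wh wy \<theta>) \<le> E * ((L + 1) * (D L * a \<theta>)) * q"
  using norm_integral_le_mult[OF AE_I2[OF err_M_sum_le] Q_integrable]
  by (simp add: Gx_def q_def)

lemma Gh_bdd: "\<theta> \<in> G \<Longrightarrow> \<bar>Gh wx wh wy \<theta> \<theta>'\<bar> \<le> E * (L * (D L * a \<theta>) * B) * q"
  using norm_integral_le_mult[OF AE_I2[OF err_M_sigma_sum_le] Q_integrable]
  by (simp add: Gh_def q_def)

end

section \<open>Weighted Lipschitz bounds for the gradient\<close>

text \<open>\<open>x z - y w = (x - y) z + y (z - w)\<close>: each factor has to be bounded on one
  side only. This matters where one of the two weights being compared is unbounded.\<close>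

lemma abs_prod_diff_le:
  fixes x y z w :: real
  assumes "\<bar>x - y\<bar> \<le> p" "\<bar>z\<bar> \<le> b" "\<bar>y\<bar> \<le> r" "\<bar>z - w\<bar> \<le> s"
  shows "\<bar>x * z - y * w\<bar> \<le> p * b + r * s"
proof -
  have "x * z - y * w = (x - y) * z + y * (z - w)"
    by (simp add: algebra_simps)
  also have "\<bar>\<dots>\<bar> \<le> \<bar>x - y\<bar> * \<bar>z\<bar> + \<bar>y\<bar> * \<bar>z - w\<bar>"
    by (metis abs_mult abs_triangle_ineq)
  also have "\<dots> \<le> p * b + r * s"
    using assms by (intro add_mono mult_mono) auto
  finally show ?thesis .
qed

lemma norm_scaleR_diff_le:
  fixes x y :: real and z w :: "'a::real_normed_vector"
  assumes "\<bar>x - y\<bar> \<le> p" "norm z \<le> b" "\<bar>y\<bar> \<le> r" "norm (z - w) \<le> s"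
  shows "norm (x *\<^sub>R z - y *\<^sub>R w) \<le> p * b + r * s"
proof -
  have "x *\<^sub>R z - y *\<^sub>R w = (x - y) *\<^sub>R z + y *\<^sub>R (z - w)"
    by (simp add: algebra_simps)
  then have "norm (x *\<^sub>R z - y *\<^sub>R w) \<le> \<bar>x - y\<bar> * norm z + \<bar>y\<bar> * norm (z - w)"
    by (metis norm_scaleR norm_triangle_ineq)
  also have "\<dots> \<le> p * b + r * s"
    using assms by (intro add_mono mult_mono) auto
  finally show ?thesis .
qed

section \<open>Constants of the Lipschitz estimates\<close>

context growth
begin

text \<open>These belong to \<open>|Z1 - Z2| \<le> c * S x * (\<alpha> * v + \<beta> * m)\<close>.
  In \<open>\<alpha>\<close>, \<open>2 * B\<close> comes from the recurrent weights (the 2 bounds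
  \<open>1 + \<eta> * m\<close>) and 1 from the input weights. \<open>\<beta>\<close> dominates the
  iterates of \<open>b \<mapsto> b + R * K * (\<alpha> + b)\<close> started at 0, which are
  \<open>\<alpha> * (1 + R * K)^j - \<alpha>\<close>.\<close>

definition \<alpha> :: real where "\<alpha> = 2 * B + 1"

definition \<beta> :: real where "\<beta> = \<alpha> * (1 + R * K) ^ L"

text \<open>\<open>C0M\<close> and \<open>C0\<close> multiply \<open>a * v\<close> in the bounds for
  the adjoint and the gradients and must stay free of \<open>m\<close> and \<open>\<eta>\<close>.
  Terms with \<open>m\<close> or \<open>1 / \<eta>\<close> are collected in \<open>c1\<close>,
  \<open>C1M\<close> and \<open>C1\<close>, the coefficients of \<open>v\<close> alone;
  \<open>e1\<close> is the Lipschitz constant of the residual.\<close>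

definition C0M :: real where "C0M = A * K * \<alpha> + K * R * D L * a1 * \<alpha>"

definition e1 :: "real \<Rightarrow> real" where "e1 m = B * m + A * K * (\<alpha> + \<beta> * a1) * m"

primrec c1 :: "real \<Rightarrow> nat \<Rightarrow> real" where
  "c1 m 0 = K + A * K * \<beta> * m"
| "c1 m (Suc i) = K * D L * R * a1 * \<beta> * m + K * R * (C0M + c1 m i) * m + 2 * K * D L * m"

definition C1M :: "real \<Rightarrow> real" where "C1M m = (\<Sum>i\<le>L. c1 m i)"

definition C0 :: real where "C0 = q * (E * K * \<alpha>) + q * ((L + 1) * (E * C0M)) + q * (L * (E * C0M * B))"

definition C1 :: "real \<Rightarrow> real \<Rightarrow> real" where
  "C1 m \<eta> = q * (B * e1 m + E * K * \<beta> * m) + q * ((L + 1) * (e1 m * D L + E * C1M m))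
     + q * (L * (e1 m * D L * B + E * C1M m * B + E * D L * K * (\<alpha> / \<eta> + \<beta> * m)))"

lemma \<alpha>_ge_1: "1 \<le> \<alpha>"
  using B_nonneg by (simp add: \<alpha>_def)

lemma \<beta>_nonneg: "0 \<le> \<beta>"
  using \<alpha>_ge_1 R_pos K_pos by (simp add: \<beta>_def)

lemma C0M_nonneg: "0 \<le> C0M"
  using \<alpha>_ge_1 R_pos K_pos A_nonneg D_nonneg[of L] a1_ge_1 by (simp add: C0M_def)

lemma e1_nonneg: "0 \<le> m \<Longrightarrow> 0 \<le> e1 m"
  using \<alpha>_ge_1 \<beta>_nonneg B_nonneg K_pos A_nonneg a1_ge_1 by (simp add: e1_def)

lemma c1_nonneg: "0 \<le> m \<Longrightarrow> 0 \<le> c1 m i"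
  using \<beta>_nonneg R_pos K_pos A_nonneg D_nonneg[of L] a1_ge_1 C0M_nonneg by (induction i) auto

lemma C1M_nonneg: "0 \<le> m \<Longrightarrow> 0 \<le> C1M m"
  using c1_nonneg by (auto simp: C1M_def intro: sum_nonneg)

lemma c1_le_C1M: "0 \<le> m \<Longrightarrow> i \<le> L \<Longrightarrow> c1 m i \<le> C1M m"
  unfolding C1M_def using c1_nonneg by (intro member_le_sum) auto

lemma C0_nonneg: "0 \<le> C0"
  using q_ge_1 E_ge_1 K_pos \<alpha>_ge_1 C0M_nonneg B_nonneg by (simp add: C0_def)

lemma C1_nonneg: "0 \<le> m \<Longrightarrow> 0 < \<eta> \<Longrightarrow> 0 \<le> C1 m \<eta>"
  using q_ge_1 E_ge_1 K_pos \<alpha>_ge_1 \<beta>_nonneg B_nonneg e1_nonneg[of m] C1M_nonneg[of m] D_nonneg[of L]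
  by (simp add: C1_def)

end

text \<open>\<open>c\<close> is the weighted distance of two triples at a fixed time. Recurrent
  weights are compared on \<open>G2\<close> only, since the recurrent equation of a solution is
  available for almost every pair. Rows and columns of \<open>G2\<close> through a neuron of
  \<open>G\<close> must both be full: rows serve the forward pass, columns the backward
  pass.\<close>

locale two_weights = growth P \<nu> Fs L \<sigma> \<sigma>' R K B a A
    + W: weights P \<nu> Fs L \<sigma> \<sigma>' R K B a A wx wh wy G
    + W': weights P \<nu> Fs L \<sigma> \<sigma>' R K B a A wx' wh' wy' G
  for P :: "'w measure" and \<nu> :: "(int \<Rightarrow> real^'d) measure" and Fs L \<sigma> \<sigma>' R K B a A
    and wx wh wy wx' wh' wy' G +
  fixes v :: "'w \<Rightarrow> real" and m \<eta> c :: real and G2 :: "('w \<times> 'w) set"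
  assumes v_meas [measurable]: "v \<in> borel_measurable P"
    and a_le_v: "\<And>\<theta>. a \<theta> \<le> v \<theta>"
    and av_integrable: "integrable P (\<lambda>\<theta>. a \<theta> * v \<theta>)"
    and av_le_m: "(\<integral>\<theta>. a \<theta> * v \<theta> \<partial>P) \<le> m"
    and \<eta>_pos: "0 < \<eta>" and \<eta>_m: "\<eta> * m \<le> 1"
    and c_nonneg: "0 \<le> c"
    and G2_sub: "G2 \<subseteq> G \<times> G"
    and AE_G2: "\<And>\<theta>. \<theta> \<in> G \<Longrightarrow> AE \<theta>' in P. (\<theta>, \<theta>') \<in> G2 \<and> (\<theta>', \<theta>) \<in> G2"
    and dx: "\<And>\<theta>. \<theta> \<in> G \<Longrightarrow> norm (wx \<theta> - wx' \<theta>) \<le> c * v \<theta>"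
    and dy: "\<And>\<theta>. \<theta> \<in> G \<Longrightarrow> \<bar>wy \<theta> - wy' \<theta>\<bar> \<le> c * v \<theta>"
    and dh: "\<And>\<theta> \<theta>'. (\<theta>, \<theta>') \<in> G2 \<Longrightarrow> \<bar>wh \<theta> \<theta>' - wh' \<theta> \<theta>'\<bar> \<le> c * v \<theta> * (1 + \<eta> * v \<theta>')"
begin

lemma v_ge_1: "1 \<le> v \<theta>"
  using a_ge_1[of \<theta>] a_le_v[of \<theta>] by linarith

lemma v_le_av: "v \<theta> \<le> a \<theta> * v \<theta>"
  using a_ge_1[of \<theta>] v_ge_1[of \<theta>] mult_right_mono[of 1 "a \<theta>" "v \<theta>"] by simp

lemma v_integrable: "integrable P v"
proof (rule Bochner_Integration.integrable_bound[OF av_integrable])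
  show "AE \<theta> in P. norm (v \<theta>) \<le> norm (a \<theta> * v \<theta>)"
  proof (rule AE_I2)
    fix \<theta>
    show "norm (v \<theta>) \<le> norm (a \<theta> * v \<theta>)"
      using v_le_av[of \<theta>] v_ge_1[of \<theta>] by (simp del: abs_mult)
  qed
qed measurable

lemma v_le_m: "(\<integral>\<theta>. v \<theta> \<partial>P) \<le> m"
proof -
  have "(\<integral>\<theta>. v \<theta> \<partial>P) \<le> (\<integral>\<theta>. a \<theta> * v \<theta> \<partial>P)"
    using v_integrable av_integrable v_le_av by (intro integral_mono)
  with av_le_m show ?thesis by simp
qed

lemma v_integral_ge_1: "1 \<le> (\<integral>\<theta>. v \<theta> \<partial>P)"
proof -
  have "(\<integral>x. 1 \<partial>P) \<le> (\<integral>\<theta>. v \<theta> \<partial>P)"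
    using v_integrable v_ge_1 by (intro integral_mono) auto
  then show ?thesis by (simp add: P.prob_space)
qed

lemma m_nonneg: "0 \<le> m"
  using v_le_m v_integral_ge_1 by simp

lemma integral_affine:
  assumes "0 \<le> r"
  shows "integrable P (\<lambda>\<theta>. p + r * v \<theta>)" and "(\<integral>\<theta>. p + r * v \<theta> \<partial>P) \<le> p + r * m"
proof -
  show "integrable P (\<lambda>\<theta>. p + r * v \<theta>)"
    using v_integrable by simp
  show "(\<integral>\<theta>. p + r * v \<theta> \<partial>P) \<le> p + r * m"
    using v_integrable v_le_m assms by (simp add: P.prob_space mult_left_mono)
qed

lemma AE_le_affineD:
  fixes f :: "'w \<Rightarrow> real"
  assumes "AE \<theta> in P. \<bar>f \<theta>\<bar> \<le> p + r * v \<theta>" "0 \<le> r"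
  shows "\<bar>\<integral>\<theta>. f \<theta> \<partial>P\<bar> \<le> p + r * m"
  using norm_integral_le_AE[OF integral_affine(1)[OF assms(2)], of f p] integral_affine(2)[OF assms(2), of p] assms(1)
  by simp

section \<open>Lipschitz bounds for the forward pass\<close>

abbreviation "Z1 \<equiv> Z wx wh"
abbreviation "Z2 \<equiv> Z wx' wh'"

text \<open>Two sources are kept apart: the change of the weights attached to \<theta> itself gives
  \<open>v \<theta>\<close>, whereas the change inherited from the preactivations of other neurons
  has been averaged and gives \<open>m\<close>.\<close>

lemma dZ_aux:
  assumes "\<theta> \<in> G" 
  shows "\<bar>Z1 x j \<theta> - Z2 x j \<theta>\<bar> \<le> c * S x * (\<alpha> * v \<theta> + (\<alpha> * (1 + R * K) ^ j - \<alpha>) * m)"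
  using assms
proof (induction j arbitrary: \<theta>)
  case 0
  have "\<bar>Z1 x 0 \<theta> - Z2 x 0 \<theta>\<bar> = \<bar>(wx \<theta> - wx' \<theta>) \<bullet> x (- int L)\<bar>"
    by (simp add: Z_def inner_diff_left)
  also have "\<dots> \<le> norm (wx \<theta> - wx' \<theta>) * norm (x (- int L))"
    by (rule Cauchy_Schwarz_ineq2)
  also have "\<dots> \<le> (c * v \<theta>) * S x"
    using dx[OF 0] norm_le_S[of L x] c_nonneg v_ge_1[of \<theta>] by (intro mult_mono) auto
  also have "\<dots> \<le> (c * S x) * (\<alpha> * v \<theta>)"
    using \<alpha>_ge_1 c_nonneg S_ge_1[of x] v_ge_1[of \<theta>] mult_right_mono[of 1 \<alpha> "c * S x * v \<theta>"]
    by (simp add: mult_ac)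
  finally show ?case by simp
next
  case (Suc j)
  define b where "b = \<alpha> * (1 + R * K) ^ j - \<alpha>"
  have b: "0 \<le> b"
    using \<alpha>_ge_1 R_pos K_pos one_le_power[of "1 + R * K" j] mult_left_mono[of 1 "(1 + R * K) ^ j" \<alpha>]
    by (simp add: b_def)
  have \<theta>: "\<theta> \<in> space P" using Suc.prems W.G_sub by auto
  have "AE \<theta>' in P. \<bar>wh \<theta> \<theta>' * \<sigma> (Z1 x j \<theta>') - wh' \<theta> \<theta>' * \<sigma> (Z2 x j \<theta>')\<bar>
      \<le> (c * v \<theta> * B + R * K * c * S x * b * m) + (c * v \<theta> * \<eta> * B + R * K * c * S x * \<alpha>) * v \<theta>'"
    using AE_G2[OF Suc.prems] W.AE_G
  proof eventually_elim
    case (elim \<theta>')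
    have "\<bar>wh \<theta> \<theta>' * \<sigma> (Z1 x j \<theta>') - wh' \<theta> \<theta>' * \<sigma> (Z2 x j \<theta>')\<bar>
      \<le> (c * v \<theta> * (1 + \<eta> * v \<theta>')) * B + R * (K * (c * S x * (\<alpha> * v \<theta>' + b * m)))"
    proof (rule abs_prod_diff_le)
      have "\<bar>\<sigma> (Z1 x j \<theta>') - \<sigma> (Z2 x j \<theta>')\<bar> \<le> K * \<bar>Z1 x j \<theta>' - Z2 x j \<theta>'\<bar>"
        by (rule sigma_lip)
      also have "\<dots> \<le> K * (c * S x * (\<alpha> * v \<theta>' + b * m))"
        using Suc.IH[of \<theta>'] elim K_pos unfolding b_def by (intro mult_left_mono) auto
      finally show "\<bar>\<sigma> (Z1 x j \<theta>') - \<sigma> (Z2 x j \<theta>')\<bar> \<le> K * (c * S x * (\<alpha> * v \<theta>' + b * m))" .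
    qed (use dh elim sigma_bdd W'.wh_bdd \<theta> W.G_sub in auto)
    then show ?case by (simp add: algebra_simps)
  qed
  from AE_le_affineD[OF this]
  have "\<bar>\<integral>\<theta>'. wh \<theta> \<theta>' * \<sigma> (Z1 x j \<theta>') - wh' \<theta> \<theta>' * \<sigma> (Z2 x j \<theta>') \<partial>P\<bar>
      \<le> (c * v \<theta> * B + R * K * c * S x * b * m) + (c * v \<theta> * \<eta> * B + R * K * c * S x * \<alpha>) * m"
    using c_nonneg v_ge_1[of \<theta>] \<eta>_pos B_nonneg R_pos K_pos S_ge_1[of x] \<alpha>_ge_1 by simp
  also have "\<dots> = (c * v \<theta> * B) * (1 + \<eta> * m) + c * S x * (R * K * (\<alpha> + b) * m)"
    by (simp add: algebra_simps)
  \<comment> \<open>Here the choice of \<open>\<eta>\<close> enters: averaging the column factor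
    \<open>1 + \<eta> * v\<close> costs only \<open>1 + \<eta> * m \<le> 2\<close>.\<close>
  also have "\<dots> \<le> (c * v \<theta> * B) * 2 * S x + c * S x * (R * K * (\<alpha> + b) * m)"
  proof -
    have "(c * v \<theta> * B) * (1 + \<eta> * m) \<le> (c * v \<theta> * B) * 2 * 1"
      using \<eta>_m c_nonneg v_ge_1[of \<theta>] B_nonneg by (simp add: mult_left_mono)
    also have "\<dots> \<le> (c * v \<theta> * B) * 2 * S x"
      using S_ge_1[of x] c_nonneg v_ge_1[of \<theta>] B_nonneg by (intro mult_left_mono) auto
    finally show ?thesis by simp
  qed
  finally have H: "\<bar>Hhh P \<sigma> wx wh x L (Suc j) \<theta> - Hhh P \<sigma> wx' wh' x L (Suc j) \<theta>\<bar>
      \<le> (c * v \<theta> * B) * 2 * S x + c * S x * (R * K * (\<alpha> + b) * m)"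
    unfolding Hhh_Suc_Z using W.wh_sigma_integrable[OF \<theta>] W'.wh_sigma_integrable[OF \<theta>] by simp
  have X: "\<bar>(wx \<theta> - wx' \<theta>) \<bullet> x (- int (L - Suc j))\<bar> \<le> (c * v \<theta>) * S x"
  proof -
    have "\<bar>(wx \<theta> - wx' \<theta>) \<bullet> x (- int (L - Suc j))\<bar> \<le> norm (wx \<theta> - wx' \<theta>) * norm (x (- int (L - Suc j)))"
      by (rule Cauchy_Schwarz_ineq2)
    also have "\<dots> \<le> (c * v \<theta>) * S x"
      using dx[OF Suc.prems] norm_le_S[of "L - Suc j" x] c_nonneg v_ge_1[of \<theta>] by (intro mult_mono) auto
    finally show ?thesis .
  qed
  have "Z1 x (Suc j) \<theta> - Z2 x (Suc j) \<theta> = (Hhh P \<sigma> wx wh x L (Suc j) \<theta> - Hhh P \<sigma> wx' wh' x L (Suc j) \<theta>)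
      + (wx \<theta> - wx' \<theta>) \<bullet> x (- int (L - Suc j))"
    by (simp add: Z_def inner_diff_left del: Hhh.simps)
  then have "\<bar>Z1 x (Suc j) \<theta> - Z2 x (Suc j) \<theta>\<bar>
      \<le> ((c * v \<theta> * B) * 2 * S x + c * S x * (R * K * (\<alpha> + b) * m)) + (c * v \<theta>) * S x"
    using H X by linarith
  also have "\<dots> = c * S x * (\<alpha> * v \<theta> + (R * K * (\<alpha> + b)) * m)"
    by (simp add: \<alpha>_def algebra_simps)
  also have "\<dots> \<le> c * S x * (\<alpha> * v \<theta> + (\<alpha> * (1 + R * K) ^ Suc j - \<alpha>) * m)"
  proof -
    have "\<alpha> * (1 + R * K) ^ Suc j - \<alpha> = b + R * K * (\<alpha> + b)"
      by (simp add: b_def algebra_simps)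
    then show ?thesis
      using b c_nonneg S_ge_1[of x] m_nonneg by (intro mult_left_mono add_left_mono mult_right_mono) auto
  qed
  finally show ?case .
qed

lemma dZ:
  assumes "\<theta> \<in> G" "j \<le> L"
  shows "\<bar>Z1 x j \<theta> - Z2 x j \<theta>\<bar> \<le> c * S x * (\<alpha> * v \<theta> + \<beta> * m)"
proof -
  have "\<alpha> * (1 + R * K) ^ j - \<alpha> \<le> \<alpha> * (1 + R * K) ^ L - 0"
    using \<alpha>_ge_1 R_pos K_pos assms(2) by (intro diff_mono mult_left_mono power_increasing) auto
  then have "\<alpha> * (1 + R * K) ^ j - \<alpha> \<le> \<beta>"
    by (simp add: \<beta>_def)
  then have "c * S x * (\<alpha> * v \<theta> + (\<alpha> * (1 + R * K) ^ j - \<alpha>) * m) \<le> c * S x * (\<alpha> * v \<theta> + \<beta> * m)"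
    using c_nonneg S_ge_1[of x] m_nonneg by (intro mult_left_mono add_left_mono mult_right_mono) auto
  with dZ_aux[OF assms(1), of x j] show ?thesis by linarith
qed

lemma dsigma:
  assumes "\<theta> \<in> G" "j \<le> L"
  shows "\<bar>\<sigma> (Z1 x j \<theta>) - \<sigma> (Z2 x j \<theta>)\<bar> \<le> K * (c * S x * (\<alpha> * v \<theta> + \<beta> * m))"
    and "\<bar>\<sigma>' (Z1 x j \<theta>) - \<sigma>' (Z2 x j \<theta>)\<bar> \<le> K * (c * S x * (\<alpha> * v \<theta> + \<beta> * m))"
  using order_trans[OF sigma_lip mult_left_mono[OF dZ[OF assms]]]
    order_trans[OF sigma'_lip mult_left_mono[OF dZ[OF assms]]] K_pos by auto

section \<open>Lipschitz bounds for the residual and the backward pass\<close>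

lemma integral_av_affine:
  assumes "AE \<theta> in P. \<bar>f \<theta>\<bar> \<le> p * v \<theta> + r * (a \<theta> * v \<theta>) + s * a \<theta>" "0 \<le> p" "0 \<le> r" 
  shows "\<bar>\<integral>\<theta>. f \<theta> \<partial>P\<bar> \<le> p * m + r * m + s * a1" 
proof -
  have "\<bar>\<integral>\<theta>. f \<theta> \<partial>P\<bar> \<le> (\<integral>\<theta>. p * v \<theta> + r * (a \<theta> * v \<theta>) + s * a \<theta> \<partial>P)"
    using norm_integral_le_AE[of P "\<lambda>\<theta>. p * v \<theta> + r * (a \<theta> * v \<theta>) + s * a \<theta>" f] assms(1)
      v_integrable av_integrable a_integrable by simp
  also have "\<dots> = p * (\<integral>\<theta>. v \<theta> \<partial>P) + r * (\<integral>\<theta>. a \<theta> * v \<theta> \<partial>P) + s * a1"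
    using v_integrable av_integrable a_integrable by (simp add: a1_def)
  also have "\<dots> \<le> p * m + r * m + s * a1"
    using v_le_m av_le_m assms(2,3) by (intro add_right_mono add_mono mult_left_mono) auto
  finally show ?thesis .
qed

text \<open>The output is an average over neurons, so even the terms of order \<open>a * v\<close>
  end in the constant \<open>e1 m\<close>. This constant contains \<open>m\<close>, but it is the
  same for all neurons and only \<open>C1\<close> will see it.\<close>

lemma derr: "\<bar>err wx wh wy x - err wx' wh' wy' x\<bar> \<le> c * S x * e1 m"
proof -
  have "AE \<theta> in P. \<bar>wy \<theta> * \<sigma> (Z1 x L \<theta>) - wy' \<theta> * \<sigma> (Z2 x L \<theta>)\<bar>
      \<le> (c * S x * B) * v \<theta> + (A * K * c * S x * \<alpha>) * (a \<theta> * v \<theta>) + (A * K * c * S x * \<beta> * m) * a \<theta>"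
    using W.AE_G
  proof eventually_elim
    case (elim \<theta>)
    have "\<bar>wy \<theta> * \<sigma> (Z1 x L \<theta>) - wy' \<theta> * \<sigma> (Z2 x L \<theta>)\<bar>
        \<le> (c * v \<theta>) * B + (A * a \<theta>) * (K * (c * S x * (\<alpha> * v \<theta> + \<beta> * m)))"
      using elim dy sigma_bdd W'.wy_bdd dsigma(1)[OF elim, of L x]
      by (intro abs_prod_diff_le) auto
    also have "\<dots> \<le> (c * v \<theta>) * B * S x + (A * a \<theta>) * (K * (c * S x * (\<alpha> * v \<theta> + \<beta> * m)))"
      using mult_left_mono[OF S_ge_1[of x], of "c * v \<theta> * B"] c_nonneg v_ge_1[of \<theta>] B_nonneg by simp
    finally show ?case by (simp add: algebra_simps)
  qed
  from integral_av_affine[OF this]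
  have "\<bar>\<integral>\<theta>. wy \<theta> * \<sigma> (Z1 x L \<theta>) - wy' \<theta> * \<sigma> (Z2 x L \<theta>) \<partial>P\<bar>
    \<le> (c * S x * B) * m + (A * K * c * S x * \<alpha>) * m + (A * K * c * S x * \<beta> * m) * a1"
    using c_nonneg B_nonneg K_pos S_ge_1[of x] \<alpha>_ge_1 A_nonneg by simp
  also have "\<dots> = c * S x * e1 m"
    by (simp add: e1_def algebra_simps)
  finally show ?thesis
    unfolding err_def using W.wy_sigma_integrable W'.wy_sigma_integrable
    by (simp add: abs_minus_commute)
qed

text \<open>The coefficient \<open>C0M\<close> of \<open>a * v\<close> does not grow with
  \<open>i\<close>: it stems from factors evaluated at \<theta> itself, namely \<open>wy\<close> at
  \<open>i = 0\<close> and the difference of \<open>\<sigma>'\<close> in every step. What the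
  adjoint hands on to the next step is averaged, so \<open>a * v\<close> turns into \<open>m\<close>
  and lands in \<open>c1\<close>.\<close>

lemma dM:
  assumes "\<theta> \<in> G" "i \<le> L"
  shows "\<bar>M wx wh wy x i \<theta> - M wx' wh' wy' x i \<theta>\<bar> \<le> c * S x * (C0M * (a \<theta> * v \<theta>) + c1 m i * v \<theta>)"
  using assms
proof (induction i arbitrary: \<theta>)
  case 0
  have nn: "0 \<le> c * S x" using c_nonneg S_ge_1[of x] by simp
  have "\<bar>wy \<theta> * \<sigma>' (Z1 x L \<theta>) - wy' \<theta> * \<sigma>' (Z2 x L \<theta>)\<bar>
        \<le> (c * v \<theta>) * K + (A * a \<theta>) * (K * (c * S x * (\<alpha> * v \<theta> + \<beta> * m)))"
    using 0 dy sigma'_bdd W'.wy_bdd dsigma(2)[OF 0(1), of L x]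
    by (intro abs_prod_diff_le) auto
  \<comment> \<open>The product of \<open>a\<close> with the averaged part
    \<open>\<beta> * m\<close> is charged to \<open>v\<close> through \<open>a \<le> v\<close>;
    bounded by \<open>a * v\<close> instead, it would bring \<open>m\<close> into
    \<open>C0M\<close>.\<close>
  also have "\<dots> \<le> (c * v \<theta>) * K * S x + (A * a \<theta>) * (K * (c * S x * (\<alpha> * v \<theta>))) + A * v \<theta> * (K * (c * S x * (\<beta> * m)))"
  proof -
    have "(c * v \<theta>) * K \<le> (c * v \<theta>) * K * S x"
      using mult_left_mono[OF S_ge_1[of x], of "c * v \<theta> * K"] c_nonneg v_ge_1[of \<theta>] K_pos by simp
    moreover have "(A * a \<theta>) * (K * (c * S x * (\<beta> * m))) \<le> A * v \<theta> * (K * (c * S x * (\<beta> * m)))"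
      using a_le_v A_nonneg K_pos nn \<beta>_nonneg m_nonneg by (intro mult_right_mono mult_left_mono) auto
    ultimately show ?thesis by (simp add: algebra_simps)
  qed
  also have "\<dots> = c * S x * ((A * K * \<alpha>) * (a \<theta> * v \<theta>) + c1 m 0 * v \<theta>)"
    by (simp add: algebra_simps)
  also have "\<dots> \<le> c * S x * (C0M * (a \<theta> * v \<theta>) + c1 m 0 * v \<theta>)"
    using nn K_pos R_pos D_nonneg[of L] a1_ge_1 \<alpha>_ge_1 a_ge_1[of \<theta>] v_ge_1[of \<theta>]
    by (intro mult_left_mono add_right_mono mult_right_mono) (auto simp: C0M_def)
  finally show ?case by simp
next
  case (Suc i)
  have nn: "0 \<le> c * S x" using c_nonneg S_ge_1[of x] by simp
  have \<theta>: "\<theta> \<in> space P" using Suc.prems W.G_sub by auto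
  define I1 where "I1 = (\<integral>\<theta>'. M wx wh wy x i \<theta>' * wh \<theta>' \<theta> \<partial>P)"
  define I2 where "I2 = (\<integral>\<theta>'. M wx' wh' wy' x i \<theta>' * wh' \<theta>' \<theta> \<partial>P)"
  have I1: "\<bar>I1\<bar> \<le> D L * a1 * R"
  proof -
    have "D i * a1 * R \<le> D L * a1 * R"
      using Suc.prems D_mono[of i L] a1_ge_1 R_pos by (intro mult_right_mono) auto
    then show ?thesis using W.M_integral_bdd(1)[OF \<theta>, of x i] unfolding I1_def by linarith
  qed
  have "AE \<theta>' in P. \<bar>M wx wh wy x i \<theta>' * wh \<theta>' \<theta> - M wx' wh' wy' x i \<theta>' * wh' \<theta>' \<theta>\<bar>
      \<le> (c * S x * c1 m i * R) * v \<theta>' + (c * S x * C0M * R + D L * c * (1 + \<eta> * v \<theta>)) * (a \<theta>' * v \<theta>') + 0 * a \<theta>'"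
    using W.AE_G AE_G2[OF Suc.prems(1)]
  proof eventually_elim
    case (elim \<theta>')
    have "\<bar>M wx wh wy x i \<theta>' * wh \<theta>' \<theta> - M wx' wh' wy' x i \<theta>' * wh' \<theta>' \<theta>\<bar>
      \<le> (c * S x * (C0M * (a \<theta>' * v \<theta>') + c1 m i * v \<theta>')) * R + (D L * a \<theta>') * (c * v \<theta>' * (1 + \<eta> * v \<theta>))"
      using Suc.IH[of \<theta>'] elim Suc.prems \<theta> W.wh_bdd W.G_sub W'.M_bdd_L[of \<theta>' i x] dh
      by (intro abs_prod_diff_le) auto
    then show ?case by (simp add: algebra_simps)
  qed
  from integral_av_affine[OF this]
  have "\<bar>\<integral>\<theta>'. M wx wh wy x i \<theta>' * wh \<theta>' \<theta> - M wx' wh' wy' x i \<theta>' * wh' \<theta>' \<theta> \<partial>P\<bar>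
      \<le> (c * S x * c1 m i * R) * m + (c * S x * C0M * R + D L * c * (1 + \<eta> * v \<theta>)) * m + 0 * a1"
    using c_nonneg R_pos S_ge_1[of x] C0M_nonneg D_nonneg[of L] c1_nonneg[OF m_nonneg, of i] \<eta>_pos v_ge_1[of \<theta>] 
    by simp
  also have "\<dots> = c * S x * (R * (C0M + c1 m i) * m) + D L * c * (m + (\<eta> * m) * v \<theta>)"
    by (simp add: algebra_simps)
  also have "\<dots> \<le> c * S x * (R * (C0M + c1 m i) * m) * v \<theta> + D L * c * (m * 2 * v \<theta> * S x)"
  proof (rule add_mono)
    show "c * S x * (R * (C0M + c1 m i) * m) \<le> c * S x * (R * (C0M + c1 m i) * m) * v \<theta>"
      using mult_left_mono[OF v_ge_1[of \<theta>], of "c * S x * (R * (C0M + c1 m i) * m)"] nn R_pos C0M_nonneg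
        c1_nonneg[OF m_nonneg, of i] m_nonneg by simp
    \<comment> \<open>In the transposed weight the averaged neuron \<theta>' carries
      \<open>v \<theta>'\<close> and the fixed one only the column factor
      \<open>1 + \<eta> * v \<theta>\<close>; with \<open>\<eta> * m \<le> 1 \<le> m\<close> the
      average stays below \<open>2 * m * v \<theta>\<close>.\<close>
    have "\<eta> * m \<le> m"
      using \<eta>_m v_le_m v_integral_ge_1 by linarith
    then have "(\<eta> * m) * v \<theta> \<le> m * v \<theta>"
      using v_ge_1[of \<theta>] by (intro mult_right_mono) auto
    moreover have "m \<le> m * v \<theta>"
      using v_ge_1[of \<theta>] m_nonneg mult_left_mono[of 1 "v \<theta>" m] by simp
    ultimately have "m + (\<eta> * m) * v \<theta> \<le> m * 2 * v \<theta>"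
      by linarith
    also have "\<dots> \<le> m * 2 * v \<theta> * S x"
      using S_ge_1[of x] v_ge_1[of \<theta>] m_nonneg mult_left_mono[of 1 "S x" "m * 2 * v \<theta>"] by simp
    finally show "D L * c * (m + (\<eta> * m) * v \<theta>) \<le> D L * c * (m * 2 * v \<theta> * S x)"
      using D_nonneg[of L] c_nonneg by (intro mult_left_mono) auto
  qed
  finally have I12: "\<bar>I1 - I2\<bar> \<le> c * S x * (R * (C0M + c1 m i) * m) * v \<theta> + D L * c * (m * 2 * v \<theta> * S x)"
    unfolding I1_def I2_def using W.M_integral_bdd(2)[OF \<theta>] W'.M_integral_bdd(2)[OF \<theta>] by simp
  have "\<bar>\<sigma>' (Z1 x (L - Suc i) \<theta>) * I1 - \<sigma>' (Z2 x (L - Suc i) \<theta>) * I2\<bar>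
      \<le> (K * (c * S x * (\<alpha> * v \<theta> + \<beta> * m))) * (D L * a1 * R)
        + K * (c * S x * (R * (C0M + c1 m i) * m) * v \<theta> + D L * c * (m * 2 * v \<theta> * S x))"
    using dsigma(2)[OF Suc.prems(1), of "L - Suc i" x] I1 I12 sigma'_bdd
    by (intro abs_prod_diff_le) auto
  also have "\<dots> \<le> (K * (c * S x * (\<alpha> * (a \<theta> * v \<theta>) + \<beta> * m * v \<theta>))) * (D L * a1 * R)
        + K * (c * S x * (R * (C0M + c1 m i) * m) * v \<theta> + D L * c * (m * 2 * v \<theta> * S x))"
  proof -
    have "\<beta> * m \<le> \<beta> * m * v \<theta>"
      using \<beta>_nonneg m_nonneg v_ge_1[of \<theta>] mult_left_mono[of 1 "v \<theta>" "\<beta> * m"] by simp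
    then have "\<alpha> * v \<theta> + \<beta> * m \<le> \<alpha> * (a \<theta> * v \<theta>) + \<beta> * m * v \<theta>"
      using v_le_av[of \<theta>] \<alpha>_ge_1 by (intro add_mono mult_left_mono) auto
    then show ?thesis
      using nn K_pos D_nonneg[of L] a1_ge_1 R_pos
      by (intro add_right_mono mult_right_mono mult_left_mono) auto
  qed
  also have "\<dots> = c * S x * ((K * R * D L * a1 * \<alpha>) * (a \<theta> * v \<theta>) + c1 m (Suc i) * v \<theta>)"
    by (simp add: algebra_simps)
  also have "\<dots> \<le> c * S x * (C0M * (a \<theta> * v \<theta>) + c1 m (Suc i) * v \<theta>)"
    using nn K_pos A_nonneg \<alpha>_ge_1 a_ge_1[of \<theta>] v_ge_1[of \<theta>]
    by (intro mult_left_mono add_right_mono mult_right_mono) (auto simp: C0M_def)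
  finally show ?case by (simp add: I1_def I2_def)
qed

lemma dM_L:
  assumes "\<theta> \<in> G" "i \<le> L"
  shows "\<bar>M wx wh wy x i \<theta> - M wx' wh' wy' x i \<theta>\<bar> \<le> c * S x * (C0M * (a \<theta> * v \<theta>) + C1M m * v \<theta>)"
proof -
  have "c * S x * (C0M * (a \<theta> * v \<theta>) + c1 m i * v \<theta>) \<le> c * S x * (C0M * (a \<theta> * v \<theta>) + C1M m * v \<theta>)"
    using c1_le_C1M[OF m_nonneg assms(2)] c_nonneg S_ge_1[of x] v_ge_1[of \<theta>]
    by (intro mult_left_mono add_left_mono mult_right_mono) auto
  with dM[OF assms, of x] show ?thesis by linarith
qed

section \<open>Lipschitz bounds for the three gradients\<close>

lemma err'_bdd: "\<bar>err wx' wh' wy' x\<bar> \<le> E * (1 + \<bar>Fs x\<bar>)"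
  by (rule W'.err_bdd)

lemma v_facts: "0 \<le> v \<theta>" "0 \<le> a \<theta>" "0 \<le> a \<theta> * v \<theta>" "v \<theta> \<le> a \<theta> * v \<theta>"
  using v_ge_1[of \<theta>] a_ge_1[of \<theta>] v_le_av[of \<theta>] by auto

text \<open>The error term of order \<open>S\<close> multiplies an integrand of order \<open>S\<close>, and \<open>S^2 \<le> Q\<close>;
  this is where the fourth moments of the input are needed.\<close>
lemma Q_combine:
  assumes "0 \<le> u" "0 \<le> w"
  shows "(c * S x * e1 m) * (u * S x) + (E * (1 + \<bar>Fs x\<bar>)) * (c * S x * w * S x) \<le> c * (e1 m * u + E * w) * Q x"
proof -
  have "(c * S x * e1 m) * (u * S x) + (E * (1 + \<bar>Fs x\<bar>)) * (c * S x * w * S x)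
     = (c * e1 m * u) * (S x)^2 + (c * E * w) * Q x"
    by (simp add: Q_def power2_eq_square algebra_simps)
  also have "\<dots> \<le> (c * e1 m * u) * Q x + (c * E * w) * Q x"
    using Fs_S_le_Q(3)[of x] c_nonneg e1_nonneg[OF m_nonneg] assms by (intro add_right_mono mult_left_mono) auto
  finally show ?thesis by (simp add: algebra_simps)
qed

lemma dGy:
  assumes "\<theta> \<in> G"
  shows "\<bar>Gy wx wh wy \<theta> - Gy wx' wh' wy' \<theta>\<bar> \<le> c * (C0 * (a \<theta> * v \<theta>) + C1 m \<eta> * v \<theta>)"
proof -
  have \<theta>: "\<theta> \<in> space P" using assms W.G_sub by auto
  let ?w = "K * (\<alpha> * v \<theta> + \<beta> * m)"
  have w: "0 \<le> ?w"
    using K_pos \<alpha>_ge_1 \<beta>_nonneg m_nonneg v_facts[of \<theta>] by simp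
  have "norm (err wx wh wy x * \<sigma> (Z1 x L \<theta>) - err wx' wh' wy' x * \<sigma> (Z2 x L \<theta>)) \<le> c * (e1 m * B + E * ?w) * Q x" for x
  proof -
    have "\<bar>err wx wh wy x * \<sigma> (Z1 x L \<theta>) - err wx' wh' wy' x * \<sigma> (Z2 x L \<theta>)\<bar>
        \<le> (c * S x * e1 m) * B + (E * (1 + \<bar>Fs x\<bar>)) * (K * (c * S x * (\<alpha> * v \<theta> + \<beta> * m)))"
      using derr sigma_bdd err'_bdd dsigma(1)[OF assms, of L x] by (intro abs_prod_diff_le) auto
    also have "\<dots> = (c * S x * e1 m) * B + (E * (1 + \<bar>Fs x\<bar>)) * (c * S x * ?w)"
      by (simp add: mult_ac)
    also have "\<dots> \<le> (c * S x * e1 m) * (B * S x) + (E * (1 + \<bar>Fs x\<bar>)) * (c * S x * ?w * S x)"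
    proof -
      have "B \<le> B * S x" using B_nonneg S_ge_1[of x] mult_left_mono[of 1 "S x" B] by simp
      moreover have "c * S x * ?w \<le> c * S x * ?w * S x"
        using c_nonneg S_ge_1[of x] w mult_left_mono[of 1 "S x" "c * S x * ?w"] by simp
      ultimately show ?thesis
        using c_nonneg S_ge_1[of x] e1_nonneg[OF m_nonneg] E_ge_1 by (intro add_mono mult_left_mono) auto
    qed
    also have "\<dots> \<le> c * (e1 m * B + E * ?w) * Q x"
      by (rule Q_combine) (use B_nonneg w in auto)
    finally show ?thesis by simp
  qed
  from norm_integral_le_mult[OF AE_I2[OF this] Q_integrable]
  have "\<bar>Gy wx wh wy \<theta> - Gy wx' wh' wy' \<theta>\<bar> \<le> c * (e1 m * B + E * ?w) * q"
    unfolding Gy_def q_def using W.G_integrands_integrable(1)[OF \<theta>] W'.G_integrands_integrable(1)[OF \<theta>]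
    by (simp add: abs_minus_commute)
  also have "\<dots> = c * ((q * (E * K * \<alpha>)) * v \<theta> + (q * (B * e1 m + E * K * \<beta> * m)))"
    by (simp add: algebra_simps)
  also have "\<dots> \<le> c * (C0 * (a \<theta> * v \<theta>) + C1 m \<eta> * v \<theta>)"
  proof -
    have 1: "0 \<le> q * (E * K * \<alpha>)" "q * (E * K * \<alpha>) \<le> C0"
      using q_ge_1 E_ge_1 K_pos \<alpha>_ge_1 C0M_nonneg B_nonneg by (simp_all add: C0_def)
    have 2: "0 \<le> q * (B * e1 m + E * K * \<beta> * m)" "q * (B * e1 m + E * K * \<beta> * m) \<le> C1 m \<eta>"
      using q_ge_1 E_ge_1 K_pos \<alpha>_ge_1 \<beta>_nonneg B_nonneg e1_nonneg[OF m_nonneg] C1M_nonneg[OF m_nonneg]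
        D_nonneg[of L] m_nonneg \<eta>_pos by (simp_all add: C1_def)
    have "q * (B * e1 m + E * K * \<beta> * m) \<le> C1 m \<eta> * v \<theta>"
      using 2 v_ge_1[of \<theta>] mult_mono[OF 2(2) v_ge_1[of \<theta>]] by simp
    moreover have "(q * (E * K * \<alpha>)) * v \<theta> \<le> C0 * (a \<theta> * v \<theta>)"
      using 1 v_facts[of \<theta>] by (intro mult_mono) auto
    ultimately show ?thesis using c_nonneg by (intro mult_left_mono add_mono)
  qed
  finally show ?thesis .
qed

lemma dGx:
  assumes "\<theta> \<in> G"
  shows "norm (Gx wx wh wy \<theta> - Gx wx' wh' wy' \<theta>) \<le> c * (C0 * (a \<theta> * v \<theta>) + C1 m \<eta> * v \<theta>)"
proof -
  let ?u = "(L + 1) * (D L * a \<theta>)" and ?w = "(L + 1) * (C0M * (a \<theta> * v \<theta>) + C1M m * v \<theta>)"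
  have w: "0 \<le> ?w" and u: "0 \<le> ?u"
    using C0M_nonneg C1M_nonneg[OF m_nonneg] v_facts[of \<theta>] D_nonneg[of L] by auto
  have "norm (err wx wh wy x *\<^sub>R (\<Sum>i\<le>L. M wx wh wy x i \<theta> *\<^sub>R x (- int i))
      - err wx' wh' wy' x *\<^sub>R (\<Sum>i\<le>L. M wx' wh' wy' x i \<theta> *\<^sub>R x (- int i))) \<le> c * (e1 m * ?u + E * ?w) * Q x"
    (is "norm (?e *\<^sub>R ?s - ?e' *\<^sub>R ?s') \<le> _") for x
  proof -
    have s: "norm (?s - ?s') \<le> c * S x * ?w * S x"
    proof -
      have eq: "?s - ?s' = (\<Sum>i\<le>L. (M wx wh wy x i \<theta> - M wx' wh' wy' x i \<theta>) *\<^sub>R x (- int i))"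
        by (simp add: sum_subtractf scaleR_diff_left)
      have "norm (?s - ?s') \<le> (\<Sum>i\<le>L. c * S x * (C0M * (a \<theta> * v \<theta>) + C1M m * v \<theta>) * S x)"
        unfolding eq
      proof (rule sum_norm_le)
        fix i assume "i \<in> {..L}"
        then show "norm ((M wx wh wy x i \<theta> - M wx' wh' wy' x i \<theta>) *\<^sub>R x (- int i))
            \<le> c * S x * (C0M * (a \<theta> * v \<theta>) + C1M m * v \<theta>) * S x"
          unfolding norm_scaleR using dM_L[OF assms, of i x] norm_le_S[of i x] 
          by (intro mult_mono) (auto intro: order_trans[OF abs_ge_zero])
      qed
      then show ?thesis by (simp add: mult_ac)
    qed
    have "norm (?e *\<^sub>R ?s - ?e' *\<^sub>R ?s') \<le> (c * S x * e1 m) * (?u * S x) + (E * (1 + \<bar>Fs x\<bar>)) * (c * S x * ?w * S x)"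
      using derr[of x] W.M_sum_bdd[OF assms, of x] err'_bdd[of x] s by (intro norm_scaleR_diff_le)
    also have "\<dots> \<le> c * (e1 m * ?u + E * ?w) * Q x"
      by (rule Q_combine) (use u w in auto)
    finally show ?thesis .
  qed
  from norm_integral_le_mult[OF AE_I2[OF this] Q_integrable]
  have "norm (Gx wx wh wy \<theta> - Gx wx' wh' wy' \<theta>) \<le> c * (e1 m * ?u + E * ?w) * q"
    unfolding Gx_def q_def using W.G_integrands_integrable(2)[OF assms] W'.G_integrands_integrable(2)[OF assms]
    by (simp add: norm_minus_commute)
  \<comment> \<open>Again \<open>a \<le> v\<close>, because the factor \<open>e1 m\<close> contains
    \<open>m\<close> and may only meet \<open>v\<close>.\<close>
  also have "\<dots> \<le> c * (e1 m * ((L + 1) * (D L * v \<theta>)) + E * ?w) * q"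
    using c_nonneg q_ge_1 e1_nonneg[OF m_nonneg] D_nonneg[of L] a_le_v[of \<theta>]
    by (intro mult_right_mono mult_left_mono add_right_mono) auto
  also have "\<dots> = c * ((q * ((L + 1) * (E * C0M))) * (a \<theta> * v \<theta>) + (q * ((L + 1) * (e1 m * D L + E * C1M m))) * v \<theta>)"
    by (simp add: algebra_simps)
  also have "\<dots> \<le> c * (C0 * (a \<theta> * v \<theta>) + C1 m \<eta> * v \<theta>)"
  proof -
    have "q * ((L + 1) * (E * C0M)) \<le> C0"
      using q_ge_1 E_ge_1 K_pos \<alpha>_ge_1 C0M_nonneg B_nonneg by (simp add: C0_def)
    moreover have "q * ((L + 1) * (e1 m * D L + E * C1M m)) \<le> C1 m \<eta>"
      using q_ge_1 E_ge_1 K_pos \<alpha>_ge_1 \<beta>_nonneg B_nonneg e1_nonneg[OF m_nonneg] C1M_nonneg[OF m_nonneg]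
        D_nonneg[of L] m_nonneg \<eta>_pos by (simp add: C1_def)
    ultimately show ?thesis using c_nonneg v_facts[of \<theta>]
      by (intro mult_left_mono[of _ _ c] add_mono mult_right_mono) auto
  qed
  finally show ?thesis .
qed

text \<open>The critical term is \<open>a \<theta> * v \<theta>'\<close>, from the adjoint at
  \<theta> times the change of the activation at \<theta>'. A weight depending on \<theta> alone
  cannot dominate it; the column factor \<open>1 + \<eta> * v \<theta>'\<close> can, at the price
  \<open>1 / \<eta>\<close>, and with \<open>a \<le> v\<close> this price goes to
  \<open>C1\<close>.\<close>

lemma dGh:
  assumes "(\<theta>, \<theta>') \<in> G2"
  shows "\<bar>Gh wx wh wy \<theta> \<theta>' - Gh wx' wh' wy' \<theta> \<theta>'\<bar>
    \<le> c * (C0 * (a \<theta> * v \<theta>) + C1 m \<eta> * v \<theta>) * (1 + \<eta> * v \<theta>')"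
proof -
  have \<theta>: "\<theta> \<in> G" "\<theta>' \<in> G" using assms G2_sub by auto
  then have \<theta>': "\<theta>' \<in> space P" using W.G_sub by auto
  let ?w1 = "(C0M * (a \<theta> * v \<theta>) + C1M m * v \<theta>) * B + (D L * a \<theta>) * (K * (\<alpha> * v \<theta>' + \<beta> * m))"
  let ?u = "L * (D L * a \<theta>) * B" and ?w = "L * ?w1"
  have w1: "0 \<le> ?w1" and u: "0 \<le> ?u"
    using C0M_nonneg C1M_nonneg[OF m_nonneg] v_facts[of \<theta>] v_facts[of \<theta>'] D_nonneg[of L] \<alpha>_ge_1 \<beta>_nonneg
      m_nonneg B_nonneg K_pos by auto
  then have w: "0 \<le> ?w" by simp
  have "norm (err wx wh wy x * (\<Sum>i<L. M wx wh wy x i \<theta> * \<sigma> (Z1 x (L - Suc i) \<theta>'))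
      - err wx' wh' wy' x * (\<Sum>i<L. M wx' wh' wy' x i \<theta> * \<sigma> (Z2 x (L - Suc i) \<theta>'))) \<le> c * (e1 m * ?u + E * ?w) * Q x"
    (is "norm (?e * ?s - ?e' * ?s') \<le> _") for x
  proof -
    have nn: "0 \<le> c * S x" using c_nonneg S_ge_1[of x] by simp
    have eq: "?s - ?s' = (\<Sum>i<L. M wx wh wy x i \<theta> * \<sigma> (Z1 x (L - Suc i) \<theta>') - M wx' wh' wy' x i \<theta> * \<sigma> (Z2 x (L - Suc i) \<theta>'))"
      by (simp add: sum_subtractf)
    have "norm (?s - ?s') \<le> (\<Sum>i<L. c * S x * ?w1)"
      unfolding eq
    proof (rule sum_norm_le)
      fix i assume i: "i \<in> {..<L}"
      have "\<bar>M wx wh wy x i \<theta> * \<sigma> (Z1 x (L - Suc i) \<theta>') - M wx' wh' wy' x i \<theta> * \<sigma> (Z2 x (L - Suc i) \<theta>')\<bar>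
          \<le> (c * S x * (C0M * (a \<theta> * v \<theta>) + C1M m * v \<theta>)) * B
            + (D L * a \<theta>) * (K * (c * S x * (\<alpha> * v \<theta>' + \<beta> * m)))"
        using dM_L[OF \<theta>(1), of i x] i sigma_bdd W'.M_bdd_L[OF \<theta>(1), of i x] dsigma(1)[OF \<theta>(2), of "L - Suc i" x]
        by (intro abs_prod_diff_le) auto
      then show "norm (M wx wh wy x i \<theta> * \<sigma> (Z1 x (L - Suc i) \<theta>') - M wx' wh' wy' x i \<theta> * \<sigma> (Z2 x (L - Suc i) \<theta>'))
         \<le> c * S x * ?w1"
        by (simp add: algebra_simps)
    qed
    then have s: "\<bar>?s - ?s'\<bar> \<le> c * S x * ?w" by (simp add: mult_ac)
    have "\<bar>?e * ?s - ?e' * ?s'\<bar> \<le> (c * S x * e1 m) * ?u + (E * (1 + \<bar>Fs x\<bar>)) * (c * S x * ?w)"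
      using derr[of x] W.M_sigma_sum_bdd[OF \<theta>(1)] err'_bdd[of x] s by (intro abs_prod_diff_le)
    also have "\<dots> \<le> (c * S x * e1 m) * (?u * S x) + (E * (1 + \<bar>Fs x\<bar>)) * (c * S x * ?w * S x)"
    proof -
      have "?u \<le> ?u * S x" using u S_ge_1[of x] mult_left_mono[of 1 "S x" ?u] by simp
      moreover have "c * S x * ?w \<le> c * S x * ?w * S x"
        using nn S_ge_1[of x] w mult_left_mono[of 1 "S x" "c * S x * ?w"] mult_nonneg_nonneg[OF nn w]
        by linarith
      ultimately show ?thesis
        using nn e1_nonneg[OF m_nonneg] E_ge_1 by (intro add_mono mult_left_mono) auto
    qed
    also have "\<dots> \<le> c * (e1 m * ?u + E * ?w) * Q x"
      by (rule Q_combine) (use u w in auto)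
    finally show ?thesis by simp
  qed
  from norm_integral_le_mult[OF AE_I2[OF this] Q_integrable]
  have "\<bar>Gh wx wh wy \<theta> \<theta>' - Gh wx' wh' wy' \<theta> \<theta>'\<bar> \<le> c * (e1 m * ?u + E * ?w) * q"
    unfolding Gh_def q_def using W.G_integrands_integrable(3)[OF \<theta>(1) \<theta>'] W'.G_integrands_integrable(3)[OF \<theta>(1) \<theta>']
    by (simp add: abs_minus_commute)
  also have "\<dots> = c * ((q * (L * (E * C0M * B))) * (a \<theta> * v \<theta>)
      + (q * L * E * C1M m * B) * v \<theta>
      + (q * L * D L * (e1 m * B + E * K * \<beta> * m)) * a \<theta>
      + (q * L * E * D L * K * \<alpha> / \<eta>) * a \<theta> * (\<eta> * v \<theta>'))"
    using \<eta>_pos by (simp add: field_simps)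
  also have "\<dots> \<le> c * ((C0 * (a \<theta> * v \<theta>) + C1 m \<eta> * v \<theta>) * (1 + \<eta> * v \<theta>'))"
  proof -
    let ?y = "1 + \<eta> * v \<theta>'"
    have y: "1 \<le> ?y" "\<eta> * v \<theta>' \<le> ?y"
      using \<eta>_pos v_facts[of \<theta>'] by auto
    have k: "0 \<le> q * L * E * D L * K * \<alpha> / \<eta>" "0 \<le> q * L * D L * (e1 m * B + E * K * \<beta> * m)"
       "0 \<le> q * L * E * C1M m * B" "0 \<le> q * (L * (E * C0M * B))"
      using q_ge_1 E_ge_1 K_pos \<alpha>_ge_1 \<beta>_nonneg B_nonneg e1_nonneg[OF m_nonneg] C1M_nonneg[OF m_nonneg]
        D_nonneg[of L] m_nonneg \<eta>_pos C0M_nonneg by simp_all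
    have "(q * L * E * D L * K * \<alpha> / \<eta>) * a \<theta> * (\<eta> * v \<theta>') \<le> (q * L * E * D L * K * \<alpha> / \<eta>) * v \<theta> * ?y"
      using k(1) a_le_v[of \<theta>] y v_facts[of \<theta>] v_facts[of \<theta>'] \<eta>_pos by (intro mult_mono mult_left_mono mult_nonneg_nonneg) auto
    moreover have "(q * L * D L * (e1 m * B + E * K * \<beta> * m)) * a \<theta> \<le> (q * L * D L * (e1 m * B + E * K * \<beta> * m)) * v \<theta> * ?y"
    proof -
      have "(q * L * D L * (e1 m * B + E * K * \<beta> * m)) * a \<theta> * 1 \<le> (q * L * D L * (e1 m * B + E * K * \<beta> * m)) * v \<theta> * ?y"
        using mult_mono[OF mult_left_mono[OF a_le_v k(2)] y(1) mult_nonneg_nonneg[OF k(2) v_facts(1)]] by simp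
      then show ?thesis by simp
    qed
    moreover have "(q * L * E * C1M m * B) * v \<theta> \<le> (q * L * E * C1M m * B) * v \<theta> * ?y"
      using mult_left_mono[OF y(1) mult_nonneg_nonneg[OF k(3) v_facts(1)[of \<theta>]]] by simp
    moreover have "(q * (L * (E * C0M * B))) * (a \<theta> * v \<theta>) \<le> (q * (L * (E * C0M * B))) * (a \<theta> * v \<theta>) * ?y"
      using mult_left_mono[OF y(1) mult_nonneg_nonneg[OF k(4) v_facts(3)[of \<theta>]]] by simp
    ultimately have "(q * (L * (E * C0M * B))) * (a \<theta> * v \<theta>) + (q * L * E * C1M m * B) * v \<theta>
      + (q * L * D L * (e1 m * B + E * K * \<beta> * m)) * a \<theta> + (q * L * E * D L * K * \<alpha> / \<eta>) * a \<theta> * (\<eta> * v \<theta>')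
      \<le> (q * (L * (E * C0M * B))) * (a \<theta> * v \<theta>) * ?y + (q * L * E * C1M m * B) * v \<theta> * ?y
      + (q * L * D L * (e1 m * B + E * K * \<beta> * m)) * v \<theta> * ?y + (q * L * E * D L * K * \<alpha> / \<eta>) * v \<theta> * ?y"
      by (intro add_mono)
    also have "\<dots> = ((q * (L * (E * C0M * B))) * (a \<theta> * v \<theta>)
        + (q * (L * (e1 m * D L * B + E * C1M m * B + E * D L * K * (\<alpha> / \<eta> + \<beta> * m)))) * v \<theta>) * ?y"
      by (simp add: algebra_simps)
    also have "\<dots> \<le> (C0 * (a \<theta> * v \<theta>) + C1 m \<eta> * v \<theta>) * ?y"
    proof -
      have "q * (L * (E * C0M * B)) \<le> C0"
        using q_ge_1 E_ge_1 K_pos \<alpha>_ge_1 C0M_nonneg B_nonneg by (simp add: C0_def)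
      moreover have "q * (L * (e1 m * D L * B + E * C1M m * B + E * D L * K * (\<alpha> / \<eta> + \<beta> * m))) \<le> C1 m \<eta>"
        using q_ge_1 E_ge_1 K_pos \<alpha>_ge_1 \<beta>_nonneg B_nonneg e1_nonneg[OF m_nonneg] C1M_nonneg[OF m_nonneg]
          D_nonneg[of L] m_nonneg \<eta>_pos by (simp add: C1_def)
      ultimately show ?thesis
        using v_facts[of \<theta>] y by (intro mult_right_mono[of _ _ ?y] add_mono mult_right_mono) auto
    qed
    finally show ?thesis
      using c_nonneg by (rule mult_left_mono)
  qed
  finally show ?thesis by (simp add: mult.assoc)
qed

end

section \<open>The gradient as variational derivative\<close>

text \<open>Sequences tending to 0 reduce this to dominated convergence. Only a dominated difference
  quotient at 0 is asked for: it is available from Lipschitz bounds, and derivatives away from 0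
  never have to be considered.\<close>

lemma has_derivative_integral_at_0:
  fixes f :: "real \<Rightarrow> 'a \<Rightarrow> real"
  assumes int: "\<And>\<epsilon>. integrable M (f \<epsilon>)"
    and f'_meas: "f' \<in> borel_measurable M"
    and deriv: "AE y in M. ((\<lambda>\<epsilon>. f \<epsilon> y) has_real_derivative f' y) (at 0)"
    and bound: "\<And>\<epsilon>. \<bar>\<epsilon>\<bar> \<le> 1 \<Longrightarrow> AE y in M. \<bar>f \<epsilon> y - f 0 y\<bar> \<le> \<bar>\<epsilon>\<bar> * g y"
    and g: "integrable M g"
  shows "((\<lambda>\<epsilon>. \<integral>y. f \<epsilon> y \<partial>M) has_real_derivative (\<integral>y. f' y \<partial>M)) (at 0)"
    and "integrable M f'"
proof -
  have main: "(\<lambda>n. \<integral>y. (f (X n) y - f 0 y) / X n \<partial>M) \<longlonglongrightarrow> (\<integral>y. f' y \<partial>M) \<and> integrable M f'"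
    if X: "\<And>n. X n \<noteq> 0" "X \<longlonglongrightarrow> 0" for X :: "nat \<Rightarrow> real"
  proof -
    \<comment> \<open>The bound is available for \<open>|\<epsilon>| \<le> 1\<close> only; the
      sequence is shifted into that range.\<close>
    obtain N where N: "\<And>n. N \<le> n \<Longrightarrow> \<bar>X n\<bar> \<le> 1"
    proof -
      have "\<forall>\<^sub>F n in sequentially. dist (X n) 0 < 1"
        using X(2) by (rule tendstoD) simp
      then show ?thesis
        using that by (auto simp: eventually_sequentially dist_real_def intro: less_imp_le)
    qed
    define s where "s n y = (f (X (n + N)) y - f 0 y) / X (n + N)" for n y
    have conv: "AE y in M. (\<lambda>n. s n y) \<longlonglongrightarrow> f' y"
      using deriv
    proof eventually_elim
      case (elim y)
      then have "((\<lambda>\<epsilon>. (f \<epsilon> y - f 0 y) / (\<epsilon> - 0)) \<longlongrightarrow> f' y) (at 0)"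
        by (simp add: has_field_derivative_iff)
      then have "(\<lambda>n. (f (X n) y - f 0 y) / X n) \<longlonglongrightarrow> f' y"
        using X by (auto simp: tendsto_at_iff_sequentially comp_def)
      then show ?case
        unfolding s_def by (rule LIMSEQ_ignore_initial_segment)
    qed
    have bound': "AE y in M. \<bar>f (X (n + N)) y - f 0 y\<bar> \<le> \<bar>X (n + N)\<bar> * g y" for n
      by (rule bound) (simp add: N)
    have dom: "AE y in M. norm (s n y) \<le> g y" for n
      using bound'[of n]
    proof eventually_elim
      case (elim y)
      then show ?case
        using X(1)[of "n + N"] by (simp add: s_def abs_divide divide_le_eq mult.commute)
    qed
    have s_meas: "s n \<in> borel_measurable M" for n
      unfolding s_def[abs_def] using int by (auto intro!: borel_measurable_divide borel_measurable_diff)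
    have "(\<lambda>n. \<integral>y. s n y \<partial>M) \<longlonglongrightarrow> (\<integral>y. f' y \<partial>M)" "integrable M f'"
      using integral_dominated_convergence[OF f'_meas s_meas g conv dom]
        integrable_dominated_convergence[OF f'_meas s_meas g conv dom] by auto
    moreover have "(\<lambda>n. \<integral>y. (f (X n) y - f 0 y) / X n \<partial>M) \<longlonglongrightarrow> (\<integral>y. f' y \<partial>M)"
      by (rule LIMSEQ_offset[of _ N]) (use calculation(1) in \<open>simp add: s_def\<close>)
    ultimately show ?thesis by simp
  qed
  show "integrable M f'"
    using main[of "\<lambda>n. inverse (real (Suc n))"] LIMSEQ_inverse_real_of_nat by simp
  show "((\<lambda>\<epsilon>. \<integral>y. f \<epsilon> y \<partial>M) has_real_derivative (\<integral>y. f' y \<partial>M)) (at 0)"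
    unfolding has_field_derivative_iff tendsto_at_iff_sequentially
    using main int by (auto simp: comp_def)
qed

text \<open>Bounds for the tangent quantities follow from the Lipschitz bounds in \<epsilon>, so
  they need no induction of their own.\<close>

lemma abs_derivative_le_at_0:
  fixes f :: "real \<Rightarrow> real"
  assumes "(f has_real_derivative D) (at 0)" and "\<And>\<epsilon>. \<bar>f \<epsilon> - f 0\<bar> \<le> \<bar>\<epsilon>\<bar> * g"
  shows "\<bar>D\<bar> \<le> g"
proof (rule tendsto_upperbound)
  show "((\<lambda>\<epsilon>. \<bar>(f \<epsilon> - f 0) / (\<epsilon> - 0)\<bar>) \<longlongrightarrow> \<bar>D\<bar>) (at 0)"
    using assms(1) unfolding has_field_derivative_iff by (rule tendsto_rabs)
  show "\<forall>\<^sub>F \<epsilon> in at 0. \<bar>(f \<epsilon> - f 0) / (\<epsilon> - 0)\<bar> \<le> g"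
    using assms(2) by (auto simp: eventually_at_filter abs_divide divide_le_eq mult.commute)
qed simp

lemma (in pair_sigma_finite) integrable_prod_mult:
  fixes f :: "'a \<Rightarrow> real" and g :: "'b \<Rightarrow> real"
  assumes "integrable M1 f" "integrable M2 g"
  shows "integrable (M1 \<Otimes>\<^sub>M M2) (\<lambda>z. f (fst z) * g (snd z))"
proof (rule Fubini_integrable)
  have [measurable]: "f \<in> borel_measurable M1" "g \<in> borel_measurable M2"
    using assms by auto
  show "(\<lambda>z. f (fst z) * g (snd z)) \<in> borel_measurable (M1 \<Otimes>\<^sub>M M2)"
    by measurable
qed (use assms in \<open>simp_all add: abs_mult\<close>)

lemma (in prob_space) AE_pair_fst:
  assumes "AE x in N. Q x"
  shows "AE z in N \<Otimes>\<^sub>M M. Q (fst z)"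
proof (rule AE_distrD[OF measurable_fst])
  show "AE x in distr (N \<Otimes>\<^sub>M M) N fst. Q x"
    unfolding distr_pair_fst by (rule assms)
qed

section \<open>Perturbation of the weights in an L2 direction\<close>

sublocale rnn \<subseteq> PP: pair_prob_space P P
  by unfold_locales

sublocale rnn \<subseteq> Pnu: pair_sigma_finite P \<nu>
  by unfold_locales

text \<open>All three weights move at once; the variational derivatives arise by setting two of the
  directions to 0. Since \<open>hh\<close> is merely square integrable,
  \<open>wh + \<epsilon> * hh\<close> need not be bounded and the perturbed triple need not satisfy
  \<open>weights\<close>, so its measurability and integrability are established separately.\<close>

locale direction = weights P \<nu> Fs L \<sigma> \<sigma>' R K B a A wx wh wy G
  for P :: "'w measure" and \<nu> :: "(int \<Rightarrow> real^'d) measure" and Fs L \<sigma> \<sigma>' R K B a A wx wh wy G +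
  fixes hx :: "'w \<Rightarrow> real^'d" and hh :: "'w \<Rightarrow> 'w \<Rightarrow> real" and hy :: "'w \<Rightarrow> real"
  assumes hx: "sq_int P hx" and hh: "sq_int (P \<Otimes>\<^sub>M P) (case_prod hh)" and hy: "sq_int P hy"
begin

lemma hx_meas [measurable]: "hx \<in> borel_measurable P"
  and hy_meas [measurable]: "hy \<in> borel_measurable P"
  and hh_meas [measurable]: "case_prod hh \<in> borel_measurable (P \<Otimes>\<^sub>M P)"
  using hx hy hh by (auto simp: sq_int_def)

lemma hx_L2: "integrable P (\<lambda>\<theta>. (norm (hx \<theta>))^2)"
  and hy_L2: "integrable P (\<lambda>\<theta>. (hy \<theta>)^2)"
  and hh_L2: "integrable (P \<Otimes>\<^sub>M P) (\<lambda>z. (hh (fst z) (snd z))^2)"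
  using hx hy hh by (auto simp: sq_int_def split_beta')

lemma a_hx_integrable: "integrable P (\<lambda>\<theta>. a \<theta> * norm (hx \<theta>))"
  using a_L2 hx_L2 by (intro integrable_mult_of_squares) auto

lemma a_hy_integrable: "integrable P (\<lambda>\<theta>. a \<theta> * \<bar>hy \<theta>\<bar>)"
  using a_L2 hy_L2 by (intro integrable_mult_of_squares) auto

lemma a_hh_integrable: "integrable (P \<Otimes>\<^sub>M P) (\<lambda>(\<theta>, \<theta>'). a \<theta> * \<bar>hh \<theta> \<theta>'\<bar>)"
proof -
  have "integrable (P \<Otimes>\<^sub>M P) (\<lambda>z. (a (fst z))^2)"
    using PP.integrable_prod_mult[OF a_L2, of "\<lambda>_. 1"] by simp
  moreover have "(\<lambda>z. hh (fst z) (snd z)) \<in> borel_measurable (P \<Otimes>\<^sub>M P)"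
    by measurable
  ultimately show ?thesis
    using hh_L2 unfolding split_beta'
    by (intro integrable_mult_of_squares[of "\<lambda>z. a (fst z)" _ "\<lambda>z. \<bar>hh (fst z) (snd z)\<bar>"]) auto
qed

lemma le_a_mult: "0 \<le> y \<Longrightarrow> y \<le> a \<theta> * y"
  using a_ge_1[of \<theta>] mult_right_mono[of 1 "a \<theta>" y] by simp

lemma integrable_of_a_mult:
  assumes "integrable P (\<lambda>\<theta>. a \<theta> * f \<theta>)" "f \<in> borel_measurable P" "\<And>\<theta>. 0 \<le> f \<theta>"
  shows "integrable P f"
proof (rule Bochner_Integration.integrable_bound[OF assms(1,2)], rule AE_I2)
  fix \<theta>
  show "norm (f \<theta>) \<le> norm (a \<theta> * f \<theta>)"
    using le_a_mult[OF assms(3), of \<theta> \<theta>] assms(3)[of \<theta>] a_ge_1[of \<theta>] by (simp add: abs_mult)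
qed

lemma hx_integrable: "integrable P (\<lambda>\<theta>. norm (hx \<theta>))"
  by (rule integrable_of_a_mult[OF a_hx_integrable]) auto

lemma hy_integrable: "integrable P (\<lambda>\<theta>. \<bar>hy \<theta>\<bar>)"
  by (rule integrable_of_a_mult[OF a_hy_integrable]) auto

text \<open>A square-integrable kernel has integrable rows only for almost every neuron;
  \<open>N\<close> collects these, and \<open>n1\<close> is the L1 norm of a row. Off
  \<open>N\<close> the integral \<open>n1\<close> is 0 by convention and carries no
  information.\<close>

definition n1 :: "'w \<Rightarrow> real" where "n1 \<theta> = (\<integral>\<theta>'. \<bar>hh \<theta> \<theta>'\<bar> \<partial>P)"

definition N :: "'w set" where "N = {\<theta> \<in> space P. integrable P (\<lambda>\<theta>'. \<bar>hh \<theta> \<theta>'\<bar>)}"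

lemma n1_meas [measurable]: "n1 \<in> borel_measurable P"
  unfolding n1_def[abs_def] by measurable

lemma n1_nonneg: "0 \<le> n1 \<theta>"
  by (simp add: n1_def)

lemma AE_N: "AE \<theta> in P. \<theta> \<in> N"
  using PP.AE_integrable_fst[OF a_hh_integrable] AE_space
proof eventually_elim
  case (elim \<theta>)
  then have "integrable P (\<lambda>\<theta>'. a \<theta> * \<bar>hh \<theta> \<theta>'\<bar>)"
    by simp
  then have "integrable P (\<lambda>\<theta>'. \<bar>hh \<theta> \<theta>'\<bar>)"
    using a_ge_1[of \<theta>] by (simp del: integrable_abs_iff)
  then show ?case using elim by (simp add: N_def)
qed

lemma a_n1_integrable: "integrable P (\<lambda>\<theta>. a \<theta> * n1 \<theta>)"
  using PP.integrable_fst[OF a_hh_integrable] by (simp add: n1_def)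

lemma n1_integrable: "integrable P n1"
  by (rule integrable_of_a_mult[OF a_n1_integrable]) (auto simp: n1_nonneg)

abbreviation "wxe \<epsilon> \<equiv> (\<lambda>\<theta>. wx \<theta> + \<epsilon> *\<^sub>R hx \<theta>)"
abbreviation "whe \<epsilon> \<equiv> (\<lambda>\<theta> \<theta>'. wh \<theta> \<theta>' + \<epsilon> * hh \<theta> \<theta>')"
abbreviation "wye \<epsilon> \<equiv> (\<lambda>\<theta>. wy \<theta> + \<epsilon> * hy \<theta>)"

abbreviation "Ze \<epsilon> \<equiv> Z (wxe \<epsilon>) (whe \<epsilon>)"

lemma meas_weights_e: "meas_weights (count_space (UNIV :: unit set)) (\<lambda>_. wxe \<epsilon>) (\<lambda>_. whe \<epsilon>) (\<lambda>_. wye \<epsilon>)"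
proof -
  have "case_prod (whe \<epsilon>) \<in> borel_measurable (P \<Otimes>\<^sub>M P)"
    by measurable
  then show ?thesis
    by (intro meas_weights_const) auto
qed

lemma Ze_measurable [measurable (raw)]: "g \<in> measurable M' \<nu> \<Longrightarrow> h \<in> measurable M' P \<Longrightarrow>
    (\<lambda>w. Ze \<epsilon> (g w) j (h w)) \<in> borel_measurable M'"
  by (rule Z_nu[OF meas_weights_e, of "\<lambda>_. ()"]) simp_all

lemma Ze_section_meas [measurable]: "(\<lambda>\<theta>. Ze \<epsilon> x j \<theta>) \<in> borel_measurable P"
  by (rule Ze_measurable) simp_all

lemma err_e_measurable [measurable]: "(\<lambda>x. err (wxe \<epsilon>) (whe \<epsilon>) (wye \<epsilon>) x) \<in> borel_measurable \<nu>"
  by (rule err_nu[OF meas_weights_e, of "\<lambda>_. ()"]) simp_all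

text \<open>Up to the factor \<open>S x\<close>, this bounds the rate of change of the preactivation
  in \<epsilon>: the perturbed row meets the bounded activation (\<open>B * n1\<close>), the input
  weight contributes \<open>norm hx\<close>, and \<open>b\<close> collects what earlier steps pass
  on.\<close>

definition \<rho> :: "real \<Rightarrow> 'w \<Rightarrow> real" where "\<rho> b \<theta> = B * n1 \<theta> + norm (hx \<theta>) + b"

lemma \<rho>_nonneg: "0 \<le> b \<Longrightarrow> 0 \<le> \<rho> b \<theta>"
  using B_nonneg n1_nonneg by (simp add: \<rho>_def)

lemma \<rho>_integrable: "integrable P (\<rho> b)"
  unfolding \<rho>_def[abs_def] using n1_integrable hx_integrable by simp

lemma a_\<rho>_integrable: "integrable P (\<lambda>\<theta>. a \<theta> * \<rho> b \<theta>)"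
proof -
  have "(\<lambda>\<theta>. a \<theta> * \<rho> b \<theta>) = (\<lambda>\<theta>. B * (a \<theta> * n1 \<theta>) + a \<theta> * norm (hx \<theta>) + a \<theta> * b)"
    by (auto simp: \<rho>_def algebra_simps)
  then show ?thesis using a_n1_integrable a_hx_integrable a_integrable by simp
qed

lemma whe_sigma_integrable:
  assumes "\<theta> \<in> N"
  shows "integrable P (\<lambda>\<theta>'. whe \<epsilon> \<theta> \<theta>' * \<sigma> (Ze \<epsilon> x j \<theta>'))"
proof (rule Bochner_Integration.integrable_bound[where f="\<lambda>\<theta>'. (R + \<bar>\<epsilon>\<bar> * \<bar>hh \<theta> \<theta>'\<bar>) * B"])
  have \<theta>: "\<theta> \<in> space P" and int: "integrable P (\<lambda>\<theta>'. \<bar>hh \<theta> \<theta>'\<bar>)"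
    using assms by (auto simp: N_def)
  note [measurable] = \<theta>
  show "integrable P (\<lambda>\<theta>'. (R + \<bar>\<epsilon>\<bar> * \<bar>hh \<theta> \<theta>'\<bar>) * B)"
    using int by (simp del: integrable_abs_iff)
  show "(\<lambda>\<theta>'. whe \<epsilon> \<theta> \<theta>' * \<sigma> (Ze \<epsilon> x j \<theta>')) \<in> borel_measurable P"
    by measurable
  show "AE \<theta>' in P. norm (whe \<epsilon> \<theta> \<theta>' * \<sigma> (Ze \<epsilon> x j \<theta>')) \<le> norm ((R + \<bar>\<epsilon>\<bar> * \<bar>hh \<theta> \<theta>'\<bar>) * B)"
  proof (rule AE_I2)
    fix \<theta>' assume "\<theta>' \<in> space P"
    then have "\<bar>whe \<epsilon> \<theta> \<theta>'\<bar> \<le> R + \<bar>\<epsilon>\<bar> * \<bar>hh \<theta> \<theta>'\<bar>"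
      using wh_bdd[OF \<theta>] abs_triangle_ineq[of "wh \<theta> \<theta>'" "\<epsilon> * hh \<theta> \<theta>'"] by (fastforce simp: abs_mult)
    then have "\<bar>whe \<epsilon> \<theta> \<theta>'\<bar> * \<bar>\<sigma> (Ze \<epsilon> x j \<theta>')\<bar> \<le> (R + \<bar>\<epsilon>\<bar> * \<bar>hh \<theta> \<theta>'\<bar>) * B"
      using sigma_bdd by (intro mult_mono) auto
    then show "norm (whe \<epsilon> \<theta> \<theta>' * \<sigma> (Ze \<epsilon> x j \<theta>')) \<le> norm ((R + \<bar>\<epsilon>\<bar> * \<bar>hh \<theta> \<theta>'\<bar>) * B)"
      using R_pos B_nonneg by (simp add: abs_mult)
  qed
qed

text \<open>The product is split so that the unbounded \<open>hh\<close> multiplies only the bounded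
  activation, and the Lipschitz difference multiplies only the unperturbed weight, which is at most
  \<open>R\<close>. A product of \<open>hh\<close> with a change of \<open>Z\<close> never occurs,
  so L1 majorants suffice.\<close>

lemma whe_sigma_diff_le:
  assumes "\<theta> \<in> N" "\<theta>' \<in> N" "\<bar>Ze \<epsilon> x j \<theta>' - Ze 0 x j \<theta>'\<bar> \<le> \<bar>\<epsilon>\<bar> * (S x * \<rho> b \<theta>')" "0 \<le> b"
  shows "\<bar>whe \<epsilon> \<theta> \<theta>' * \<sigma> (Ze \<epsilon> x j \<theta>') - whe 0 \<theta> \<theta>' * \<sigma> (Ze 0 x j \<theta>')\<bar>
    \<le> \<bar>\<epsilon>\<bar> * (\<bar>hh \<theta> \<theta>'\<bar> * B + R * K * S x * \<rho> b \<theta>')"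
proof -
  have "\<bar>whe \<epsilon> \<theta> \<theta>' * \<sigma> (Ze \<epsilon> x j \<theta>') - whe 0 \<theta> \<theta>' * \<sigma> (Ze 0 x j \<theta>')\<bar>
     \<le> (\<bar>\<epsilon>\<bar> * \<bar>hh \<theta> \<theta>'\<bar>) * B + R * (K * (\<bar>\<epsilon>\<bar> * (S x * \<rho> b \<theta>')))"
  proof (rule abs_prod_diff_le)
    have "\<bar>\<sigma> (Ze \<epsilon> x j \<theta>') - \<sigma> (Ze 0 x j \<theta>')\<bar> \<le> K * \<bar>Ze \<epsilon> x j \<theta>' - Ze 0 x j \<theta>'\<bar>"
      by (rule sigma_lip)
    also have "\<dots> \<le> K * (\<bar>\<epsilon>\<bar> * (S x * \<rho> b \<theta>'))"
      using assms(3) K_pos by (intro mult_left_mono) auto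
    finally show "\<bar>\<sigma> (Ze \<epsilon> x j \<theta>') - \<sigma> (Ze 0 x j \<theta>')\<bar> \<le> K * (\<bar>\<epsilon>\<bar> * (S x * \<rho> b \<theta>'))" .
  qed (use sigma_bdd wh_bdd[of \<theta> \<theta>'] assms(1,2) in \<open>auto simp: N_def abs_mult\<close>)
  then show ?thesis by (simp add: algebra_simps)
qed

lemma inner_hx_le:
  assumes "i \<le> L"
  shows "\<bar>\<epsilon> *\<^sub>R hx \<theta> \<bullet> x (- int i)\<bar> \<le> \<bar>\<epsilon>\<bar> * (norm (hx \<theta>) * S x)"
proof -
  have "\<bar>hx \<theta> \<bullet> x (- int i)\<bar> \<le> norm (hx \<theta>) * norm (x (- int i))"
    by (rule Cauchy_Schwarz_ineq2)
  also have "\<dots> \<le> norm (hx \<theta>) * S x"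
    using norm_le_S[OF assms] by (intro mult_left_mono) auto
  finally show ?thesis
    by (simp add: abs_mult mult_left_mono)
qed

lemma Ze_diff_le: "\<exists>b\<ge>0. \<forall>\<theta>\<in>N. \<forall>x \<epsilon>. \<bar>Ze \<epsilon> x j \<theta> - Ze 0 x j \<theta>\<bar> \<le> \<bar>\<epsilon>\<bar> * (S x * \<rho> b \<theta>)"
proof (induction j)
  case 0
  have "\<bar>Ze \<epsilon> x 0 \<theta> - Ze 0 x 0 \<theta>\<bar> \<le> \<bar>\<epsilon>\<bar> * (S x * \<rho> 0 \<theta>)" for x \<epsilon> \<theta>
  proof -
    have "\<bar>Ze \<epsilon> x 0 \<theta> - Ze 0 x 0 \<theta>\<bar> \<le> \<bar>\<epsilon>\<bar> * (norm (hx \<theta>) * S x)"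
      using inner_hx_le[of L \<epsilon> \<theta> x] by (simp add: Z_def inner_add_left)
    also have "\<dots> \<le> \<bar>\<epsilon>\<bar> * (\<rho> 0 \<theta> * S x)"
      using B_nonneg n1_nonneg S_ge_1[of x] by (intro mult_left_mono mult_right_mono) (auto simp: \<rho>_def)
    finally show ?thesis by (simp add: mult_ac)
  qed
  then show ?case by blast
next
  case (Suc j)
  then obtain b where b: "0 \<le> b"
    and IH: "\<And>\<theta> x \<epsilon>. \<theta> \<in> N \<Longrightarrow> \<bar>Ze \<epsilon> x j \<theta> - Ze 0 x j \<theta>\<bar> \<le> \<bar>\<epsilon>\<bar> * (S x * \<rho> b \<theta>)"
    by blast
  \<comment> \<open>The part transported through the unperturbed recurrent weights is an average
    over neurons, hence a constant.\<close>
  define b' where "b' = R * K * (\<integral>\<theta>. \<rho> b \<theta> \<partial>P)"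
  have b': "0 \<le> b'"
    unfolding b'_def using R_pos K_pos \<rho>_nonneg[OF b] by (intro mult_nonneg_nonneg integral_nonneg) auto
  have "\<bar>Ze \<epsilon> x (Suc j) \<theta> - Ze 0 x (Suc j) \<theta>\<bar> \<le> \<bar>\<epsilon>\<bar> * (S x * \<rho> b' \<theta>)" if "\<theta> \<in> N" for \<theta> x \<epsilon>
  proof -
    have int: "integrable P (\<lambda>\<theta>'. \<bar>hh \<theta> \<theta>'\<bar>)"
      using that by (auto simp: N_def)
    have "AE \<theta>' in P. norm (whe \<epsilon> \<theta> \<theta>' * \<sigma> (Ze \<epsilon> x j \<theta>') - whe 0 \<theta> \<theta>' * \<sigma> (Ze 0 x j \<theta>'))
       \<le> \<bar>\<epsilon>\<bar> * (\<bar>hh \<theta> \<theta>'\<bar> * B + R * K * S x * \<rho> b \<theta>')"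
      using AE_N unfolding real_norm_def by eventually_elim (rule whe_sigma_diff_le[OF that _ IH b])
    moreover have "integrable P (\<lambda>\<theta>'. \<bar>hh \<theta> \<theta>'\<bar> * B + R * K * S x * \<rho> b \<theta>')"
      using int \<rho>_integrable by (simp del: integrable_abs_iff)
    ultimately have "norm (\<integral>\<theta>'. whe \<epsilon> \<theta> \<theta>' * \<sigma> (Ze \<epsilon> x j \<theta>') - whe 0 \<theta> \<theta>' * \<sigma> (Ze 0 x j \<theta>') \<partial>P)
       \<le> \<bar>\<epsilon>\<bar> * (\<integral>\<theta>'. \<bar>hh \<theta> \<theta>'\<bar> * B + R * K * S x * \<rho> b \<theta>' \<partial>P)"
      by (rule norm_integral_le_mult)
    also have "\<dots> = \<bar>\<epsilon>\<bar> * (n1 \<theta> * B + S x * b')"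
      using int \<rho>_integrable by (simp add: n1_def b'_def mult_ac del: integrable_abs_iff)
    finally have H: "\<bar>Hhh P \<sigma> (wxe \<epsilon>) (whe \<epsilon>) x L (Suc j) \<theta> - Hhh P \<sigma> (wxe 0) (whe 0) x L (Suc j) \<theta>\<bar>
        \<le> \<bar>\<epsilon>\<bar> * (n1 \<theta> * B + S x * b')"
      unfolding Hhh_Suc_Z
      by (subst Bochner_Integration.integral_diff[symmetric])
         (use whe_sigma_integrable[OF that, of _ x j] in \<open>simp_all only: real_norm_def\<close>)
    have "Ze \<epsilon> x (Suc j) \<theta> - Ze 0 x (Suc j) \<theta>
      = (Hhh P \<sigma> (wxe \<epsilon>) (whe \<epsilon>) x L (Suc j) \<theta> - Hhh P \<sigma> (wxe 0) (whe 0) x L (Suc j) \<theta>) + \<epsilon> *\<^sub>R hx \<theta> \<bullet> x (- int (L - Suc j))"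
      by (simp add: Z_def inner_add_left del: Hhh.simps)
    then have "\<bar>Ze \<epsilon> x (Suc j) \<theta> - Ze 0 x (Suc j) \<theta>\<bar> \<le> \<bar>\<epsilon>\<bar> * (n1 \<theta> * B + S x * b') + \<bar>\<epsilon>\<bar> * (norm (hx \<theta>) * S x)"
      using H inner_hx_le[of "L - Suc j" \<epsilon> \<theta> x] by linarith
    also have "\<dots> \<le> \<bar>\<epsilon>\<bar> * (n1 \<theta> * B * S x + S x * b') + \<bar>\<epsilon>\<bar> * (norm (hx \<theta>) * S x)"
      using S_ge_1[of x] n1_nonneg[of \<theta>] B_nonneg mult_left_mono[of 1 "S x" "n1 \<theta> * B"]
      by (intro add_right_mono mult_left_mono) auto
    also have "\<dots> = \<bar>\<epsilon>\<bar> * (S x * \<rho> b' \<theta>)"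
      by (simp add: \<rho>_def algebra_simps)
    finally show ?thesis .
  qed
  with b' show ?case by blast
qed

text \<open>The tangent recursion: formal derivative of \<open>Hhh\<close> in the direction
  \<open>(hx, hh)\<close> at \<epsilon> = 0. \<open>Zd\<close> is the corresponding derivative of
  the preactivation.\<close>

primrec Hd :: "(int \<Rightarrow> real^'d) \<Rightarrow> nat \<Rightarrow> 'w \<Rightarrow> real" where
  "Hd x 0 \<theta> = 0"
| "Hd x (Suc j) \<theta> = (\<integral>\<theta>'. hh \<theta> \<theta>' * \<sigma> (Z wx wh x j \<theta>')
     + wh \<theta> \<theta>' * (\<sigma>' (Z wx wh x j \<theta>') * (Hd x j \<theta>' + hx \<theta>' \<bullet> x (- int (L - j)))) \<partial>P)"

definition Zd :: "(int \<Rightarrow> real^'d) \<Rightarrow> nat \<Rightarrow> 'w \<Rightarrow> real" where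
  "Zd x j \<theta> = Hd x j \<theta> + hx \<theta> \<bullet> x (- int (L - j))"

lemma Zd_measurable [measurable (raw)]:
  assumes [measurable]: "g \<in> measurable M' \<nu>" "h \<in> measurable M' P"
  shows "(\<lambda>w. Zd (g w) j (h w)) \<in> borel_measurable M'"
proof -
  have [measurable]: "(\<lambda>w. Zd (fst w) j (snd w)) \<in> borel_measurable (\<nu> \<Otimes>\<^sub>M P)"
  proof (induction j)
    case 0
    show ?case by (simp add: Zd_def)
  next
    case (Suc j)
    have [measurable]: "(\<lambda>w. Zd (fst (fst w)) j (snd w)) \<in> borel_measurable ((\<nu> \<Otimes>\<^sub>M P) \<Otimes>\<^sub>M P)"
      by (rule measurable_compose[OF _ Suc.IH, of "\<lambda>w. (fst (fst w), snd w)", simplified]) measurable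
    show ?case
      unfolding Zd_def Hd.simps unfolding Zd_def[symmetric] by measurable
  qed
  show ?thesis
    using measurable_compose[of "\<lambda>w. (g w, h w)" M' "\<nu> \<Otimes>\<^sub>M P" "\<lambda>w. Zd (fst w) j (snd w)"] by simp
qed

lemma Zd_section_meas [measurable]: "(\<lambda>\<theta>. Zd x j \<theta>) \<in> borel_measurable P"
  by (rule Zd_measurable) simp_all

lemma Hd_Suc_Zd: "Hd x (Suc j) \<theta> = (\<integral>\<theta>'. hh \<theta> \<theta>' * \<sigma> (Z wx wh x j \<theta>')
     + wh \<theta> \<theta>' * (\<sigma>' (Z wx wh x j \<theta>') * Zd x j \<theta>') \<partial>P)"
  by (simp add: Zd_def)

text \<open>Restricted to \<open>N\<close>: for other rows the integrand may fail to be integrable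
  at \<epsilon> \<noteq> 0, and the hidden state would then jump to the default value 0.\<close>

lemma Ze_derivative:
  "\<theta> \<in> N \<Longrightarrow> ((\<lambda>\<epsilon>. Ze \<epsilon> x j \<theta>) has_real_derivative Zd x j \<theta>) (at 0)"
proof (induction j arbitrary: \<theta>)
  case 0
  show ?case
    by (auto simp: Z_def Zd_def inner_add_left intro!: derivative_eq_intros)
next
  case (Suc j)
  obtain b where b: "0 \<le> b"
    and diff: "\<And>\<theta> x \<epsilon>. \<theta> \<in> N \<Longrightarrow> \<bar>Ze \<epsilon> x j \<theta> - Ze 0 x j \<theta>\<bar> \<le> \<bar>\<epsilon>\<bar> * (S x * \<rho> b \<theta>)"
    using Ze_diff_le[of j] by blast
  have int: "integrable P (\<lambda>\<theta>'. \<bar>hh \<theta> \<theta>'\<bar>)" and [measurable]: "\<theta> \<in> space P"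
    using Suc.prems by (auto simp: N_def)
  have "((\<lambda>\<epsilon>. Hhh P \<sigma> (wxe \<epsilon>) (whe \<epsilon>) x L (Suc j) \<theta>) has_real_derivative Hd x (Suc j) \<theta>) (at 0)"
    unfolding Hhh_Suc_Z Hd_Suc_Zd
  proof (rule has_derivative_integral_at_0(1)[where f="\<lambda>\<epsilon> \<theta>'. whe \<epsilon> \<theta> \<theta>' * \<sigma> (Ze \<epsilon> x j \<theta>')"])
    show "integrable P (\<lambda>\<theta>'. whe \<epsilon> \<theta> \<theta>' * \<sigma> (Ze \<epsilon> x j \<theta>'))" for \<epsilon>
      by (rule whe_sigma_integrable[OF Suc.prems])
    show "AE \<theta>' in P. \<bar>whe \<epsilon> \<theta> \<theta>' * \<sigma> (Ze \<epsilon> x j \<theta>') - whe 0 \<theta> \<theta>' * \<sigma> (Ze 0 x j \<theta>')\<bar>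
       \<le> \<bar>\<epsilon>\<bar> * (\<bar>hh \<theta> \<theta>'\<bar> * B + R * K * S x * \<rho> b \<theta>')" for \<epsilon>
      using AE_N by eventually_elim (rule whe_sigma_diff_le[OF Suc.prems _ diff b])
    show "integrable P (\<lambda>\<theta>'. \<bar>hh \<theta> \<theta>'\<bar> * B + R * K * S x * \<rho> b \<theta>')"
      using int \<rho>_integrable by (simp del: integrable_abs_iff)
    show "AE \<theta>' in P. ((\<lambda>\<epsilon>. whe \<epsilon> \<theta> \<theta>' * \<sigma> (Ze \<epsilon> x j \<theta>')) has_real_derivative
        hh \<theta> \<theta>' * \<sigma> (Z wx wh x j \<theta>') + wh \<theta> \<theta>' * (\<sigma>' (Z wx wh x j \<theta>') * Zd x j \<theta>')) (at 0)"
      using AE_N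
    proof eventually_elim
      case (elim \<theta>')
      have "((\<lambda>\<epsilon>. \<sigma> (Ze \<epsilon> x j \<theta>')) has_real_derivative \<sigma>' (Ze 0 x j \<theta>') * Zd x j \<theta>') (at 0)"
        by (rule DERIV_chain2[OF sigma_deriv Suc.IH[OF elim]])
      then show ?case
        by (auto intro!: derivative_eq_intros)
    qed
  qed measurable
  then have "((\<lambda>\<epsilon>. Hhh P \<sigma> (wxe \<epsilon>) (whe \<epsilon>) x L (Suc j) \<theta> + (wx \<theta> + \<epsilon> *\<^sub>R hx \<theta>) \<bullet> x (- int (L - Suc j)))
      has_real_derivative Hd x (Suc j) \<theta> + hx \<theta> \<bullet> x (- int (L - Suc j))) (at 0)"
    by (rule DERIV_add) (auto simp: inner_add_left intro!: derivative_eq_intros)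
  then show ?case
    by (simp only: Z_def Zd_def)
qed

end

lemma (in pair_prob_space) AE_pair_snd:
  assumes "AE y in M2. Q y"
  shows "AE z in M1 \<Otimes>\<^sub>M M2. Q (snd z)"
proof -
  have *: "AE z in M2 \<Otimes>\<^sub>M M1. Q (fst z)"
    by (rule M1.AE_pair_fst[OF assms])
  interpret Q: pair_sigma_finite M2 M1 ..
  have "AE z in distr (M1 \<Otimes>\<^sub>M M2) (M2 \<Otimes>\<^sub>M M1) (\<lambda>(x, y). (y, x)). Q (fst z)"
    unfolding Q.distr_pair_swap[symmetric] by (rule *)
  then have "AE z in M1 \<Otimes>\<^sub>M M2. Q (fst (case z of (x, y) \<Rightarrow> (y, x)))"
    by (rule AE_distrD[OF measurable_pair_swap'])
  then show ?thesis by (simp add: split_beta')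
qed

sublocale rnn \<subseteq> PPnu: pair_sigma_finite "P \<Otimes>\<^sub>M P" \<nu>
  by unfold_locales

section \<open>Directional derivative of the output and the loss\<close>

context direction
begin

lemma Zd_bound: "\<exists>b\<ge>0. \<forall>\<theta>\<in>N. \<forall>x. \<bar>Zd x j \<theta>\<bar> \<le> S x * \<rho> b \<theta>"
proof -
  obtain b where b: "0 \<le> b"
    and diff: "\<And>\<theta> x \<epsilon>. \<theta> \<in> N \<Longrightarrow> \<bar>Ze \<epsilon> x j \<theta> - Ze 0 x j \<theta>\<bar> \<le> \<bar>\<epsilon>\<bar> * (S x * \<rho> b \<theta>)"
    using Ze_diff_le[of j] by blast
  have "\<bar>Zd x j \<theta>\<bar> \<le> S x * \<rho> b \<theta>" if "\<theta> \<in> N" for x \<theta>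
    by (rule abs_derivative_le_at_0[OF Ze_derivative[OF that, of x j] diff[OF that]])
  with b show ?thesis by blast
qed

abbreviation "Fe \<epsilon> x \<equiv> \<integral>\<theta>. wye \<epsilon> \<theta> * \<sigma> (Ze \<epsilon> x L \<theta>) \<partial>P"

definition Fd :: "(int \<Rightarrow> real^'d) \<Rightarrow> real" where
  "Fd x = (\<integral>\<theta>. hy \<theta> * \<sigma> (Z wx wh x L \<theta>) + wy \<theta> * (\<sigma>' (Z wx wh x L \<theta>) * Zd x L \<theta>) \<partial>P)"

lemma Fd_measurable [measurable]: "Fd \<in> borel_measurable \<nu>"
  unfolding Fd_def[abs_def] by measurable

lemma wye_sigma_integrable: "integrable P (\<lambda>\<theta>. wye \<epsilon> \<theta> * \<sigma> (Ze \<epsilon> x j \<theta>))"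
proof (rule Bochner_Integration.integrable_bound[where f="\<lambda>\<theta>. (A * a \<theta> + \<bar>\<epsilon>\<bar> * \<bar>hy \<theta>\<bar>) * B"])
  show "integrable P (\<lambda>\<theta>. (A * a \<theta> + \<bar>\<epsilon>\<bar> * \<bar>hy \<theta>\<bar>) * B)"
    using a_integrable hy_integrable by (simp del: integrable_abs_iff)
  show "AE \<theta> in P. norm (wye \<epsilon> \<theta> * \<sigma> (Ze \<epsilon> x j \<theta>)) \<le> norm ((A * a \<theta> + \<bar>\<epsilon>\<bar> * \<bar>hy \<theta>\<bar>) * B)"
    using AE_wy_bdd
  proof eventually_elim
    case (elim \<theta>)
    then have "\<bar>wye \<epsilon> \<theta>\<bar> \<le> A * a \<theta> + \<bar>\<epsilon>\<bar> * \<bar>hy \<theta>\<bar>"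
      using abs_triangle_ineq[of "wy \<theta>" "\<epsilon> * hy \<theta>"] by (simp add: abs_mult)
    then have "\<bar>wye \<epsilon> \<theta>\<bar> * \<bar>\<sigma> (Ze \<epsilon> x j \<theta>)\<bar> \<le> (A * a \<theta> + \<bar>\<epsilon>\<bar> * \<bar>hy \<theta>\<bar>) * B"
      using sigma_bdd by (intro mult_mono) auto
    then show ?case
      unfolding real_norm_def abs_mult[of "wye \<epsilon> \<theta>"] by (rule order_trans[OF _ abs_ge_self])
  qed
qed measurable

text \<open>One constant \<open>C\<close> for all inputs, with linear growth in \<open>S x\<close>,
  is what differentiation under the integral over \<nu> requires.\<close>

lemma Fe_derivative: 
  "\<exists>C\<ge>0. \<forall>x. ((\<lambda>\<epsilon>. Fe \<epsilon> x) has_real_derivative Fd x) (at 0) \<and> (\<forall>\<epsilon>. \<bar>Fe \<epsilon> x - Fe 0 x\<bar> \<le> \<bar>\<epsilon>\<bar> * (S x * C))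
     \<and> \<bar>Fd x\<bar> \<le> S x * C"
proof -
  obtain b where b: "0 \<le> b"
    and diff: "\<And>\<theta> x \<epsilon>. \<theta> \<in> N \<Longrightarrow> \<bar>Ze \<epsilon> x L \<theta> - Ze 0 x L \<theta>\<bar> \<le> \<bar>\<epsilon>\<bar> * (S x * \<rho> b \<theta>)"
    using Ze_diff_le[of L] by blast
  define g where "g \<theta> = \<bar>hy \<theta>\<bar> * B + A * K * (a \<theta> * \<rho> b \<theta>)" for \<theta>
  have g: "integrable P g"
    unfolding g_def[abs_def] using hy_integrable a_\<rho>_integrable by (simp del: integrable_abs_iff)
  have g_nonneg: "0 \<le> g \<theta>" for \<theta>
    using B_nonneg A_nonneg K_pos \<rho>_nonneg[OF b, of \<theta>] a_ge_1[of \<theta>] by (simp add: g_def)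
  have dom: "AE \<theta> in P. \<bar>wye \<epsilon> \<theta> * \<sigma> (Ze \<epsilon> x L \<theta>) - wye 0 \<theta> * \<sigma> (Ze 0 x L \<theta>)\<bar> \<le> \<bar>\<epsilon>\<bar> * (S x * g \<theta>)" for \<epsilon> x
    using AE_N AE_wy_bdd
  proof eventually_elim
    case (elim \<theta>)
    have "\<bar>wye \<epsilon> \<theta> * \<sigma> (Ze \<epsilon> x L \<theta>) - wye 0 \<theta> * \<sigma> (Ze 0 x L \<theta>)\<bar>
        \<le> (\<bar>\<epsilon>\<bar> * \<bar>hy \<theta>\<bar>) * B + (A * a \<theta>) * (K * (\<bar>\<epsilon>\<bar> * (S x * \<rho> b \<theta>)))"
    proof (rule abs_prod_diff_le)
      have "\<bar>\<sigma> (Ze \<epsilon> x L \<theta>) - \<sigma> (Ze 0 x L \<theta>)\<bar> \<le> K * \<bar>Ze \<epsilon> x L \<theta> - Ze 0 x L \<theta>\<bar>"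
        by (rule sigma_lip)
      also have "\<dots> \<le> K * (\<bar>\<epsilon>\<bar> * (S x * \<rho> b \<theta>))"
        using diff[OF elim(1)] K_pos by (intro mult_left_mono) auto
      finally show "\<bar>\<sigma> (Ze \<epsilon> x L \<theta>) - \<sigma> (Ze 0 x L \<theta>)\<bar> \<le> K * (\<bar>\<epsilon>\<bar> * (S x * \<rho> b \<theta>))" .
    qed (use elim sigma_bdd in \<open>auto simp: abs_mult\<close>)
    also have "\<dots> \<le> (\<bar>\<epsilon>\<bar> * \<bar>hy \<theta>\<bar>) * B * S x + (A * a \<theta>) * (K * (\<bar>\<epsilon>\<bar> * (S x * \<rho> b \<theta>)))"
      using B_nonneg S_ge_1[of x] mult_left_mono[of 1 "S x" "\<bar>\<epsilon>\<bar> * \<bar>hy \<theta>\<bar> * B"] by simp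
    also have "\<dots> = \<bar>\<epsilon>\<bar> * (S x * g \<theta>)"
      by (simp add: g_def algebra_simps)
    finally show ?case .
  qed
  have deriv: "((\<lambda>\<epsilon>. Fe \<epsilon> x) has_real_derivative Fd x) (at 0)" for x
    unfolding Fd_def
  proof (rule has_derivative_integral_at_0(1)[where f="\<lambda>\<epsilon> \<theta>. wye \<epsilon> \<theta> * \<sigma> (Ze \<epsilon> x L \<theta>)" and g="\<lambda>\<theta>. S x * g \<theta>"])
    show "AE \<theta> in P. ((\<lambda>\<epsilon>. wye \<epsilon> \<theta> * \<sigma> (Ze \<epsilon> x L \<theta>)) has_real_derivative
        hy \<theta> * \<sigma> (Z wx wh x L \<theta>) + wy \<theta> * (\<sigma>' (Z wx wh x L \<theta>) * Zd x L \<theta>)) (at 0)"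
      using AE_N
    proof eventually_elim
      case (elim \<theta>)
      have "((\<lambda>\<epsilon>. \<sigma> (Ze \<epsilon> x L \<theta>)) has_real_derivative \<sigma>' (Ze 0 x L \<theta>) * Zd x L \<theta>) (at 0)"
        by (rule DERIV_chain2[OF sigma_deriv Ze_derivative[OF elim]])
      then show ?case
        by (auto intro!: derivative_eq_intros)
    qed
  qed (use dom g wye_sigma_integrable in \<open>simp_all\<close>)
  define C where "C = (\<integral>\<theta>. g \<theta> \<partial>P)"
  have lip: "\<bar>Fe \<epsilon> x - Fe 0 x\<bar> \<le> \<bar>\<epsilon>\<bar> * (S x * C)" for \<epsilon> x
  proof -
    have "norm (\<integral>\<theta>. wye \<epsilon> \<theta> * \<sigma> (Ze \<epsilon> x L \<theta>) - wye 0 \<theta> * \<sigma> (Ze 0 x L \<theta>) \<partial>P) \<le> \<bar>\<epsilon>\<bar> * (\<integral>\<theta>. S x * g \<theta> \<partial>P)"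
      by (rule norm_integral_le_mult) (use dom g in auto)
    then show ?thesis
      using wye_sigma_integrable[of \<epsilon> x L] wye_sigma_integrable[of 0 x L] g by (simp add: C_def)
  qed
  have "\<bar>Fd x\<bar> \<le> S x * C" for x
    by (rule abs_derivative_le_at_0[OF deriv lip])
  moreover have "0 \<le> C"
    unfolding C_def using g_nonneg by (intro Bochner_Integration.integral_nonneg) auto
  ultimately show ?thesis using deriv lip by blast
qed

text \<open>The increment of the squared residual is the increment of the output times the sum of
  two residuals, of order \<open>S * ((1 + |Fs|) + S)\<close>; both products are below multiples of
  \<open>Q\<close>. Restricting to \<open>|\<epsilon>| \<le> 1\<close> absorbs the term quadratic in
  \<epsilon>.\<close>

lemma loss_derivative_Fd:
  shows "((\<lambda>\<epsilon>. loss P \<nu> Fs \<sigma> L (wxe \<epsilon>) (whe \<epsilon>) (wye \<epsilon>)) has_real_derivative - (\<integral>x. err wx wh wy x * Fd x \<partial>\<nu>)) (at 0)"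
proof -
  obtain C where C: "0 \<le> C" and deriv: "\<And>x. ((\<lambda>\<epsilon>. Fe \<epsilon> x) has_real_derivative Fd x) (at 0)"
    and lip: "\<And>x \<epsilon>. \<bar>Fe \<epsilon> x - Fe 0 x\<bar> \<le> \<bar>\<epsilon>\<bar> * (S x * C)" and Fd: "\<And>x. \<bar>Fd x\<bar> \<le> S x * C"
    using Fe_derivative by blast
  let ?e = "\<lambda>\<epsilon> x. err (wxe \<epsilon>) (whe \<epsilon>) (wye \<epsilon>) x"
  have e: "?e \<epsilon> x = Fs x - Fe \<epsilon> x" for \<epsilon> x
    by (simp add: err_def)
  have e0: "?e 0 = err wx wh wy"
    by simp
  have "((\<lambda>\<epsilon>. \<integral>x. (?e \<epsilon> x)^2 \<partial>\<nu>) has_real_derivative (\<integral>x. 2 * (err wx wh wy x * (- Fd x)) \<partial>\<nu>)) (at 0)"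
  proof (rule has_derivative_integral_at_0(1)[where g="\<lambda>x. (2 * C * E + C^2) * Q x"])
    fix \<epsilon> :: real
    have le: "\<bar>?e \<epsilon> x\<bar> \<le> E * (1 + \<bar>Fs x\<bar>) + \<bar>\<epsilon>\<bar> * (S x * C)" for x
      using err_bdd[of x] lip[of \<epsilon> x] e[of \<epsilon> x] e[of 0 x] unfolding e0 by linarith
    show "integrable \<nu> (\<lambda>x. (?e \<epsilon> x)^2)"
    proof (rule Bochner_Integration.integrable_bound[where f="\<lambda>x. 2 * (E^2 * (1 + \<bar>Fs x\<bar>)^2 + (\<epsilon> * C)^2 * Q x)"])
      show "integrable \<nu> (\<lambda>x. 2 * (E^2 * (1 + \<bar>Fs x\<bar>)^2 + (\<epsilon> * C)^2 * Q x))"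
        using Fs1_L2 Q_integrable by simp
      show "AE x in \<nu>. norm ((?e \<epsilon> x)^2) \<le> norm (2 * (E^2 * (1 + \<bar>Fs x\<bar>)^2 + (\<epsilon> * C)^2 * Q x))"
      proof (rule AE_I2)
        fix x
        let ?u = "E * (1 + \<bar>Fs x\<bar>)" and ?w = "\<bar>\<epsilon>\<bar> * (S x * C)"
        have "(?e \<epsilon> x)^2 = \<bar>?e \<epsilon> x\<bar>^2"
          by simp
        also have "\<dots> \<le> (?u + ?w)^2"
          using le by (intro power_mono) auto
        also have "\<dots> \<le> 2 * (?u^2 + ?w^2)"
          using sum_squares_bound[of ?u ?w] by (simp add: power2_sum)
        also have "\<dots> = 2 * (E^2 * (1 + \<bar>Fs x\<bar>)^2 + (\<epsilon> * C)^2 * (S x)^2)"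
          by (simp add: power_mult_distrib mult_ac)
        also have "\<dots> \<le> 2 * (E^2 * (1 + \<bar>Fs x\<bar>)^2 + (\<epsilon> * C)^2 * Q x)"
          using Fs_S_le_Q(3)[of x] by (intro mult_left_mono add_left_mono) auto
        finally have "(?e \<epsilon> x)^2 \<le> 2 * (E^2 * (1 + \<bar>Fs x\<bar>)^2 + (\<epsilon> * C)^2 * Q x)" .
        then show "norm ((?e \<epsilon> x)^2) \<le> norm (2 * (E^2 * (1 + \<bar>Fs x\<bar>)^2 + (\<epsilon> * C)^2 * Q x))"
          unfolding real_norm_def abs_power2 by linarith
      qed
    qed measurable
    assume \<epsilon>: "\<bar>\<epsilon>\<bar> \<le> 1"
    show "AE x in \<nu>. \<bar>(?e \<epsilon> x)^2 - (?e 0 x)^2\<bar> \<le> \<bar>\<epsilon>\<bar> * ((2 * C * E + C^2) * Q x)"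
    proof (rule AE_I2)
      fix x
      let ?u = "E * (1 + \<bar>Fs x\<bar>)"
      have "\<bar>(?e \<epsilon> x)^2 - (?e 0 x)^2\<bar> = \<bar>?e \<epsilon> x - ?e 0 x\<bar> * \<bar>?e \<epsilon> x + ?e 0 x\<bar>"
        by (simp add: abs_mult[symmetric] power2_eq_square square_diff_square_factored mult.commute)
      also have "\<dots> \<le> (\<bar>\<epsilon>\<bar> * (S x * C)) * (2 * ?u + S x * C)"
      proof (rule mult_mono)
        show "\<bar>?e \<epsilon> x - ?e 0 x\<bar> \<le> \<bar>\<epsilon>\<bar> * (S x * C)"
          using lip[of \<epsilon> x] e[of \<epsilon> x] e[of 0 x] by linarith
        have "\<bar>\<epsilon>\<bar> * (S x * C) \<le> 1 * (S x * C)"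
          using \<epsilon> C S_ge_1[of x] by (intro mult_right_mono) auto
        then show "\<bar>?e \<epsilon> x + ?e 0 x\<bar> \<le> 2 * ?u + S x * C"
          using le[of x] err_bdd[of x] unfolding e0 by linarith
      qed (use C S_ge_1[of x] in auto)
      also have "\<dots> = \<bar>\<epsilon>\<bar> * (2 * C * E * ((1 + \<bar>Fs x\<bar>) * S x) + C^2 * (S x)^2)"
        by (simp add: algebra_simps power2_eq_square)
      also have "\<dots> \<le> \<bar>\<epsilon>\<bar> * (2 * C * E * Q x + C^2 * Q x)"
        using Fs_S_le_Q[of x] C E_ge_1 by (intro mult_left_mono add_mono) auto
      finally show "\<bar>(?e \<epsilon> x)^2 - (?e 0 x)^2\<bar> \<le> \<bar>\<epsilon>\<bar> * ((2 * C * E + C^2) * Q x)"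
        by (simp add: algebra_simps)
    qed
  next
    show "AE x in \<nu>. ((\<lambda>\<epsilon>. (?e \<epsilon> x)^2) has_real_derivative 2 * (err wx wh wy x * (- Fd x))) (at 0)"
    proof (rule AE_I2)
      fix x
      have "((\<lambda>\<epsilon>. (Fs x - Fe \<epsilon> x)^2) has_real_derivative 2 * ((Fs x - Fe 0 x) * (- Fd x))) (at 0)"
        using deriv[of x] by (auto intro!: derivative_eq_intros)
      then show "((\<lambda>\<epsilon>. (?e \<epsilon> x)^2) has_real_derivative 2 * (err wx wh wy x * (- Fd x))) (at 0)"
        unfolding e unfolding err_def by simp
    qed
  qed (use Q_integrable in auto)
  from DERIV_cmult[OF this, of "1/2"] show ?thesis
    by (simp add: loss_def err_Fhat mult.assoc)
qed

section \<open>Transposing the tangent recursion into backpropagation\<close>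

lemma M_hx_integrable:
  assumes "i \<le> L"
  shows "integrable P (\<lambda>\<theta>. M wx wh wy x i \<theta> * (hx \<theta> \<bullet> x (- int i)))"
proof (rule Bochner_Integration.integrable_bound[where f="\<lambda>\<theta>. D L * S x * (a \<theta> * norm (hx \<theta>))"])
  show "AE \<theta> in P. norm (M wx wh wy x i \<theta> * (hx \<theta> \<bullet> x (- int i))) \<le> norm (D L * S x * (a \<theta> * norm (hx \<theta>)))"
    using AE_G
  proof eventually_elim
    case (elim \<theta>)
    have "\<bar>M wx wh wy x i \<theta>\<bar> * \<bar>hx \<theta> \<bullet> x (- int i)\<bar> \<le> (D L * a \<theta>) * (norm (hx \<theta>) * S x)"
      using M_bdd_L[OF elim assms] inner_hx_le[of i 1 \<theta> x] assms
      by (intro mult_mono) (auto intro: order_trans[OF abs_ge_zero])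
    then show ?case
      using D_nonneg[of L] a_ge_1[of \<theta>] S_ge_1[of x] by (simp add: abs_mult mult_ac)
  qed
qed (use a_hx_integrable in auto)

lemma M_hh_integrable:
  assumes "i \<le> L"
  shows "integrable (P \<Otimes>\<^sub>M P) (\<lambda>z. M wx wh wy x i (fst z) * (hh (fst z) (snd z) * \<sigma> (Z wx wh x j (snd z))))"
proof (rule Bochner_Integration.integrable_bound[where f="\<lambda>z. (D L * B) * (a (fst z) * \<bar>hh (fst z) (snd z)\<bar>)"])
  show "AE z in P \<Otimes>\<^sub>M P. norm (M wx wh wy x i (fst z) * (hh (fst z) (snd z) * \<sigma> (Z wx wh x j (snd z))))
      \<le> norm ((D L * B) * (a (fst z) * \<bar>hh (fst z) (snd z)\<bar>))"
    using P.AE_pair_fst[OF AE_G]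
  proof eventually_elim
    case (elim z)
    have "\<bar>M wx wh wy x i (fst z)\<bar> * (\<bar>hh (fst z) (snd z)\<bar> * \<bar>\<sigma> (Z wx wh x j (snd z))\<bar>)
        \<le> (D L * a (fst z)) * (\<bar>hh (fst z) (snd z)\<bar> * B)"
      using M_bdd_L[OF elim assms] sigma_bdd
      by (intro mult_mono mult_left_mono) (auto intro: order_trans[OF abs_ge_zero])
    then show ?case
      using D_nonneg[of L] B_nonneg a_ge_1[of "fst z"] by (simp add: abs_mult mult_ac)
  qed
qed (use a_hh_integrable in \<open>simp add: split_beta'\<close>, measurable)

text \<open>Inserting the tangent recursion for \<open>Zd\<close> splits off the direct
  contributions of \<open>hx\<close> and \<open>hh\<close>. In the remaining double integral Fubini
  moves \<open>wh\<close> from the tangent to the adjoint variable, and \<open>\<sigma>'\<close>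
  times the average of \<open>M * wh\<close> is \<open>M\<close> at \<open>Suc i\<close>.\<close>

lemma adjoint_step:
  assumes "i < L"
  shows "(\<integral>\<theta>. M wx wh wy x i \<theta> * Zd x (L - i) \<theta> \<partial>P)
    = (\<integral>\<theta>. M wx wh wy x i \<theta> * (hx \<theta> \<bullet> x (- int i)) \<partial>P)
      + (\<integral>z. M wx wh wy x i (fst z) * (hh (fst z) (snd z) * \<sigma> (Z wx wh x (L - Suc i) (snd z))) \<partial>(P \<Otimes>\<^sub>M P))
      + (\<integral>\<theta>. M wx wh wy x (Suc i) \<theta> * Zd x (L - Suc i) \<theta> \<partial>P)"
proof -
  define j where "j = L - Suc i"
  \<comment> \<open>\<open>j\<close> is the step before \<open>L - i\<close> in the forward
    numbering; the second identity makes the input read at step \<open>Suc j\<close> the one with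
    index \<open>i\<close>.\<close>
  have j: "L - i = Suc j" "L - Suc j = i" using assms by (auto simp: j_def)
  let ?M = "M wx wh wy x i" and ?Z = "Z wx wh x j"
  let ?f1 = "\<lambda>\<theta> \<theta>'. ?M \<theta> * (hh \<theta> \<theta>' * \<sigma> (?Z \<theta>'))"
  let ?f2 = "\<lambda>\<theta> \<theta>'. ?M \<theta> * (wh \<theta> \<theta>' * (\<sigma>' (?Z \<theta>') * Zd x j \<theta>'))"
  obtain b where b: "0 \<le> b" and Zd: "\<And>\<theta>. \<theta> \<in> N \<Longrightarrow> \<bar>Zd x j \<theta>\<bar> \<le> S x * \<rho> b \<theta>"
    using Zd_bound[of j] by blast
  have M_le: "\<bar>?M \<theta>\<bar> \<le> D L * a \<theta>" if "\<theta> \<in> G" for \<theta>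
    using M_bdd_L[OF that, of i x] assms by simp
  have f1: "integrable (P \<Otimes>\<^sub>M P) (case_prod ?f1)"
    using M_hh_integrable[of i x j] assms by (simp add: split_beta')
  have f2: "integrable (P \<Otimes>\<^sub>M P) (case_prod ?f2)"
  proof (rule Bochner_Integration.integrable_bound[where f="\<lambda>z. (D L * a (fst z)) * (R * K * (S x * \<rho> b (snd z)))"])
    show "integrable (P \<Otimes>\<^sub>M P) (\<lambda>z. (D L * a (fst z)) * (R * K * (S x * \<rho> b (snd z))))"
      by (rule PP.integrable_prod_mult) (use a_integrable \<rho>_integrable in auto)
    show "AE z in P \<Otimes>\<^sub>M P. norm (case z of (\<theta>, \<theta>') \<Rightarrow> ?f2 \<theta> \<theta>')
        \<le> norm ((D L * a (fst z)) * (R * K * (S x * \<rho> b (snd z))))"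
      using P.AE_pair_fst[OF AE_G] PP.AE_pair_snd[OF AE_N]
    proof eventually_elim
      case (elim z)
      have "\<bar>?M (fst z)\<bar> * (\<bar>wh (fst z) (snd z)\<bar> * (\<bar>\<sigma>' (?Z (snd z))\<bar> * \<bar>Zd x j (snd z)\<bar>))
          \<le> (D L * a (fst z)) * (R * (K * (S x * \<rho> b (snd z))))"
        using M_le[OF elim(1)] sigma'_bdd Zd[OF elim(2)] wh_bdd[of "fst z" "snd z"] elim G_sub K_pos R_pos
        by (intro mult_mono) (auto simp: N_def)
      then show ?case
        using D_nonneg[of L] K_pos R_pos a_ge_1[of "fst z"] S_ge_1[of x] \<rho>_nonneg[OF b, of "snd z"]
        by (simp add: split_beta' abs_mult mult_ac)
    qed
  qed measurable
  have "AE \<theta> in P. ?M \<theta> * Zd x (L - i) \<theta>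
      = ?M \<theta> * (hx \<theta> \<bullet> x (- int i)) + (\<integral>\<theta>'. ?f1 \<theta> \<theta>' \<partial>P) + (\<integral>\<theta>'. ?f2 \<theta> \<theta>' \<partial>P)"
    using AE_N
  proof eventually_elim
    case (elim \<theta>)
    then have int: "integrable P (\<lambda>\<theta>'. \<bar>hh \<theta> \<theta>'\<bar>)" and [measurable]: "\<theta> \<in> space P"
      by (auto simp: N_def)
    have 1: "integrable P (\<lambda>\<theta>'. hh \<theta> \<theta>' * \<sigma> (?Z \<theta>'))"
    proof (rule Bochner_Integration.integrable_bound[where f="\<lambda>\<theta>'. \<bar>hh \<theta> \<theta>'\<bar> * B"])
      show "AE \<theta>' in P. norm (hh \<theta> \<theta>' * \<sigma> (?Z \<theta>')) \<le> norm (\<bar>hh \<theta> \<theta>'\<bar> * B)"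
        using sigma_bdd B_nonneg by (auto simp: abs_mult mult_left_mono)
      show "integrable P (\<lambda>\<theta>'. \<bar>hh \<theta> \<theta>'\<bar> * B)"
        by (rule integrable_mult_left) (rule int)
    qed measurable
    have 2: "integrable P (\<lambda>\<theta>'. wh \<theta> \<theta>' * (\<sigma>' (?Z \<theta>') * Zd x j \<theta>'))"
    proof (rule Bochner_Integration.integrable_bound[where f="\<lambda>\<theta>'. R * (K * (S x * \<rho> b \<theta>'))"])
      show "AE \<theta>' in P. norm (wh \<theta> \<theta>' * (\<sigma>' (?Z \<theta>') * Zd x j \<theta>')) \<le> norm (R * (K * (S x * \<rho> b \<theta>')))"
        using AE_N
      proof eventually_elim
        case (elim \<theta>')
        have "\<bar>wh \<theta> \<theta>'\<bar> * (\<bar>\<sigma>' (?Z \<theta>')\<bar> * \<bar>Zd x j \<theta>'\<bar>) \<le> R * (K * (S x * \<rho> b \<theta>'))"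
          using sigma'_bdd Zd[OF elim] wh_bdd[of \<theta> \<theta>'] elim \<open>\<theta> \<in> space P\<close> K_pos R_pos
          by (intro mult_mono) (auto simp: N_def)
        then show ?case
          using K_pos R_pos S_ge_1[of x] \<rho>_nonneg[OF b, of \<theta>'] by (simp add: abs_mult)
      qed
    qed (use \<rho>_integrable in \<open>simp_all\<close>)
    show ?case
      unfolding j Zd_def[of x "Suc j"] Hd_Suc_Zd using 1 2 by (simp add: distrib_left)
  qed
  then have "(\<integral>\<theta>. ?M \<theta> * Zd x (L - i) \<theta> \<partial>P)
      = (\<integral>\<theta>. ?M \<theta> * (hx \<theta> \<bullet> x (- int i)) + (\<integral>\<theta>'. ?f1 \<theta> \<theta>' \<partial>P) + (\<integral>\<theta>'. ?f2 \<theta> \<theta>' \<partial>P) \<partial>P)"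
    by (intro integral_cong_AE) measurable
  also have "\<dots> = (\<integral>\<theta>. ?M \<theta> * (hx \<theta> \<bullet> x (- int i)) \<partial>P) + (\<integral>\<theta>. (\<integral>\<theta>'. ?f1 \<theta> \<theta>' \<partial>P) \<partial>P)
      + (\<integral>\<theta>. (\<integral>\<theta>'. ?f2 \<theta> \<theta>' \<partial>P) \<partial>P)"
    using M_hx_integrable[OF less_imp_le[OF assms], of x] PP.integrable_fst[OF f1] PP.integrable_fst[OF f2] by (simp only: Bochner_Integration.integral_add Bochner_Integration.integrable_add)
  also have "(\<integral>\<theta>. (\<integral>\<theta>'. ?f1 \<theta> \<theta>' \<partial>P) \<partial>P)
      = (\<integral>z. M wx wh wy x i (fst z) * (hh (fst z) (snd z) * \<sigma> (Z wx wh x (L - Suc i) (snd z))) \<partial>(P \<Otimes>\<^sub>M P))"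
    unfolding PP.integral_fst[OF f1] by (simp add: split_beta' j_def)
  also have "(\<integral>\<theta>. (\<integral>\<theta>'. ?f2 \<theta> \<theta>' \<partial>P) \<partial>P) = (\<integral>\<theta>'. (\<integral>\<theta>. ?f2 \<theta> \<theta>' \<partial>P) \<partial>P)"
    by (rule PP.Fubini_integral[OF f2, symmetric])
  also have "\<dots> = (\<integral>\<theta>. M wx wh wy x (Suc i) \<theta> * Zd x (L - Suc i) \<theta> \<partial>P)"
  proof (rule Bochner_Integration.integral_cong[OF refl])
    fix \<theta>'
    have "(\<integral>\<theta>. ?f2 \<theta> \<theta>' \<partial>P) = (\<integral>\<theta>. (\<sigma>' (?Z \<theta>') * Zd x j \<theta>') * (?M \<theta> * wh \<theta> \<theta>') \<partial>P)"
      by (intro Bochner_Integration.integral_cong[OF refl]) (simp add: mult_ac)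
    also have "\<dots> = M wx wh wy x (Suc i) \<theta>' * Zd x (L - Suc i) \<theta>'"
      unfolding integral_mult_right_zero M.simps j_def by (simp only: mult_ac)
    finally show "(\<integral>\<theta>. ?f2 \<theta> \<theta>' \<partial>P) = M wx wh wy x (Suc i) \<theta>' * Zd x (L - Suc i) \<theta>'" .
  qed
  finally show ?thesis .
qed

lemma adjoint_sum:
  "k \<le> L \<Longrightarrow> (\<integral>\<theta>. M wx wh wy x 0 \<theta> * Zd x L \<theta> \<partial>P)
    = (\<Sum>i<k. \<integral>\<theta>. M wx wh wy x i \<theta> * (hx \<theta> \<bullet> x (- int i)) \<partial>P)
      + (\<Sum>i<k. \<integral>z. M wx wh wy x i (fst z) * (hh (fst z) (snd z) * \<sigma> (Z wx wh x (L - Suc i) (snd z))) \<partial>(P \<Otimes>\<^sub>M P))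
      + (\<integral>\<theta>. M wx wh wy x k \<theta> * Zd x (L - k) \<theta> \<partial>P)"
proof (induction k)
  case 0
  show ?case by simp
next
  case (Suc k)
  then show ?case
    using adjoint_step[of k x] by (simp del: M.simps)
qed

text \<open>At \<open>k = L\<close> the recursion has reached \<open>Zd x 0\<close>, where the
  hidden part \<open>Hd\<close> vanishes and only the input term remains. Therefore the input sum
  runs up to \<open>L\<close> while the recurrent sum stops before \<open>L\<close>.\<close>

lemma Fd_adjoint:
  "Fd x = (\<integral>\<theta>. hy \<theta> * \<sigma> (Z wx wh x L \<theta>) \<partial>P)
    + (\<Sum>i\<le>L. \<integral>\<theta>. M wx wh wy x i \<theta> * (hx \<theta> \<bullet> x (- int i)) \<partial>P)
    + (\<Sum>i<L. \<integral>z. M wx wh wy x i (fst z) * (hh (fst z) (snd z) * \<sigma> (Z wx wh x (L - Suc i) (snd z))) \<partial>(P \<Otimes>\<^sub>M P))"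
proof -
  obtain b where b: "0 \<le> b" and Zd: "\<And>\<theta>. \<theta> \<in> N \<Longrightarrow> \<bar>Zd x L \<theta>\<bar> \<le> S x * \<rho> b \<theta>"
    using Zd_bound[of L] by blast
  have 1: "integrable P (\<lambda>\<theta>. hy \<theta> * \<sigma> (Z wx wh x L \<theta>))"
  proof (rule Bochner_Integration.integrable_bound[where f="\<lambda>\<theta>. \<bar>hy \<theta>\<bar> * B"])
    show "AE \<theta> in P. norm (hy \<theta> * \<sigma> (Z wx wh x L \<theta>)) \<le> norm (\<bar>hy \<theta>\<bar> * B)"
      using sigma_bdd B_nonneg by (auto simp: abs_mult mult_left_mono)
    show "integrable P (\<lambda>\<theta>. \<bar>hy \<theta>\<bar> * B)"
      by (rule integrable_mult_left) (rule hy_integrable)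
  qed measurable
  have 2: "integrable P (\<lambda>\<theta>. M wx wh wy x 0 \<theta> * Zd x L \<theta>)"
  proof (rule Bochner_Integration.integrable_bound[where f="\<lambda>\<theta>. D L * S x * (a \<theta> * \<rho> b \<theta>)"])
    show "AE \<theta> in P. norm (M wx wh wy x 0 \<theta> * Zd x L \<theta>) \<le> norm (D L * S x * (a \<theta> * \<rho> b \<theta>))"
      using AE_G AE_N
    proof eventually_elim
      case (elim \<theta>)
      have "\<bar>M wx wh wy x 0 \<theta>\<bar> * \<bar>Zd x L \<theta>\<bar> \<le> (D L * a \<theta>) * (S x * \<rho> b \<theta>)"
        using M_bdd_L[OF elim(1), of 0 x] Zd[OF elim(2)] by (intro mult_mono) (auto intro: order_trans[OF abs_ge_zero])
      then show ?case
        using D_nonneg[of L] a_ge_1[of \<theta>] S_ge_1[of x] \<rho>_nonneg[OF b, of \<theta>] by (simp add: abs_mult mult_ac del: M.simps)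
    qed
  qed (use a_\<rho>_integrable in \<open>simp_all del: M.simps\<close>)
  have "Fd x = (\<integral>\<theta>. hy \<theta> * \<sigma> (Z wx wh x L \<theta>) + M wx wh wy x 0 \<theta> * Zd x L \<theta> \<partial>P)"
    by (simp add: Fd_def mult.assoc)
  also have "\<dots> = (\<integral>\<theta>. hy \<theta> * \<sigma> (Z wx wh x L \<theta>) \<partial>P) + (\<integral>\<theta>. M wx wh wy x 0 \<theta> * Zd x L \<theta> \<partial>P)"
    using 1 2 by (rule Bochner_Integration.integral_add)
  also have "(\<integral>\<theta>. M wx wh wy x L \<theta> * Zd x (L - L) \<theta> \<partial>P) = (\<integral>\<theta>. M wx wh wy x L \<theta> * (hx \<theta> \<bullet> x (- int L)) \<partial>P)"
    by (simp add: Zd_def)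
  then have "(\<integral>\<theta>. M wx wh wy x 0 \<theta> * Zd x L \<theta> \<partial>P)
    = (\<Sum>i\<le>L. \<integral>\<theta>. M wx wh wy x i \<theta> * (hx \<theta> \<bullet> x (- int i)) \<partial>P)
      + (\<Sum>i<L. \<integral>z. M wx wh wy x i (fst z) * (hh (fst z) (snd z) * \<sigma> (Z wx wh x (L - Suc i) (snd z))) \<partial>(P \<Otimes>\<^sub>M P))"
    using adjoint_sum[OF order_refl, of x] by (simp add: lessThan_Suc_atMost[symmetric] del: M.simps)
  finally show ?thesis by (simp add: add.assoc del: M.simps)
qed

end

section \<open>The derivative of the loss as an L2 pairing\<close>

context direction
begin

text \<open>As in the two analogous results that follow, the joint integrand is dominated by a
  function of the neuron (or pair of neurons) times a multiple of \<open>Q\<close>, so Fubini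
  exchanges neuron and input; the inner integral over \<nu> is then the gradient.\<close>

lemma Gy_dual:
  "integrable \<nu> (\<lambda>x. err wx wh wy x * (\<integral>\<theta>. hy \<theta> * \<sigma> (Z wx wh x L \<theta>) \<partial>P))" (is ?I)
  "(\<integral>x. err wx wh wy x * (\<integral>\<theta>. hy \<theta> * \<sigma> (Z wx wh x L \<theta>) \<partial>P) \<partial>\<nu>) = - (\<integral>\<theta>. Gy wx wh wy \<theta> * hy \<theta> \<partial>P)" (is ?E)
proof -
  let ?f = "\<lambda>\<theta> x. err wx wh wy x * (hy \<theta> * \<sigma> (Z wx wh x L \<theta>))"
  have f: "integrable (P \<Otimes>\<^sub>M \<nu>) (case_prod ?f)"
  proof (rule Bochner_Integration.integrable_bound[where f="\<lambda>z. \<bar>hy (fst z)\<bar> * ((E * B) * Q (snd z))"])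
    show "integrable (P \<Otimes>\<^sub>M \<nu>) (\<lambda>z. \<bar>hy (fst z)\<bar> * ((E * B) * Q (snd z)))"
      by (rule Pnu.integrable_prod_mult) (use hy_integrable Q_integrable in \<open>simp_all del: integrable_abs_iff\<close>)
    show "AE z in P \<Otimes>\<^sub>M \<nu>. norm (case z of (\<theta>, x) \<Rightarrow> ?f \<theta> x) \<le> norm (\<bar>hy (fst z)\<bar> * ((E * B) * Q (snd z)))"
    proof (rule AE_I2)
      fix z
      have "\<bar>hy (fst z)\<bar> * norm (err wx wh wy (snd z) * \<sigma> (Z wx wh (snd z) L (fst z))) \<le> \<bar>hy (fst z)\<bar> * ((E * B) * Q (snd z))"
        by (intro mult_left_mono err_sigma_le) simp
      then show "norm (case z of (\<theta>, x) \<Rightarrow> ?f \<theta> x) \<le> norm (\<bar>hy (fst z)\<bar> * ((E * B) * Q (snd z)))"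
        using E_ge_1 B_nonneg Q_ge_1[of "snd z"] by (simp add: split_beta' abs_mult mult_ac)
    qed
  qed measurable
  show ?I
    using Pnu.integrable_snd[OF f] by simp
  have "(\<integral>x. (\<integral>\<theta>. ?f \<theta> x \<partial>P) \<partial>\<nu>) = (\<integral>\<theta>. (\<integral>x. ?f \<theta> x \<partial>\<nu>) \<partial>P)"
    by (rule Pnu.Fubini_integral[OF f])
  also have "\<dots> = (\<integral>\<theta>. - (Gy wx wh wy \<theta> * hy \<theta>) \<partial>P)"
  proof (rule Bochner_Integration.integral_cong[OF refl])
    fix \<theta>
    have "(\<integral>x. ?f \<theta> x \<partial>\<nu>) = (\<integral>x. hy \<theta> * (err wx wh wy x * \<sigma> (Z wx wh x L \<theta>)) \<partial>\<nu>)"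
      by (intro Bochner_Integration.integral_cong[OF refl]) (simp add: mult_ac)
    then show "(\<integral>x. ?f \<theta> x \<partial>\<nu>) = - (Gy wx wh wy \<theta> * hy \<theta>)"
      by (simp add: Gy_def)
  qed
  finally show ?E by simp
qed

lemma Gx_dual:
  "integrable \<nu> (\<lambda>x. err wx wh wy x * (\<Sum>i\<le>L. \<integral>\<theta>. M wx wh wy x i \<theta> * (hx \<theta> \<bullet> x (- int i)) \<partial>P))" (is ?I)
  "(\<integral>x. err wx wh wy x * (\<Sum>i\<le>L. \<integral>\<theta>. M wx wh wy x i \<theta> * (hx \<theta> \<bullet> x (- int i)) \<partial>P) \<partial>\<nu>)
     = - (\<integral>\<theta>. Gx wx wh wy \<theta> \<bullet> hx \<theta> \<partial>P)" (is ?E)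
proof -
  let ?v = "\<lambda>\<theta> x. err wx wh wy x *\<^sub>R (\<Sum>i\<le>L. M wx wh wy x i \<theta> *\<^sub>R x (- int i))"
  let ?f = "\<lambda>\<theta> x. err wx wh wy x * (\<Sum>i\<le>L. M wx wh wy x i \<theta> * (hx \<theta> \<bullet> x (- int i)))"
  have inner: "?f \<theta> x = ?v \<theta> x \<bullet> hx \<theta>" for \<theta> x
    by (simp add: inner_sum_left inner_commute[of "hx \<theta>"])
  let ?C = "E * ((L + 1) * D L)"
  have f: "integrable (P \<Otimes>\<^sub>M \<nu>) (case_prod ?f)"
  proof (rule Bochner_Integration.integrable_bound[where f="\<lambda>z. (a (fst z) * norm (hx (fst z))) * (?C * Q (snd z))"])
    show "integrable (P \<Otimes>\<^sub>M \<nu>) (\<lambda>z. (a (fst z) * norm (hx (fst z))) * (?C * Q (snd z)))"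
      by (rule Pnu.integrable_prod_mult) (use a_hx_integrable Q_integrable in simp_all)
    show "AE z in P \<Otimes>\<^sub>M \<nu>. norm (case z of (\<theta>, x) \<Rightarrow> ?f \<theta> x) \<le> norm ((a (fst z) * norm (hx (fst z))) * (?C * Q (snd z)))"
      using nu.AE_pair_fst[OF AE_G]
    proof eventually_elim
      case (elim z)
      have "norm (?f (fst z) (snd z)) \<le> norm (?v (fst z) (snd z)) * norm (hx (fst z))"
        unfolding inner by (simp only: real_norm_def Cauchy_Schwarz_ineq2)
      also have "\<dots> \<le> ((E * ((L + 1) * (D L * a (fst z)))) * Q (snd z)) * norm (hx (fst z))"
        by (intro mult_right_mono err_M_sum_le[OF elim]) simp
      also have "\<dots> = (a (fst z) * norm (hx (fst z))) * (?C * Q (snd z))"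
        by (simp add: mult_ac)
      finally show ?case
        by (simp only: split_beta' real_norm_def)
    qed
  qed measurable
  have sec: "AE x in \<nu>. (\<integral>\<theta>. ?f \<theta> x \<partial>P) = err wx wh wy x * (\<Sum>i\<le>L. \<integral>\<theta>. M wx wh wy x i \<theta> * (hx \<theta> \<bullet> x (- int i)) \<partial>P)"
  proof (rule AE_I2)
    fix x
    show "(\<integral>\<theta>. ?f \<theta> x \<partial>P) = err wx wh wy x * (\<Sum>i\<le>L. \<integral>\<theta>. M wx wh wy x i \<theta> * (hx \<theta> \<bullet> x (- int i)) \<partial>P)"
      using M_hx_integrable[of _ x] by (simp add: Bochner_Integration.integral_sum)
  qed
  have meas: "(\<lambda>x. err wx wh wy x * (\<Sum>i\<le>L. \<integral>\<theta>. M wx wh wy x i \<theta> * (hx \<theta> \<bullet> x (- int i)) \<partial>P)) \<in> borel_measurable \<nu>"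
    by measurable
  show ?I
    using Pnu.integrable_snd[OF f] integrable_cong_AE[OF _ meas sec] by (simp add: borel_measurable_integrable)
  have "(\<integral>x. err wx wh wy x * (\<Sum>i\<le>L. \<integral>\<theta>. M wx wh wy x i \<theta> * (hx \<theta> \<bullet> x (- int i)) \<partial>P) \<partial>\<nu>)
     = (\<integral>x. (\<integral>\<theta>. ?f \<theta> x \<partial>P) \<partial>\<nu>)"
    using Pnu.integrable_snd[OF f] integral_cong_AE[OF _ meas sec] by (simp add: borel_measurable_integrable)
  also have "\<dots> = (\<integral>\<theta>. (\<integral>x. ?f \<theta> x \<partial>\<nu>) \<partial>P)"
    by (rule Pnu.Fubini_integral[OF f])
  also have "\<dots> = (\<integral>\<theta>. - (Gx wx wh wy \<theta> \<bullet> hx \<theta>) \<partial>P)"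
  proof (rule integral_cong_AE)
    show "(\<lambda>\<theta>. \<integral>x. ?f \<theta> x \<partial>\<nu>) \<in> borel_measurable P"
      using Pnu.integrable_fst[OF f] by (simp add: borel_measurable_integrable)
    have "(\<lambda>w. Gx wx wh wy (snd ((), w))) \<in> borel_measurable P"
      using measurable_compose[OF _ Gx_measurable_param[OF meas_weights_unit], of "\<lambda>w. ((), w)" P] by simp
    then show "(\<lambda>\<theta>. - (Gx wx wh wy \<theta> \<bullet> hx \<theta>)) \<in> borel_measurable P"
      by simp
    show "AE \<theta> in P. (\<integral>x. ?f \<theta> x \<partial>\<nu>) = - (Gx wx wh wy \<theta> \<bullet> hx \<theta>)"
      using AE_G
    proof eventually_elim
      case (elim \<theta>)
      have "(\<integral>x. ?v \<theta> x \<bullet> hx \<theta> \<partial>\<nu>) = (\<integral>x. ?v \<theta> x \<partial>\<nu>) \<bullet> hx \<theta>"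
        by (rule integral_inner_left) (rule G_integrands_integrable(2)[OF elim])
      then show ?case
        unfolding inner Gx_def inner_minus_left minus_minus .
    qed
  qed
  finally show ?E by simp
qed

lemma Gh_dual:
  "integrable \<nu> (\<lambda>x. err wx wh wy x * (\<Sum>i<L. \<integral>z. M wx wh wy x i (fst z) * (hh (fst z) (snd z)
      * \<sigma> (Z wx wh x (L - Suc i) (snd z))) \<partial>(P \<Otimes>\<^sub>M P)))" (is ?I)
  "(\<integral>x. err wx wh wy x * (\<Sum>i<L. \<integral>z. M wx wh wy x i (fst z) * (hh (fst z) (snd z)
      * \<sigma> (Z wx wh x (L - Suc i) (snd z))) \<partial>(P \<Otimes>\<^sub>M P)) \<partial>\<nu>)
     = - (\<integral>z. Gh wx wh wy (fst z) (snd z) * hh (fst z) (snd z) \<partial>(P \<Otimes>\<^sub>M P))" (is ?E)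
proof -
  let ?v = "\<lambda>z x. err wx wh wy x * (\<Sum>i<L. M wx wh wy x i (fst z) * \<sigma> (Z wx wh x (L - Suc i) (snd z)))"
  let ?g = "\<lambda>i z x. M wx wh wy x i (fst z) * (hh (fst z) (snd z) * \<sigma> (Z wx wh x (L - Suc i) (snd z)))"
  let ?f = "\<lambda>z x. err wx wh wy x * (\<Sum>i<L. ?g i z x)"
  have prod: "?f z x = ?v z x * hh (fst z) (snd z)" for z x
    by (simp add: sum_distrib_right sum_distrib_left mult_ac)
  have ahh: "integrable (P \<Otimes>\<^sub>M P) (\<lambda>z. a (fst z) * \<bar>hh (fst z) (snd z)\<bar>)"
    using a_hh_integrable by (simp add: split_beta')
  let ?C = "E * (L * D L * B)"
  have f: "integrable ((P \<Otimes>\<^sub>M P) \<Otimes>\<^sub>M \<nu>) (case_prod ?f)"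
  proof (rule Bochner_Integration.integrable_bound[where f="\<lambda>z. (a (fst (fst z)) * \<bar>hh (fst (fst z)) (snd (fst z))\<bar>) * (?C * Q (snd z))"])
    show "integrable ((P \<Otimes>\<^sub>M P) \<Otimes>\<^sub>M \<nu>) (\<lambda>z. (a (fst (fst z)) * \<bar>hh (fst (fst z)) (snd (fst z))\<bar>) * (?C * Q (snd z)))"
      by (rule PPnu.integrable_prod_mult[OF ahh]) (use Q_integrable in simp)
    show "AE z in (P \<Otimes>\<^sub>M P) \<Otimes>\<^sub>M \<nu>. norm (case z of (z, x) \<Rightarrow> ?f z x)
        \<le> norm ((a (fst (fst z)) * \<bar>hh (fst (fst z)) (snd (fst z))\<bar>) * (?C * Q (snd z)))"
      using nu.AE_pair_fst[OF P.AE_pair_fst[OF AE_G]]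
    proof eventually_elim
      case (elim z)
      have "norm (?f (fst z) (snd z)) = norm (?v (fst z) (snd z)) * \<bar>hh (fst (fst z)) (snd (fst z))\<bar>"
        unfolding prod by (simp only: real_norm_def abs_mult)
      also have "\<dots> \<le> ((E * (L * (D L * a (fst (fst z))) * B)) * Q (snd z)) * \<bar>hh (fst (fst z)) (snd (fst z))\<bar>"
        by (intro mult_right_mono err_M_sigma_sum_le[OF elim]) simp
      also have "\<dots> = (a (fst (fst z)) * \<bar>hh (fst (fst z)) (snd (fst z))\<bar>) * (?C * Q (snd z))"
        by (simp add: mult_ac)
      finally show ?case
        by (simp only: split_beta' real_norm_def)
    qed
  qed measurable
  have sec: "AE x in \<nu>. (\<integral>z. ?f z x \<partial>(P \<Otimes>\<^sub>M P)) = err wx wh wy x * (\<Sum>i<L. \<integral>z. ?g i z x \<partial>(P \<Otimes>\<^sub>M P))"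
  proof (rule AE_I2)
    fix x
    show "(\<integral>z. ?f z x \<partial>(P \<Otimes>\<^sub>M P)) = err wx wh wy x * (\<Sum>i<L. \<integral>z. ?g i z x \<partial>(P \<Otimes>\<^sub>M P))"
      using M_hh_integrable[OF less_imp_le, of _ x] by (simp add: Bochner_Integration.integral_sum)
  qed
  have meas: "(\<lambda>x. err wx wh wy x * (\<Sum>i<L. \<integral>z. ?g i z x \<partial>(P \<Otimes>\<^sub>M P))) \<in> borel_measurable \<nu>"
    by measurable
  show ?I
    using PPnu.integrable_snd[OF f] integrable_cong_AE[OF _ meas sec] by (simp add: borel_measurable_integrable)
  have "(\<integral>x. err wx wh wy x * (\<Sum>i<L. \<integral>z. ?g i z x \<partial>(P \<Otimes>\<^sub>M P)) \<partial>\<nu>) = (\<integral>x. (\<integral>z. ?f z x \<partial>(P \<Otimes>\<^sub>M P)) \<partial>\<nu>)"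
    using PPnu.integrable_snd[OF f] integral_cong_AE[OF _ meas sec] by (simp add: borel_measurable_integrable)
  also have "\<dots> = (\<integral>z. (\<integral>x. ?f z x \<partial>\<nu>) \<partial>(P \<Otimes>\<^sub>M P))"
    by (rule PPnu.Fubini_integral[OF f])
  also have "\<dots> = (\<integral>z. - (Gh wx wh wy (fst z) (snd z) * hh (fst z) (snd z)) \<partial>(P \<Otimes>\<^sub>M P))"
    unfolding prod by (simp add: Gh_def)
  finally show ?E by simp
qed

theorem loss_derivative:
  "((\<lambda>\<epsilon>. loss P \<nu> Fs \<sigma> L (wxe \<epsilon>) (whe \<epsilon>) (wye \<epsilon>)) has_real_derivative
     (\<integral>\<theta>. Gx wx wh wy \<theta> \<bullet> hx \<theta> \<partial>P) + (\<integral>z. Gh wx wh wy (fst z) (snd z) * hh (fst z) (snd z) \<partial>(P \<Otimes>\<^sub>M P))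
     + (\<integral>\<theta>. Gy wx wh wy \<theta> * hy \<theta> \<partial>P)) (at 0)"
proof -
  have "- (\<integral>x. err wx wh wy x * Fd x \<partial>\<nu>) = (\<integral>\<theta>. Gx wx wh wy \<theta> \<bullet> hx \<theta> \<partial>P)
     + (\<integral>z. Gh wx wh wy (fst z) (snd z) * hh (fst z) (snd z) \<partial>(P \<Otimes>\<^sub>M P)) + (\<integral>\<theta>. Gy wx wh wy \<theta> * hy \<theta> \<partial>P)"
    unfolding Fd_adjoint distrib_left
    using Gy_dual Gx_dual Gh_dual
    by (simp only: Bochner_Integration.integral_add Bochner_Integration.integrable_add)
  with loss_derivative_Fd show ?thesis by simp
qed

end

section \<open>Existence of the variational derivatives\<close>

context weights
begin

lemma Gx_meas [measurable]: "Gx wx wh wy \<in> borel_measurable P"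
  using measurable_compose[OF _ Gx_measurable_param[OF meas_weights_unit], of "\<lambda>w. ((), w)" P] by simp

lemma Gy_meas [measurable]: "Gy wx wh wy \<in> borel_measurable P"
  using measurable_compose[OF _ Gy_measurable_param[OF meas_weights_unit], of "\<lambda>w. ((), w)" P] by simp

lemma Gh_meas [measurable]: "case_prod (Gh wx wh wy) \<in> borel_measurable (P \<Otimes>\<^sub>M P)"
  using measurable_compose[OF _ Gh_measurable_param[OF meas_weights_unit], of "\<lambda>w. ((), w)" "P \<Otimes>\<^sub>M P"]
  by (simp add: split_beta')

text \<open>The gradients in a single neuron are at most of order \<open>a\<close>, which is square
  integrable; this is the L2 membership that variational derivatives demand.\<close>

lemma a_L2_dominated:
  fixes f :: "'w \<Rightarrow> 'b::{real_normed_vector, second_countable_topology}"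
  assumes "f \<in> borel_measurable P" "\<And>\<theta>. \<theta> \<in> G \<Longrightarrow> norm (f \<theta>) \<le> C * a \<theta>"
  shows "sq_int P f"
  unfolding sq_int_def
proof (rule conjI[OF assms(1)], rule Bochner_Integration.integrable_bound[where f="\<lambda>\<theta>. C^2 * (a \<theta>)^2"])
  show "AE \<theta> in P. norm ((norm (f \<theta>))^2) \<le> norm (C^2 * (a \<theta>)^2)"
    using AE_G
  proof eventually_elim
    case (elim \<theta>)
    then have "(norm (f \<theta>))^2 \<le> (C * a \<theta>)^2"
      using assms(2) by (intro power_mono) auto
    then show ?case by (simp add: power_mult_distrib)
  qed
qed (use a_L2 assms(1) in auto)

lemma sq_int_G: "sq_int P (Gx wx wh wy)" "sq_int P (Gy wx wh wy)" "sq_int (P \<Otimes>\<^sub>M P) (case_prod (Gh wx wh wy))"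
proof -
  show "sq_int P (Gx wx wh wy)"
    by (rule a_L2_dominated[OF Gx_meas, of "E * ((L + 1) * D L) * q"]) (use Gx_bdd in \<open>simp add: mult_ac\<close>)
  show "sq_int P (Gy wx wh wy)"
  proof (rule a_L2_dominated[OF Gy_meas, of "E * B * q"])
    fix \<theta>
    have "E * B * q \<le> E * B * q * a \<theta>"
      using E_ge_1 B_nonneg q_ge_1 a_ge_1[of \<theta>] mult_left_mono[of 1 "a \<theta>" "E * B * q"] by simp
    then show "norm (Gy wx wh wy \<theta>) \<le> E * B * q * a \<theta>"
      using Gy_bdd[of \<theta>] by simp
  qed
  show "sq_int (P \<Otimes>\<^sub>M P) (case_prod (Gh wx wh wy))"
    unfolding sq_int_def
  proof (rule conjI[OF Gh_meas], rule Bochner_Integration.integrable_bound[where f="\<lambda>z. (a (fst z))^2 * (E * (L * D L * B) * q)^2"])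
    show "integrable (P \<Otimes>\<^sub>M P) (\<lambda>z. (a (fst z))^2 * (E * (L * D L * B) * q)^2)"
      by (rule PP.integrable_prod_mult[OF a_L2]) simp
    show "AE z in P \<Otimes>\<^sub>M P. norm ((norm (case_prod (Gh wx wh wy) z))^2) \<le> norm ((a (fst z))^2 * (E * (L * D L * B) * q)^2)"
      using P.AE_pair_fst[OF AE_G]
    proof eventually_elim
      case (elim z)
      have "\<bar>Gh wx wh wy (fst z) (snd z)\<bar>^2 \<le> (E * (L * (D L * a (fst z)) * B) * q)^2"
        using Gh_bdd[OF elim] by (intro power_mono) auto
      then show ?case by (simp add: split_beta' power_mult_distrib mult_ac)
    qed
  qed measurable
qed

lemma direction_axioms:
  assumes "sq_int P hx" "sq_int (P \<Otimes>\<^sub>M P) (case_prod hh)" "sq_int P hy"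
  shows "direction P \<nu> Fs \<sigma> \<sigma>' R K B a A wx wh wy G hx hh hy"
  by (intro direction.intro weights_axioms direction_axioms.intro assms)

lemma sq_int_0: "sq_int P (\<lambda>_. 0 :: 'b::{real_normed_vector, second_countable_topology})"
   "sq_int (P \<Otimes>\<^sub>M P) (case_prod (\<lambda>_ _. 0 :: real))"
  by (auto simp: sq_int_def split_beta')

lemma vd_xh_Gx: "vd_xh P (loss P \<nu> Fs \<sigma> L) wx wh wy (Gx wx wh wy)"
  unfolding vd_xh_def
proof (intro conjI allI impI sq_int_G)
  fix h :: "'w \<Rightarrow> real^'d" assume "sq_int P h"
  then interpret direction P \<nu> Fs L \<sigma> \<sigma>' R K B a A wx wh wy G h "\<lambda>_ _. 0" "\<lambda>_. 0"
    by (intro direction_axioms sq_int_0)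
  show "((\<lambda>\<epsilon>. loss P \<nu> Fs \<sigma> L (\<lambda>\<theta>. wx \<theta> + \<epsilon> *\<^sub>R h \<theta>) wh wy) has_real_derivative
      (\<integral>\<theta>. Gx wx wh wy \<theta> \<bullet> h \<theta> \<partial>P)) (at 0)"
    using loss_derivative by simp
qed

lemma vd_hh_Gh: "vd_hh P (loss P \<nu> Fs \<sigma> L) wx wh wy (Gh wx wh wy)"
  unfolding vd_hh_def
proof (intro conjI allI impI sq_int_G)
  fix h :: "'w \<Rightarrow> 'w \<Rightarrow> real" assume "sq_int (P \<Otimes>\<^sub>M P) (case_prod h)"
  then interpret direction P \<nu> Fs L \<sigma> \<sigma>' R K B a A wx wh wy G "\<lambda>_. 0" h "\<lambda>_. 0"
    by (intro direction_axioms sq_int_0)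
  show "((\<lambda>\<epsilon>. loss P \<nu> Fs \<sigma> L wx (\<lambda>\<theta> \<theta>'. wh \<theta> \<theta>' + \<epsilon> * h \<theta> \<theta>') wy) has_real_derivative
      (\<integral>z. Gh wx wh wy (fst z) (snd z) * h (fst z) (snd z) \<partial>(P \<Otimes>\<^sub>M P))) (at 0)"
    using loss_derivative by simp
qed

lemma vd_hy_Gy: "vd_hy P (loss P \<nu> Fs \<sigma> L) wx wh wy (Gy wx wh wy)"
  unfolding vd_hy_def
proof (intro conjI allI impI sq_int_G)
  fix h :: "'w \<Rightarrow> real" assume "sq_int P h"
  then interpret direction P \<nu> Fs L \<sigma> \<sigma>' R K B a A wx wh wy G "\<lambda>_. 0" "\<lambda>_ _. 0" h
    by (intro direction_axioms sq_int_0)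
  show "((\<lambda>\<epsilon>. loss P \<nu> Fs \<sigma> L wx wh (\<lambda>\<theta>. wy \<theta> + \<epsilon> * h \<theta>)) has_real_derivative
      (\<integral>\<theta>. Gy wx wh wy \<theta> * h \<theta> \<partial>P)) (at 0)"
    using loss_derivative by simp
qed

end

section \<open>Uniqueness of variational derivatives almost everywhere\<close>

lemma sq_int_diff:
  fixes f g :: "'a \<Rightarrow> 'b::{real_normed_vector, second_countable_topology}"
  assumes "sq_int M f" "sq_int M g"
  shows "sq_int M (\<lambda>x. f x - g x)"
proof -
  have [measurable]: "f \<in> borel_measurable M" "g \<in> borel_measurable M"
    using assms by (auto simp: sq_int_def)
  have "integrable M (\<lambda>x. (norm (f x - g x))^2)"
  proof (rule Bochner_Integration.integrable_bound[where f="\<lambda>x. 2 * ((norm (f x))^2 + (norm (g x))^2)"])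
  show "(\<lambda>x. (norm (f x - g x))^2) \<in> borel_measurable M"
    by measurable
  show "AE x in M. norm ((norm (f x - g x))^2) \<le> norm (2 * ((norm (f x))^2 + (norm (g x))^2))"
  proof (rule AE_I2)
    fix x
    have "(norm (f x - g x))^2 \<le> (norm (f x) + norm (g x))^2"
      by (intro power_mono norm_triangle_ineq4) auto
    also have "\<dots> \<le> 2 * ((norm (f x))^2 + (norm (g x))^2)"
      using sum_squares_bound[of "norm (f x)" "norm (g x)"] by (simp add: power2_sum)
    finally show "norm ((norm (f x - g x))^2) \<le> norm (2 * ((norm (f x))^2 + (norm (g x))^2))"
      by simp
  qed
  qed (use assms in \<open>auto simp: sq_int_def\<close>)
  then show ?thesis by (simp add: sq_int_def)
qed

text \<open>The two functionals are tested on the difference \<open>g - g'\<close> itself, which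
  yields its squared L2 norm. Equality almost everywhere is all that directions in L2 can
  detect.\<close>

lemma AE_eq_of_L2_dual:
  fixes g g' :: "'a \<Rightarrow> 'b::{real_inner, second_countable_topology}"
  assumes g: "sq_int M g" and g': "sq_int M g'"
    and eq: "(\<integral>x. g x \<bullet> (g x - g' x) \<partial>M) = (\<integral>x. g' x \<bullet> (g x - g' x) \<partial>M)"
  shows "AE x in M. g x = g' x"
proof -
  have [measurable]: "g \<in> borel_measurable M" "g' \<in> borel_measurable M"
    using g g' by (auto simp: sq_int_def)
  have d: "sq_int M (\<lambda>x. g x - g' x)"
    by (rule sq_int_diff[OF g g'])
  have inner_int: "integrable M (\<lambda>x. f x \<bullet> h x)" if f: "sq_int M f" and h: "sq_int M h" for f h :: "'a \<Rightarrow> 'b"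
  proof (rule Bochner_Integration.integrable_bound[where f="\<lambda>x. norm (f x) * norm (h x)"])
    show "integrable M (\<lambda>x. norm (f x) * norm (h x))"
      using f h by (intro integrable_mult_of_squares) (auto simp: sq_int_def)
  qed (use f h Cauchy_Schwarz_ineq2 in \<open>auto simp: sq_int_def\<close>)
  have "(\<integral>x. (norm (g x - g' x))^2 \<partial>M) = (\<integral>x. g x \<bullet> (g x - g' x) - g' x \<bullet> (g x - g' x) \<partial>M)"
    by (intro Bochner_Integration.integral_cong[OF refl]) (simp add: power2_norm_eq_inner inner_diff_left)
  also have "\<dots> = 0"
    using inner_int[OF g d] inner_int[OF g' d] eq by simp
  finally have "AE x in M. (norm (g x - g' x))^2 = 0"
    using d by (subst integral_nonneg_eq_0_iff_AE[symmetric]) (auto simp: sq_int_def)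
  then show ?thesis by eventually_elim simp
qed

lemma vd_xh_unique:
  assumes "vd_xh P Lf wx wh wy g" "vd_xh P Lf wx wh wy g'"
  shows "AE \<theta> in P. g \<theta> = g' \<theta>"
proof -
  have g: "sq_int P g" and g': "sq_int P g'"
    using assms by (auto simp: vd_xh_def)
  have "(\<integral>\<theta>. g \<theta> \<bullet> (g \<theta> - g' \<theta>) \<partial>P) = (\<integral>\<theta>. g' \<theta> \<bullet> (g \<theta> - g' \<theta>) \<partial>P)"
    using assms sq_int_diff[OF g g'] unfolding vd_xh_def by (meson DERIV_unique)
  then show ?thesis by (rule AE_eq_of_L2_dual[OF g g'])
qed

lemma vd_hy_unique:
  assumes "vd_hy P Lf wx wh wy g" "vd_hy P Lf wx wh wy g'"
  shows "AE \<theta> in P. g \<theta> = g' \<theta>"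
proof -
  have g: "sq_int P g" and g': "sq_int P g'"
    using assms by (auto simp: vd_hy_def)
  have "(\<integral>\<theta>. g \<theta> * (g \<theta> - g' \<theta>) \<partial>P) = (\<integral>\<theta>. g' \<theta> * (g \<theta> - g' \<theta>) \<partial>P)"
    using assms sq_int_diff[OF g g'] unfolding vd_hy_def by (meson DERIV_unique)
  then show ?thesis by (intro AE_eq_of_L2_dual[OF g g']) simp
qed

lemma vd_hh_unique:
  assumes "vd_hh P Lf wx wh wy g" "vd_hh P Lf wx wh wy g'"
  shows "AE z in P \<Otimes>\<^sub>M P. g (fst z) (snd z) = g' (fst z) (snd z)"
proof -
  have g: "sq_int (P \<Otimes>\<^sub>M P) (case_prod g)" and g': "sq_int (P \<Otimes>\<^sub>M P) (case_prod g')"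
    using assms by (auto simp: vd_hh_def)
  have "sq_int (P \<Otimes>\<^sub>M P) (case_prod (\<lambda>\<theta> \<theta>'. g \<theta> \<theta>' - g' \<theta> \<theta>'))"
    using sq_int_diff[OF g g'] by (simp add: split_beta')
  then have "(\<integral>z. g (fst z) (snd z) * (g (fst z) (snd z) - g' (fst z) (snd z)) \<partial>(P \<Otimes>\<^sub>M P))
      = (\<integral>z. g' (fst z) (snd z) * (g (fst z) (snd z) - g' (fst z) (snd z)) \<partial>(P \<Otimes>\<^sub>M P))"
    using assms unfolding vd_hh_def by (meson DERIV_unique)
  then have "AE z in P \<Otimes>\<^sub>M P. case_prod g z = case_prod g' z"
    by (intro AE_eq_of_L2_dual[OF g g']) (simp add: split_beta')
  then show ?thesis by (simp add: split_beta')
qed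

section \<open>The clipped vector field and the Picard iteration\<close>

text \<open>A mean value inequality: \<open>w\<close> is the comparison function and
  \<open>w'\<close> bounds the integrand off a negligible set. With the Henstock-Kurzweil integral,
  derivatives that exist everywhere qualify as integrands without further regularity.\<close>

lemma norm_integral_le_increment:
  fixes f :: "real \<Rightarrow> 'b::{banach}"
  assumes t: "0 \<le> t" and f: "f integrable_on {0..t}" and N: "negligible N"
    and le: "\<And>s. s \<in> {0..t} - N \<Longrightarrow> norm (f s) \<le> w' s"
    and w: "\<And>s. s \<in> {0..t} \<Longrightarrow> (w has_real_derivative w' s) (at s)"
  shows "norm (integral {0..t} f) \<le> w t - w 0"
proof -
  \<comment> \<open>Both functions are set to 0 on \<open>N\<close>, so that the comparison holds at
    every point.\<close>
  define g where "g s = (if s \<in> N then 0 else f s)" for s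
  define h where "h s = (if s \<in> N then 0 else w' s)" for s
  have w': "(w' has_integral (w t - w 0)) {0..t}"
    using t w by (intro fundamental_theorem_of_calculus)
      (auto simp: has_real_derivative_iff_has_vector_derivative[symmetric] intro: has_field_derivative_at_within)
  have h: "(h has_integral (w t - w 0)) {0..t}"
    by (rule has_integral_spike[OF N _ w']) (simp add: h_def)
  have g: "g integrable_on {0..t}" "integral {0..t} g = integral {0..t} f"
    using integrable_spike[OF f N, of g] integral_spike[OF N, of "{0..t}" f g] by (auto simp: g_def)
  have "norm (integral {0..t} g) \<le> integral {0..t} h"
  proof (rule integral_norm_bound_integral[OF g(1)])
    show "h integrable_on {0..t}" using h by blast
    show "norm (g s) \<le> h s" if "s \<in> {0..t}" for s
      using le[of s] that by (simp add: g_def h_def)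
  qed
  then show ?thesis using g(2) h by (simp add: integral_unique)
qed

lemma set_integrable_Icc_bounded:
  fixes f :: "real \<Rightarrow> 'b::euclidean_space"
  assumes "f \<in> borel_measurable borel" and "\<And>s. s \<in> {0..t} \<Longrightarrow> norm (f s) \<le> C"
  shows "set_integrable lborel {0..t} f"
  unfolding set_integrable_def
proof (rule Bochner_Integration.integrable_bound[where f="\<lambda>s. indicator {0..t} s *\<^sub>R C"])
  show "integrable lborel (\<lambda>s. indicator {0..t} s *\<^sub>R C)"
    using borel_integrable_compact[of "{0..t}" "\<lambda>_. C"] by simp
  show "AE s in lborel. norm (indicator {0..t} s *\<^sub>R f s) \<le> norm (indicator {0..t} s *\<^sub>R C)"
    using assms(2) by (intro AE_I2) (auto simp: indicator_def intro: order_trans[OF _ abs_ge_self])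
qed (use assms(1) in simp)

text \<open>The Picard map is written with Lebesgue integrals, which are jointly measurable in time
  and neuron; its estimates and derivatives use the Henstock-Kurzweil integral. For bounded Borel
  functions on an interval the two agree.\<close>

lemma set_lebesgue_integral_Icc:
  fixes f :: "real \<Rightarrow> 'b::euclidean_space"
  assumes "f \<in> borel_measurable borel" and "\<And>s. s \<in> {0..t} \<Longrightarrow> norm (f s) \<le> C"
  shows "f integrable_on {0..t}" "(LBINT s:{0..t}. f s) = integral {0..t} f"
  using set_borel_integral_eq_integral[OF set_integrable_Icc_bounded[OF assms]] by auto

section \<open>The clipped vector field and the growth of the output weights\<close>

locale flow = rnn P \<nu> Fs L \<sigma> \<sigma>' R K B
  for P :: "'w measure" and \<nu> :: "(int \<Rightarrow> real^'d) measure" and Fs L \<sigma> \<sigma>' R K B +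
  fixes chi :: "real \<Rightarrow> real" and Kc Bc :: real
    and W0x :: "'w \<Rightarrow> real^'d" and W0h :: "'w \<Rightarrow> 'w \<Rightarrow> real" and W0y :: "'w \<Rightarrow> real"
  assumes chi_lip: "\<And>u v. \<bar>chi u - chi v\<bar> \<le> Kc * \<bar>u - v\<bar>"
    and chi_bdd: "\<And>u. \<bar>chi u\<bar> \<le> Bc"
    and chi_zero: "\<And>u. R \<le> \<bar>u\<bar> \<Longrightarrow> chi u = 0"
    and W0x_meas [measurable]: "W0x \<in> borel_measurable P"
    and W0h_meas [measurable]: "case_prod W0h \<in> borel_measurable (P \<Otimes>\<^sub>M P)"
    and W0y_meas [measurable]: "W0y \<in> borel_measurable P"
    and W0h_bdd: "\<And>\<theta> \<theta>'. \<theta> \<in> space P \<Longrightarrow> \<theta>' \<in> space P \<Longrightarrow> \<bar>W0h \<theta> \<theta>'\<bar> \<le> R"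
    and exp_moments: "\<And>l. integrable P (\<lambda>\<theta>. exp (l * \<bar>W0y \<theta>\<bar>))"
begin

definition a :: "'w \<Rightarrow> real" where "a \<theta> = 1 + \<bar>W0y \<theta>\<bar>"

lemma a_measurable [measurable]: "a \<in> borel_measurable P"
  unfolding a_def[abs_def] by measurable

lemma a_ge1: "1 \<le> a \<theta>"
  by (simp add: a_def)

lemma exp_a_integrable: "integrable P (\<lambda>\<theta>. exp (a \<theta> * l))"
proof -
  have "(\<lambda>\<theta>. exp (a \<theta> * l)) = (\<lambda>\<theta>. exp l * exp (l * \<bar>W0y \<theta>\<bar>))"
    by (auto simp: a_def exp_add[symmetric] algebra_simps)
  then show ?thesis using exp_moments[of l] by simp
qed

lemma a_le_exp: "a \<theta> \<le> exp (a \<theta>)"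
  using exp_ge_add_one_self[of "a \<theta>"] by linarith

lemma a_exp_integrable: "integrable P (\<lambda>\<theta>. a \<theta> * exp (a \<theta> * l))"
proof (rule Bochner_Integration.integrable_bound[OF exp_a_integrable[of "1 + l"]])
  show "AE \<theta> in P. norm (a \<theta> * exp (a \<theta> * l)) \<le> norm (exp (a \<theta> * (1 + l)))"
  proof (rule AE_I2)
    fix \<theta>
    have "a \<theta> * exp (a \<theta> * l) \<le> exp (a \<theta>) * exp (a \<theta> * l)"
      using a_le_exp by (intro mult_right_mono) auto
    then show "norm (a \<theta> * exp (a \<theta> * l)) \<le> norm (exp (a \<theta> * (1 + l)))"
      using a_ge1[of \<theta>] by (simp add: exp_add distrib_left abs_mult)
  qed
qed measurable

lemma a_square_integrable: "integrable P (\<lambda>\<theta>. (a \<theta>)^2)"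
proof (rule Bochner_Integration.integrable_bound[OF exp_a_integrable[of 2]])
  show "AE \<theta> in P. norm ((a \<theta>)^2) \<le> norm (exp (a \<theta> * 2))"
  proof (rule AE_I2)
    fix \<theta>
    have "(a \<theta>)^2 \<le> (exp (a \<theta>))^2"
      using a_le_exp a_ge1[of \<theta>] by (intro power_mono) auto
    then show "norm ((a \<theta>)^2) \<le> norm (exp (a \<theta> * 2))"
      by (simp add: exp_double[symmetric] mult.commute)
  qed
qed measurable

lemma growth_a: "0 \<le> A \<Longrightarrow> growth P \<nu> Fs \<sigma> \<sigma>' R K B a A"
  by (intro growth.intro rnn_axioms growth_axioms.intro a_measurable a_ge1 a_square_integrable)

lemma Kc_nonneg: "0 \<le> Kc" and Bc_nonneg: "0 \<le> Bc"
  using chi_lip[of 0 1] chi_bdd[of 0] by auto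

lemma chi_measurable [measurable]: "chi \<in> borel_measurable borel"
proof (rule borel_measurable_continuous_onI, rule lipschitz_on_continuous_on)
  show "Kc-lipschitz_on UNIV chi"
    using chi_lip Kc_nonneg by (auto simp: lipschitz_on_def dist_real_def)
qed

definition clip :: "('w \<Rightarrow> 'w \<Rightarrow> real) \<Rightarrow> 'w \<Rightarrow> 'w \<Rightarrow> real" where
  "clip h \<theta> \<theta>' = max (- R) (min R (h \<theta> \<theta>'))"

lemma clip_bdd: "\<bar>clip h \<theta> \<theta>'\<bar> \<le> R"
  using R_pos by (auto simp: clip_def)

lemma clip_lip: "\<bar>clip h \<theta> \<theta>' - clip h' \<theta> \<theta>'\<bar> \<le> \<bar>h \<theta> \<theta>' - h' \<theta> \<theta>'\<bar>"
  by (auto simp: clip_def max_def min_def)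

text \<open>The gradients see the clipped recurrent weights and hence satisfy all bounds, whereas
  \<open>chi\<close> in \<open>Vh\<close> receives \<open>h\<close> unclipped: outside [-R, R] the
  velocity is 0 and a trajectory cannot proceed there.\<close>

definition Vx where "Vx x h y \<theta> = - Gx x (clip h) y \<theta>"
definition Vy where "Vy x h y \<theta> = - Gy x (clip h) y \<theta>"
definition Vh where "Vh x h y \<theta> \<theta>' = - chi (h \<theta> \<theta>') * Gh x (clip h) y \<theta> \<theta>'"

definition a1' :: real where "a1' = (\<integral>\<theta>. a \<theta> \<partial>P)"

text \<open>With \<open>A = 1 + exp (rate * t)\<close> the gradient in W_hy-direction is at most
  \<open>(1 + B * a1') * B * q + B * a1' * B * q * exp (rate * t)\<close>. The rate makes this at
  most \<open>rate * exp (rate * t)\<close>, the derivative of the growth bound, so the bound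
  reproduces itself under the Picard map. The summand 1 gives \<open>1 \<le> rate\<close>, so that
  \<open>exp (rate * T)\<close> exceeds any prescribed constant once \<open>T\<close> does.\<close>

definition rate :: real where "rate = 1 + (1 + B * a1') * B * q + B * a1' * B * q"

lemma a1'_ge_1: "1 \<le> a1'"
proof -
  interpret growth P \<nu> Fs L \<sigma> \<sigma>' R K B a 0 by (rule growth_a) simp
  show ?thesis using a1_ge_1 by (simp add: a1_def a1'_def)
qed

lemma rate_ge_1: "1 \<le> rate"
  using a1'_ge_1 B_nonneg q_ge_1 by (simp add: rate_def)

lemma rate_nonneg: "0 \<le> rate"
  using rate_ge_1 by simp

definition AT :: "real \<Rightarrow> real" where "AT T = 1 + exp (rate * T)"

lemma AT_nonneg: "0 \<le> AT T"
  by (simp add: AT_def add_nonneg_nonneg)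

lemma weights_clip:
  assumes "x \<in> borel_measurable P" "case_prod h \<in> borel_measurable (P \<Otimes>\<^sub>M P)" "y \<in> borel_measurable P"
    and "G \<subseteq> space P" "AE \<theta> in P. \<theta> \<in> G"
    and y: "\<And>\<theta>. \<theta> \<in> G \<Longrightarrow> \<bar>y \<theta>\<bar> \<le> \<bar>W0y \<theta>\<bar> + exp (rate * T)"
  shows "weights P \<nu> Fs \<sigma> \<sigma>' R K B a (AT T) x (clip h) y G"
proof (intro weights.intro weights_axioms.intro growth_a[OF AT_nonneg])
  have [measurable]: "case_prod h \<in> borel_measurable (P \<Otimes>\<^sub>M P)" by fact
  show "case_prod (clip h) \<in> borel_measurable (P \<Otimes>\<^sub>M P)"
    unfolding clip_def[abs_def] by measurable
  fix \<theta> assume "\<theta> \<in> G"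
  have "AT T * a \<theta> = 1 + \<bar>W0y \<theta>\<bar> + exp (rate * T) + exp (rate * T) * \<bar>W0y \<theta>\<bar>"
    by (simp add: AT_def a_def algebra_simps)
  moreover have "0 \<le> exp (rate * T) * \<bar>W0y \<theta>\<bar>" by simp
  ultimately show "\<bar>y \<theta>\<bar> \<le> AT T * a \<theta>"
    using y[OF \<open>\<theta> \<in> G\<close>] by linarith
qed (use assms clip_bdd in auto)

lemma Vy_growth:
  assumes "weights P \<nu> Fs \<sigma> \<sigma>' R K B a (AT t) x (clip h) y G"
    and "0 \<le> t"
  shows "\<bar>Vy x h y \<theta>\<bar> \<le> rate * exp (rate * t)"
proof -
  interpret weights P \<nu> Fs L \<sigma> \<sigma>' R K B a "AT t" x "clip h" y G by (rule assms(1))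
  have "\<bar>Vy x h y \<theta>\<bar> \<le> (1 + B * AT t * a1') * B * q"
    using Gy_bdd[of \<theta>] by (simp add: Vy_def E_def a1_def a1'_def)
  also have "\<dots> = (1 + B * a1') * B * q + (B * a1' * B * q) * exp (rate * t)"
    by (simp add: AT_def algebra_simps)
  also have "\<dots> \<le> ((1 + B * a1') * B * q) * exp (rate * t) + (B * a1' * B * q) * exp (rate * t)"
  proof -
    have "1 \<le> exp (rate * t)" using rate_nonneg assms(2) by simp
    moreover have "0 \<le> (1 + B * a1') * B * q"
      using B_nonneg a1'_ge_1 q_ge_1 by simp
    ultimately show ?thesis using mult_left_mono[of 1 "exp (rate * t)" "(1 + B * a1') * B * q"] by simp
  qed
  also have "\<dots> \<le> rate * exp (rate * t)"
    by (simp add: rate_def distrib_right)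
  finally show ?thesis .
qed

end

section \<open>Time-dependent weights on a finite horizon\<close>

locale horizon = flow P \<nu> Fs L \<sigma> \<sigma>' R K B chi Kc Bc W0x W0h W0y
  for P :: "'w measure" and \<nu> :: "(int \<Rightarrow> real^'d) measure" and Fs L \<sigma> \<sigma>' R K B chi Kc Bc W0x W0h W0y +
  fixes T :: real
  assumes T_nonneg: "0 \<le> T"

sublocale horizon \<subseteq> growth P \<nu> Fs L \<sigma> \<sigma>' R K B a "AT T"
  by (rule growth_a[OF AT_nonneg])

context horizon
begin

definition gx :: real where "gx = E * ((L + 1) * D L) * q"
definition gy :: real where "gy = E * B * q"
definition gh :: real where "gh = E * (L * D L * B) * q"

text \<open>Twice a bound for the coefficient of \<open>a\<close> in the Lipschitz estimates of the
  vector field: \<open>C0\<close> for W_xh and W_hy, and for W_hh both \<open>Bc * C0\<close>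
  (change of the gradient) and \<open>Kc * gh\<close> (change of \<open>chi\<close> times the
  gradient).\<close>

definition \<kappa> :: real where "\<kappa> = 2 * (C0 * (1 + Bc) + Kc * gh)"

text \<open>The 1 in the exponent ensures \<open>a \<le> v\<close> already at \<open>t = 0\<close>,
  which is used whenever a bare factor \<open>a\<close> is charged to \<open>v\<close>.\<close>

definition v :: "real \<Rightarrow> 'w \<Rightarrow> real" where "v t \<theta> = exp (a \<theta> * (1 + \<kappa> * t))"

text \<open>The moment is taken at the final time \<open>T\<close>; by monotonicity it bounds the
  averages of \<open>a * v t\<close> for all earlier times, so \<open>\<eta>\<close> and
  \<open>\<mu>\<close> can be constants.\<close>

definition m :: real where "m = (\<integral>\<theta>. a \<theta> * v T \<theta> \<partial>P)"

definition \<eta> :: real where "\<eta> = 1 / m"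

definition \<mu> :: real where "\<mu> = 2 * (C1 m \<eta> * (1 + Bc))"

definition w1 :: "real \<Rightarrow> 'w \<Rightarrow> real" where "w1 t \<theta> = exp (\<mu> * t) * v t \<theta>"

definition w2 :: "real \<Rightarrow> 'w \<Rightarrow> 'w \<Rightarrow> real" where "w2 t \<theta> \<theta>' = w1 t \<theta> * (1 + \<eta> * v t \<theta>')"

lemma g_nonneg: "0 \<le> gx" "0 \<le> gy" "0 \<le> gh"
  using E_ge_1 D_nonneg[of L] q_ge_1 B_nonneg by (simp_all add: gx_def gy_def gh_def)

lemma \<kappa>_nonneg: "0 \<le> \<kappa>"
  using C0_nonneg Bc_nonneg Kc_nonneg g_nonneg by (simp add: \<kappa>_def)

lemma v_measurable [measurable]: "v t \<in> borel_measurable P"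
  unfolding v_def[abs_def] by measurable

lemma a_le_v: "0 \<le> t \<Longrightarrow> a \<theta> \<le> v t \<theta>"
proof -
  assume "0 \<le> t"
  then have "a \<theta> * 1 \<le> a \<theta> * (1 + \<kappa> * t)"
    using \<kappa>_nonneg a_ge1[of \<theta>] by (intro mult_left_mono) auto
  then have "exp (a \<theta>) \<le> v t \<theta>" by (simp add: v_def)
  then show ?thesis using a_le_exp[of \<theta>] by linarith
qed

lemma v_ge1: "0 \<le> t \<Longrightarrow> 1 \<le> v t \<theta>"
  using a_le_v[of t \<theta>] a_ge1[of \<theta>] by linarith

lemma v_mono: "t \<le> T \<Longrightarrow> v t \<theta> \<le> v T \<theta>"
  using \<kappa>_nonneg a_ge1[of \<theta>] by (auto simp: v_def intro!: mult_left_mono)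

lemma av_integrable: "integrable P (\<lambda>\<theta>. a \<theta> * v t \<theta>)"
  unfolding v_def by (rule a_exp_integrable)

lemma av_le_m: "t \<le> T \<Longrightarrow> (\<integral>\<theta>. a \<theta> * v t \<theta> \<partial>P) \<le> m"
proof -
  assume "t \<le> T"
  then show ?thesis
    unfolding m_def using a_ge1 order_trans[OF zero_le_one a_ge1]
    by (intro integral_mono av_integrable mult_left_mono v_mono)
qed

lemma m_ge_1: "1 \<le> m"
proof -
  have "(\<integral>\<theta>. 1 \<partial>P) \<le> m"
    unfolding m_def
  proof (intro integral_mono av_integrable)
    fix \<theta>
    show "1 \<le> a \<theta> * v T \<theta>"
      using mult_mono[OF a_ge1[of \<theta>] v_ge1[OF T_nonneg, of \<theta>]] a_ge1[of \<theta>] by simp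
  qed auto
  then show ?thesis by (simp add: P.prob_space)
qed

lemma \<eta>_pos: "0 < \<eta>" and \<eta>_m: "\<eta> * m \<le> 1"
  using m_ge_1 by (auto simp: \<eta>_def)

lemma \<mu>_nonneg: "0 \<le> \<mu>"
  using C1_nonneg[of m \<eta>] m_ge_1 \<eta>_pos Bc_nonneg by (simp add: \<mu>_def)

lemma w1_ge: "0 \<le> t \<Longrightarrow> v t \<theta> \<le> w1 t \<theta>"
  using \<mu>_nonneg mult_right_mono[of 1 "exp (\<mu> * t)" "v t \<theta>"] by (simp add: w1_def v_def)

lemma w1_pos: "0 < w1 t \<theta>" and w2_pos: "0 < w2 t \<theta> \<theta>'"
  using \<eta>_pos by (auto simp: w1_def w2_def v_def intro!: mult_pos_pos add_pos_pos)

lemma w1_le_w2: "w1 t \<theta> \<le> w2 t \<theta> \<theta>'"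
  using mult_left_mono[of 1 "1 + \<eta> * v t \<theta>'" "w1 t \<theta>"] w1_pos[of t \<theta>] \<eta>_pos by (simp add: w2_def v_def)

lemma a_le_w1: "0 \<le> t \<Longrightarrow> a \<theta> \<le> w1 t \<theta>"
  using a_le_v[of t \<theta>] w1_ge[of t \<theta>] by linarith

text \<open>A weighted supremum distance at most \<open>c\<close>, written as a relation. The time
  \<open>t\<close> enters only through the weights, not through the arguments; this allows states at
  different times to be compared under one common weight.\<close>

definition close where
  "close c t G G2 x h y x' h' y' \<longleftrightarrow>
     (\<forall>\<theta>\<in>G. norm (x \<theta> - x' \<theta>) \<le> c * w1 t \<theta> \<and> \<bar>y \<theta> - y' \<theta>\<bar> \<le> c * w1 t \<theta>) \<and>
     (\<forall>(\<theta>, \<theta>')\<in>G2. \<bar>h \<theta> \<theta>' - h' \<theta> \<theta>'\<bar> \<le> c * w2 t \<theta> \<theta>')"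

lemma V_bdd:
  assumes "weights P \<nu> Fs \<sigma> \<sigma>' R K B a (AT T) x (clip h) y G"
  shows "\<theta> \<in> G \<Longrightarrow> norm (Vx x h y \<theta>) \<le> gx * a \<theta>" and "\<bar>Vy x h y \<theta>\<bar> \<le> gy"
    and "\<theta> \<in> G \<Longrightarrow> \<bar>Vh x h y \<theta> \<theta>'\<bar> \<le> Bc * gh * a \<theta>"
    and "\<theta> \<in> G \<Longrightarrow> \<bar>Gh x (clip h) y \<theta> \<theta>'\<bar> \<le> gh * a \<theta>"
proof -
  interpret weights P \<nu> Fs L \<sigma> \<sigma>' R K B a "AT T" x "clip h" y G by (rule assms)
  show "\<theta> \<in> G \<Longrightarrow> norm (Vx x h y \<theta>) \<le> gx * a \<theta>" "\<bar>Vy x h y \<theta>\<bar> \<le> gy"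
    using Gx_bdd[of \<theta>] Gy_bdd[of \<theta>] by (simp_all add: Vx_def Vy_def gx_def gy_def mult_ac)
  assume "\<theta> \<in> G"
  then show G: "\<bar>Gh x (clip h) y \<theta> \<theta>'\<bar> \<le> gh * a \<theta>"
    using Gh_bdd[of \<theta>] by (simp add: gh_def mult_ac)
  have "\<bar>chi (h \<theta> \<theta>')\<bar> * \<bar>Gh x (clip h) y \<theta> \<theta>'\<bar> \<le> Bc * (gh * a \<theta>)"
    using chi_bdd G Bc_nonneg by (intro mult_mono) auto
  then show "\<bar>Vh x h y \<theta> \<theta>'\<bar> \<le> Bc * gh * a \<theta>"
    by (simp add: Vh_def abs_mult mult_ac)
qed

text \<open>The factor \<open>exp (\<mu> * t)\<close> is the same for all neurons and is merged with
  \<open>c\<close>; what remains is the setting of \<open>two_weights\<close>. Afterwards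
  \<open>C0\<close> is charged to \<open>\<kappa>\<close> and \<open>C1\<close> to
  \<open>\<mu>\<close>, each with the factor 1/2 that becomes the contraction constant.\<close>

lemma V_diff:
  assumes W: "weights P \<nu> Fs \<sigma> \<sigma>' R K B a (AT T) x (clip h) y G"
    and W': "weights P \<nu> Fs \<sigma> \<sigma>' R K B a (AT T) x' (clip h') y' G"
    and G2: "G2 \<subseteq> G \<times> G" "\<And>\<theta>. \<theta> \<in> G \<Longrightarrow> AE \<theta>' in P. (\<theta>, \<theta>') \<in> G2 \<and> (\<theta>', \<theta>) \<in> G2"
    and t: "0 \<le> t" "t \<le> T" and c: "0 \<le> c" and close: "close c t G G2 x h y x' h' y'"
  shows "\<theta> \<in> G \<Longrightarrow> norm (Vx x h y \<theta> - Vx x' h' y' \<theta>) \<le> c / 2 * ((\<mu> + \<kappa> * a \<theta>) * w1 t \<theta>)"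
    and "\<theta> \<in> G \<Longrightarrow> \<bar>Vy x h y \<theta> - Vy x' h' y' \<theta>\<bar> \<le> c / 2 * ((\<mu> + \<kappa> * a \<theta>) * w1 t \<theta>)"
    and "(\<theta>, \<theta>') \<in> G2 \<Longrightarrow> \<bar>Vh x h y \<theta> \<theta>' - Vh x' h' y' \<theta> \<theta>'\<bar> \<le> c / 2 * ((\<mu> + \<kappa> * a \<theta>) * w2 t \<theta> \<theta>')"
proof -
  interpret W: weights P \<nu> Fs L \<sigma> \<sigma>' R K B a "AT T" x "clip h" y G by (rule W)
  interpret W': weights P \<nu> Fs L \<sigma> \<sigma>' R K B a "AT T" x' "clip h'" y' G by (rule W')
  interpret two: two_weights P \<nu> Fs L \<sigma> \<sigma>' R K B a "AT T" x "clip h" y x' "clip h'" y' G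
    "v t" m \<eta> "c * exp (\<mu> * t)" G2
  proof unfold_locales
    show "\<And>\<theta>. \<theta> \<in> G \<Longrightarrow> norm (x \<theta> - x' \<theta>) \<le> c * exp (\<mu> * t) * v t \<theta>"
      "\<And>\<theta>. \<theta> \<in> G \<Longrightarrow> \<bar>y \<theta> - y' \<theta>\<bar> \<le> c * exp (\<mu> * t) * v t \<theta>"
      using close by (auto simp: close_def w1_def mult_ac)
    fix \<theta> \<theta>' assume "(\<theta>, \<theta>') \<in> G2"
    then have "\<bar>h \<theta> \<theta>' - h' \<theta> \<theta>'\<bar> \<le> c * w2 t \<theta> \<theta>'"
      using close by (auto simp: close_def)
    then show "\<bar>clip h \<theta> \<theta>' - clip h' \<theta> \<theta>'\<bar> \<le> c * exp (\<mu> * t) * v t \<theta> * (1 + \<eta> * v t \<theta>')"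
      using clip_lip[of h \<theta> \<theta>' h'] by (simp add: w1_def w2_def mult.assoc)
  qed (use a_le_v t av_integrable av_le_m \<eta>_pos \<eta>_m c G2 in auto)
  have C1: "C1 m \<eta> \<le> \<mu> / 2" and C0: "C0 \<le> \<kappa> / 2"
    using C1_nonneg[of m \<eta>] C0_nonneg m_ge_1 \<eta>_pos Bc_nonneg Kc_nonneg g_nonneg(3)
    by (auto simp: \<mu>_def \<kappa>_def algebra_simps)
  have le: "c * exp (\<mu> * t) * (C0 * (a \<theta> * v t \<theta>) + C1 m \<eta> * v t \<theta>) \<le> c / 2 * ((\<mu> + \<kappa> * a \<theta>) * w1 t \<theta>)" for \<theta>
  proof -
    have "c * exp (\<mu> * t) * (C0 * (a \<theta> * v t \<theta>) + C1 m \<eta> * v t \<theta>)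
        \<le> c * exp (\<mu> * t) * (\<kappa> / 2 * (a \<theta> * v t \<theta>) + \<mu> / 2 * v t \<theta>)"
      using C0 C1 c a_ge1[of \<theta>] v_ge1[OF t(1), of \<theta>] by (intro mult_left_mono add_mono mult_right_mono) auto
    also have "\<dots> = c / 2 * ((\<mu> + \<kappa> * a \<theta>) * w1 t \<theta>)"
      by (simp add: w1_def algebra_simps)
    finally show ?thesis .
  qed
  show "norm (Vx x h y \<theta> - Vx x' h' y' \<theta>) \<le> c / 2 * ((\<mu> + \<kappa> * a \<theta>) * w1 t \<theta>)"
    "\<bar>Vy x h y \<theta> - Vy x' h' y' \<theta>\<bar> \<le> c / 2 * ((\<mu> + \<kappa> * a \<theta>) * w1 t \<theta>)" if "\<theta> \<in> G"
    using order_trans[OF two.dGx[OF that] le] order_trans[OF two.dGy[OF that] le]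
    by (simp_all add: Vx_def Vy_def norm_minus_commute abs_minus_commute)
  assume 2: "(\<theta>, \<theta>') \<in> G2"
  then have \<theta>: "\<theta> \<in> G" using G2 by auto
  let ?y = "1 + \<eta> * v t \<theta>'"
  have y: "0 \<le> ?y" using \<eta>_pos by (simp add: v_def)
  have "\<bar>chi (h \<theta> \<theta>') - chi (h' \<theta> \<theta>')\<bar> \<le> Kc * (c * w2 t \<theta> \<theta>')"
    using order_trans[OF chi_lip mult_left_mono[OF _ Kc_nonneg]] close 2 by (auto simp: close_def)
  then have "\<bar>chi (h \<theta> \<theta>') * Gh x (clip h) y \<theta> \<theta>' - chi (h' \<theta> \<theta>') * Gh x' (clip h') y' \<theta> \<theta>'\<bar>
      \<le> (Kc * (c * w2 t \<theta> \<theta>')) * (gh * a \<theta>)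
        + Bc * (c * exp (\<mu> * t) * (C0 * (a \<theta> * v t \<theta>) + C1 m \<eta> * v t \<theta>) * ?y)"
    by (intro abs_prod_diff_le V_bdd(4)[OF W \<theta>] chi_bdd two.dGh[OF 2])
  also have "\<dots> = c * (exp (\<mu> * t) * ?y * ((Kc * gh + Bc * C0) * (a \<theta> * v t \<theta>) + (Bc * C1 m \<eta>) * v t \<theta>))"
    by (simp add: w2_def w1_def algebra_simps)
  also have "\<dots> \<le> c * (exp (\<mu> * t) * ?y * (\<kappa> / 2 * (a \<theta> * v t \<theta>) + \<mu> / 2 * v t \<theta>))"
  proof -
    have "Kc * gh + Bc * C0 \<le> \<kappa> / 2" "Bc * C1 m \<eta> \<le> \<mu> / 2"
      using C0_nonneg C1_nonneg[of m \<eta>] m_ge_1 \<eta>_pos by (simp_all add: \<kappa>_def \<mu>_def algebra_simps)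
    then show ?thesis
      using c y a_ge1[of \<theta>] v_ge1[OF t(1), of \<theta>] by (intro mult_left_mono add_mono mult_right_mono) auto
  qed
  also have "\<dots> = c / 2 * ((\<mu> + \<kappa> * a \<theta>) * w2 t \<theta> \<theta>')"
    by (simp add: w1_def w2_def algebra_simps)
  finally show "\<bar>Vh x h y \<theta> \<theta>' - Vh x' h' y' \<theta> \<theta>'\<bar> \<le> c / 2 * ((\<mu> + \<kappa> * a \<theta>) * w2 t \<theta> \<theta>')"
    by (simp add: Vh_def abs_minus_commute)
qed

lemma w1_derivative: "((\<lambda>t. w1 t \<theta>) has_real_derivative (\<mu> + \<kappa> * a \<theta>) * w1 t \<theta>) (at t)"
  unfolding w1_def v_def by (auto intro!: derivative_eq_intros simp: algebra_simps)

lemma w2_derivative: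
  "((\<lambda>t. w2 t \<theta> \<theta>') has_real_derivative (\<mu> + \<kappa> * a \<theta>) * w2 t \<theta> \<theta>' + w1 t \<theta> * (\<eta> * (\<kappa> * a \<theta>' * v t \<theta>'))) (at t)"
proof -
  have "((\<lambda>t. v t \<theta>') has_real_derivative \<kappa> * a \<theta>' * v t \<theta>') (at t)"
    unfolding v_def by (auto intro!: derivative_eq_intros simp: algebra_simps)
  then show ?thesis
    unfolding w2_def using w1_derivative[of \<theta> t]
    by (auto intro!: derivative_eq_intros simp: algebra_simps)
qed

text \<open>The weights grow at rate at least \<open>\<mu> + \<kappa> * a\<close>, twice the Lipschitz rate of the vector field:
  integrating a \<open>c\<close>-close pair in time makes it \<open>c / 2\<close>-close.\<close>
lemma integrate_w1:
  fixes f :: "real \<Rightarrow> 'b::banach"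
  assumes "0 \<le> t" "f integrable_on {0..t}" "negligible N" "0 \<le> c"
    and "\<And>s. s \<in> {0..t} - N \<Longrightarrow> norm (f s) \<le> c / 2 * ((\<mu> + \<kappa> * a \<theta>) * w1 s \<theta>)"
  shows "norm (integral {0..t} f) \<le> c / 2 * w1 t \<theta>"
proof -
  have "norm (integral {0..t} f) \<le> c / 2 * w1 t \<theta> - c / 2 * w1 0 \<theta>"
    by (rule norm_integral_le_increment[OF assms(1-3,5)]) (simp, rule DERIV_cmult[OF w1_derivative])
  moreover have "0 \<le> c / 2 * w1 0 \<theta>"
    using w1_pos[of 0 \<theta>] assms(4) by simp
  ultimately show ?thesis by linarith
qed

lemma integrate_w2:
  fixes f :: "real \<Rightarrow> 'b::banach"
  assumes "0 \<le> t" "f integrable_on {0..t}" "negligible N" "0 \<le> c"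
    and le: "\<And>s. s \<in> {0..t} - N \<Longrightarrow> norm (f s) \<le> c / 2 * ((\<mu> + \<kappa> * a \<theta>) * w2 s \<theta> \<theta>')"
  shows "norm (integral {0..t} f) \<le> c / 2 * w2 t \<theta> \<theta>'"
proof -
  have "norm (integral {0..t} f) \<le> c / 2 * w2 t \<theta> \<theta>' - c / 2 * w2 0 \<theta> \<theta>'"
  proof (rule norm_integral_le_increment[OF assms(1-3)])
    show "((\<lambda>s. c / 2 * w2 s \<theta> \<theta>') has_real_derivative
        c / 2 * ((\<mu> + \<kappa> * a \<theta>) * w2 s \<theta> \<theta>' + w1 s \<theta> * (\<eta> * (\<kappa> * a \<theta>' * v s \<theta>')))) (at s)" for s
      by (rule DERIV_cmult[OF w2_derivative])
    fix s assume s: "s \<in> {0..t} - N"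
    \<comment> \<open>The column factor grows in time as well; its contribution to the derivative is
      nonnegative and only enlarges the majorant.\<close>
    have "0 \<le> w1 s \<theta> * (\<eta> * (\<kappa> * a \<theta>' * v s \<theta>'))"
      using w1_pos[of s \<theta>] \<eta>_pos \<kappa>_nonneg a_ge1[of \<theta>'] by (simp add: v_def)
    then have "c / 2 * ((\<mu> + \<kappa> * a \<theta>) * w2 s \<theta> \<theta>') \<le> c / 2 * ((\<mu> + \<kappa> * a \<theta>) * w2 s \<theta> \<theta>' + w1 s \<theta> * (\<eta> * (\<kappa> * a \<theta>' * v s \<theta>')))"
      using assms(4) by (intro mult_left_mono) auto
    with le[OF s] show "norm (f s) \<le> c / 2 * ((\<mu> + \<kappa> * a \<theta>) * w2 s \<theta> \<theta>' + w1 s \<theta> * (\<eta> * (\<kappa> * a \<theta>' * v s \<theta>')))"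
      by linarith
  qed
  moreover have "0 \<le> c / 2 * w2 0 \<theta> \<theta>'"
    using w2_pos[of 0 \<theta> \<theta>'] assms(4) by simp
  ultimately show ?thesis by linarith
qed

end

lemma geometric_limit:
  fixes f :: "nat \<Rightarrow> 'b::banach"
  assumes "\<And>n. norm (f (Suc n) - f n) \<le> c * (1/2)^n"
  shows "f \<longlonglongrightarrow> lim f" and "norm (f n - lim f) \<le> 2 * c * (1/2)^n"
proof -
  have c: "0 \<le> c" using order_trans[OF norm_ge_zero assms[of 0]] by simp
  \<comment> \<open>The subtracted tail makes the induction on \<open>k\<close> close
    exactly.\<close>
  have le: "norm (f (n + k) - f n) \<le> 2 * c * (1/2)^n - 2 * c * (1/2)^(n + k)" for n k
  proof (induction k)
    case (Suc k)
    have "norm (f (n + Suc k) - f n) \<le> norm (f (Suc (n + k)) - f (n + k)) + norm (f (n + k) - f n)"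
      using norm_triangle_ineq[of "f (Suc (n + k)) - f (n + k)" "f (n + k) - f n"] by simp
    also have "\<dots> \<le> c * (1/2)^(n + k) + (2 * c * (1/2)^n - 2 * c * (1/2)^(n + k))"
      by (intro add_mono assms Suc)
    also have "\<dots> = 2 * c * (1/2)^n - 2 * c * (1/2)^(n + Suc k)"
      by simp
    finally show ?case .
  qed simp
  then have le': "norm (f (n + k) - f n) \<le> 2 * c * (1/2)^n" for n k
    using le[of n k] c by (smt (verit) mult_nonneg_nonneg zero_le_power divide_nonneg_nonneg)
  have "Cauchy f"
  proof (rule CauchyI')
    fix e :: real assume e: "0 < e"
    have "(\<lambda>n. 2 * c * (1/2)^n) \<longlonglongrightarrow> 2 * c * 0"
      by (intro tendsto_mult_left LIMSEQ_realpow_zero) auto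
    then have "\<forall>\<^sub>F n in sequentially. 2 * c * (1/2)^n < e"
      using e by (auto dest: order_tendstoD)
    then obtain N where N: "\<And>n. N \<le> n \<Longrightarrow> 2 * c * (1/2)^n < e"
      by (auto simp: eventually_sequentially)
    show "\<exists>N. \<forall>m\<ge>N. \<forall>n>m. dist (f m) (f n) < e"
    proof (intro exI allI impI)
      fix m n assume "N \<le> m" "m < n"
      then show "dist (f m) (f n) < e"
        using le'[of m "n - m"] N[of m] by (simp add: dist_norm norm_minus_commute)
    qed
  qed
  then show lim: "f \<longlonglongrightarrow> lim f"
    using convergent_LIMSEQ_iff Cauchy_convergent by blast
  have "(\<lambda>k. norm (f n - f (k + n))) \<longlonglongrightarrow> norm (f n - lim f)"
    by (intro tendsto_norm tendsto_diff tendsto_const LIMSEQ_ignore_initial_segment lim)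
  then show "norm (f n - lim f) \<le> 2 * c * (1/2)^n"
    by (rule Lim_bounded[where M=0]) (use le'[of n] in \<open>simp add: norm_minus_commute add.commute\<close>)
qed

section \<open>The Picard map and its iterates\<close>

context flow
begin

text \<open>The invariant of the iteration. Only W_hy needs a bound: \<open>h\<close> enters the
  gradients clipped, and the gradient bounds do not involve the size of \<open>x\<close>. Dependence
  on time is merely measurable at this stage.\<close>

definition path where
  "path x h y \<longleftrightarrow> meas_weights borel x h y \<and>
     (\<forall>t\<ge>0. \<forall>\<theta>\<in>space P. \<bar>y t \<theta>\<bar> \<le> \<bar>W0y \<theta>\<bar> + exp (rate * t))"

definition \<Phi>x where "\<Phi>x x h y (t :: real) \<theta> = W0x \<theta> + (LBINT s:{0..t}. Vx (x s) (h s) (y s) \<theta>)"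
definition \<Phi>y where "\<Phi>y x h y (t :: real) \<theta> = W0y \<theta> + (LBINT s:{0..t}. Vy (x s) (h s) (y s) \<theta>)"
definition \<Phi>h where "\<Phi>h x h y (t :: real) \<theta> \<theta>' = W0h \<theta> \<theta>' + (LBINT s:{0..t}. Vh (x s) (h s) (y s) \<theta> \<theta>')"

lemma meas_weights_section:
  assumes "meas_weights N x h y" "t \<in> space N"
  shows "x t \<in> borel_measurable P" "case_prod (h t) \<in> borel_measurable (P \<Otimes>\<^sub>M P)" "y t \<in> borel_measurable P"
proof -
  have [measurable]: "(\<lambda>_. t) \<in> measurable P N" "(\<lambda>_. t) \<in> measurable (P \<Otimes>\<^sub>M P) N"
    using assms(2) by simp_all
  show "x t \<in> borel_measurable P" "y t \<in> borel_measurable P"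
    using meas_weightsD(1,2)[OF assms(1), of "\<lambda>_. t" P "\<lambda>\<theta>. \<theta>"] by simp_all
  show "case_prod (h t) \<in> borel_measurable (P \<Otimes>\<^sub>M P)"
    using meas_weightsD(3)[OF assms(1), of "\<lambda>_. t" "P \<Otimes>\<^sub>M P" fst snd] by (simp add: split_beta')
qed

lemma meas_weights_clip:
  assumes "meas_weights N x h y"
  shows "meas_weights N x (\<lambda>t. clip (h t)) y"
proof -
  have "(\<lambda>(p, \<theta>, \<theta>'). h p \<theta> \<theta>') \<in> borel_measurable (N \<Otimes>\<^sub>M (P \<Otimes>\<^sub>M P))"
    using assms by (simp add: meas_weights_def)
  then have "(\<lambda>(p, \<theta>, \<theta>'). clip (h p) \<theta> \<theta>') \<in> borel_measurable (N \<Otimes>\<^sub>M (P \<Otimes>\<^sub>M P))"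
    unfolding clip_def split_beta' by measurable
  then show ?thesis using assms by (simp add: meas_weights_def)
qed

lemma V_measurable:
  assumes "meas_weights N x h y"
    and [measurable]: "f \<in> measurable A N" "g \<in> measurable A P"
  shows "(\<lambda>w. Vx (x (f w)) (h (f w)) (y (f w)) (g w)) \<in> borel_measurable A"
    and "(\<lambda>w. Vy (x (f w)) (h (f w)) (y (f w)) (g w)) \<in> borel_measurable A"
    and "g' \<in> measurable A P \<Longrightarrow> (\<lambda>w. Vh (x (f w)) (h (f w)) (y (f w)) (g w) (g' w)) \<in> borel_measurable A"
proof -
  note [measurable] = Gx_measurable_param[OF meas_weights_clip[OF assms(1)]]
    Gy_measurable_param[OF meas_weights_clip[OF assms(1)]]
  show "(\<lambda>w. Vx (x (f w)) (h (f w)) (y (f w)) (g w)) \<in> borel_measurable A"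
    "(\<lambda>w. Vy (x (f w)) (h (f w)) (y (f w)) (g w)) \<in> borel_measurable A"
    unfolding Vx_def Vy_def by measurable
  assume [measurable]: "g' \<in> measurable A P"
  have [measurable]: "(\<lambda>w. Gh (x (f w)) (clip (h (f w))) (y (f w)) (g w) (g' w)) \<in> borel_measurable A"
    using measurable_compose[OF _ Gh_measurable_param[OF meas_weights_clip[OF assms(1)]],
        of "\<lambda>w. (f w, g w, g' w)" A] by simp
  have [measurable]: "(\<lambda>w. h (f w) (g w) (g' w)) \<in> borel_measurable A"
    by (rule meas_weightsD(3)[OF assms(1)]) measurable
  show "(\<lambda>w. Vh (x (f w)) (h (f w)) (y (f w)) (g w) (g' w)) \<in> borel_measurable A"
    unfolding Vh_def by measurable
qed

lemma path_weights:
  assumes "path x h y" "0 \<le> t" "t \<le> T"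
  shows "weights P \<nu> Fs \<sigma> \<sigma>' R K B a (AT T) (x t) (clip (h t)) (y t) (space P)"
proof (rule weights_clip)
  fix \<theta> assume "\<theta> \<in> space P"
  then have "\<bar>y t \<theta>\<bar> \<le> \<bar>W0y \<theta>\<bar> + exp (rate * t)"
    using assms by (simp add: path_def)
  also have "\<dots> \<le> \<bar>W0y \<theta>\<bar> + exp (rate * T)"
    using rate_nonneg assms by (simp add: mult_left_mono)
  finally show "\<bar>y t \<theta>\<bar> \<le> \<bar>W0y \<theta>\<bar> + exp (rate * T)" .
qed (use assms meas_weights_section[of borel x h y t] in \<open>auto simp: path_def AE_space\<close>)

lemma horizon: "0 \<le> T \<Longrightarrow> horizon P \<nu> Fs \<sigma> \<sigma>' R K B chi Kc Bc W0x W0h W0y T"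
  by (intro horizon.intro flow_axioms horizon_axioms.intro)

lemma path_integral:
  assumes p: "path x h y" and t: "0 \<le> t" and \<theta>: "\<theta> \<in> space P"
  shows "(\<lambda>s. Vx (x s) (h s) (y s) \<theta>) integrable_on {0..t}"
    and "\<Phi>x x h y t \<theta> = W0x \<theta> + integral {0..t} (\<lambda>s. Vx (x s) (h s) (y s) \<theta>)"
    and "(\<lambda>s. Vy (x s) (h s) (y s) \<theta>) integrable_on {0..t}"
    and "\<Phi>y x h y t \<theta> = W0y \<theta> + integral {0..t} (\<lambda>s. Vy (x s) (h s) (y s) \<theta>)"
    and "\<theta>' \<in> space P \<Longrightarrow> (\<lambda>s. Vh (x s) (h s) (y s) \<theta> \<theta>') integrable_on {0..t}"
    and "\<theta>' \<in> space P \<Longrightarrow> \<Phi>h x h y t \<theta> \<theta>' = W0h \<theta> \<theta>' + integral {0..t} (\<lambda>s. Vh (x s) (h s) (y s) \<theta> \<theta>')"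
proof -
  interpret horizon P \<nu> Fs L \<sigma> \<sigma>' R K B chi Kc Bc W0x W0h W0y t by (rule horizon[OF t])
  have mw: "meas_weights borel x h y" using p by (simp add: path_def)
  have W: "weights P \<nu> Fs \<sigma> \<sigma>' R K B a (AT t) (x s) (clip (h s)) (y s) (space P)" if "s \<in> {0..t}" for s
    by (rule path_weights[OF p]) (use that in auto)
  note [measurable] = \<theta>
  have "(\<lambda>s. Vx (x s) (h s) (y s) \<theta>) \<in> borel_measurable borel"
    by (rule V_measurable[OF mw, of "\<lambda>s. s" borel "\<lambda>_. \<theta>"]) measurable
  note x = set_lebesgue_integral_Icc[OF this V_bdd(1)[OF W \<theta>], of t]
  then show "(\<lambda>s. Vx (x s) (h s) (y s) \<theta>) integrable_on {0..t}"
    "\<Phi>x x h y t \<theta> = W0x \<theta> + integral {0..t} (\<lambda>s. Vx (x s) (h s) (y s) \<theta>)"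
    by (simp_all add: \<Phi>x_def)
  have "(\<lambda>s. Vy (x s) (h s) (y s) \<theta>) \<in> borel_measurable borel"
    by (rule V_measurable[OF mw, of "\<lambda>s. s" borel "\<lambda>_. \<theta>"]) measurable
  note y = set_lebesgue_integral_Icc[OF this V_bdd(2)[OF W, folded real_norm_def], of t]
  then show "(\<lambda>s. Vy (x s) (h s) (y s) \<theta>) integrable_on {0..t}"
    "\<Phi>y x h y t \<theta> = W0y \<theta> + integral {0..t} (\<lambda>s. Vy (x s) (h s) (y s) \<theta>)"
    by (simp_all add: \<Phi>y_def)
  assume [measurable]: "\<theta>' \<in> space P"
  have "(\<lambda>s. Vh (x s) (h s) (y s) \<theta> \<theta>') \<in> borel_measurable borel"
    by (rule V_measurable(3)[OF mw, of "\<lambda>s. s" borel "\<lambda>_. \<theta>" "\<lambda>_. \<theta>'"]) measurable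
  note h = set_lebesgue_integral_Icc[OF this V_bdd(3)[OF W \<theta>, folded real_norm_def], of t]
  then show "(\<lambda>s. Vh (x s) (h s) (y s) \<theta> \<theta>') integrable_on {0..t}"
    "\<Phi>h x h y t \<theta> \<theta>' = W0h \<theta> \<theta>' + integral {0..t} (\<lambda>s. Vh (x s) (h s) (y s) \<theta> \<theta>')"
    by (simp_all add: \<Phi>h_def)
qed

lemma Icc_indicator_measurable [measurable]:
  "(\<lambda>w :: (real \<times> 'm) \<times> real. indicator {0..fst (fst w)} (snd w) :: real) \<in> borel_measurable ((borel \<Otimes>\<^sub>M M1) \<Otimes>\<^sub>M lborel)"
proof -
  have *: "(\<lambda>w :: (real \<times> 'm) \<times> real. indicator {0..fst (fst w)} (snd w) :: real)
      = (\<lambda>w. if 0 \<le> snd w \<and> snd w \<le> fst (fst w) then 1 else 0)"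
    by (auto simp: indicator_def)
  show ?thesis unfolding * by measurable
qed

lemma \<Phi>_meas:
  assumes mw: "meas_weights borel x h y"
  shows "meas_weights borel (\<Phi>x x h y) (\<Phi>h x h y) (\<Phi>y x h y)"
proof -
  have "(\<lambda>w. Vx (x (snd w)) (h (snd w)) (y (snd w)) (snd (fst w))) \<in> borel_measurable ((borel \<Otimes>\<^sub>M P) \<Otimes>\<^sub>M lborel)"
    "(\<lambda>w. Vy (x (snd w)) (h (snd w)) (y (snd w)) (snd (fst w))) \<in> borel_measurable ((borel \<Otimes>\<^sub>M P) \<Otimes>\<^sub>M lborel)"
    "(\<lambda>w. Vh (x (snd w)) (h (snd w)) (y (snd w)) (fst (snd (fst w))) (snd (snd (fst w))))
      \<in> borel_measurable ((borel \<Otimes>\<^sub>M (P \<Otimes>\<^sub>M P)) \<Otimes>\<^sub>M lborel)"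
    by (rule V_measurable[OF mw], measurable)+
  note V = this
  have "(\<lambda>z. \<integral>s. indicator {0..fst z} s *\<^sub>R Vx (x s) (h s) (y s) (snd z) \<partial>lborel) \<in> borel_measurable (borel \<Otimes>\<^sub>M P)"
    "(\<lambda>z. \<integral>s. indicator {0..fst z} s *\<^sub>R Vy (x s) (h s) (y s) (snd z) \<partial>lborel) \<in> borel_measurable (borel \<Otimes>\<^sub>M P)"
    "(\<lambda>z. \<integral>s. indicator {0..fst z} s *\<^sub>R Vh (x s) (h s) (y s) (fst (snd z)) (snd (snd z)) \<partial>lborel)
      \<in> borel_measurable (borel \<Otimes>\<^sub>M (P \<Otimes>\<^sub>M P))"
    by (rule lborel.borel_measurable_lebesgue_integral, simp only: split_beta', intro borel_measurable_scaleR Icc_indicator_measurable V)+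
  moreover have "(\<lambda>z. W0x (snd z)) \<in> borel_measurable (borel \<Otimes>\<^sub>M P)"
    "(\<lambda>z. W0y (snd z)) \<in> borel_measurable (borel \<Otimes>\<^sub>M P)"
    "(\<lambda>z. W0h (fst (snd z)) (snd (snd z))) \<in> borel_measurable (borel \<Otimes>\<^sub>M (P \<Otimes>\<^sub>M P))"
    by measurable
  ultimately show ?thesis
    unfolding meas_weights_def \<Phi>x_def \<Phi>h_def \<Phi>y_def set_lebesgue_integral_def split_beta'
    by (intro conjI borel_measurable_add)
qed

lemma \<Phi>_path:
  assumes p: "path x h y"
  shows "path (\<Phi>x x h y) (\<Phi>h x h y) (\<Phi>y x h y)"
  unfolding path_def
proof (intro conjI allI impI ballI)
  show "meas_weights borel (\<Phi>x x h y) (\<Phi>h x h y) (\<Phi>y x h y)"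
    using p by (intro \<Phi>_meas) (simp add: path_def)
  fix t :: real and \<theta> assume t: "0 \<le> t" and \<theta>: "\<theta> \<in> space P"
  have "norm (integral {0..t} (\<lambda>s. Vy (x s) (h s) (y s) \<theta>)) \<le> exp (rate * t) - exp (rate * 0)"
  proof (rule norm_integral_le_increment[OF t path_integral(3)[OF p t \<theta>] negligible_empty])
    show "norm (Vy (x s) (h s) (y s) \<theta>) \<le> rate * exp (rate * s)" if "s \<in> {0..t} - {}" for s
      using Vy_growth[OF path_weights[OF p, of s s]] that by simp
    show "((\<lambda>s. exp (rate * s)) has_real_derivative rate * exp (rate * s)) (at s)" for s
      by (auto intro!: derivative_eq_intros)
  qed
  then have "\<bar>integral {0..t} (\<lambda>s. Vy (x s) (h s) (y s) \<theta>)\<bar> \<le> exp (rate * t)"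
    by simp
  then show "\<bar>\<Phi>y x h y t \<theta>\<bar> \<le> \<bar>W0y \<theta>\<bar> + exp (rate * t)"
    unfolding path_integral(4)[OF p t \<theta>] by linarith
qed

primrec It :: "nat \<Rightarrow> (real \<Rightarrow> 'w \<Rightarrow> real^'d) \<times> (real \<Rightarrow> 'w \<Rightarrow> 'w \<Rightarrow> real) \<times> (real \<Rightarrow> 'w \<Rightarrow> real)" where
  "It 0 = ((\<lambda>_. W0x), (\<lambda>_. W0h), (\<lambda>_. W0y))"
| "It (Suc n) = (case It n of (x, h, y) \<Rightarrow> (\<Phi>x x h y, \<Phi>h x h y, \<Phi>y x h y))"

definition X where "X n = fst (It n)"
definition H where "H n = fst (snd (It n))"
definition Y where "Y n = snd (snd (It n))"

lemma It_0: "X 0 = (\<lambda>_. W0x)" "H 0 = (\<lambda>_. W0h)" "Y 0 = (\<lambda>_. W0y)"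
  by (simp_all add: X_def H_def Y_def)

lemma It_Suc: "X (Suc n) = \<Phi>x (X n) (H n) (Y n)" "H (Suc n) = \<Phi>h (X n) (H n) (Y n)"
  "Y (Suc n) = \<Phi>y (X n) (H n) (Y n)"
  by (simp_all add: X_def H_def Y_def split_beta)

lemma It_path: "path (X n) (H n) (Y n)"
proof (induction n)
  case 0
  have "meas_weights borel (\<lambda>_. W0x) (\<lambda>_. W0h) (\<lambda>_. W0y)"
    by (rule meas_weights_const) measurable
  then show ?case by (simp add: It_0 path_def)
next
  case (Suc n)
  then show ?case unfolding It_Suc by (rule \<Phi>_path)
qed

text \<open>\<open>lim\<close> is total, and as a pointwise limit it is measurable whether or not
  the sequence converges; joint measurability of the limit can thus precede convergence.\<close>

definition Xl where "Xl t \<theta> = lim (\<lambda>n. X n t \<theta>)"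
definition Hl where "Hl t \<theta> \<theta>' = lim (\<lambda>n. H n t \<theta> \<theta>')"
definition Yl where "Yl t \<theta> = lim (\<lambda>n. Y n t \<theta>)"

lemma limit_meas: "meas_weights borel Xl Hl Yl"
proof -
  have mw: "meas_weights borel (X n) (H n) (Y n)" for n
    using It_path[of n] by (simp add: path_def)
  have "(\<lambda>z. X n (fst z) (snd z)) \<in> borel_measurable (borel \<Otimes>\<^sub>M P)"
    "(\<lambda>z. Y n (fst z) (snd z)) \<in> borel_measurable (borel \<Otimes>\<^sub>M P)"
    "(\<lambda>z. H n (fst z) (fst (snd z)) (snd (snd z))) \<in> borel_measurable (borel \<Otimes>\<^sub>M (P \<Otimes>\<^sub>M P))" for n
    using mw[of n] by (simp_all add: meas_weights_def split_beta')
  then show ?thesis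
    unfolding meas_weights_def Xl_def Hl_def Yl_def split_beta'
    by (intro conjI borel_measurable_lim_metric)
qed

end

section \<open>Contraction and time regularity of the Picard map\<close>

context horizon
begin

abbreviation "close' c t \<equiv> close c t (space P) (space P \<times> space P)"

lemma \<Phi>_close:
  assumes p: "path x h y" and p': "path x' h' y'" and c: "0 \<le> c"
    and close: "\<And>t. 0 \<le> t \<Longrightarrow> t \<le> T \<Longrightarrow> close' c t (x t) (h t) (y t) (x' t) (h' t) (y' t)"
    and t: "0 \<le> t" "t \<le> T"
  shows "close' (c / 2) t (\<Phi>x x h y t) (\<Phi>h x h y t) (\<Phi>y x h y t) (\<Phi>x x' h' y' t) (\<Phi>h x' h' y' t) (\<Phi>y x' h' y' t)"
  unfolding close_def
proof (intro conjI ballI)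
  have V: "\<theta> \<in> space P \<Longrightarrow> norm (Vx (x s) (h s) (y s) \<theta> - Vx (x' s) (h' s) (y' s) \<theta>) \<le> c / 2 * ((\<mu> + \<kappa> * a \<theta>) * w1 s \<theta>)"
    "\<theta> \<in> space P \<Longrightarrow> \<bar>Vy (x s) (h s) (y s) \<theta> - Vy (x' s) (h' s) (y' s) \<theta>\<bar> \<le> c / 2 * ((\<mu> + \<kappa> * a \<theta>) * w1 s \<theta>)"
    "(\<theta>, \<theta>') \<in> space P \<times> space P \<Longrightarrow> \<bar>Vh (x s) (h s) (y s) \<theta> \<theta>' - Vh (x' s) (h' s) (y' s) \<theta> \<theta>'\<bar> \<le> c / 2 * ((\<mu> + \<kappa> * a \<theta>) * w2 s \<theta> \<theta>')"
    if "s \<in> {0..t}" for s \<theta> \<theta>'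
  proof -
    have s: "0 \<le> s" "s \<le> T" using that t by auto
    note V = V_diff[OF path_weights[OF p s] path_weights[OF p' s] order_refl _ s c close[OF s]]
    show "\<theta> \<in> space P \<Longrightarrow> norm (Vx (x s) (h s) (y s) \<theta> - Vx (x' s) (h' s) (y' s) \<theta>) \<le> c / 2 * ((\<mu> + \<kappa> * a \<theta>) * w1 s \<theta>)"
      "\<theta> \<in> space P \<Longrightarrow> \<bar>Vy (x s) (h s) (y s) \<theta> - Vy (x' s) (h' s) (y' s) \<theta>\<bar> \<le> c / 2 * ((\<mu> + \<kappa> * a \<theta>) * w1 s \<theta>)"
      "(\<theta>, \<theta>') \<in> space P \<times> space P \<Longrightarrow> \<bar>Vh (x s) (h s) (y s) \<theta> \<theta>' - Vh (x' s) (h' s) (y' s) \<theta> \<theta>'\<bar> \<le> c / 2 * ((\<mu> + \<kappa> * a \<theta>) * w2 s \<theta> \<theta>')"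
      by (rule V; simp)+
  qed
  fix \<theta> assume \<theta>: "\<theta> \<in> space P"
  note I = path_integral[OF p t(1) \<theta>] and I' = path_integral[OF p' t(1) \<theta>]
  have "\<Phi>x x h y t \<theta> - \<Phi>x x' h' y' t \<theta> = integral {0..t} (\<lambda>s. Vx (x s) (h s) (y s) \<theta> - Vx (x' s) (h' s) (y' s) \<theta>)"
    using I(1,2) I'(1,2) by (simp add: Henstock_Kurzweil_Integration.integral_diff)
  then show "norm (\<Phi>x x h y t \<theta> - \<Phi>x x' h' y' t \<theta>) \<le> c / 2 * w1 t \<theta>"
    using integrate_w1[OF t(1) integrable_diff[OF I(1) I'(1)] negligible_empty c] V(1)[OF _ \<theta>] by simp
  have "\<Phi>y x h y t \<theta> - \<Phi>y x' h' y' t \<theta> = integral {0..t} (\<lambda>s. Vy (x s) (h s) (y s) \<theta> - Vy (x' s) (h' s) (y' s) \<theta>)"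
    using I(3,4) I'(3,4) by (simp add: Henstock_Kurzweil_Integration.integral_diff)
  then show "\<bar>\<Phi>y x h y t \<theta> - \<Phi>y x' h' y' t \<theta>\<bar> \<le> c / 2 * w1 t \<theta>"
    using integrate_w1[OF t(1) integrable_diff[OF I(3) I'(3)] negligible_empty c] V(2)[OF _ \<theta>] by simp
next
  fix z assume "z \<in> space P \<times> space P"
  then obtain \<theta> \<theta>' where z: "z = (\<theta>, \<theta>')" and \<theta>: "\<theta> \<in> space P" "\<theta>' \<in> space P" by auto
  have V: "norm (Vh (x s) (h s) (y s) \<theta> \<theta>' - Vh (x' s) (h' s) (y' s) \<theta> \<theta>') \<le> c / 2 * ((\<mu> + \<kappa> * a \<theta>) * w2 s \<theta> \<theta>')"
    if "s \<in> {0..t} - {}" for s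
  proof -
    have s: "0 \<le> s" "s \<le> T" using that t by auto
    show ?thesis
      unfolding real_norm_def
      by (rule V_diff(3)[OF path_weights[OF p s] path_weights[OF p' s] order_refl _ s c close[OF s]]) (use \<theta> in simp_all)
  qed
  note I = path_integral(5,6)[OF p t(1) \<theta>] and I' = path_integral(5,6)[OF p' t(1) \<theta>]
  have "\<Phi>h x h y t \<theta> \<theta>' - \<Phi>h x' h' y' t \<theta> \<theta>' = integral {0..t} (\<lambda>s. Vh (x s) (h s) (y s) \<theta> \<theta>' - Vh (x' s) (h' s) (y' s) \<theta> \<theta>')"
    using I I' by (simp add: Henstock_Kurzweil_Integration.integral_diff)
  then show "case z of (\<theta>, \<theta>') \<Rightarrow> \<bar>\<Phi>h x h y t \<theta> \<theta>' - \<Phi>h x' h' y' t \<theta> \<theta>'\<bar> \<le> c / 2 * w2 t \<theta> \<theta>'"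
    using integrate_w2[OF t(1) integrable_diff[OF I(1) I'(1)] negligible_empty c V] by (simp add: z)
qed

definition cV :: real where "cV = gx + gy + Bc * gh"

lemma cV_nonneg: "0 \<le> cV"
  using g_nonneg Bc_nonneg by (simp add: cV_def)

lemma integral_Lipschitz:
  fixes f :: "real \<Rightarrow> 'b::banach"
  assumes "0 \<le> s" "s \<le> t" "f integrable_on {0..t}" "\<And>r. r \<in> {0..t} \<Longrightarrow> norm (f r) \<le> C"
  shows "norm (integral {0..t} f - integral {0..s} f) \<le> C * (t - s)"
proof -
  have int: "f integrable_on {s..t}"
    by (rule integrable_subinterval_real[OF assms(3)]) (use assms in auto)
  have "integral {0..t} f - integral {0..s} f = integral {s..t} f"
    using Henstock_Kurzweil_Integration.integral_combine[OF assms(1,2,3)] by (simp add: algebra_simps)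
  moreover have "norm (integral {s..t} f) \<le> integral {s..t} (\<lambda>_. C)"
    by (rule integral_norm_bound_integral[OF int]) (use assms in auto)
  ultimately show ?thesis using assms(2) by (simp add: mult.commute)
qed

text \<open>The velocities are of order \<open>a\<close>, which every weight \<open>w1 r\<close>
  with \<open>r \<ge> 0\<close> dominates; hence the weight time \<open>r\<close> is free. The bound
  serves to start the iteration (\<open>s = 0\<close>) and to show that the vector field is
  continuous along the limit.\<close>

lemma \<Phi>_Lipschitz:
  assumes p: "path x h y" and s: "0 \<le> s" "s \<le> t" "t \<le> T" and r: "0 \<le> r"
  shows "close' (cV * (t - s)) r (\<Phi>x x h y t) (\<Phi>h x h y t) (\<Phi>y x h y t) (\<Phi>x x h y s) (\<Phi>h x h y s) (\<Phi>y x h y s)"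
proof -
  have t: "0 \<le> t" using s by simp
  have W: "weights P \<nu> Fs \<sigma> \<sigma>' R K B a (AT T) (x u) (clip (h u)) (y u) (space P)" if "u \<in> {0..t}" for u
    by (rule path_weights[OF p]) (use that s in auto)
  have w: "C * a \<theta> * (t - s) \<le> cV * (t - s) * w1 r \<theta>" if "C \<le> cV" "0 \<le> C" for C \<theta>
  proof -
    have "C * a \<theta> \<le> cV * w1 r \<theta>"
      using that a_le_w1[OF r, of \<theta>] a_ge1[of \<theta>] by (intro mult_mono) auto
    then have "C * a \<theta> * (t - s) \<le> cV * w1 r \<theta> * (t - s)"
      using s by (intro mult_right_mono) auto
    then show ?thesis by (simp add: mult_ac)
  qed
  have c: "gx \<le> cV" "gy \<le> cV" "Bc * gh \<le> cV" "0 \<le> Bc * gh"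
    using g_nonneg Bc_nonneg by (auto simp: cV_def)
  have ga: "gy \<le> gy * a \<theta>" for \<theta>
    using g_nonneg(2) a_ge1[of \<theta>] mult_left_mono[of 1 "a \<theta>" gy] by simp
  have "norm (\<Phi>x x h y t \<theta> - \<Phi>x x h y s \<theta>) \<le> cV * (t - s) * w1 r \<theta>"
    "\<bar>\<Phi>y x h y t \<theta> - \<Phi>y x h y s \<theta>\<bar> \<le> cV * (t - s) * w1 r \<theta>" if \<theta>: "\<theta> \<in> space P" for \<theta>
  proof -
    note I = path_integral[OF p t \<theta>] and I' = path_integral[OF p s(1) \<theta>]
    have "norm (\<Phi>x x h y t \<theta> - \<Phi>x x h y s \<theta>) \<le> (gx * a \<theta>) * (t - s)"
      unfolding I(2) I'(2) using integral_Lipschitz[OF s(1,2) I(1) V_bdd(1)[OF W \<theta>]] by simp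
    then show "norm (\<Phi>x x h y t \<theta> - \<Phi>x x h y s \<theta>) \<le> cV * (t - s) * w1 r \<theta>"
      using w[OF c(1) g_nonneg(1), of \<theta>] by linarith
    have "norm (Vy (x u) (h u) (y u) \<theta>) \<le> gy * a \<theta>" if "u \<in> {0..t}" for u
      using V_bdd(2)[OF W[OF that], of \<theta>] ga[of \<theta>] by simp
    then have "\<bar>\<Phi>y x h y t \<theta> - \<Phi>y x h y s \<theta>\<bar> \<le> (gy * a \<theta>) * (t - s)"
      unfolding I(4) I'(4) using integral_Lipschitz[OF s(1,2) I(3)] by simp
    then show "\<bar>\<Phi>y x h y t \<theta> - \<Phi>y x h y s \<theta>\<bar> \<le> cV * (t - s) * w1 r \<theta>"
      using w[OF c(2) g_nonneg(2), of \<theta>] by linarith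
  qed
  moreover have "\<bar>\<Phi>h x h y t \<theta> \<theta>' - \<Phi>h x h y s \<theta> \<theta>'\<bar> \<le> cV * (t - s) * w2 r \<theta> \<theta>'"
    if \<theta>: "\<theta> \<in> space P" "\<theta>' \<in> space P" for \<theta> \<theta>'
  proof -
    note I = path_integral(5,6)[OF p t \<theta>] and I' = path_integral(5,6)[OF p s(1) \<theta>]
    have "\<bar>\<Phi>h x h y t \<theta> \<theta>' - \<Phi>h x h y s \<theta> \<theta>'\<bar> \<le> (Bc * gh * a \<theta>) * (t - s)"
      unfolding I(2) I'(2) using integral_Lipschitz[OF s(1,2) I(1) V_bdd(3)[OF W \<theta>(1), folded real_norm_def]] by simp
    also have "\<dots> \<le> cV * (t - s) * w1 r \<theta>"
      by (rule w[OF c(3,4)])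
    also have "\<dots> \<le> cV * (t - s) * w2 r \<theta> \<theta>'"
      using w1_le_w2 cV_nonneg s by (intro mult_left_mono) auto
    finally show ?thesis .
  qed
  ultimately show ?thesis unfolding close_def by auto
qed

end

text \<open>The unsimplified bound is the shape in which the halved distance between iterates and
  limit arrives.\<close>

lemma LIMSEQ_eq_geometric:
  fixes f :: "nat \<Rightarrow> 'b::banach"
  assumes "f \<longlonglongrightarrow> l" and "\<And>n. norm (f (Suc n) - l') \<le> (2 * C * (1/2)^n / 2) * c"
  shows "l = l'"
proof (rule LIMSEQ_unique[OF LIMSEQ_Suc[OF assms(1)]])
  have "(\<lambda>n. (2 * C * (1/2)^n / 2) * c) \<longlonglongrightarrow> (2 * C * 0 / 2) * c"
    by (intro tendsto_intros LIMSEQ_realpow_zero) auto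
  then have "(\<lambda>n. (2 * C * (1/2)^n / 2) * c) \<longlonglongrightarrow> 0" by simp
  then have "(\<lambda>n. f (Suc n) - l') \<longlonglongrightarrow> 0"
    by (rule Lim_null_comparison[rotated]) (use assms(2) in auto)
  then show "(\<lambda>n. f (Suc n)) \<longlonglongrightarrow> l'"
    by (rule LIM_zero_cancel)
qed

lemma has_vector_derivative_integral_half_line:
  fixes f F :: "real \<Rightarrow> 'b::banach"
  assumes cont: "\<And>T. 0 \<le> T \<Longrightarrow> continuous_on {0..T} f"
    and F: "\<And>t. 0 \<le> t \<Longrightarrow> F t = c + integral {0..t} f" and t: "0 \<le> t"
  shows "(F has_vector_derivative f t) (at t within {0..})"
proof -
  have "((\<lambda>u. integral {0..u} f) has_vector_derivative f t) (at t within {0..t + 1})"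
    by (rule integral_has_vector_derivative[OF cont]) (use t in auto)
  then have "((\<lambda>u. c + integral {0..u} f) has_vector_derivative 0 + f t) (at t within {0..t + 1})"
    by (intro has_vector_derivative_add has_vector_derivative_const)
  then have "(F has_vector_derivative f t) (at t within {0..t + 1})"
    using t by (auto intro: has_vector_derivative_transform simp: F)
  moreover have "at t within {0..t + 1} = at t within {0..}"
    by (rule at_within_nhd[of t "{..<t + 1}"]) auto
  ultimately show ?thesis by simp
qed

text \<open>After the last time \<open>s\<close> with \<open>|w s| \<le> R\<close> the factor
  \<open>chi (w t)\<close> vanishes, so \<open>w\<close> is constant on \<open>{s..t}\<close> and
  cannot exceed \<open>R\<close> in modulus. Nothing is assumed of \<open>g\<close>, which for a
  given solution is an arbitrary representative of the gradient.\<close>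

lemma trapped_in_interval:
  fixes w :: "real \<Rightarrow> real"
  assumes deriv: "\<And>t. 0 \<le> t \<Longrightarrow> (w has_real_derivative - chi (w t) * g t) (at t within {0..})"
    and chi: "\<And>u. R \<le> \<bar>u\<bar> \<Longrightarrow> chi u = 0" and w0: "\<bar>w 0\<bar> \<le> R" and t: "0 \<le> t"
  shows "\<bar>w t\<bar> \<le> R"
proof (rule ccontr)
  assume out: "\<not> \<bar>w t\<bar> \<le> R"
  have cont: "continuous_on {0..t} w"
    by (rule continuous_on_subset[OF DERIV_continuous_on[of "{0..}"]]) (use deriv in auto)
  define s where "s = Sup {s \<in> {0..t}. \<bar>w s\<bar> \<le> R}"
  let ?S = "{s \<in> {0..t}. \<bar>w s\<bar> \<le> R}"
  have "closed ?S"
    by (intro continuous_on_closed_Collect_le continuous_intros cont closed_atLeastAtMost)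
  moreover have "?S \<noteq> {}" "bdd_above ?S"
    using w0 t by auto
  ultimately have s: "s \<in> ?S"
    unfolding s_def by (intro closed_contains_Sup)
  have above: "R < \<bar>w u\<bar>" if "s < u" "u \<le> t" for u
    using cSup_upper[of u ?S] that s \<open>bdd_above ?S\<close> by (fastforce simp: s_def)
  have "s < t" using s out by (cases "s = t") auto
  then have "w t = w s"
  proof (rule DERIV_isconst_end)
    show "continuous_on {s..t} w"
      by (rule continuous_on_subset[OF cont]) (use s in auto)
    fix u assume u: "s < u" "u < t"
    then have "(w has_real_derivative 0) (at u within {0..})"
      using deriv[of u] chi[of "w u"] above[of u] s by simp
    moreover have "at u within {0..} = at u"
      using u s by (intro at_within_interior) (auto simp: interior_Ici)
    ultimately show "DERIV w u :> 0" by simp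
  qed
  with s out show False by simp
qed

section \<open>Convergence of the iterates\<close>

context horizon
begin

lemma close_mono:
  assumes "close c t G G2 x h y x' h' y'" "c \<le> c'"
  shows "close c' t G G2 x h y x' h' y'"
proof -
  have "c * w1 t \<theta> \<le> c' * w1 t \<theta>" "c * w2 t \<theta> \<theta>' \<le> c' * w2 t \<theta> \<theta>'" for \<theta> \<theta>'
    using assms(2) w1_pos[of t \<theta>] w2_pos[of t \<theta> \<theta>'] by (simp_all add: mult_right_mono)
  then show ?thesis
    using assms(1) unfolding close_def by (fastforce intro: order_trans)
qed

lemma It_close:
  "0 \<le> t \<Longrightarrow> t \<le> T \<Longrightarrow>
    close' (cV * T * (1/2)^n) t (X (Suc n) t) (H (Suc n) t) (Y (Suc n) t) (X n t) (H n t) (Y n t)"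
proof (induction n arbitrary: t)
  case 0
  have "close' (cV * (t - 0)) t (\<Phi>x (X 0) (H 0) (Y 0) t) (\<Phi>h (X 0) (H 0) (Y 0) t) (\<Phi>y (X 0) (H 0) (Y 0) t)
      (\<Phi>x (X 0) (H 0) (Y 0) 0) (\<Phi>h (X 0) (H 0) (Y 0) 0) (\<Phi>y (X 0) (H 0) (Y 0) 0)"
    by (rule \<Phi>_Lipschitz[OF It_path]) (use 0 in auto)
  moreover have "cV * (t - 0) \<le> cV * T * (1/2)^0"
    using 0 cV_nonneg by (simp add: mult_left_mono)
  ultimately have *: "close' (cV * T * (1/2)^0) t (X (Suc 0) t) (H (Suc 0) t) (Y (Suc 0) t)
      (\<Phi>x (X 0) (H 0) (Y 0) 0) (\<Phi>h (X 0) (H 0) (Y 0) 0) (\<Phi>y (X 0) (H 0) (Y 0) 0)"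
    unfolding It_Suc by (rule close_mono)
  \<comment> \<open>The zeroth iterate is constant in time and equals the Picard map at time 0, so
    the Lipschitz bound in time measures the first step of the iteration.\<close>
  have "X 0 t \<theta> = \<Phi>x (X 0) (H 0) (Y 0) 0 \<theta>" "Y 0 t \<theta> = \<Phi>y (X 0) (H 0) (Y 0) 0 \<theta>"
    "\<theta>' \<in> space P \<Longrightarrow> H 0 t \<theta> \<theta>' = \<Phi>h (X 0) (H 0) (Y 0) 0 \<theta> \<theta>'" if "\<theta> \<in> space P" for \<theta> \<theta>'
    using path_integral(2,4,6)[OF It_path[of 0] order_refl that] by (simp_all add: It_0)
  then show ?case
    using * by (auto simp: close_def)
next
  case (Suc n)
  have "close' (cV * T * (1/2)^n / 2) t (X (Suc (Suc n)) t) (H (Suc (Suc n)) t) (Y (Suc (Suc n)) t)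
      (X (Suc n) t) (H (Suc n) t) (Y (Suc n) t)"
    unfolding It_Suc[of "Suc n"] It_Suc[of n]
    by (rule \<Phi>_close[OF \<Phi>_path[OF It_path] It_path _ Suc.IH[unfolded It_Suc[of n]]])
       (use Suc.prems cV_nonneg T_nonneg in auto)
  then show ?case by simp
qed

lemma It_limit:
  assumes t: "0 \<le> t" "t \<le> T"
  shows "\<theta> \<in> space P \<Longrightarrow> (\<lambda>n. X n t \<theta>) \<longlonglongrightarrow> Xl t \<theta>"
    and "\<theta> \<in> space P \<Longrightarrow> (\<lambda>n. Y n t \<theta>) \<longlonglongrightarrow> Yl t \<theta>"
    and "\<theta> \<in> space P \<Longrightarrow> \<theta>' \<in> space P \<Longrightarrow> (\<lambda>n. H n t \<theta> \<theta>') \<longlonglongrightarrow> Hl t \<theta> \<theta>'"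
    and "close' (2 * (cV * T) * (1/2)^n) t (X n t) (H n t) (Y n t) (Xl t) (Hl t) (Yl t)"
proof -
  have x: "norm (X (Suc n) t \<theta> - X n t \<theta>) \<le> (cV * T * w1 t \<theta>) * (1/2)^n"
    and y: "norm (Y (Suc n) t \<theta> - Y n t \<theta>) \<le> (cV * T * w1 t \<theta>) * (1/2)^n"
    and h: "\<theta>' \<in> space P \<Longrightarrow> norm (H (Suc n) t \<theta> \<theta>' - H n t \<theta> \<theta>') \<le> (cV * T * w2 t \<theta> \<theta>') * (1/2)^n"
    if "\<theta> \<in> space P" for n \<theta> \<theta>'
    using It_close[OF t, of n] that unfolding close_def by (auto simp: mult_ac)
  show "(\<lambda>n. X n t \<theta>) \<longlonglongrightarrow> Xl t \<theta>" "(\<lambda>n. Y n t \<theta>) \<longlonglongrightarrow> Yl t \<theta>" if "\<theta> \<in> space P"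
    unfolding Xl_def Yl_def using geometric_limit(1)[OF x[OF that]] geometric_limit(1)[OF y[OF that]] by auto
  show "(\<lambda>n. H n t \<theta> \<theta>') \<longlonglongrightarrow> Hl t \<theta> \<theta>'" if "\<theta> \<in> space P" "\<theta>' \<in> space P"
    unfolding Hl_def using geometric_limit(1)[OF h[OF that]] by auto
  show "close' (2 * (cV * T) * (1/2)^n) t (X n t) (H n t) (Y n t) (Xl t) (Hl t) (Yl t)"
    unfolding close_def Xl_def Hl_def Yl_def
    using geometric_limit(2)[OF x, of _ n] geometric_limit(2)[OF y, of _ n] geometric_limit(2)[OF h, of _ _ n]
    by (auto simp: mult_ac)
qed

end

section \<open>The limit solves the mean-field system\<close>

context flow
begin

lemma limit_path: "path Xl Hl Yl"
  unfolding path_def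
proof (intro conjI allI impI ballI limit_meas)
  fix t \<theta> assume t: "0 \<le> (t :: real)" and \<theta>: "\<theta> \<in> space P"
  interpret horizon P \<nu> Fs L \<sigma> \<sigma>' R K B chi Kc Bc W0x W0h W0y t by (rule horizon[OF t])
  show "\<bar>Yl t \<theta>\<bar> \<le> \<bar>W0y \<theta>\<bar> + exp (rate * t)"
  proof (rule Lim_bounded)
    show "(\<lambda>n. \<bar>Y n t \<theta>\<bar>) \<longlonglongrightarrow> \<bar>Yl t \<theta>\<bar>"
      by (intro tendsto_rabs It_limit(2) t \<theta> order_refl)
    show "\<forall>n\<ge>0. \<bar>Y n t \<theta>\<bar> \<le> \<bar>W0y \<theta>\<bar> + exp (rate * t)"
      using It_path t \<theta> by (auto simp: path_def)
  qed
qed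

text \<open>The iterates are close to the limit on the whole interval, the Picard map halves this
  distance, and so the shifted sequence converges to the image of the limit as well.\<close>

lemma limit_fixpoint:
  assumes t: "0 \<le> t" and \<theta>: "\<theta> \<in> space P"
  shows "Xl t \<theta> = \<Phi>x Xl Hl Yl t \<theta>" "Yl t \<theta> = \<Phi>y Xl Hl Yl t \<theta>"
    "\<theta>' \<in> space P \<Longrightarrow> Hl t \<theta> \<theta>' = \<Phi>h Xl Hl Yl t \<theta> \<theta>'"
proof -
  interpret horizon P \<nu> Fs L \<sigma> \<sigma>' R K B chi Kc Bc W0x W0h W0y t by (rule horizon[OF t])
  have *: "close' (2 * (cV * t) * (1/2)^n / 2) t (X (Suc n) t) (H (Suc n) t) (Y (Suc n) t)
      (\<Phi>x Xl Hl Yl t) (\<Phi>h Xl Hl Yl t) (\<Phi>y Xl Hl Yl t)" for n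
    unfolding It_Suc by (rule \<Phi>_close[OF It_path limit_path _ It_limit(4)]) (use t cV_nonneg in auto)
  show "Xl t \<theta> = \<Phi>x Xl Hl Yl t \<theta>"
    by (rule LIMSEQ_eq_geometric[where c="w1 t \<theta>" and C="cV * t", OF It_limit(1)[OF t order_refl \<theta>]]) (use *[unfolded close_def] \<theta> in blast)
  show "Yl t \<theta> = \<Phi>y Xl Hl Yl t \<theta>"
    by (rule LIMSEQ_eq_geometric[where c="w1 t \<theta>" and C="cV * t", OF It_limit(2)[OF t order_refl \<theta>]]) (use *[unfolded close_def] \<theta> in simp)
  show "Hl t \<theta> \<theta>' = \<Phi>h Xl Hl Yl t \<theta> \<theta>'" if "\<theta>' \<in> space P"
    by (rule LIMSEQ_eq_geometric[where c="w2 t \<theta> \<theta>'" and C="cV * t", OF It_limit(3)[OF t order_refl \<theta> that]]) (use *[unfolded close_def] \<theta> that in simp)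
qed

text \<open>Continuity in time is what turns the integral equation into a derivative at every time.
  States at two times are compared under the weights at \<open>T\<close>, so one Lipschitz constant
  serves the whole interval.\<close>

lemma V_limit_continuous:
  assumes T: "0 \<le> T" and \<theta>: "\<theta> \<in> space P"
  shows "continuous_on {0..T} (\<lambda>s. Vx (Xl s) (Hl s) (Yl s) \<theta>)"
    and "continuous_on {0..T} (\<lambda>s. Vy (Xl s) (Hl s) (Yl s) \<theta>)"
    and "\<theta>' \<in> space P \<Longrightarrow> continuous_on {0..T} (\<lambda>s. Vh (Xl s) (Hl s) (Yl s) \<theta> \<theta>')"
proof -
  interpret horizon P \<nu> Fs L \<sigma> \<sigma>' R K B chi Kc Bc W0x W0h W0y T by (rule horizon[OF T])
  have V: "dist (Vx (Xl s) (Hl s) (Yl s) \<theta>) (Vx (Xl t) (Hl t) (Yl t) \<theta>) \<le> cV / 2 * ((\<mu> + \<kappa> * a \<theta>) * w1 T \<theta>) * dist s t"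
    "dist (Vy (Xl s) (Hl s) (Yl s) \<theta>) (Vy (Xl t) (Hl t) (Yl t) \<theta>) \<le> cV / 2 * ((\<mu> + \<kappa> * a \<theta>) * w1 T \<theta>) * dist s t"
    "\<theta>' \<in> space P \<Longrightarrow> dist (Vh (Xl s) (Hl s) (Yl s) \<theta> \<theta>') (Vh (Xl t) (Hl t) (Yl t) \<theta> \<theta>')
      \<le> cV / 2 * ((\<mu> + \<kappa> * a \<theta>) * w2 T \<theta> \<theta>') * dist s t"
    if st: "s \<in> {0..T}" "t \<in> {0..T}" "s \<le> t" for s t \<theta>'
  proof -
    have s: "0 \<le> s" "s \<le> T" and t: "0 \<le> t" "t \<le> T" using st by auto
    have "close' (cV * (t - s)) T (\<Phi>x Xl Hl Yl t) (\<Phi>h Xl Hl Yl t) (\<Phi>y Xl Hl Yl t)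
        (\<Phi>x Xl Hl Yl s) (\<Phi>h Xl Hl Yl s) (\<Phi>y Xl Hl Yl s)"
      by (rule \<Phi>_Lipschitz[OF limit_path s(1) st(3) t(2) T])
    then have c: "close' (cV * (t - s)) T (Xl t) (Hl t) (Yl t) (Xl s) (Hl s) (Yl s)"
      unfolding close_def using limit_fixpoint[OF s(1)] limit_fixpoint[OF t(1)] by auto
    have nn: "0 \<le> cV * (t - s)" using st cV_nonneg by simp
    note V = V_diff[OF path_weights[OF limit_path t] path_weights[OF limit_path s] order_refl _ T order_refl nn c]
    have "norm (Vx (Xl t) (Hl t) (Yl t) \<theta> - Vx (Xl s) (Hl s) (Yl s) \<theta>) \<le> cV * (t - s) / 2 * ((\<mu> + \<kappa> * a \<theta>) * w1 T \<theta>)"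
      "\<bar>Vy (Xl t) (Hl t) (Yl t) \<theta> - Vy (Xl s) (Hl s) (Yl s) \<theta>\<bar> \<le> cV * (t - s) / 2 * ((\<mu> + \<kappa> * a \<theta>) * w1 T \<theta>)"
      "\<theta>' \<in> space P \<Longrightarrow> \<bar>Vh (Xl t) (Hl t) (Yl t) \<theta> \<theta>' - Vh (Xl s) (Hl s) (Yl s) \<theta> \<theta>'\<bar>
        \<le> cV * (t - s) / 2 * ((\<mu> + \<kappa> * a \<theta>) * w2 T \<theta> \<theta>')"
      by (rule V; use \<theta> in simp)+
    moreover have "cV * (t - s) / 2 * r = cV / 2 * r * dist s t" for r
      using st by (simp add: dist_real_def)
    ultimately show "dist (Vx (Xl s) (Hl s) (Yl s) \<theta>) (Vx (Xl t) (Hl t) (Yl t) \<theta>) \<le> cV / 2 * ((\<mu> + \<kappa> * a \<theta>) * w1 T \<theta>) * dist s t"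
      "dist (Vy (Xl s) (Hl s) (Yl s) \<theta>) (Vy (Xl t) (Hl t) (Yl t) \<theta>) \<le> cV / 2 * ((\<mu> + \<kappa> * a \<theta>) * w1 T \<theta>) * dist s t"
      "\<theta>' \<in> space P \<Longrightarrow> dist (Vh (Xl s) (Hl s) (Yl s) \<theta> \<theta>') (Vh (Xl t) (Hl t) (Yl t) \<theta> \<theta>')
        \<le> cV / 2 * ((\<mu> + \<kappa> * a \<theta>) * w2 T \<theta> \<theta>') * dist s t"
      by (simp_all only: dist_norm real_norm_def norm_minus_commute[of "Vx (Xl s) (Hl s) (Yl s) \<theta>"]
          abs_minus_commute[of "Vy (Xl s) (Hl s) (Yl s) \<theta>"] abs_minus_commute[of "Vh (Xl s) (Hl s) (Yl s) \<theta> \<theta>'"])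
  qed
  have nn: "0 \<le> cV / 2 * ((\<mu> + \<kappa> * a \<theta>) * w1 T \<theta>)" "0 \<le> cV / 2 * ((\<mu> + \<kappa> * a \<theta>) * w2 T \<theta> \<theta>')" for \<theta>'
    using cV_nonneg \<mu>_nonneg \<kappa>_nonneg a_ge1[of \<theta>] w1_pos[of T \<theta>] w2_pos[of T \<theta> \<theta>'] by simp_all
  show "continuous_on {0..T} (\<lambda>s. Vx (Xl s) (Hl s) (Yl s) \<theta>)"
    by (rule lipschitz_on_continuous_on, rule lipschitz_on_leI[OF V(1) nn(1)])
  show "continuous_on {0..T} (\<lambda>s. Vy (Xl s) (Hl s) (Yl s) \<theta>)"
    by (rule lipschitz_on_continuous_on, rule lipschitz_on_leI[OF V(2) nn(1)])
  show "continuous_on {0..T} (\<lambda>s. Vh (Xl s) (Hl s) (Yl s) \<theta> \<theta>')" if "\<theta>' \<in> space P"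
    by (rule lipschitz_on_continuous_on, rule lipschitz_on_leI[OF V(3)[OF _ _ _ that] nn(2)])
qed

lemma limit_derivative:
  assumes t: "0 \<le> t" and \<theta>: "\<theta> \<in> space P"
  shows "((\<lambda>s. Xl s \<theta>) has_vector_derivative Vx (Xl t) (Hl t) (Yl t) \<theta>) (at t within {0..})"
    and "((\<lambda>s. Yl s \<theta>) has_real_derivative Vy (Xl t) (Hl t) (Yl t) \<theta>) (at t within {0..})"
    and "\<theta>' \<in> space P \<Longrightarrow> ((\<lambda>s. Hl s \<theta> \<theta>') has_real_derivative Vh (Xl t) (Hl t) (Yl t) \<theta> \<theta>') (at t within {0..})"
  unfolding has_real_derivative_iff_has_vector_derivative
  by (rule has_vector_derivative_integral_half_line[OF V_limit_continuous(1)[OF _ \<theta>] _ t, of "\<lambda>s. Xl s \<theta>"],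
      assumption, simp only: limit_fixpoint(1)[OF _ \<theta>] path_integral(2)[OF limit_path _ \<theta>],
      rule has_vector_derivative_integral_half_line[OF V_limit_continuous(2)[OF _ \<theta>] _ t, of "\<lambda>s. Yl s \<theta>"],
      assumption, simp only: limit_fixpoint(2)[OF _ \<theta>] path_integral(4)[OF limit_path _ \<theta>],
      rule has_vector_derivative_integral_half_line[OF V_limit_continuous(3)[OF _ \<theta>] _ t, of \<theta>' "\<lambda>s. Hl s \<theta> \<theta>'"],
      assumption, assumption, simp only: limit_fixpoint(3)[OF _ \<theta>] path_integral(6)[OF limit_path _ \<theta>])

lemma limit_initial:
  assumes "\<theta> \<in> space P"
  shows "Xl 0 \<theta> = W0x \<theta>" "Yl 0 \<theta> = W0y \<theta>" "\<theta>' \<in> space P \<Longrightarrow> Hl 0 \<theta> \<theta>' = W0h \<theta> \<theta>'"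
  using limit_fixpoint[OF order_refl assms] path_integral(2,4,6)[OF limit_path order_refl assms] by simp_all

lemma limit_Hl_bdd:
  assumes "0 \<le> t" "\<theta> \<in> space P" "\<theta>' \<in> space P"
  shows "\<bar>Hl t \<theta> \<theta>'\<bar> \<le> R"
proof (rule trapped_in_interval[of "\<lambda>t. Hl t \<theta> \<theta>'" chi "\<lambda>t. Gh (Xl t) (clip (Hl t)) (Yl t) \<theta> \<theta>'"])
  show "((\<lambda>t. Hl t \<theta> \<theta>') has_real_derivative - chi (Hl t \<theta> \<theta>') * Gh (Xl t) (clip (Hl t)) (Yl t) \<theta> \<theta>') (at t within {0..})"
    if "0 \<le> t" for t
    using limit_derivative(3)[OF that assms(2,3)] by (simp add: Vh_def)
qed (use assms chi_zero W0h_bdd limit_initial in auto)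

lemma clip_eq: "\<bar>h \<theta> \<theta>'\<bar> \<le> R \<Longrightarrow> clip h \<theta> \<theta>' = h \<theta> \<theta>'"
  by (auto simp: clip_def)

text \<open>For \<open>t \<ge> 0\<close> and on \<open>space P\<close> clipping changes nothing,
  since the limit stays in [-R, R]. The clipped version is presented as the solution because its
  gradients are the ones that have been identified, and it is bounded everywhere.\<close>

theorem flow_solution:
  "mf_solution P \<nu> Fs \<sigma> L chi W0x W0h W0y Xl (\<lambda>t. clip (Hl t)) Yl"
proof -
  have clip: "clip (Hl t) \<theta> \<theta>' = Hl t \<theta> \<theta>'" if "0 \<le> t" "\<theta> \<in> space P" "\<theta>' \<in> space P" for t \<theta> \<theta>'
    by (rule clip_eq, rule limit_Hl_bdd[OF that])
  have vd: "vd_hy P (loss P \<nu> Fs \<sigma> L) (Xl t) (clip (Hl t)) (Yl t) (\<lambda>\<theta>. - Vy (Xl t) (Hl t) (Yl t) \<theta>)"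
    "vd_xh P (loss P \<nu> Fs \<sigma> L) (Xl t) (clip (Hl t)) (Yl t) (\<lambda>\<theta>. - Vx (Xl t) (Hl t) (Yl t) \<theta>)"
    "vd_hh P (loss P \<nu> Fs \<sigma> L) (Xl t) (clip (Hl t)) (Yl t) (Gh (Xl t) (clip (Hl t)) (Yl t))" if t: "0 \<le> t" for t
  proof -
    interpret weights P \<nu> Fs L \<sigma> \<sigma>' R K B a "AT t" "Xl t" "clip (Hl t)" "Yl t" "space P"
      by (rule path_weights[OF limit_path t order_refl])
    show "vd_hy P (loss P \<nu> Fs \<sigma> L) (Xl t) (clip (Hl t)) (Yl t) (\<lambda>\<theta>. - Vy (Xl t) (Hl t) (Yl t) \<theta>)"
      "vd_xh P (loss P \<nu> Fs \<sigma> L) (Xl t) (clip (Hl t)) (Yl t) (\<lambda>\<theta>. - Vx (Xl t) (Hl t) (Yl t) \<theta>)"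
      "vd_hh P (loss P \<nu> Fs \<sigma> L) (Xl t) (clip (Hl t)) (Yl t) (Gh (Xl t) (clip (Hl t)) (Yl t))"
      using vd_hy_Gy vd_xh_Gx vd_hh_Gh by (simp_all add: Vx_def Vy_def)
  qed
  have dh: "((\<lambda>s. clip (Hl s) \<theta> \<theta>') has_real_derivative Vh (Xl t) (Hl t) (Yl t) \<theta> \<theta>') (at t within {0..})"
    if t: "0 \<le> t" and \<theta>: "\<theta> \<in> space P" "\<theta>' \<in> space P" for t \<theta> \<theta>'
    unfolding has_real_derivative_iff_has_vector_derivative
    by (rule has_vector_derivative_transform[OF _ _ limit_derivative(3)[OF t \<theta>,
          unfolded has_real_derivative_iff_has_vector_derivative]])
       (use t clip[OF _ \<theta>] in auto)
  show ?thesis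
    unfolding mf_solution_def
  proof (intro conjI exI[of _ "\<lambda>t. Vx (Xl t) (Hl t) (Yl t)"] exI[of _ "\<lambda>t. Vh (Xl t) (Hl t) (Yl t)"]
      exI[of _ "\<lambda>t. Vy (Xl t) (Hl t) (Yl t)"] allI impI ballI)
    fix t :: real assume t: "0 \<le> t"
    show "\<exists>g. vd_hh P (loss P \<nu> Fs \<sigma> L) (Xl t) (clip (Hl t)) (Yl t) g \<and>
        (\<forall>\<theta>\<in>space P. \<forall>\<theta>'\<in>space P. Vh (Xl t) (Hl t) (Yl t) \<theta> \<theta>' = - chi (clip (Hl t) \<theta> \<theta>') * g \<theta> \<theta>')"
      by (intro exI[of _ "Gh (Xl t) (clip (Hl t)) (Yl t)"] conjI vd(3)[OF t] ballI)
         (simp add: Vh_def clip[OF t])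
  qed (use limit_initial limit_derivative dh vd clip[OF order_refl] in auto)
qed

end

section \<open>Sub-Gaussian moments\<close>

text \<open>\<open>moment_const\<close> is an infimum; its finiteness amounts to a witness
  \<open>c\<close>, and only witnesses are manipulated.\<close>

definition moments_le :: "'a measure \<Rightarrow> ('a \<Rightarrow> ennreal) \<Rightarrow> real \<Rightarrow> bool" where
  "moments_le M f c \<longleftrightarrow> 0 \<le> c \<and> (\<forall>m::nat. 1 \<le> m \<longrightarrow> (\<integral>\<^sup>+x. f x ^ m \<partial>M) \<le> ennreal ((c * sqrt (real m)) ^ m))"

lemma moments_leI: "moment_const M f < \<infinity> \<Longrightarrow> \<exists>c. moments_le M f c"
  unfolding moment_const_def Inf_less_iff moments_le_def by auto

lemma moment_const_finite: "moments_le M f c \<Longrightarrow> moment_const M f < \<infinity>"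
  unfolding moment_const_def Inf_less_iff moments_le_def by (intro bexI[of _ "ereal c"]) auto

lemma moment_const_nonneg: "0 \<le> moment_const M f"
  unfolding moment_const_def by (rule Inf_greatest) auto

lemma subg_finite_iff: "subg M f < \<infinity> \<longleftrightarrow> moment_const M f < \<infinity>"
  using moment_const_nonneg[of M f] by (cases "moment_const M f") (auto simp: subg_def)

lemma moments_le_mono:
  assumes "moments_le M g c" "\<And>x. x \<in> space M \<Longrightarrow> f x \<le> g x"
  shows "moments_le M f c"
  unfolding moments_le_def
proof (intro conjI allI impI)
  fix m :: nat assume "1 \<le> m"
  have "(\<integral>\<^sup>+x. f x ^ m \<partial>M) \<le> (\<integral>\<^sup>+x. g x ^ m \<partial>M)"
    using assms(2) by (intro nn_integral_mono power_mono) auto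
  also have "\<dots> \<le> ennreal ((c * sqrt (real m)) ^ m)"
    using assms(1) \<open>1 \<le> m\<close> by (simp add: moments_le_def)
  finally show "(\<integral>\<^sup>+x. f x ^ m \<partial>M) \<le> ennreal ((c * sqrt (real m)) ^ m)" .
qed (use assms(1) in \<open>simp add: moments_le_def\<close>)

lemma power_add_le_add_power:
  fixes x y :: real
  assumes "0 \<le> x" "0 \<le> y" "1 \<le> m"
  shows "x ^ m + y ^ m \<le> (x + y) ^ m"
proof -
  obtain k where k: "m = Suc k" using assms(3) by (cases m) auto
  have "x ^ m + y ^ m \<le> x * (x + y) ^ k + y * (x + y) ^ k"
    unfolding k power_Suc using assms by (intro add_mono mult_left_mono power_mono) auto
  then show ?thesis by (simp add: k distrib_right)
qed

lemma ennreal_add_power_le: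
  fixes x y :: ennreal
  shows "(x + y) ^ m \<le> 2 ^ m * (x ^ m + y ^ m)"
proof -
  have "(x + y) ^ m \<le> (2 * max x y) ^ m"
    by (intro power_mono) (auto simp: mult_2 intro: add_mono)
  also have "\<dots> = 2 ^ m * (max x y) ^ m"
    by (simp add: power_mult_distrib)
  also have "(max x y) ^ m \<le> x ^ m + y ^ m"
    by (auto simp: max_def)
  finally show ?thesis by (simp add: mult_left_mono)
qed

text \<open>\<open>(x + y)^m \<le> 2^m * (x^m + y^m)\<close> replaces Minkowski's inequality; the
  lost constant is immaterial because only finiteness is at stake.\<close>

lemma moments_le_add:
  assumes f: "moments_le M f c" "f \<in> borel_measurable M" and g: "moments_le M g d" "g \<in> borel_measurable M"
  shows "moments_le M (\<lambda>x. f x + g x) (2 * (c + d))"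
  unfolding moments_le_def
proof (intro conjI allI impI)
  have cd: "0 \<le> c" "0 \<le> d" using f g by (auto simp: moments_le_def)
  then show "0 \<le> 2 * (c + d)" by simp
  fix m :: nat assume m: "1 \<le> m"
  note [measurable] = f(2) g(2)
  have "(\<integral>\<^sup>+x. (f x + g x) ^ m \<partial>M) \<le> (\<integral>\<^sup>+x. 2 ^ m * (f x ^ m + g x ^ m) \<partial>M)"
    by (intro nn_integral_mono ennreal_add_power_le)
  also have "\<dots> = 2 ^ m * ((\<integral>\<^sup>+x. f x ^ m \<partial>M) + (\<integral>\<^sup>+x. g x ^ m \<partial>M))"
    by (simp add: nn_integral_cmult nn_integral_add)
  also have "\<dots> \<le> 2 ^ m * (ennreal ((c * sqrt (real m)) ^ m) + ennreal ((d * sqrt (real m)) ^ m))"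
    using f(1) g(1) m by (intro mult_left_mono add_mono) (auto simp: moments_le_def)
  also have "\<dots> = ennreal (2 ^ m * ((c * sqrt (real m)) ^ m + (d * sqrt (real m)) ^ m))"
    using cd by (simp add: ennreal_mult ennreal_plus ennreal_power[symmetric])
  also have "\<dots> \<le> ennreal (2 ^ m * ((c * sqrt (real m) + d * sqrt (real m)) ^ m))"
    using cd m by (intro ennreal_leI mult_left_mono power_add_le_add_power) auto
  also have "2 ^ m * ((c * sqrt (real m) + d * sqrt (real m)) ^ m) = (2 * (c + d) * sqrt (real m)) ^ m"
    by (simp add: power_mult_distrib[symmetric] algebra_simps)
  finally show "(\<integral>\<^sup>+x. (f x + g x) ^ m \<partial>M) \<le> ennreal ((2 * (c + d) * sqrt (real m)) ^ m)" .
qed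

lemma moments_le_const:
  assumes "prob_space M" "0 \<le> r"
  shows "moments_le M (\<lambda>_. ennreal r) r"
  unfolding moments_le_def
proof (intro conjI allI impI assms(2))
  interpret prob_space M by fact
  fix m :: nat assume "1 \<le> m"
  have "r * 1 \<le> r * sqrt (real m)"
    using assms(2) \<open>1 \<le> m\<close> by (intro mult_left_mono) auto
  then have "r ^ m \<le> (r * sqrt (real m)) ^ m"
    using assms(2) by (intro power_mono) auto
  then show "(\<integral>\<^sup>+x. ennreal r ^ m \<partial>M) \<le> ennreal ((r * sqrt (real m)) ^ m)"
    using assms(2) by (simp add: emeasure_space_1 ennreal_power ennreal_leI)
qed

lemma moments_le_cmult:
  assumes "moments_le M f c" "0 \<le> r" "f \<in> borel_measurable M"
  shows "moments_le M (\<lambda>x. ennreal r * f x) (r * c)"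
  unfolding moments_le_def
proof (intro conjI allI impI)
  have c: "0 \<le> c" using assms(1) by (simp add: moments_le_def)
  then show "0 \<le> r * c" using assms(2) by simp
  fix m :: nat assume m: "1 \<le> m"
  note [measurable] = assms(3)
  have "(\<integral>\<^sup>+x. (ennreal r * f x) ^ m \<partial>M) = ennreal r ^ m * (\<integral>\<^sup>+x. f x ^ m \<partial>M)"
    by (simp add: power_mult_distrib nn_integral_cmult)
  also have "\<dots> \<le> ennreal r ^ m * ennreal ((c * sqrt (real m)) ^ m)"
    using assms(1) m by (intro mult_left_mono) (auto simp: moments_le_def)
  also have "\<dots> = ennreal ((r * c * sqrt (real m)) ^ m)"
    using assms(2) c by (simp add: ennreal_power ennreal_mult[symmetric] power_mult_distrib[symmetric] mult.assoc)
  finally show "(\<integral>\<^sup>+x. (ennreal r * f x) ^ m \<partial>M) \<le> ennreal ((r * c * sqrt (real m)) ^ m)" .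
qed

lemma moments_le_integrable:
  fixes y :: "'a \<Rightarrow> real"
  assumes "moments_le M (\<lambda>x. ennreal \<bar>y x\<bar>) c" "y \<in> borel_measurable M" "1 \<le> m"
  shows "integrable M (\<lambda>x. \<bar>y x\<bar> ^ m)" "(\<integral>x. \<bar>y x\<bar> ^ m \<partial>M) \<le> (c * sqrt (real m)) ^ m"
proof -
  have le: "(\<integral>\<^sup>+x. ennreal (\<bar>y x\<bar> ^ m) \<partial>M) \<le> ennreal ((c * sqrt (real m)) ^ m)"
    using assms by (auto simp: moments_le_def ennreal_power)
  show int: "integrable M (\<lambda>x. \<bar>y x\<bar> ^ m)"
  proof (rule integrableI_bounded)
    show "(\<integral>\<^sup>+x. ennreal (norm (\<bar>y x\<bar> ^ m)) \<partial>M) < \<infinity>"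
      using le by (simp add: power_abs le_less_trans)
  qed (use assms in simp)
  have "ennreal (\<integral>x. \<bar>y x\<bar> ^ m \<partial>M) \<le> ennreal ((c * sqrt (real m)) ^ m)"
    using le by (subst nn_integral_eq_integral[symmetric, OF int]) auto
  then show "(\<integral>x. \<bar>y x\<bar> ^ m \<partial>M) \<le> (c * sqrt (real m)) ^ m"
    using assms(1) by (simp add: moments_le_def)
qed

text \<open>\<open>m^m / fact m\<close> is one term of the series of \<open>exp m\<close>, so
  \<open>m^m \<le> exp 1 ^ m * fact m\<close>. The general term is therefore at most
  \<open>(b * exp 1 / sqrt m)^m\<close>, and \<open>m \<ge> (2 * b * exp 1)^2\<close> brings it
  below \<open>(1/2)^m\<close>.\<close>

lemma summable_sqrt_power_fact: 
  assumes "0 \<le> b"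
  shows "summable (\<lambda>m. (b * sqrt (real m)) ^ m / fact m)"
proof (rule summable_comparison_test')
  show "summable (\<lambda>m. (1/2 :: real) ^ m)"
    by (rule summable_geometric) simp
  define N where "N = nat \<lceil>(2 * b * exp 1)^2\<rceil> + 1"
  fix m assume m: "N \<le> m"
  then have m0: "0 < m" by (simp add: N_def)
  have "(2 * b * exp 1)^2 \<le> real m"
    using m by (simp add: N_def) linarith
  then have "2 * b * exp 1 \<le> sqrt (real m)"
    by (rule real_le_rsqrt)
  then have "b * exp 1 * sqrt (real m) \<le> 1/2 * (sqrt (real m) * sqrt (real m))"
    using mult_right_mono[of "2 * b * exp 1" "sqrt (real m)" "sqrt (real m)"] by simp
  then have le: "b * sqrt (real m) * exp 1 \<le> 1/2 * real m"
    by (simp add: mult_ac)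
  have "real m ^ m / fact m \<le> exp (real m)"
  proof -
    have "(\<Sum>n\<in>{m}. real m ^ n / fact n) \<le> (\<Sum>n. real m ^ n / fact n)"
      using summable_exp[of "real m"] by (intro sum_le_suminf) (auto simp: divide_inverse mult.commute)
    then show ?thesis by (simp add: exp_def divide_inverse mult.commute)
  qed
  then have "real m ^ m \<le> exp 1 ^ m * fact m"
    by (simp add: divide_le_eq exp_of_nat_mult[symmetric])
  then have "(b * sqrt (real m)) ^ m * real m ^ m \<le> (b * sqrt (real m)) ^ m * (exp 1 ^ m * fact m)"
    using assms by (intro mult_left_mono) auto
  also have "\<dots> = (b * sqrt (real m) * exp 1) ^ m * fact m"
    by (simp add: power_mult_distrib)
  also have "\<dots> \<le> (1/2 * real m) ^ m * fact m"
    using le assms by (intro mult_right_mono power_mono) auto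
  also have "\<dots> = ((1/2) ^ m * fact m) * real m ^ m"
    by (simp only: power_mult_distrib mult_ac)
  finally have "(b * sqrt (real m)) ^ m \<le> (1/2) ^ m * fact m"
    using m0 by (simp only: mult_le_cancel_right) auto
  then show "norm ((b * sqrt (real m)) ^ m / fact m) \<le> (1/2) ^ m"
    using assms by (simp add: divide_le_eq)
qed

text \<open>The exponential series is integrated term by term. Moments growing like
  \<open>(c * sqrt m)^m\<close> are summable against \<open>l^m / fact m\<close> for every
  \<open>l\<close>; growth like \<open>(c * m)^m\<close> would only allow small
  \<open>l\<close>.\<close>

lemma moments_le_exp_integrable:
  fixes y :: "'a \<Rightarrow> real"
  assumes M: "prob_space M" and y: "moments_le M (\<lambda>x. ennreal \<bar>y x\<bar>) c" and [measurable]: "y \<in> borel_measurable M"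
  shows "integrable M (\<lambda>x. exp (l * \<bar>y x\<bar>))"
proof (rule integrableI_bounded)
  interpret prob_space M by fact
  have c: "0 \<le> c" using y by (simp add: moments_le_def)
  define b where "b = \<bar>l\<bar>"
  have "(\<integral>\<^sup>+x. ennreal (norm (exp (l * \<bar>y x\<bar>))) \<partial>M) \<le> (\<integral>\<^sup>+x. ennreal (exp (b * \<bar>y x\<bar>)) \<partial>M)"
    by (intro nn_integral_mono ennreal_leI) (auto simp: b_def intro!: mult_right_mono)
  also have "\<dots> = (\<integral>\<^sup>+x. (\<Sum>m. ennreal ((b * \<bar>y x\<bar>) ^ m / fact m)) \<partial>M)"
  proof (rule nn_integral_cong)
    fix x
    have "(\<Sum>m. ennreal ((b * \<bar>y x\<bar>) ^ m / fact m)) = ennreal (\<Sum>m. (b * \<bar>y x\<bar>) ^ m / fact m)"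
      using summable_exp[of "b * \<bar>y x\<bar>"]
      by (intro suminf_ennreal2) (auto simp: b_def divide_inverse mult.commute)
    then show "ennreal (exp (b * \<bar>y x\<bar>)) = (\<Sum>m. ennreal ((b * \<bar>y x\<bar>) ^ m / fact m))"
      by (simp add: exp_def divide_inverse mult.commute)
  qed
  also have "\<dots> = (\<Sum>m. \<integral>\<^sup>+x. ennreal ((b * \<bar>y x\<bar>) ^ m / fact m) \<partial>M)"
    by (rule nn_integral_suminf) simp
  also have "\<dots> \<le> (\<Sum>m. ennreal ((b * c * sqrt (real m)) ^ m / fact m))"
  proof (rule suminf_le)
    fix m :: nat
    show "(\<integral>\<^sup>+x. ennreal ((b * \<bar>y x\<bar>) ^ m / fact m) \<partial>M) \<le> ennreal ((b * c * sqrt (real m)) ^ m / fact m)"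
    \<comment> \<open>\<open>moments_le\<close> says nothing about \<open>m = 0\<close>; there both
      sides are 1, the left one as the total mass.\<close>
    proof (cases "m = 0")
      case True
      then show ?thesis by (simp add: emeasure_space_1)
    next
      case False
      have "(\<integral>\<^sup>+x. ennreal ((b * \<bar>y x\<bar>) ^ m / fact m) \<partial>M) = (\<integral>\<^sup>+x. ennreal (b ^ m / fact m) * ennreal \<bar>y x\<bar> ^ m \<partial>M)"
        by (intro nn_integral_cong) (simp add: b_def ennreal_power ennreal_mult[symmetric] power_mult_distrib)
      also have "\<dots> = ennreal (b ^ m / fact m) * (\<integral>\<^sup>+x. ennreal \<bar>y x\<bar> ^ m \<partial>M)"
        by (rule nn_integral_cmult) simp
      also have "\<dots> \<le> ennreal (b ^ m / fact m) * ennreal ((c * sqrt (real m)) ^ m)"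
        using y False by (intro mult_left_mono) (auto simp: moments_le_def)
      also have "\<dots> = ennreal ((b * c * sqrt (real m)) ^ m / fact m)"
        using c by (simp add: b_def ennreal_mult[symmetric] power_mult_distrib mult_ac)
      finally show ?thesis .
    qed
  qed auto
  also have "\<dots> = ennreal (\<Sum>m. (b * c * sqrt (real m)) ^ m / fact m)"
    using summable_sqrt_power_fact[of "b * c"] c by (intro suminf_ennreal2) (auto simp: b_def)
  also have "\<dots> < \<infinity>"
    by simp
  finally show "(\<integral>\<^sup>+x. ennreal (norm (exp (l * \<bar>y x\<bar>))) \<partial>M) < \<infinity>" .
qed simp

section \<open>Uniqueness\<close>

text \<open>Time is rounded down to a grid of mesh \<open>1 / Suc n\<close>, which leaves countably
  many measurable sections; continuity in time gives the limit. \<open>max 0\<close> continues the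
  path to negative times, so that the whole real line can serve as parameter space.\<close>

lemma caratheodory_measurable:
  fixes f :: "real \<Rightarrow> 'w \<Rightarrow> 'b::metric_space"
  assumes meas: "\<And>t. 0 \<le> t \<Longrightarrow> f t \<in> borel_measurable M"
    and cont: "\<And>\<theta>. \<theta> \<in> space M \<Longrightarrow> continuous_on {0..} (\<lambda>t. f t \<theta>)"
  shows "(\<lambda>z. f (max 0 (fst z)) (snd z)) \<in> borel_measurable (borel \<Otimes>\<^sub>M M)"
proof (rule borel_measurable_LIMSEQ_metric)
  let ?s = "\<lambda>n r. real (nat \<lfloor>real (Suc n) * max 0 r\<rfloor>) / real (Suc n)"
  show "(\<lambda>z. f (?s n (fst z)) (snd z)) \<in> borel_measurable (borel \<Otimes>\<^sub>M M)" for n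
  proof (rule measurable_compose_countable[of "\<lambda>i z. f (real i / real (Suc n)) (snd z)" _ _
        "\<lambda>z. nat \<lfloor>real (Suc n) * max 0 (fst z)\<rfloor>"])
    show "(\<lambda>z. f (real i / real (Suc n)) (snd z)) \<in> borel_measurable (borel \<Otimes>\<^sub>M M)" for i
      by (rule measurable_compose[OF measurable_snd meas]) simp
  qed measurable
  fix z assume z: "z \<in> space (borel \<Otimes>\<^sub>M M :: (real \<times> 'w) measure)"
  let ?r = "max 0 (fst z)"
  have "(\<lambda>n. ?s n (fst z)) \<longlonglongrightarrow> ?r"
  proof (rule LIM_zero_cancel, rule Lim_null_comparison)
    show "(\<lambda>n. inverse (real (Suc n))) \<longlonglongrightarrow> 0"
      by (rule LIMSEQ_inverse_real_of_nat)
    have "norm (?s n (fst z) - ?r) \<le> inverse (real (Suc n))" for n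
    proof -
      have "real (nat \<lfloor>real (Suc n) * ?r\<rfloor>) = of_int \<lfloor>real (Suc n) * ?r\<rfloor>"
        by simp
      then have "\<bar>real (nat \<lfloor>real (Suc n) * ?r\<rfloor>) - real (Suc n) * ?r\<bar> \<le> 1"
        by linarith
      moreover have "?s n (fst z) - ?r = (real (nat \<lfloor>real (Suc n) * ?r\<rfloor>) - real (Suc n) * ?r) / real (Suc n)"
        by (simp add: field_simps)
      ultimately show ?thesis
        by (simp add: abs_divide divide_right_mono inverse_eq_divide)
    qed
    then show "\<forall>\<^sub>F n in sequentially. norm (?s n (fst z) - ?r) \<le> inverse (real (Suc n))"
      by simp
  qed
  then show "(\<lambda>n. f (?s n (fst z)) (snd z)) \<longlonglongrightarrow> f ?r (snd z)"
    using continuous_on_tendsto_compose[OF cont, of "snd z" "\<lambda>n. ?s n (fst z)" ?r sequentially] z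
    by (auto simp: space_pair_measure)
qed

text \<open>The derivative is the limit of forward difference quotients with step
  \<open>1 / Suc n\<close>; forward steps stay in the half line, so the endpoint 0 needs no separate
  treatment.\<close>

lemma derivative_measurable:
  fixes f :: "real \<Rightarrow> 'w \<Rightarrow> 'b::{real_normed_vector, second_countable_topology}"
  assumes meas: "\<And>t. 0 \<le> t \<Longrightarrow> f t \<in> borel_measurable M"
    and deriv: "\<And>t \<theta>. 0 \<le> t \<Longrightarrow> \<theta> \<in> space M \<Longrightarrow> ((\<lambda>s. f s \<theta>) has_vector_derivative D t \<theta>) (at t within {0..})"
  shows "(\<lambda>z. f (max 0 (fst z)) (snd z)) \<in> borel_measurable (borel \<Otimes>\<^sub>M M)"
    and "(\<lambda>z. D (max 0 (fst z)) (snd z)) \<in> borel_measurable (borel \<Otimes>\<^sub>M M)"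
proof -
  have cont: "continuous_on {0..} (\<lambda>t. f t \<theta>)" if "\<theta> \<in> space M" for \<theta>
    using deriv[OF _ that] by (intro continuous_on_vector_derivative) auto
  show f: "(\<lambda>z. f (max 0 (fst z)) (snd z)) \<in> borel_measurable (borel \<Otimes>\<^sub>M M)"
    by (rule caratheodory_measurable[OF meas cont])
  let ?h = "\<lambda>n. inverse (real (Suc n))"
  show "(\<lambda>z. D (max 0 (fst z)) (snd z)) \<in> borel_measurable (borel \<Otimes>\<^sub>M M)"
  proof (rule borel_measurable_LIMSEQ_metric)
    have "(\<lambda>z. f (max 0 (fst z) + ?h n) (snd z)) \<in> borel_measurable (borel \<Otimes>\<^sub>M M)" for n
      using measurable_compose[OF _ f, of "\<lambda>z. (max 0 (fst z) + ?h n, snd z)" "borel \<Otimes>\<^sub>M M"]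
      by (simp add: max_absorb2)
    then show "(\<lambda>z. (f (max 0 (fst z) + ?h n) (snd z) - f (max 0 (fst z)) (snd z)) /\<^sub>R ?h n) \<in> borel_measurable (borel \<Otimes>\<^sub>M M)" for n
      using f by (intro borel_measurable_scaleR borel_measurable_diff) auto
    fix z assume z: "z \<in> space (borel \<Otimes>\<^sub>M M :: (real \<times> 'w) measure)"
    define t where "t = max 0 (fst z)"
    have t: "0 \<le> t" by (simp add: t_def)
    have h0: "?h \<longlonglongrightarrow> 0" by (rule LIMSEQ_inverse_real_of_nat)
    have lim: "filterlim (\<lambda>n. t + ?h n) (at t within {0..}) sequentially"
      unfolding filterlim_at
    proof (intro conjI)
      show "(\<lambda>n. t + ?h n) \<longlonglongrightarrow> t"
        using tendsto_add[OF tendsto_const[of t] h0] by simp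
      show "\<forall>\<^sub>F n in sequentially. t + ?h n \<in> {0..} \<and> t + ?h n \<noteq> t"
        using t by (auto intro!: always_eventually)
    qed
    have "((\<lambda>u. (f u (snd z) - f t (snd z) - (u - t) *\<^sub>R D t (snd z)) /\<^sub>R norm (u - t)) \<longlongrightarrow> 0) (at t within {0..})"
      using deriv[OF t, of "snd z"] z
      by (auto simp: has_vector_derivative_def has_derivative_at_within space_pair_measure)
    then have "(\<lambda>n. (f (t + ?h n) (snd z) - f t (snd z) - (t + ?h n - t) *\<^sub>R D t (snd z)) /\<^sub>R norm (t + ?h n - t)) \<longlonglongrightarrow> 0"
      by (rule filterlim_compose[OF _ lim])
    then have "(\<lambda>n. (f (t + ?h n) (snd z) - f t (snd z)) /\<^sub>R ?h n - D t (snd z)) \<longlonglongrightarrow> 0"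
      by (simp add: scaleR_diff_right)
    then show "(\<lambda>n. (f (max 0 (fst z) + ?h n) (snd z) - f (max 0 (fst z)) (snd z)) /\<^sub>R ?h n) \<longlonglongrightarrow> D (max 0 (fst z)) (snd z)"
      unfolding t_def by (rule LIM_zero_cancel)
  qed
qed

text \<open>An identity holding at each time for almost every neuron becomes one holding for almost
  every neuron at almost all times. The exchange needs a measurable exceptional set in the product,
  hence joint measurability of both sides.\<close>

lemma AE_time_swap:
  fixes f g :: "real \<Rightarrow> 'w \<Rightarrow> 'b::euclidean_space"
  assumes "sigma_finite_measure M"
    and f: "(\<lambda>z. f (fst z) (snd z)) \<in> borel_measurable (borel \<Otimes>\<^sub>M M)"
    and g: "(\<lambda>z. g (fst z) (snd z)) \<in> borel_measurable (borel \<Otimes>\<^sub>M M)"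
    and AE: "\<And>t. AE \<theta> in M. f t \<theta> = g t \<theta>"
  shows "AE \<theta> in M. AE t in lborel. f t \<theta> = g t \<theta>"
proof -
  interpret M: sigma_finite_measure M by fact
  interpret pair_sigma_finite lborel M ..
  have [measurable_cong]: "sets (lborel \<Otimes>\<^sub>M M) = sets (borel \<Otimes>\<^sub>M M)"
    by (intro sets_pair_measure_cong) auto
  have [measurable]: "(\<lambda>z. norm (f (fst z) (snd z) - g (fst z) (snd z))) \<in> borel_measurable (lborel \<Otimes>\<^sub>M M)"
    using f g by (simp cong: measurable_cong_sets)
  have "{z \<in> space (lborel \<Otimes>\<^sub>M M). norm (f (fst z) (snd z) - g (fst z) (snd z)) = 0} \<in> sets (lborel \<Otimes>\<^sub>M M)"
    by measurable
  then have "{z \<in> space (lborel \<Otimes>\<^sub>M M). f (fst z) (snd z) = g (fst z) (snd z)} \<in> sets (lborel \<Otimes>\<^sub>M M)"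
    by simp
  from AE_commute[OF this] show ?thesis
    using AE by simp
qed

lemma AE_lborel_negligible:
  assumes "AE t in lborel. Q t"
  shows "\<exists>N. negligible N \<and> (\<forall>t. t \<notin> N \<longrightarrow> Q t)"
proof -
  from assms obtain N where N: "{t \<in> space lborel. \<not> Q t} \<subseteq> N" "emeasure lborel N = 0" "N \<in> sets lborel"
    by (rule AE_E)
  then have "N \<in> null_sets lebesgue"
    by (intro null_sets_completionI) auto
  then have "negligible N"
    by (simp add: negligible_iff_null_sets)
  with N(1) show ?thesis by (intro exI[of _ N]) auto
qed

lemma has_integral_half_line_derivative:
  fixes f :: "real \<Rightarrow> 'b::banach"
  assumes "\<And>t. 0 \<le> t \<Longrightarrow> (f has_vector_derivative D t) (at t within {0..})" "0 \<le> t"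
  shows "(D has_integral (f t - f 0)) {0..t}"
  by (rule fundamental_theorem_of_calculus[OF assms(2)])
     (rule has_vector_derivative_within_subset[OF assms(1)], auto)

section \<open>Identifying the derivatives of a given solution\<close>

context rnn
begin

context
  fixes h h' :: "'w \<Rightarrow> 'w \<Rightarrow> real"
  assumes eq: "\<And>\<theta> \<theta>'. \<theta> \<in> space P \<Longrightarrow> \<theta>' \<in> space P \<Longrightarrow> h \<theta> \<theta>' = h' \<theta> \<theta>'"
begin

text \<open>A solution is known to lie in [-R, R] only for neurons in \<open>space P\<close>, where
  it agrees with its clipped version. Integrals see nothing else, so the gradients of both coincide
  there.\<close>

lemma Z_cong: "\<theta> \<in> space P \<Longrightarrow> Z wx h x j \<theta> = Z wx h' x j \<theta>"
proof (induction j arbitrary: \<theta>)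
  case 0
  show ?case by (simp add: Z_def)
next
  case (Suc j)
  have "Hhh P \<sigma> wx h x L (Suc j) \<theta> = Hhh P \<sigma> wx h' x L (Suc j) \<theta>"
    unfolding Hhh_Suc_Z using Suc eq by (intro Bochner_Integration.integral_cong) auto
  then show ?case unfolding Z_def by simp
qed

lemma M_cong: "\<theta> \<in> space P \<Longrightarrow> M wx h wy x i \<theta> = M wx h' wy x i \<theta>"
proof (induction i arbitrary: \<theta>)
  case 0
  then show ?case by (simp add: Z_cong)
next
  case (Suc i)
  have "(\<integral>\<theta>'. M wx h wy x i \<theta>' * h \<theta>' \<theta> \<partial>P) = (\<integral>\<theta>'. M wx h' wy x i \<theta>' * h' \<theta>' \<theta> \<partial>P)"
    using Suc eq by (intro Bochner_Integration.integral_cong) auto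
  then show ?case using Z_cong[OF Suc.prems] by simp
qed

lemma err_cong: "err wx h wy x = err wx h' wy x"
  unfolding err_def by (auto intro!: Bochner_Integration.integral_cong simp: Z_cong)

lemma Gx_cong: "\<theta> \<in> space P \<Longrightarrow> Gx wx h wy \<theta> = Gx wx h' wy \<theta>"
  and Gy_cong: "\<theta> \<in> space P \<Longrightarrow> Gy wx h wy \<theta> = Gy wx h' wy \<theta>"
  and Gh_cong: "\<theta> \<in> space P \<Longrightarrow> \<theta>' \<in> space P \<Longrightarrow> Gh wx h wy \<theta> \<theta>' = Gh wx h' wy \<theta> \<theta>'"
  by (simp_all add: Gx_def Gy_def Gh_def Z_cong M_cong err_cong[of wx wy])

end

end

context flow
begin

text \<open>For a given solution no bound by \<open>|W0y|\<close> is known beforehand. At a fixed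
  time the estimates are therefore run with \<open>a = 1 + |y|\<close> and \<open>A = 1\<close>,
  which suffices to identify its variational derivatives.\<close>

lemma weights_L2:
  assumes [measurable]: "x \<in> borel_measurable P" "case_prod h \<in> borel_measurable (P \<Otimes>\<^sub>M P)" "y \<in> borel_measurable P"
    and h: "\<And>\<theta> \<theta>'. \<theta> \<in> space P \<Longrightarrow> \<theta>' \<in> space P \<Longrightarrow> \<bar>h \<theta> \<theta>'\<bar> \<le> R"
    and y: "integrable P (\<lambda>\<theta>. (y \<theta>)^2)"
  shows "weights P \<nu> Fs \<sigma> \<sigma>' R K B (\<lambda>\<theta>. 1 + \<bar>y \<theta>\<bar>) 1 x h y (space P)"
proof (intro weights.intro weights_axioms.intro growth.intro growth_axioms.intro rnn_axioms)
  show "integrable P (\<lambda>\<theta>. (1 + \<bar>y \<theta>\<bar>)^2)"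
  proof (rule Bochner_Integration.integrable_bound[where f="\<lambda>\<theta>. 2 * (1 + (y \<theta>)^2)"])
    show "AE \<theta> in P. norm ((1 + \<bar>y \<theta>\<bar>)^2) \<le> norm (2 * (1 + (y \<theta>)^2))"
    proof (rule AE_I2)
      fix \<theta>
      show "norm ((1 + \<bar>y \<theta>\<bar>)^2) \<le> norm (2 * (1 + (y \<theta>)^2))"
        using sum_squares_bound[of 1 "\<bar>y \<theta>\<bar>"] by (simp add: power2_sum)
    qed
  qed (use y in auto)
qed (use h in \<open>auto simp: AE_space\<close>)

end

text \<open>\<open>y_L2\<close> at each time identifies the gradients; \<open>y_L1\<close>, uniform
  on bounded time intervals, is the input of the growth estimate. Both are extracted from the moment
  condition in \<open>admissible\<close>.\<close>

locale solution = flow P \<nu> Fs L \<sigma> \<sigma>' R K B chi Kc Bc W0x W0h W0y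
  for P :: "'w measure" and \<nu> :: "(int \<Rightarrow> real^'d) measure" and Fs L \<sigma> \<sigma>' R K B chi Kc Bc W0x W0h W0y +
  fixes x :: "real \<Rightarrow> 'w \<Rightarrow> real^'d" and h :: "real \<Rightarrow> 'w \<Rightarrow> 'w \<Rightarrow> real" and y :: "real \<Rightarrow> 'w \<Rightarrow> real"
    and Dx :: "real \<Rightarrow> 'w \<Rightarrow> real^'d" and Dh :: "real \<Rightarrow> 'w \<Rightarrow> 'w \<Rightarrow> real" and Dy :: "real \<Rightarrow> 'w \<Rightarrow> real"
    and g :: "real \<Rightarrow> 'w \<Rightarrow> 'w \<Rightarrow> real"
  assumes meas: "\<And>t. 0 \<le> t \<Longrightarrow> x t \<in> borel_measurable P"
      "\<And>t. 0 \<le> t \<Longrightarrow> case_prod (h t) \<in> borel_measurable (P \<Otimes>\<^sub>M P)" "\<And>t. 0 \<le> t \<Longrightarrow> y t \<in> borel_measurable P"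
    and initial: "\<And>\<theta>. \<theta> \<in> space P \<Longrightarrow> x 0 \<theta> = W0x \<theta>" "\<And>\<theta>. \<theta> \<in> space P \<Longrightarrow> y 0 \<theta> = W0y \<theta>"
      "\<And>\<theta> \<theta>'. \<theta> \<in> space P \<Longrightarrow> \<theta>' \<in> space P \<Longrightarrow> h 0 \<theta> \<theta>' = W0h \<theta> \<theta>'"
    and deriv_x: "\<And>t \<theta>. 0 \<le> t \<Longrightarrow> \<theta> \<in> space P \<Longrightarrow> ((\<lambda>s. x s \<theta>) has_vector_derivative Dx t \<theta>) (at t within {0..})"
    and deriv_y: "\<And>t \<theta>. 0 \<le> t \<Longrightarrow> \<theta> \<in> space P \<Longrightarrow> ((\<lambda>s. y s \<theta>) has_vector_derivative Dy t \<theta>) (at t within {0..})"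
    and deriv_h: "\<And>t \<theta> \<theta>'. 0 \<le> t \<Longrightarrow> \<theta> \<in> space P \<Longrightarrow> \<theta>' \<in> space P \<Longrightarrow>
      ((\<lambda>s. h s \<theta> \<theta>') has_vector_derivative Dh t \<theta> \<theta>') (at t within {0..})"
    and grad_y: "\<And>t. 0 \<le> t \<Longrightarrow> vd_hy P (loss P \<nu> Fs \<sigma> L) (x t) (h t) (y t) (\<lambda>\<theta>. - Dy t \<theta>)"
    and grad_x: "\<And>t. 0 \<le> t \<Longrightarrow> vd_xh P (loss P \<nu> Fs \<sigma> L) (x t) (h t) (y t) (\<lambda>\<theta>. - Dx t \<theta>)"
    and grad_h: "\<And>t. 0 \<le> t \<Longrightarrow> vd_hh P (loss P \<nu> Fs \<sigma> L) (x t) (h t) (y t) (g t)"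
    and Dh: "\<And>t \<theta> \<theta>'. 0 \<le> t \<Longrightarrow> \<theta> \<in> space P \<Longrightarrow> \<theta>' \<in> space P \<Longrightarrow> Dh t \<theta> \<theta>' = - chi (h t \<theta> \<theta>') * g t \<theta> \<theta>'"
    and y_L2: "\<And>t. 0 \<le> t \<Longrightarrow> integrable P (\<lambda>\<theta>. (y t \<theta>)^2)"
    and y_L1: "\<And>T. 0 \<le> T \<Longrightarrow> \<exists>C. \<forall>t\<in>{0..T}. (\<integral>\<theta>. \<bar>y t \<theta>\<bar> \<partial>P) \<le> C"
begin

lemma h_bdd: "0 \<le> t \<Longrightarrow> \<theta> \<in> space P \<Longrightarrow> \<theta>' \<in> space P \<Longrightarrow> \<bar>h t \<theta> \<theta>'\<bar> \<le> R"
proof (rule trapped_in_interval[of "\<lambda>t. h t \<theta> \<theta>'" chi "\<lambda>t. g t \<theta> \<theta>'"])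
  assume \<theta>: "\<theta> \<in> space P" "\<theta>' \<in> space P"
  show "((\<lambda>t. h t \<theta> \<theta>') has_real_derivative - chi (h t \<theta> \<theta>') * g t \<theta> \<theta>') (at t within {0..})" if "0 \<le> t" for t
    using deriv_h[OF that \<theta>] Dh[OF that \<theta>] by (simp add: has_real_derivative_iff_has_vector_derivative)
  show "\<bar>h 0 \<theta> \<theta>'\<bar> \<le> R" using initial(3)[OF \<theta>] W0h_bdd[OF \<theta>] by simp
qed (use chi_zero in auto)

lemma clip_h: "0 \<le> t \<Longrightarrow> \<theta> \<in> space P \<Longrightarrow> \<theta>' \<in> space P \<Longrightarrow> clip (h t) \<theta> \<theta>' = h t \<theta> \<theta>'"
  by (rule clip_eq, rule h_bdd)

lemma weights_t:
  assumes "0 \<le> t"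
  shows "weights P \<nu> Fs \<sigma> \<sigma>' R K B (\<lambda>\<theta>. 1 + \<bar>y t \<theta>\<bar>) 1 (x t) (h t) (y t) (space P)"
  by (rule weights_L2[OF meas(1)[OF assms] meas(2)[OF assms] meas(3)[OF assms] h_bdd[OF assms] y_L2[OF assms]])

lemma V_eq_G:
  assumes "0 \<le> t" "\<theta> \<in> space P"
  shows "Vx (x t) (h t) (y t) \<theta> = - Gx (x t) (h t) (y t) \<theta>" "Vy (x t) (h t) (y t) \<theta> = - Gy (x t) (h t) (y t) \<theta>"
    "\<theta>' \<in> space P \<Longrightarrow> Vh (x t) (h t) (y t) \<theta> \<theta>' = - chi (h t \<theta> \<theta>') * Gh (x t) (h t) (y t) \<theta> \<theta>'"
  using Gx_cong[OF clip_h[OF assms(1)] assms(2)] Gy_cong[OF clip_h[OF assms(1)] assms(2)]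
    Gh_cong[OF clip_h[OF assms(1)] assms(2)]
  by (simp_all add: Vx_def Vy_def Vh_def)

lemma D_AE:
  assumes t: "0 \<le> t"
  shows "AE \<theta> in P. Dx t \<theta> = Vx (x t) (h t) (y t) \<theta>" "AE \<theta> in P. Dy t \<theta> = Vy (x t) (h t) (y t) \<theta>"
    "AE z in P \<Otimes>\<^sub>M P. Dh t (fst z) (snd z) = Vh (x t) (h t) (y t) (fst z) (snd z)"
proof -
  interpret weights P \<nu> Fs L \<sigma> \<sigma>' R K B "\<lambda>\<theta>. 1 + \<bar>y t \<theta>\<bar>" 1 "x t" "h t" "y t" "space P"
    by (rule weights_t[OF t])
  show "AE \<theta> in P. Dx t \<theta> = Vx (x t) (h t) (y t) \<theta>"
    using vd_xh_unique[OF grad_x[OF t] vd_xh_Gx] AE_space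
    by eventually_elim (metis V_eq_G(1)[OF t] minus_minus)
  show "AE \<theta> in P. Dy t \<theta> = Vy (x t) (h t) (y t) \<theta>"
    using vd_hy_unique[OF grad_y[OF t] vd_hy_Gy] AE_space
    by eventually_elim (metis V_eq_G(2)[OF t] minus_minus)
  show "AE z in P \<Otimes>\<^sub>M P. Dh t (fst z) (snd z) = Vh (x t) (h t) (y t) (fst z) (snd z)"
    using vd_hh_unique[OF grad_h[OF t] vd_hh_Gh] AE_space
    by eventually_elim (auto simp: V_eq_G[OF t] Dh[OF t] space_pair_measure)
qed

lemma D_joint_measurable:
  "(\<lambda>z. x (max 0 (fst z)) (snd z)) \<in> borel_measurable (borel \<Otimes>\<^sub>M P)"
  "(\<lambda>z. y (max 0 (fst z)) (snd z)) \<in> borel_measurable (borel \<Otimes>\<^sub>M P)"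
  "(\<lambda>z. h (max 0 (fst z)) (fst (snd z)) (snd (snd z))) \<in> borel_measurable (borel \<Otimes>\<^sub>M (P \<Otimes>\<^sub>M P))"
  "(\<lambda>z. Dx (max 0 (fst z)) (snd z)) \<in> borel_measurable (borel \<Otimes>\<^sub>M P)"
  "(\<lambda>z. Dy (max 0 (fst z)) (snd z)) \<in> borel_measurable (borel \<Otimes>\<^sub>M P)"
  "(\<lambda>z. Dh (max 0 (fst z)) (fst (snd z)) (snd (snd z))) \<in> borel_measurable (borel \<Otimes>\<^sub>M (P \<Otimes>\<^sub>M P))"
  using derivative_measurable[OF meas(1) deriv_x] derivative_measurable[OF meas(3) deriv_y]
    derivative_measurable[of "\<lambda>t z. h t (fst z) (snd z)" "P \<Otimes>\<^sub>M P" "\<lambda>t z. Dh t (fst z) (snd z)"] meas(2) deriv_h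
  by (auto simp: split_beta' space_pair_measure)

lemma meas_weights_joint: "meas_weights borel (\<lambda>t. x (max 0 t)) (\<lambda>t. h (max 0 t)) (\<lambda>t. y (max 0 t))"
  using D_joint_measurable by (simp add: meas_weights_def split_beta')

lemma D_AE_time:
  shows "AE \<theta> in P. AE t in lborel. Dx (max 0 t) \<theta> = Vx (x (max 0 t)) (h (max 0 t)) (y (max 0 t)) \<theta>"
    and "AE \<theta> in P. AE t in lborel. Dy (max 0 t) \<theta> = Vy (x (max 0 t)) (h (max 0 t)) (y (max 0 t)) \<theta>"
    and "AE z in P \<Otimes>\<^sub>M P. AE t in lborel.
      Dh (max 0 t) (fst z) (snd z) = Vh (x (max 0 t)) (h (max 0 t)) (y (max 0 t)) (fst z) (snd z)"
proof -
  show "AE \<theta> in P. AE t in lborel. Dx (max 0 t) \<theta> = Vx (x (max 0 t)) (h (max 0 t)) (y (max 0 t)) \<theta>"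
    by (rule AE_time_swap[OF P.sigma_finite_measure_axioms D_joint_measurable(4)
          V_measurable(1)[OF meas_weights_joint measurable_fst measurable_snd] D_AE(1)]) simp
  show "AE \<theta> in P. AE t in lborel. Dy (max 0 t) \<theta> = Vy (x (max 0 t)) (h (max 0 t)) (y (max 0 t)) \<theta>"
    by (rule AE_time_swap[OF P.sigma_finite_measure_axioms D_joint_measurable(5)
          V_measurable(2)[OF meas_weights_joint measurable_fst measurable_snd] D_AE(2)]) simp
  have "(\<lambda>z. Vh (x (max 0 (fst z))) (h (max 0 (fst z))) (y (max 0 (fst z))) (fst (snd z)) (snd (snd z)))
      \<in> borel_measurable (borel \<Otimes>\<^sub>M (P \<Otimes>\<^sub>M P))"
    by (rule V_measurable(3)[OF meas_weights_joint, of fst _ "\<lambda>z. fst (snd z)"]) measurable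
  then show "AE z in P \<Otimes>\<^sub>M P. AE t in lborel.
      Dh (max 0 t) (fst z) (snd z) = Vh (x (max 0 t)) (h (max 0 t)) (y (max 0 t)) (fst z) (snd z)"
    by (intro AE_time_swap[where f="\<lambda>t z. Dh (max 0 t) (fst z) (snd z)"] D_joint_measurable(6) D_AE(3)
        PP.sigma_finite_measure_axioms) simp_all
qed

definition good :: "'w set" where
  "good = {\<theta> \<in> space P.
     (AE t in lborel. Dx (max 0 t) \<theta> = Vx (x (max 0 t)) (h (max 0 t)) (y (max 0 t)) \<theta>) \<and>
     (AE t in lborel. Dy (max 0 t) \<theta> = Vy (x (max 0 t)) (h (max 0 t)) (y (max 0 t)) \<theta>)}"

definition good2 :: "('w \<times> 'w) set" where
  "good2 = {z \<in> space P \<times> space P. AE t in lborel.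
      Dh (max 0 t) (fst z) (snd z) = Vh (x (max 0 t)) (h (max 0 t)) (y (max 0 t)) (fst z) (snd z)}"

lemma AE_good: "AE \<theta> in P. \<theta> \<in> good"
  using D_AE_time(1,2) AE_space by eventually_elim (simp add: good_def)

lemma AE_good2: "AE z in P \<Otimes>\<^sub>M P. z \<in> good2"
  using D_AE_time(3) AE_space by eventually_elim (auto simp: good2_def space_pair_measure)

lemma goodD:
  assumes "\<theta> \<in> good"
  obtains N where "negligible N" "\<And>t. 0 \<le> t \<Longrightarrow> t \<notin> N \<Longrightarrow> Dx t \<theta> = Vx (x t) (h t) (y t) \<theta>"
    "\<And>t. 0 \<le> t \<Longrightarrow> t \<notin> N \<Longrightarrow> Dy t \<theta> = Vy (x t) (h t) (y t) \<theta>"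
proof -
  have "AE t in lborel. Dx (max 0 t) \<theta> = Vx (x (max 0 t)) (h (max 0 t)) (y (max 0 t)) \<theta> \<and>
      Dy (max 0 t) \<theta> = Vy (x (max 0 t)) (h (max 0 t)) (y (max 0 t)) \<theta>"
    using assms by (simp add: good_def)
  then obtain N where "negligible N" and N: "\<And>t. t \<notin> N \<Longrightarrow> Dx (max 0 t) \<theta> = Vx (x (max 0 t)) (h (max 0 t)) (y (max 0 t)) \<theta> \<and>
      Dy (max 0 t) \<theta> = Vy (x (max 0 t)) (h (max 0 t)) (y (max 0 t)) \<theta>"
    using AE_lborel_negligible by blast
  show ?thesis
    by (rule that[OF \<open>negligible N\<close>]) (use N in \<open>metis max_absorb2\<close>)+
qed

lemma good2D:
  assumes "(\<theta>, \<theta>') \<in> good2"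
  obtains N where "negligible N" "\<And>t. 0 \<le> t \<Longrightarrow> t \<notin> N \<Longrightarrow> Dh t \<theta> \<theta>' = Vh (x t) (h t) (y t) \<theta> \<theta>'"
proof -
  have "AE t in lborel. Dh (max 0 t) \<theta> \<theta>' = Vh (x (max 0 t)) (h (max 0 t)) (y (max 0 t)) \<theta> \<theta>'"
    using assms by (simp add: good2_def)
  then obtain N where "negligible N" and N: "\<And>t. t \<notin> N \<Longrightarrow> Dh (max 0 t) \<theta> \<theta>' = Vh (x (max 0 t)) (h (max 0 t)) (y (max 0 t)) \<theta> \<theta>'"
    using AE_lborel_negligible by blast
  show ?thesis
    by (rule that[OF \<open>negligible N\<close>]) (use N in \<open>metis max_absorb2\<close>)
qed

text \<open>A bootstrap: the bound on the gradient in W_hy-direction involves the output weights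
  only through their mean modulus. A local L1 bound thus makes the velocity bounded uniformly in the
  neuron, and integration in time bounds \<open>y\<close> relative to \<open>W0y\<close>. After this
  the solution fits the weights built from \<open>a\<close>.\<close>

lemma y_growth:
  assumes T: "0 \<le> T"
  shows "\<exists>C. \<forall>\<theta>\<in>good. \<forall>t\<in>{0..T}. \<bar>y t \<theta>\<bar> \<le> \<bar>W0y \<theta>\<bar> + C"
proof -
  obtain C1 where C1: "\<And>t. t \<in> {0..T} \<Longrightarrow> (\<integral>\<theta>. \<bar>y t \<theta>\<bar> \<partial>P) \<le> C1"
    using y_L1[OF T] by blast
  define C2 where "C2 = (1 + B * (1 + C1)) * B * q"
  have V: "\<bar>Vy (x t) (h t) (y t) \<theta>\<bar> \<le> C2" if t: "t \<in> {0..T}" and \<theta>: "\<theta> \<in> space P" for t \<theta>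
  proof -
    have t0: "0 \<le> t" using t by simp
    interpret W: weights P \<nu> Fs L \<sigma> \<sigma>' R K B "\<lambda>\<theta>. 1 + \<bar>y t \<theta>\<bar>" 1 "x t" "h t" "y t" "space P"
      by (rule weights_t[OF t0])
    have "integrable P (\<lambda>\<theta>. \<bar>y t \<theta>\<bar>)"
      using W.a_integrable Bochner_Integration.integrable_diff[OF W.a_integrable, of "\<lambda>_. 1"] by simp
    then have "W.a1 = 1 + (\<integral>\<theta>. \<bar>y t \<theta>\<bar> \<partial>P)"
      unfolding W.a1_def by (simp add: P.prob_space del: integrable_abs_iff)
    then have "W.a1 \<le> 1 + C1" using C1[OF t] by simp
    then have "B * 1 * W.a1 \<le> B * (1 + C1)"
      using B_nonneg by (simp only: mult_1_right) (rule mult_left_mono)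
    then have "W.E * B * q \<le> C2"
      unfolding W.E_def C2_def using B_nonneg q_ge_1 by (intro mult_right_mono add_left_mono) auto
    then show ?thesis
      using W.Gy_bdd[of \<theta>] by (simp add: V_eq_G[OF t0 \<theta>])
  qed
  have "\<bar>y t \<theta>\<bar> \<le> \<bar>W0y \<theta>\<bar> + C2 * T" if \<theta>: "\<theta> \<in> good" and t: "t \<in> {0..T}" for \<theta> t
  proof -
    have sp: "\<theta> \<in> space P" using \<theta> by (simp add: good_def)
    obtain N where N: "negligible N" and Dy: "\<And>t. 0 \<le> t \<Longrightarrow> t \<notin> N \<Longrightarrow> Dy t \<theta> = Vy (x t) (h t) (y t) \<theta>"
      using goodD[OF \<theta>] by metis
    have I: "((\<lambda>t. Dy t \<theta>) has_integral (y t \<theta> - y 0 \<theta>)) {0..t}"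
      by (rule has_integral_half_line_derivative[OF deriv_y[OF _ sp]]) (use t in auto)
    have "norm (integral {0..t} (\<lambda>t. Dy t \<theta>)) \<le> C2 * t - C2 * 0"
    proof (rule norm_integral_le_increment[OF _ _ N])
      show "norm (Dy s \<theta>) \<le> C2" if "s \<in> {0..t} - N" for s
        using Dy[of s] V[of s \<theta>] sp that t by auto
      show "((\<lambda>s. C2 * s) has_real_derivative C2) (at s)" for s
        by (auto intro!: derivative_eq_intros)
    qed (use t I in auto)
    moreover have "C2 * t \<le> C2 * T"
      using V[of 0 \<theta>] sp T t by (intro mult_left_mono) (auto intro: order_trans[OF abs_ge_zero])
    ultimately show ?thesis
      using I initial(2)[OF sp] by (simp add: integral_unique)
  qed
  then show ?thesis by blast
qed

end

lemma le_all_geometric_imp_eq: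
  fixes u w :: "'b::real_normed_vector"
  assumes "\<And>n. norm (u - w) \<le> (c * (1/2)^n) * r"
  shows "u = w"
proof -
  have "(\<lambda>n. (c * (1/2)^n) * r) \<longlonglongrightarrow> (c * 0) * r"
    by (intro tendsto_intros LIMSEQ_realpow_zero) auto
  then have "norm (u - w) \<le> 0"
    by (intro LIMSEQ_le_const[of "\<lambda>n. (c * (1/2)^n) * r"]) (use assms in auto)
  then show ?thesis by simp
qed

lemma (in pair_prob_space) AE_pair_swap:
  assumes "AE z in M1 \<Otimes>\<^sub>M M2. Q (fst z) (snd z)"
  shows "AE y in M2. AE x in M1. Q x y"
proof -
  interpret Q: pair_sigma_finite M2 M1 ..
  have "AE z in distr (M2 \<Otimes>\<^sub>M M1) (M1 \<Otimes>\<^sub>M M2) (\<lambda>(x, y). (y, x)). Q (fst z) (snd z)"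
    unfolding distr_pair_swap[symmetric] by (rule assms)
  from AE_distrD[OF measurable_pair_swap' this]
  have "AE z in M2 \<Otimes>\<^sub>M M1. Q (snd z) (fst z)"
    by (simp add: split_beta')
  from Q.AE_pair[OF this] show ?thesis by simp
qed

section \<open>Comparison of two solutions\<close>

context flow
begin

theorem solutions_unique:
  assumes S1: "solution P \<nu> Fs L \<sigma> \<sigma>' R K B chi Kc Bc W0x W0h W0y x h y Dx Dh Dy g"
    and S2: "solution P \<nu> Fs L \<sigma> \<sigma>' R K B chi Kc Bc W0x W0h W0y x' h' y' Dx' Dh' Dy' g'"
    and t: "0 \<le> t"
  shows "AE \<theta> in P. x t \<theta> = x' t \<theta>" "AE \<theta> in P. y t \<theta> = y' t \<theta>"
    "AE z in P \<Otimes>\<^sub>M P. h t (fst z) (snd z) = h' t (fst z) (snd z)"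
proof -
  interpret S1: solution P \<nu> Fs L \<sigma> \<sigma>' R K B chi Kc Bc W0x W0h W0y x h y Dx Dh Dy g by (rule S1)
  interpret S2: solution P \<nu> Fs L \<sigma> \<sigma>' R K B chi Kc Bc W0x W0h W0y x' h' y' Dx' Dh' Dy' g' by (rule S2)
  define G12 where "G12 = S1.good2 \<inter> S2.good2"
  \<comment> \<open>A neuron is kept only if almost all pairs with it, in either order, are good;
    Fubini shows that almost every neuron is kept. This yields full rows and columns of
    \<open>G2\<close>.\<close>
  define G where "G = {\<theta> \<in> S1.good \<inter> S2.good. (AE \<theta>' in P. (\<theta>, \<theta>') \<in> G12) \<and> (AE \<theta>' in P. (\<theta>', \<theta>) \<in> G12)}"
  define G2 where "G2 = G12 \<inter> G \<times> G"
  have AE_G12: "AE z in P \<Otimes>\<^sub>M P. z \<in> G12"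
    using S1.AE_good2 S2.AE_good2 by eventually_elim (simp add: G12_def)
  have AE_G: "AE \<theta> in P. \<theta> \<in> G"
  proof -
    have "AE \<theta> in P. AE \<theta>' in P. (\<theta>, \<theta>') \<in> G12"
      by (rule PP.AE_pair[OF AE_G12])
    moreover have "AE \<theta> in P. AE \<theta>' in P. (\<theta>', \<theta>) \<in> G12"
      by (rule PP.AE_pair_swap) (use AE_G12 in simp)
    ultimately show ?thesis
      using S1.AE_good S2.AE_good by eventually_elim (simp add: G_def)
  qed
  have G_sub: "G \<subseteq> space P" by (auto simp: G_def S1.good_def)
  have G2_sub: "G2 \<subseteq> G \<times> G" by (auto simp: G2_def)
  have AE_G2: "AE \<theta>' in P. (\<theta>, \<theta>') \<in> G2 \<and> (\<theta>', \<theta>) \<in> G2" if "\<theta> \<in> G" for \<theta>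
  proof -
    have "AE \<theta>' in P. (\<theta>, \<theta>') \<in> G12" "AE \<theta>' in P. (\<theta>', \<theta>) \<in> G12"
      using that by (auto simp: G_def)
    then show ?thesis
      using AE_G by eventually_elim (use that in \<open>simp add: G2_def\<close>)
  qed
  obtain C C' where C: "\<And>\<theta> s. \<theta> \<in> G \<Longrightarrow> s \<in> {0..t} \<Longrightarrow> \<bar>y s \<theta>\<bar> \<le> \<bar>W0y \<theta>\<bar> + C"
    and C': "\<And>\<theta> s. \<theta> \<in> G \<Longrightarrow> s \<in> {0..t} \<Longrightarrow> \<bar>y' s \<theta>\<bar> \<le> \<bar>W0y \<theta>\<bar> + C'"
    using S1.y_growth[OF t] S2.y_growth[OF t] unfolding G_def by blast
  \<comment> \<open>The horizon is enlarged beyond \<open>t\<close> until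
    \<open>exp (rate * T)\<close> exceeds the growth constants of both solutions; then
    \<open>AT T * a\<close> bounds their output weights.\<close>
  define T where "T = max t (max C C')"
  have T: "0 \<le> T" "t \<le> T" using t by (auto simp: T_def)
  have exp_T: "C \<le> exp (rate * T)" "C' \<le> exp (rate * T)"
  proof -
    have "T \<le> rate * T" using rate_ge_1 T mult_right_mono[of 1 rate T] by simp
    also have "\<dots> \<le> exp (rate * T)" using exp_ge_add_one_self[of "rate * T"] by linarith
    finally show "C \<le> exp (rate * T)" "C' \<le> exp (rate * T)" by (auto simp: T_def)
  qed
  interpret horizon P \<nu> Fs L \<sigma> \<sigma>' R K B chi Kc Bc W0x W0h W0y T by (rule horizon[OF T(1)])
  have W: "weights P \<nu> Fs \<sigma> \<sigma>' R K B a (AT T) (x s) (clip (h s)) (y s) G"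
    and W': "weights P \<nu> Fs \<sigma> \<sigma>' R K B a (AT T) (x' s) (clip (h' s)) (y' s) G" if s: "s \<in> {0..t}" for s
    by (rule weights_clip; use s S1.meas S2.meas G_sub AE_G C[OF _ s] C'[OF _ s] exp_T in fastforce)+
  have diff_x: "\<exists>N. negligible N \<and> (\<forall>s\<in>{0..t}. ((\<lambda>r. Dx r \<theta> - Dx' r \<theta>) has_integral (x s \<theta> - x' s \<theta>)) {0..s}) \<and>
      (\<forall>s\<in>{0..t}. ((\<lambda>r. Dy r \<theta> - Dy' r \<theta>) has_integral (y s \<theta> - y' s \<theta>)) {0..s}) \<and>
      (\<forall>s. 0 \<le> s \<and> s \<notin> N \<longrightarrow> Dx s \<theta> = Vx (x s) (h s) (y s) \<theta> \<and> Dx' s \<theta> = Vx (x' s) (h' s) (y' s) \<theta>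
        \<and> Dy s \<theta> = Vy (x s) (h s) (y s) \<theta> \<and> Dy' s \<theta> = Vy (x' s) (h' s) (y' s) \<theta>)" if \<theta>: "\<theta> \<in> G" for \<theta>
  proof -
    have g: "\<theta> \<in> S1.good" "\<theta> \<in> S2.good" and sp: "\<theta> \<in> space P" using \<theta> G_sub by (auto simp: G_def)
    obtain N where N: "negligible N" "\<And>t. 0 \<le> t \<Longrightarrow> t \<notin> N \<Longrightarrow> Dx t \<theta> = Vx (x t) (h t) (y t) \<theta>"
      "\<And>t. 0 \<le> t \<Longrightarrow> t \<notin> N \<Longrightarrow> Dy t \<theta> = Vy (x t) (h t) (y t) \<theta>"
      using S1.goodD[OF g(1)] by metis
    obtain N' where N': "negligible N'" "\<And>t. 0 \<le> t \<Longrightarrow> t \<notin> N' \<Longrightarrow> Dx' t \<theta> = Vx (x' t) (h' t) (y' t) \<theta>"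
      "\<And>t. 0 \<le> t \<Longrightarrow> t \<notin> N' \<Longrightarrow> Dy' t \<theta> = Vy (x' t) (h' t) (y' t) \<theta>"
      using S2.goodD[OF g(2)] by metis
    have "((\<lambda>r. Dx r \<theta> - Dx' r \<theta>) has_integral ((x s \<theta> - x 0 \<theta>) - (x' s \<theta> - x' 0 \<theta>))) {0..s}"
      "((\<lambda>r. Dy r \<theta> - Dy' r \<theta>) has_integral ((y s \<theta> - y 0 \<theta>) - (y' s \<theta> - y' 0 \<theta>))) {0..s}" if "s \<in> {0..t}" for s
      using that by (intro has_integral_diff has_integral_half_line_derivative S1.deriv_x S1.deriv_y S2.deriv_x S2.deriv_y sp; simp)+
    then show ?thesis
      using N N' S1.initial(1,2)[OF sp] S2.initial(1,2)[OF sp] by (intro exI[of _ "N \<union> N'"]) auto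
  qed
  have diff_h: "\<exists>N. negligible N \<and> (\<forall>s\<in>{0..t}. ((\<lambda>r. Dh r \<theta> \<theta>' - Dh' r \<theta> \<theta>') has_integral (h s \<theta> \<theta>' - h' s \<theta> \<theta>')) {0..s}) \<and>
      (\<forall>s. 0 \<le> s \<and> s \<notin> N \<longrightarrow> Dh s \<theta> \<theta>' = Vh (x s) (h s) (y s) \<theta> \<theta>' \<and> Dh' s \<theta> \<theta>' = Vh (x' s) (h' s) (y' s) \<theta> \<theta>')"
    if \<theta>: "(\<theta>, \<theta>') \<in> G2" for \<theta> \<theta>'
  proof -
    have g: "(\<theta>, \<theta>') \<in> S1.good2" "(\<theta>, \<theta>') \<in> S2.good2" and sp: "\<theta> \<in> space P" "\<theta>' \<in> space P"
      using \<theta> G_sub by (auto simp: G2_def G12_def)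
    obtain N where N: "negligible N" "\<And>t. 0 \<le> t \<Longrightarrow> t \<notin> N \<Longrightarrow> Dh t \<theta> \<theta>' = Vh (x t) (h t) (y t) \<theta> \<theta>'"
      using S1.good2D[OF g(1)] by metis
    obtain N' where N': "negligible N'" "\<And>t. 0 \<le> t \<Longrightarrow> t \<notin> N' \<Longrightarrow> Dh' t \<theta> \<theta>' = Vh (x' t) (h' t) (y' t) \<theta> \<theta>'"
      using S2.good2D[OF g(2)] by metis
    have "((\<lambda>r. Dh r \<theta> \<theta>' - Dh' r \<theta> \<theta>') has_integral ((h s \<theta> \<theta>' - h 0 \<theta> \<theta>') - (h' s \<theta> \<theta>' - h' 0 \<theta> \<theta>'))) {0..s}" if "s \<in> {0..t}" for s
      using that by (intro has_integral_diff has_integral_half_line_derivative S1.deriv_h S2.deriv_h sp; simp)+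
    then show ?thesis
      using N N' S1.initial(3)[OF sp] S2.initial(3)[OF sp] by (intro exI[of _ "N \<union> N'"]) auto
  qed
  \<comment> \<open>A crude distance to start from: the velocities are at most \<open>gx * a\<close>
    and \<open>gy\<close>, and both recurrent weights lie in [-R, R]. It bounds the weighted
    distance because \<open>1 \<le> a \<le> w1 \<le> w2\<close>.\<close>
  define c where "c = 2 * gx * t + 2 * gy * t + 2 * R"
  have c: "0 \<le> c" using g_nonneg t R_pos by (simp add: c_def)
  \<comment> \<open>The contraction is applied to the pair of solutions itself; iterating it forces
    their distance to 0.\<close>
  have close: "\<forall>s\<in>{0..t}. close (c * (1/2)^n) s G G2 (x s) (h s) (y s) (x' s) (h' s) (y' s)" for n
  proof (induction n)
    case 0
    show ?case
    proof
      fix s assume s: "s \<in> {0..t}"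
      have w: "b \<le> c * w1 s \<theta>" if "b \<le> 2 * gx * t * a \<theta> \<or> b \<le> 2 * gy * t * a \<theta> \<or> b \<le> 2 * R * a \<theta>" for b \<theta>
      proof -
        have "2 * gx * t * a \<theta> \<le> c * a \<theta>" "2 * gy * t * a \<theta> \<le> c * a \<theta>" "2 * R * a \<theta> \<le> c * a \<theta>"
          using g_nonneg t R_pos a_ge1[of \<theta>] by (intro mult_right_mono; simp add: c_def)+
        moreover have "c * a \<theta> \<le> c * w1 s \<theta>"
          using a_le_w1[of s \<theta>] s c by (intro mult_left_mono) auto
        ultimately show ?thesis using that by linarith
      qed
      have "norm (x s \<theta> - x' s \<theta>) \<le> c * w1 s \<theta>" "\<bar>y s \<theta> - y' s \<theta>\<bar> \<le> c * w1 s \<theta>" if \<theta>: "\<theta> \<in> G" for \<theta>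
      proof -
        obtain N where N: "negligible N"
          and Ix: "((\<lambda>r. Dx r \<theta> - Dx' r \<theta>) has_integral (x s \<theta> - x' s \<theta>)) {0..s}"
          and Iy: "((\<lambda>r. Dy r \<theta> - Dy' r \<theta>) has_integral (y s \<theta> - y' s \<theta>)) {0..s}"
          and V: "\<And>s. 0 \<le> s \<Longrightarrow> s \<notin> N \<Longrightarrow> Dx s \<theta> = Vx (x s) (h s) (y s) \<theta> \<and> Dx' s \<theta> = Vx (x' s) (h' s) (y' s) \<theta>
            \<and> Dy s \<theta> = Vy (x s) (h s) (y s) \<theta> \<and> Dy' s \<theta> = Vy (x' s) (h' s) (y' s) \<theta>"
          using diff_x[OF \<theta>] s by blast
        have der: "((\<lambda>r. k * r) has_real_derivative k) (at r)" for k r :: real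
          by (auto intro!: derivative_eq_intros)
        have s0: "0 \<le> s" using s by simp
        have "norm (integral {0..s} (\<lambda>r. Dx r \<theta> - Dx' r \<theta>)) \<le> (2 * gx * a \<theta>) * s - (2 * gx * a \<theta>) * 0"
        proof (rule norm_integral_le_increment[OF s0 has_integral_integrable[OF Ix] N _ der])
          fix r assume r: "r \<in> {0..s} - N"
          then have r': "r \<in> {0..t}" "0 \<le> r" "r \<notin> N" using s by auto
          show "norm (Dx r \<theta> - Dx' r \<theta>) \<le> 2 * gx * a \<theta>"
            using V[OF r'(2,3)] V_bdd(1)[OF W[OF r'(1)] \<theta>] V_bdd(1)[OF W'[OF r'(1)] \<theta>]
              norm_triangle_ineq4[of "Dx r \<theta>" "Dx' r \<theta>"] by simp
        qed
        also have "\<dots> \<le> 2 * gx * t * a \<theta>"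
          using s g_nonneg(1) a_ge1[of \<theta>] mult_left_mono[of s t "2 * gx * a \<theta>"] by (simp add: mult_ac)
        finally show "norm (x s \<theta> - x' s \<theta>) \<le> c * w1 s \<theta>"
          using Ix by (intro w) (simp add: integral_unique)
        have "norm (integral {0..s} (\<lambda>r. Dy r \<theta> - Dy' r \<theta>)) \<le> (2 * gy) * s - (2 * gy) * 0"
        proof (rule norm_integral_le_increment[OF s0 has_integral_integrable[OF Iy] N _ der])
          fix r assume r: "r \<in> {0..s} - N"
          then have r': "r \<in> {0..t}" "0 \<le> r" "r \<notin> N" using s by auto
          show "norm (Dy r \<theta> - Dy' r \<theta>) \<le> 2 * gy"
            using V[OF r'(2,3)] V_bdd(2)[OF W[OF r'(1)], of \<theta>] V_bdd(2)[OF W'[OF r'(1)], of \<theta>]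
              norm_triangle_ineq4[of "Dy r \<theta>" "Dy' r \<theta>"] by simp
        qed
        also have "\<dots> \<le> 2 * gy * t"
          using s g_nonneg(2) mult_left_mono[of s t "2 * gy"] by simp
        also have "\<dots> \<le> 2 * gy * t * a \<theta>"
          using mult_left_mono[OF a_ge1[of \<theta>], of "2 * gy * t"] g_nonneg(2) t by simp
        finally show "\<bar>y s \<theta> - y' s \<theta>\<bar> \<le> c * w1 s \<theta>"
          using Iy by (intro w) (simp add: integral_unique)
      qed
      moreover have "\<bar>h s \<theta> \<theta>' - h' s \<theta> \<theta>'\<bar> \<le> c * w2 s \<theta> \<theta>'" if "(\<theta>, \<theta>') \<in> G2" for \<theta> \<theta>'
      proof -
        have "\<theta> \<in> space P" "\<theta>' \<in> space P" using that G2_sub G_sub by auto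
        then have "\<bar>h s \<theta> \<theta>' - h' s \<theta> \<theta>'\<bar> \<le> 2 * R"
          using S1.h_bdd[of s \<theta> \<theta>'] S2.h_bdd[of s \<theta> \<theta>'] s by simp
        also have "\<dots> \<le> 2 * R * a \<theta>"
          using mult_left_mono[OF a_ge1[of \<theta>], of "2 * R"] R_pos by simp
        also have "\<dots> \<le> c * w1 s \<theta>" by (rule w) simp
        also have "\<dots> \<le> c * w2 s \<theta> \<theta>'"
          using w1_le_w2 c by (intro mult_left_mono)
        finally show ?thesis .
      qed
      ultimately show "close (c * (1/2)^0) s G G2 (x s) (h s) (y s) (x' s) (h' s) (y' s)"
        by (auto simp: close_def)
    qed
  next
    case (Suc n)
    let ?c = "c * (1/2)^n"
    have c': "0 \<le> ?c" using c by simp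
    have Suc_c: "c * (1/2)^Suc n = ?c / 2" by simp
    have V: "\<theta> \<in> G \<Longrightarrow> norm (Vx (x r) (h r) (y r) \<theta> - Vx (x' r) (h' r) (y' r) \<theta>) \<le> ?c / 2 * ((\<mu> + \<kappa> * a \<theta>) * w1 r \<theta>)"
      "\<theta> \<in> G \<Longrightarrow> \<bar>Vy (x r) (h r) (y r) \<theta> - Vy (x' r) (h' r) (y' r) \<theta>\<bar> \<le> ?c / 2 * ((\<mu> + \<kappa> * a \<theta>) * w1 r \<theta>)"
      "(\<theta>, \<theta>') \<in> G2 \<Longrightarrow> \<bar>Vh (x r) (h r) (y r) \<theta> \<theta>' - Vh (x' r) (h' r) (y' r) \<theta> \<theta>'\<bar> \<le> ?c / 2 * ((\<mu> + \<kappa> * a \<theta>) * w2 r \<theta> \<theta>')"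
      if r: "r \<in> {0..t}" for r \<theta> \<theta>'
    proof -
      have r': "0 \<le> r" "r \<le> T" using r T by auto
      note V = V_diff[OF W[OF r] W'[OF r] G2_sub AE_G2 r' c' Suc.IH[rule_format, OF r]]
      show "\<theta> \<in> G \<Longrightarrow> norm (Vx (x r) (h r) (y r) \<theta> - Vx (x' r) (h' r) (y' r) \<theta>) \<le> ?c / 2 * ((\<mu> + \<kappa> * a \<theta>) * w1 r \<theta>)"
        "\<theta> \<in> G \<Longrightarrow> \<bar>Vy (x r) (h r) (y r) \<theta> - Vy (x' r) (h' r) (y' r) \<theta>\<bar> \<le> ?c / 2 * ((\<mu> + \<kappa> * a \<theta>) * w1 r \<theta>)"
        "(\<theta>, \<theta>') \<in> G2 \<Longrightarrow> \<bar>Vh (x r) (h r) (y r) \<theta> \<theta>' - Vh (x' r) (h' r) (y' r) \<theta> \<theta>'\<bar> \<le> ?c / 2 * ((\<mu> + \<kappa> * a \<theta>) * w2 r \<theta> \<theta>')"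
        by (rule V; assumption)+
    qed
    show ?case
    proof
      fix s assume s: "s \<in> {0..t}"
      then have s0: "0 \<le> s" by simp
      have "norm (x s \<theta> - x' s \<theta>) \<le> ?c / 2 * w1 s \<theta>" "\<bar>y s \<theta> - y' s \<theta>\<bar> \<le> ?c / 2 * w1 s \<theta>" if \<theta>: "\<theta> \<in> G" for \<theta>
      proof -
        obtain N where N: "negligible N"
          and Ix: "((\<lambda>r. Dx r \<theta> - Dx' r \<theta>) has_integral (x s \<theta> - x' s \<theta>)) {0..s}"
          and Iy: "((\<lambda>r. Dy r \<theta> - Dy' r \<theta>) has_integral (y s \<theta> - y' s \<theta>)) {0..s}"
          and D: "\<And>s. 0 \<le> s \<Longrightarrow> s \<notin> N \<Longrightarrow> Dx s \<theta> = Vx (x s) (h s) (y s) \<theta> \<and> Dx' s \<theta> = Vx (x' s) (h' s) (y' s) \<theta>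
            \<and> Dy s \<theta> = Vy (x s) (h s) (y s) \<theta> \<and> Dy' s \<theta> = Vy (x' s) (h' s) (y' s) \<theta>"
          using diff_x[OF \<theta>] s by blast
        have "norm (integral {0..s} (\<lambda>r. Dx r \<theta> - Dx' r \<theta>)) \<le> ?c / 2 * w1 s \<theta>"
        proof (rule integrate_w1[OF s0 has_integral_integrable[OF Ix] N c'])
          fix r assume "r \<in> {0..s} - N"
          then have r: "r \<in> {0..t}" "0 \<le> r" "r \<notin> N" using s by auto
          show "norm (Dx r \<theta> - Dx' r \<theta>) \<le> ?c / 2 * ((\<mu> + \<kappa> * a \<theta>) * w1 r \<theta>)"
            using V(1)[OF r(1) \<theta>] D[OF r(2,3)] by simp
        qed
        then show "norm (x s \<theta> - x' s \<theta>) \<le> ?c / 2 * w1 s \<theta>"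
          using Ix by (simp add: integral_unique)
        have "norm (integral {0..s} (\<lambda>r. Dy r \<theta> - Dy' r \<theta>)) \<le> ?c / 2 * w1 s \<theta>"
        proof (rule integrate_w1[OF s0 has_integral_integrable[OF Iy] N c'])
          fix r assume "r \<in> {0..s} - N"
          then have r: "r \<in> {0..t}" "0 \<le> r" "r \<notin> N" using s by auto
          show "norm (Dy r \<theta> - Dy' r \<theta>) \<le> ?c / 2 * ((\<mu> + \<kappa> * a \<theta>) * w1 r \<theta>)"
            using V(2)[OF r(1) \<theta>] D[OF r(2,3)] by simp
        qed
        then show "\<bar>y s \<theta> - y' s \<theta>\<bar> \<le> ?c / 2 * w1 s \<theta>"
          using Iy by (simp add: integral_unique)
      qed
      moreover have "\<bar>h s \<theta> \<theta>' - h' s \<theta> \<theta>'\<bar> \<le> ?c / 2 * w2 s \<theta> \<theta>'" if \<theta>: "(\<theta>, \<theta>') \<in> G2" for \<theta> \<theta>'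
      proof -
        obtain N where N: "negligible N"
          and I: "((\<lambda>r. Dh r \<theta> \<theta>' - Dh' r \<theta> \<theta>') has_integral (h s \<theta> \<theta>' - h' s \<theta> \<theta>')) {0..s}"
          and D: "\<And>s. 0 \<le> s \<Longrightarrow> s \<notin> N \<Longrightarrow> Dh s \<theta> \<theta>' = Vh (x s) (h s) (y s) \<theta> \<theta>' \<and> Dh' s \<theta> \<theta>' = Vh (x' s) (h' s) (y' s) \<theta> \<theta>'"
          using diff_h[OF \<theta>] s by blast
        have "norm (integral {0..s} (\<lambda>r. Dh r \<theta> \<theta>' - Dh' r \<theta> \<theta>')) \<le> ?c / 2 * w2 s \<theta> \<theta>'"
        proof (rule integrate_w2[OF s0 has_integral_integrable[OF I] N c'])
          fix r assume "r \<in> {0..s} - N"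
          then have r: "r \<in> {0..t}" "0 \<le> r" "r \<notin> N" using s by auto
          show "norm (Dh r \<theta> \<theta>' - Dh' r \<theta> \<theta>') \<le> ?c / 2 * ((\<mu> + \<kappa> * a \<theta>) * w2 r \<theta> \<theta>')"
            using V(3)[OF r(1) \<theta>] D[OF r(2,3)] by simp
        qed
        then show ?thesis
          using I by (simp add: integral_unique)
      qed
      ultimately show "close (c * (1/2)^Suc n) s G G2 (x s) (h s) (y s) (x' s) (h' s) (y' s)"
        unfolding Suc_c close_def by blast
    qed
  qed
  have close_t: "close (c * (1/2)^n) t G G2 (x t) (h t) (y t) (x' t) (h' t) (y' t)" for n
    using close[of n] t by simp
  have "x t \<theta> = x' t \<theta>" "y t \<theta> = y' t \<theta>" if "\<theta> \<in> G" for \<theta>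
    by (rule le_all_geometric_imp_eq[where c=c and r="w1 t \<theta>"];
        use close_t[unfolded close_def] that in \<open>simp only: real_norm_def\<close>)+
  then show "AE \<theta> in P. x t \<theta> = x' t \<theta>" "AE \<theta> in P. y t \<theta> = y' t \<theta>"
    using AE_G by auto
  have h: "h t \<theta> \<theta>' = h' t \<theta> \<theta>'" if "(\<theta>, \<theta>') \<in> G2" for \<theta> \<theta>'
    by (rule le_all_geometric_imp_eq[where c=c and r="w2 t \<theta> \<theta>'"])
       (use close_t[unfolded close_def] that in \<open>fastforce simp only: real_norm_def\<close>)
  show "AE z in P \<Otimes>\<^sub>M P. h t (fst z) (snd z) = h' t (fst z) (snd z)"
    using AE_G12 P.AE_pair_fst[OF AE_G] PP.AE_pair_snd[OF AE_G]
    by eventually_elim (rule h, simp add: G2_def mem_Times_iff)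
qed

end

section \<open>Existence and uniqueness\<close>

lemma psi_norm_finite_iff:
  "psi_norm P Wxh Whh Why t < \<infinity> \<longleftrightarrow>
     moment_const (P \<Otimes>\<^sub>M P) (\<lambda>z. SUP s\<in>{0..<t}. ennreal \<bar>Whh s (fst z) (snd z)\<bar>) < \<infinity> \<and>
     moment_const P (\<lambda>\<theta>. SUP s\<in>{0..<t}. ennreal (norm (Wxh s \<theta>))) < \<infinity> \<and>
     moment_const P (\<lambda>\<theta>. SUP s\<in>{0..<t}. ennreal \<bar>Why s \<theta>\<bar>) < \<infinity>"
  by (simp only: psi_norm_def max_less_iff_conj subg_finite_iff)

section \<open>Admissibility of the limit and the data of an admissible solution\<close>

context flow
begin

lemma Xl_growth:
  assumes t: "0 \<le> t"
  shows "\<exists>C\<ge>0. \<forall>s\<in>{0..t}. \<forall>\<theta>\<in>space P. norm (Xl s \<theta>) \<le> norm (W0x \<theta>) + C * a \<theta>"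
proof -
  interpret horizon P \<nu> Fs L \<sigma> \<sigma>' R K B chi Kc Bc W0x W0h W0y t by (rule horizon[OF t])
  have "norm (Xl s \<theta>) \<le> norm (W0x \<theta>) + (gx * t) * a \<theta>" if s: "s \<in> {0..t}" and \<theta>: "\<theta> \<in> space P" for s \<theta>
  proof -
    have s': "0 \<le> s" "s \<le> t" using s by auto
    have "norm (integral {0..s} (\<lambda>r. Vx (Xl r) (Hl r) (Yl r) \<theta>)) \<le> (gx * a \<theta>) * s - (gx * a \<theta>) * 0"
    proof (rule norm_integral_le_increment[OF s'(1) path_integral(1)[OF limit_path s'(1) \<theta>] negligible_empty])
      show "norm (Vx (Xl r) (Hl r) (Yl r) \<theta>) \<le> gx * a \<theta>" if "r \<in> {0..s} - {}" for r
        by (rule V_bdd(1)[OF path_weights[OF limit_path] \<theta>]) (use that s' in auto)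
      show "((\<lambda>r. (gx * a \<theta>) * r) has_real_derivative gx * a \<theta>) (at r)" for r
        by (auto intro!: derivative_eq_intros)
    qed
    also have "\<dots> \<le> (gx * t) * a \<theta>"
      using s' g_nonneg(1) a_ge1[of \<theta>] mult_left_mono[of s t "gx * a \<theta>"] by (simp add: mult_ac)
    finally show ?thesis
      using limit_fixpoint(1)[OF s'(1) \<theta>] path_integral(2)[OF limit_path s'(1) \<theta>]
        norm_triangle_ineq[of "W0x \<theta>" "integral {0..s} (\<lambda>r. Vx (Xl r) (Hl r) (Yl r) \<theta>)"] by simp
  qed
  then show ?thesis
    using g_nonneg(1) t by (intro exI[of _ "gx * t"]) auto
qed

text \<open>The majorants hold for all \<open>s < t\<close> at once, so they cover the supremum
  inside the norm. The input weights acquire a multiple of \<open>1 + |W0y|\<close> because their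
  velocity is of order \<open>a\<close>.\<close>

lemma limit_admissible:
  assumes x: "moments_le P (\<lambda>\<theta>. ennreal (norm (W0x \<theta>))) cx" and y: "moments_le P (\<lambda>\<theta>. ennreal \<bar>W0y \<theta>\<bar>) cy"
  shows "admissible P Xl (\<lambda>t. clip (Hl t)) Yl"
  unfolding admissible_def psi_norm_finite_iff
proof (intro conjI allI impI)
  fix t :: real
  { assume t: "0 \<le> t"
    interpret weights P \<nu> Fs L \<sigma> \<sigma>' R K B a "AT t" "Xl t" "clip (Hl t)" "Yl t" "space P"
      by (rule path_weights[OF limit_path t order_refl])
    show "Xl t \<in> borel_measurable P" "Yl t \<in> borel_measurable P"
      "case_prod (clip (Hl t)) \<in> borel_measurable (P \<Otimes>\<^sub>M P)"
      by measurable }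
  assume "0 < t"
  then have t: "0 \<le> t" by simp
  have "moments_le (P \<Otimes>\<^sub>M P) (\<lambda>z. SUP s\<in>{0..<t}. ennreal \<bar>clip (Hl s) (fst z) (snd z)\<bar>) R"
    by (rule moments_le_mono[OF moments_le_const])
       (use clip_bdd R_pos PP.prob_space_axioms in \<open>auto intro!: SUP_least ennreal_leI\<close>)
  then show "moment_const (P \<Otimes>\<^sub>M P) (\<lambda>z. SUP s\<in>{0..<t}. ennreal \<bar>clip (Hl s) (fst z) (snd z)\<bar>) < \<infinity>"
    by (rule moment_const_finite)
  have a: "moments_le P (\<lambda>\<theta>. ennreal 1 + ennreal \<bar>W0y \<theta>\<bar>) (2 * (1 + cy))"
    by (intro moments_le_add moments_le_const P.prob_space_axioms y) auto
  have "moments_le P (\<lambda>\<theta>. ennreal \<bar>W0y \<theta>\<bar> + ennreal (exp (rate * t))) (2 * (cy + exp (rate * t)))"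
    by (intro moments_le_add moments_le_const P.prob_space_axioms y) auto
  then have "moments_le P (\<lambda>\<theta>. SUP s\<in>{0..<t}. ennreal \<bar>Yl s \<theta>\<bar>) (2 * (cy + exp (rate * t)))"
  proof (rule moments_le_mono, intro SUP_least)
    fix \<theta> s assume \<theta>: "\<theta> \<in> space P" and s: "s \<in> {0..<t}"
    have "\<bar>Yl s \<theta>\<bar> \<le> \<bar>W0y \<theta>\<bar> + exp (rate * s)"
      using limit_path \<theta> s by (simp add: path_def)
    also have "\<dots> \<le> \<bar>W0y \<theta>\<bar> + exp (rate * t)"
      using s rate_nonneg by (simp add: mult_left_mono)
    finally show "ennreal \<bar>Yl s \<theta>\<bar> \<le> ennreal \<bar>W0y \<theta>\<bar> + ennreal (exp (rate * t))"
      by (simp flip: ennreal_plus)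
  qed
  then show "moment_const P (\<lambda>\<theta>. SUP s\<in>{0..<t}. ennreal \<bar>Yl s \<theta>\<bar>) < \<infinity>"
    by (rule moment_const_finite)
  obtain C where C: "0 \<le> C" and X: "\<And>s \<theta>. s \<in> {0..t} \<Longrightarrow> \<theta> \<in> space P \<Longrightarrow> norm (Xl s \<theta>) \<le> norm (W0x \<theta>) + C * a \<theta>"
    using Xl_growth[OF t] by blast
  have "moments_le P (\<lambda>\<theta>. ennreal (norm (W0x \<theta>)) + ennreal C * (ennreal 1 + ennreal \<bar>W0y \<theta>\<bar>)) (2 * (cx + C * (2 * (1 + cy))))"
    by (intro moments_le_add moments_le_cmult x a C) auto
  then have "moments_le P (\<lambda>\<theta>. SUP s\<in>{0..<t}. ennreal (norm (Xl s \<theta>))) (2 * (cx + C * (2 * (1 + cy))))"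
  proof (rule moments_le_mono, intro SUP_least)
    fix \<theta> s assume \<theta>: "\<theta> \<in> space P" and s: "s \<in> {0..<t}"
    have "ennreal (norm (Xl s \<theta>)) \<le> ennreal (norm (W0x \<theta>) + C * (1 + \<bar>W0y \<theta>\<bar>))"
      using X[of s \<theta>] \<theta> s by (intro ennreal_leI) (simp add: a_def)
    also have "\<dots> = ennreal (norm (W0x \<theta>)) + ennreal C * (ennreal 1 + ennreal \<bar>W0y \<theta>\<bar>)"
      using C by (simp add: ennreal_plus[symmetric] ennreal_mult[symmetric] del: ennreal_plus ennreal_1)
    finally show "ennreal (norm (Xl s \<theta>)) \<le> ennreal (norm (W0x \<theta>)) + ennreal C * (ennreal 1 + ennreal \<bar>W0y \<theta>\<bar>)" .
  qed
  then show "moment_const P (\<lambda>\<theta>. SUP s\<in>{0..<t}. ennreal (norm (Xl s \<theta>))) < \<infinity>"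
    by (rule moment_const_finite)
qed

lemma solutionI:
  assumes adm: "admissible P x h y" and sol: "mf_solution P \<nu> Fs \<sigma> L chi W0x W0h W0y x h y"
  shows "\<exists>Dx Dh Dy g. solution P \<nu> Fs L \<sigma> \<sigma>' R K B chi Kc Bc W0x W0h W0y x h y Dx Dh Dy g"
proof -
  from sol obtain Dx Dh Dy where
    init: "\<forall>\<theta>\<in>space P. x 0 \<theta> = W0x \<theta> \<and> y 0 \<theta> = W0y \<theta> \<and> (\<forall>\<theta>'\<in>space P. h 0 \<theta> \<theta>' = W0h \<theta> \<theta>')"
    and D: "\<forall>t\<ge>0. \<forall>\<theta>\<in>space P.
        ((\<lambda>s. x s \<theta>) has_vector_derivative Dx t \<theta>) (at t within {0..}) \<and>
        ((\<lambda>s. y s \<theta>) has_real_derivative Dy t \<theta>) (at t within {0..}) \<and>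
        (\<forall>\<theta>'\<in>space P. ((\<lambda>s. h s \<theta> \<theta>') has_real_derivative Dh t \<theta> \<theta>') (at t within {0..}))"
    and vd: "\<forall>t\<ge>0. vd_hy P (loss P \<nu> Fs \<sigma> L) (x t) (h t) (y t) (\<lambda>\<theta>. - Dy t \<theta>) \<and>
      vd_xh P (loss P \<nu> Fs \<sigma> L) (x t) (h t) (y t) (\<lambda>\<theta>. - Dx t \<theta>) \<and>
      (\<exists>g. vd_hh P (loss P \<nu> Fs \<sigma> L) (x t) (h t) (y t) g \<and>
          (\<forall>\<theta>\<in>space P. \<forall>\<theta>'\<in>space P. Dh t \<theta> \<theta>' = - chi (h t \<theta> \<theta>') * g \<theta> \<theta>'))"
    unfolding mf_solution_def by (elim conjE exE) (rule that)
  obtain g where g: "\<And>t. 0 \<le> t \<Longrightarrow> vd_hh P (loss P \<nu> Fs \<sigma> L) (x t) (h t) (y t) (g t) \<and>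
          (\<forall>\<theta>\<in>space P. \<forall>\<theta>'\<in>space P. Dh t \<theta> \<theta>' = - chi (h t \<theta> \<theta>') * g t \<theta> \<theta>')"
    using vd by metis
  have meas: "x t \<in> borel_measurable P" "y t \<in> borel_measurable P" "case_prod (h t) \<in> borel_measurable (P \<Otimes>\<^sub>M P)"
    if "0 \<le> t" for t
    using adm that by (auto simp: admissible_def)
  have mom: "\<exists>c. \<forall>s\<in>{0..t}. moments_le P (\<lambda>\<theta>. ennreal \<bar>y s \<theta>\<bar>) c" if t: "0 \<le> t" for t
  proof -
    \<comment> \<open>The supremum in \<open>psi_norm\<close> at time \<open>t\<close> runs over the
      half-open interval \<open>{0..<t}\<close>; taking \<open>t + 1\<close> includes
      \<open>t\<close> itself.\<close>
    have "psi_norm P x h y (t + 1) < \<infinity>"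
      using adm t by (simp add: admissible_def)
    then obtain c where "moments_le P (\<lambda>\<theta>. SUP s\<in>{0..<t + 1}. ennreal \<bar>y s \<theta>\<bar>) c"
      unfolding psi_norm_finite_iff using moments_leI by blast
    then have "moments_le P (\<lambda>\<theta>. ennreal \<bar>y s \<theta>\<bar>) c" if "s \<in> {0..t}" for s
      by (rule moments_le_mono) (use that in \<open>auto intro!: SUP_upper\<close>)
    then show ?thesis by blast
  qed
  have L2: "integrable P (\<lambda>\<theta>. (y t \<theta>)^2)" if t: "0 \<le> t" for t
  proof -
    obtain c where "moments_le P (\<lambda>\<theta>. ennreal \<bar>y t \<theta>\<bar>) c"
      using mom[OF t] t by fastforce
    from moments_le_integrable(1)[OF this meas(2)[OF t], of 2] show ?thesis by simp
  qed
  have L1: "\<exists>C. \<forall>s\<in>{0..t}. (\<integral>\<theta>. \<bar>y s \<theta>\<bar> \<partial>P) \<le> C" if t: "0 \<le> t" for t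
  proof -
    obtain c where c: "\<And>s. s \<in> {0..t} \<Longrightarrow> moments_le P (\<lambda>\<theta>. ennreal \<bar>y s \<theta>\<bar>) c"
      using mom[OF t] by blast
    have "(\<integral>\<theta>. \<bar>y s \<theta>\<bar> \<partial>P) \<le> c" if "s \<in> {0..t}" for s
      using moments_le_integrable(2)[OF c[OF that] meas(2), of 1] that by simp
    then show ?thesis by blast
  qed
  have "solution P \<nu> Fs L \<sigma> \<sigma>' R K B chi Kc Bc W0x W0h W0y x h y Dx Dh Dy g"
    using meas D vd g init L2 L1
    by (intro solution.intro flow_axioms solution_axioms.intro)
       (simp_all add: has_real_derivative_iff_has_vector_derivative)
  then show ?thesis by blast
qed

end

text \<open>The function vanishes where \<open>|u| \<ge> R\<close>, so it equals its composition
  with the projection \<open>p\<close> onto [-R, R]. As \<open>p\<close> is 1-Lipschitz, bounds on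
  the compact interval suffice.\<close>

lemma bump_bounded_Lipschitz:
  fixes chi :: "real \<Rightarrow> real"
  assumes "smooth_fun chi" and zero: "\<And>u. R \<le> \<bar>u\<bar> \<Longrightarrow> chi u = 0" and R: "0 < R"
  obtains Kc Bc where "\<And>u v. \<bar>chi u - chi v\<bar> \<le> Kc * \<bar>u - v\<bar>" "\<And>u. \<bar>chi u\<bar> \<le> Bc"
proof -
  obtain D where D: "D 0 = chi" "\<And>n x. (D n has_real_derivative D (Suc n) x) (at x)"
    using assms(1) unfolding smooth_fun_def by blast
  have cont: "continuous_on A (D n)" for A n
    by (rule DERIV_continuous_on) (rule has_field_derivative_at_within[OF D(2)])
  have "bounded (D 0 ` {-R..R})" "bounded (D 1 ` {-R..R})"
    by (intro compact_imp_bounded compact_continuous_image cont compact_Icc)+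
  then obtain Bc Kc where Bc: "\<And>u. u \<in> {-R..R} \<Longrightarrow> \<bar>chi u\<bar> \<le> Bc" and Kc: "\<And>u. u \<in> {-R..R} \<Longrightarrow> \<bar>D 1 u\<bar> \<le> Kc"
    unfolding bounded_iff D(1) by fastforce
  have nn: "0 \<le> Bc" "0 \<le> Kc"
    using Bc[of 0] Kc[of 0] R by auto
  define p where "p u = max (-R) (min R u)" for u
  have p: "p u \<in> {-R..R}" "chi u = chi (p u)" "\<bar>p u - p v\<bar> \<le> \<bar>u - v\<bar>" for u v
  proof -
    show "p u \<in> {-R..R}" "\<bar>p u - p v\<bar> \<le> \<bar>u - v\<bar>"
      using R by (auto simp: p_def)
    show "chi u = chi (p u)"
    proof (cases "R \<le> \<bar>u\<bar>")
      case True
      then have "R \<le> \<bar>p u\<bar>" using R by (auto simp: p_def)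
      then show ?thesis using True zero by simp
    next
      case False
      then have "p u = u" by (auto simp: p_def)
      then show ?thesis by simp
    qed
  qed
  show ?thesis
  proof
    fix u v
    show "\<bar>chi u\<bar> \<le> Bc" using Bc[OF p(1)] p(2)[of u] by simp
    have "norm (chi (p u) - chi (p v)) \<le> Kc * norm (p u - p v)"
      by (rule field_differentiable_bound[of "{-R..R}" chi "D 1"])
         (use Kc p(1) D(2)[of 0] D(1) in \<open>auto intro: has_field_derivative_at_within\<close>)
    also have "\<dots> \<le> Kc * \<bar>u - v\<bar>"
      using p(3) nn by (simp add: mult_left_mono)
    finally show "\<bar>chi u - chi v\<bar> \<le> Kc * \<bar>u - v\<bar>"
      using p(2)[of u] p(2)[of v] by simp
  qed
qed

text \<open>Shift invariance equates the moments of neighbouring coordinates, and induction over the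
  integers runs from 0 in both directions.\<close>

lemma invariant_seq_measure_moment:
  fixes \<nu> :: "(int \<Rightarrow> real^'d) measure"
  assumes nu: "invariant_seq_measure T \<nu>" and 0: "integrable \<nu> (\<lambda>x. norm (x 0) ^ 4)"
  shows "integrable \<nu> (\<lambda>x. norm (x k) ^ 4)"
proof -
  have sets: "sets \<nu> = sets seq_space" and inv: "distr \<nu> seq_space (\<lambda>x k. x (k + 1)) = \<nu>"
    using nu by (auto simp: invariant_seq_measure_def)
  have comp: "(\<lambda>x :: int \<Rightarrow> real^'d. x j) \<in> borel_measurable seq_space" for j
    by (rule measurable_component_singleton) simp
  then have comp_nu: "(\<lambda>x. x j) \<in> borel_measurable \<nu>" for j
    by (simp cong: measurable_cong_sets add: sets)
  have shift: "(\<lambda>x k. x (k + 1)) \<in> measurable \<nu> seq_space"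
    by (rule measurable_PiM_single') (auto simp: comp_nu)
  have step: "integrable \<nu> (\<lambda>x. norm (x (k + 1)) ^ 4) \<longleftrightarrow> integrable \<nu> (\<lambda>x. norm (x k) ^ 4)" for k
  proof -
    have "integrable (distr \<nu> seq_space (\<lambda>x k. x (k + 1))) (\<lambda>x. norm (x k) ^ 4)
        \<longleftrightarrow> integrable \<nu> (\<lambda>x. norm (x (k + 1)) ^ 4)"
      by (rule integrable_distr_eq[OF shift]) (use comp[of k] in simp)
    then show ?thesis by (simp add: inv)
  qed
  show ?thesis
  proof (induction k rule: int_induct[where k=0])
    case base show ?case by (rule 0)
  next
    case (step1 i) then show ?case by (simp add: step)
  next
    case (step2 i) then show ?case using step[of "i - 1"] by simp
  qed
qed

theorem mainTheorem3:
  fixes T :: "real^'d \<Rightarrow> real^'d"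
    and \<nu> :: "(int \<Rightarrow> real^'d) measure"
    and Fs :: "(int \<Rightarrow> real^'d) \<Rightarrow> real"
    and L :: nat
    and P :: "'w measure"
    and \<sigma> \<sigma>' chi :: "real \<Rightarrow> real"
    and R K :: real
    and W0xh :: "'w \<Rightarrow> real^'d" and W0hh :: "'w \<Rightarrow> 'w \<Rightarrow> real" and W0hy :: "'w \<Rightarrow> real"
  assumes T_cont: "continuous_on UNIV T"
    and T_ue: "uniquely_ergodic T"
    and nu: "invariant_seq_measure T \<nu>"
    and nu_moment4: "integrable \<nu> (\<lambda>x. norm (x 0) ^ 4)"
    and Fs_meas: "Fs \<in> borel_measurable \<nu>"
    and Fs_L2: "integrable \<nu> (\<lambda>x. (Fs x)^2)"
    and Fs_dep: "\<And>x y. (\<forall>k\<in>{- int L..0}. x k = y k) \<Longrightarrow> Fs x = Fs y"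
    and P: "prob_space P"
    and R_pos: "0 < R"
    and chi_smooth: "smooth_fun chi"
    and chi_id: "\<And>w. \<bar>w\<bar> \<le> R / 2 \<Longrightarrow> chi w = w"
    and chi_zero: "\<And>w. \<bar>w\<bar> \<ge> R \<Longrightarrow> chi w = 0"
    and KR: "K > R"
    and A3a_bdd: "\<exists>B. \<forall>w. \<bar>\<sigma> w\<bar> \<le> B"
    and A3a_deriv: "\<And>w. (\<sigma> has_real_derivative \<sigma>' w) (at w)"
    and A3a_0: "\<sigma> 0 = 0"
    and A3a_d0: "\<sigma>' 0 \<noteq> 0"
    and A3a_dbdd: "\<And>w. \<bar>\<sigma>' w\<bar> \<le> K"
    and A3a_dlip: "\<And>u v. \<bar>\<sigma>' u - \<sigma>' v\<bar> \<le> K * \<bar>u - v\<bar>"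
    and A3b: "dense_span \<sigma> (distr \<nu> borel (\<lambda>x. x 0))"
    and W0_meas: "W0xh \<in> borel_measurable P" "W0hy \<in> borel_measurable P"
                 "case_prod W0hh \<in> borel_measurable (P \<Otimes>\<^sub>M P)"
    and A3c: "support_condition P R W0xh W0hh"
    and A3d_hh: "\<And>\<theta> \<theta>'. \<theta> \<in> space P \<Longrightarrow> \<theta>' \<in> space P \<Longrightarrow> \<bar>W0hh \<theta> \<theta>'\<bar> \<le> R"
    and A3d_mom: "max (moment_const P (\<lambda>\<theta>. ennreal (norm (W0xh \<theta>))))
                      (moment_const P (\<lambda>\<theta>. ennreal \<bar>W0hy \<theta>\<bar>)) < ereal K"
    and init: "psi_norm0 P W0xh W0hh W0hy < ereal K"
  shows "(\<exists>Wxh Whh Why. admissible P Wxh Whh Why \<and>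
            mf_solution P \<nu> Fs \<sigma> L chi W0xh W0hh W0hy Wxh Whh Why) \<and>
         (\<forall>Wxh1 Whh1 Why1 Wxh2 Whh2 Why2.
            admissible P Wxh1 Whh1 Why1 \<and> mf_solution P \<nu> Fs \<sigma> L chi W0xh W0hh W0hy Wxh1 Whh1 Why1 \<and>
            admissible P Wxh2 Whh2 Why2 \<and> mf_solution P \<nu> Fs \<sigma> L chi W0xh W0hh W0hy Wxh2 Whh2 Why2 \<longrightarrow>
            (\<forall>t\<ge>0. (AE \<theta> in P. Wxh1 t \<theta> = Wxh2 t \<theta>) \<and> (AE \<theta> in P. Why1 t \<theta> = Why2 t \<theta>) \<and>
                    (AE z in P \<Otimes>\<^sub>M P. Whh1 t (fst z) (snd z) = Whh2 t (fst z) (snd z))))"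
proof -
  obtain B where B: "\<And>w. \<bar>\<sigma> w\<bar> \<le> B" using A3a_bdd by blast
  obtain Kc Bc where chi: "\<And>u v. \<bar>chi u - chi v\<bar> \<le> Kc * \<bar>u - v\<bar>" "\<And>u. \<bar>chi u\<bar> \<le> Bc"
    using bump_bounded_Lipschitz[OF chi_smooth chi_zero R_pos] by metis
  have nu': "prob_space \<nu>" "sets \<nu> = sets seq_space"
    using nu by (auto simp: invariant_seq_measure_def)
  have "moment_const P (\<lambda>\<theta>. ennreal (norm (W0xh \<theta>))) < \<infinity>" "moment_const P (\<lambda>\<theta>. ennreal \<bar>W0hy \<theta>\<bar>) < \<infinity>"
    using A3d_mom by (auto simp: less_ereal.simps intro: less_trans)
  then obtain cx cy where cx: "moments_le P (\<lambda>\<theta>. ennreal (norm (W0xh \<theta>))) cx"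
    and cy: "moments_le P (\<lambda>\<theta>. ennreal \<bar>W0hy \<theta>\<bar>) cy"
    using moments_leI by blast
  interpret prob_space P by (rule P)
  interpret rnn P \<nu> Fs L \<sigma> \<sigma>' R K B
    by (intro rnn.intro rnn_axioms.intro P nu' Fs_meas Fs_L2 B A3a_deriv A3a_dbdd A3a_dlip R_pos
        invariant_seq_measure_moment[OF nu nu_moment4]) (use KR R_pos in simp)
  interpret flow P \<nu> Fs L \<sigma> \<sigma>' R K B chi Kc Bc W0xh W0hh W0hy
    by (intro flow.intro rnn_axioms flow_axioms.intro chi chi_zero W0_meas A3d_hh
        moments_le_exp_integrable[OF P cy])
  show ?thesis
  proof (intro conjI allI impI)
    show "\<exists>Wxh Whh Why. admissible P Wxh Whh Why \<and>
        mf_solution P \<nu> Fs \<sigma> L chi W0xh W0hh W0hy Wxh Whh Why"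
      using limit_admissible[OF cx cy] flow_solution by blast
    fix Wxh1 Whh1 Why1 Wxh2 Whh2 Why2 and t :: real
    assume *: "admissible P Wxh1 Whh1 Why1 \<and> mf_solution P \<nu> Fs \<sigma> L chi W0xh W0hh W0hy Wxh1 Whh1 Why1 \<and>
            admissible P Wxh2 Whh2 Why2 \<and> mf_solution P \<nu> Fs \<sigma> L chi W0xh W0hh W0hy Wxh2 Whh2 Why2" and t: "0 \<le> t"
    obtain Dx Dh Dy g where S1: "solution P \<nu> Fs L \<sigma> \<sigma>' R K B chi Kc Bc W0xh W0hh W0hy Wxh1 Whh1 Why1 Dx Dh Dy g"
      using solutionI * by blast
    obtain Dx' Dh' Dy' g' where S2: "solution P \<nu> Fs L \<sigma> \<sigma>' R K B chi Kc Bc W0xh W0hh W0hy Wxh2 Whh2 Why2 Dx' Dh' Dy' g'"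
      using solutionI * by blast
    show "AE \<theta> in P. Wxh1 t \<theta> = Wxh2 t \<theta>" "AE \<theta> in P. Why1 t \<theta> = Why2 t \<theta>"
      "AE z in P \<Otimes>\<^sub>M P. Whh1 t (fst z) (snd z) = Whh2 t (fst z) (snd z)"
      by (rule solutions_unique[OF S1 S2 t])+
  qed
qed

end
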